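(* Let $g_t$ be a $g^\top$-variation of a pseudo-Riemannian metric $g$ on $(M,\widetilde{\mathcal D})$, and $B=\partial_tg_t$. Then \begin{align*} \partial_t\langle\tilde h,\tilde h\rangle&=\langle\Phi_{\tilde h},B\rangle-B(\tilde H,\tilde H),\\ \partial_tg(\tilde H,\tilde H)&=-B(\tilde H,\tilde H),\\ \partial_t\langle h,h\rangle&=\langle\operatorname{div}h+\mathcal K^\flat,B\rangle-\operatorname{div}\langle h,B\rangle,\\ \partial_tg(H,H)&=\langle(\operatorname{div}H)\,g^\top,B\rangle-\operatorname{div}\big((\operatorname{tr}_{\widetilde{\mathcal D}}B^\sharp)H\big),\\ \partial_t\langle\tilde T,\tilde T\rangle&=-\langle\Phi_{\tilde T},B\rangle,\\ \partial_t\langle T,T\rangle&=2\langle\mathcal T^\flat,B\rangle. \end{align*}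
   Context: $M^{n+p}$ is a connected manifold with a rank-$n$ distribution $\widetilde{\mathcal D}$, $g$ is non-degenerate on $\widetilde{\mathcal D}$, and $\mathcal D$ is the $g$-orthogonal complement of $\widetilde{\mathcal D}$ (rank $p$). A $g^\top$-variation is a smooth family $g_t$ ($|t|<\varepsilon$, $g_0=g$) of pseudo-Riemannian metrics, non-degenerate on $\widetilde{\mathcal D}$, for which $\widetilde{\mathcal D}$ and $\mathcal D$ remain orthogonal and $g_t(X,Y)=g(X,Y)$ for $X,Y\in\mathcal D$; $B=\partial_tg_t$ is supported in a relatively compact domain. All geometric objects at time $t$ are those of $g_t$ (written $g$ below). $X^\top,X^\perp$ are the $\widetilde{\mathcal D}$- and $\mathcal D$-components; $g^\top(X,Y)=g(X^\top,Y^\top)$. $\{E_a\}_{a\le n}\subset\widetilde{\mathcal D}$, $\{\mathcal E_i\}_{i\le p}\subset\mathcal D$ is a local orthonormal frame, $\epsilon_a=g(E_a,E_a)$, $\epsilon_i=g(\mathcal E_i,\mathcal E_i)$; $\{e_\lambda\}$ is the full frame, $\epsilon_\lambda=g(e_\lambda,e_\lambda)$. Tensors defined only on $\mathcal D$ or $\widetilde{\mathcal D}$ are extended by zero. For $X,Y\in\widetilde{\mathcal D}$: $T(X,Y)=\frac12[X,Y]^\perp$, $h(X,Y)=\frac12(\nabla_XY+\nabla_YX)^\perp$; for $X,Y\in\mathcal D$: $\tilde T(X,Y)=\frac12[X,Y]^\top$, $\tilde h(X,Y)=\frac12(\nabla_XY+\nabla_YX)^\top$. $H=\sum_a\epsilon_ah(E_a,E_a)$,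 $\tilde H=\sum_i\epsilon_i\tilde h(\mathcal E_i,\mathcal E_i)$. $\langle h,h\rangle=\sum_{a,b}\epsilon_a\epsilon_bg(h(E_a,E_b),h(E_a,E_b))$, similarly $\langle T,T\rangle$, and $\langle\tilde h,\tilde h\rangle,\langle\tilde T,\tilde T\rangle$ with the frame $\mathcal E_i$. For $Z\in\mathcal D$, $X,Y\in\widetilde{\mathcal D}$: $g(A_ZX,Y)=g(h(X,Y),Z)$, $g(T^\sharp_ZX,Y)=g(T(X,Y),Z)$. $\mathcal T=\sum_i\epsilon_i(T^\sharp_{\mathcal E_i})^2$, $\mathcal K=\sum_i\epsilon_i[T^\sharp_{\mathcal E_i},A_{\mathcal E_i}]$. For $(0,2)$-tensors $\langle C,S\rangle=\operatorname{tr}(C^\sharp S^\sharp)$; for symmetric $S$: $\langle\Phi_{\tilde h},S\rangle=S(\tilde H,\tilde H)-\sum_{i,j}\epsilon_i\epsilon_jS(\tilde h(\mathcal E_i,\mathcal E_j),\tilde h(\mathcal E_i,\mathcal E_j))$, $\langle\Phi_{\tilde T},S\rangle=-\sum_{i,j}\epsilon_i\epsilon_jS(\tilde T(\mathcal E_i,\mathcal E_j),\tilde T(\mathcal E_i,\mathcal E_j))$. $\langle h,B\rangle=\sum_{a,b}\epsilon_a\epsilon_bB(E_a,E_b)h(E_a,E_b)$ (a vector field); $(\operatorname{div}h)(X,Y)=\sum_\lambda\epsilon_\lambda g((\nabla_{e_\lambda}h)(X,Y),e_\lambda)$ for $X,Y\in\widetilde{\mathcal D}$; $\operatorname{tr}_{\widetilde{\mathcal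 D}}B^\sharp=\sum_a\epsilon_aB(E_a,E_a)$; $F^\flat(X,Y)=g(FX,Y)$. *)

theory Defs
  imports "HOL-Analysis.Analysis"
begin

section \<open>Smooth maps on open subsets of Euclidean spaces\<close>

primrec continuously_diff_on ::
  "nat \<Rightarrow> 'b::real_normed_vector set \<Rightarrow> ('b \<Rightarrow> 'c::real_normed_vector) \<Rightarrow> bool" where
  "continuously_diff_on 0 S f \<longleftrightarrow> continuous_on S f"
| "continuously_diff_on (Suc k) S f \<longleftrightarrow>
     (\<forall>x\<in>S. f differentiable (at x)) \<and>
     (\<forall>v. continuously_diff_on k S (\<lambda>x. frechet_derivative f (at x) v))"

definition smooth_on :: "'b::real_normed_vector set \<Rightarrow> ('b \<Rightarrow> 'c::real_normed_vector) \<Rightarrow> bool" where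
  "smooth_on S f \<longleftrightarrow> (\<forall>k. continuously_diff_on k S f)"

section \<open>Smooth manifolds\<close>

text \<open>
  The points of the manifold form a type \<open>'a\<close>, the charts take values in a Euclidean space \<open>'e\<close>.
  A chart is a pair of its domain and its coordinate map (only the values on the domain matter).
\<close>

type_synonym ('a, 'e) chart = "'a set \<times> ('a \<Rightarrow> 'e)"

definition chart_inv :: "('a, 'e) chart \<Rightarrow> 'e \<Rightarrow> 'a" where
  "chart_inv c = inv_into (fst c) (snd c)"

definition is_chart :: "('a::topological_space, 'e::euclidean_space) chart \<Rightarrow> bool" where
  "is_chart c \<longleftrightarrow> open (fst c) \<and> open (snd c ` fst c) \<and>
     homeomorphism (fst c) (snd c ` fst c) (snd c) (chart_inv c)"

definition smooth_atlas :: "('a::topological_space, 'e::euclidean_space) chart set \<Rightarrow> bool" where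
  "smooth_atlas A \<longleftrightarrow> (\<forall>c\<in>A. is_chart c) \<and> (\<Union>c\<in>A. fst c) = UNIV \<and>
     (\<forall>c\<in>A. \<forall>d\<in>A. smooth_on (snd c ` (fst c \<inter> fst d)) (snd d \<circ> chart_inv c))"

text \<open>
  Every point \<open>x\<close> gets one preferred chart \<open>chart_at A x\<close> of the atlas. The tangent space at \<open>x\<close> is
  the space \<open>'e\<close>, where \<open>v :: 'e\<close> stands for the tangent vector whose components in
  \<open>chart_at A x\<close> are \<open>v\<close>. Its components in any other chart are obtained by \<open>change\<close>, the
  differential of the transition map. The preferred charts of neighbouring points may be unrelated,
  hence the smoothness of a field is not that of the function \<open>'a \<Rightarrow> 'e\<close>, but that of its
  components in the charts of the atlas.
\<close>

definition chart_at :: "('a, 'e) chart set \<Rightarrow> 'a \<Rightarrow> ('a, 'e) chart" where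
  "chart_at A x = (SOME c. c \<in> A \<and> x \<in> fst c)"

definition change ::
  "('a, 'e::euclidean_space) chart \<Rightarrow> ('a, 'e) chart \<Rightarrow> 'a \<Rightarrow> 'e \<Rightarrow> 'e" where
  "change c d x v = frechet_derivative (snd d \<circ> chart_inv c) (at (snd c x)) v"

type_synonym ('a, 'e) vfield = "'a \<Rightarrow> 'e"
type_synonym ('a, 'e) tensor02 = "'a \<Rightarrow> 'e \<Rightarrow> 'e \<Rightarrow> real"
type_synonym ('a, 'e) tensor12 = "'a \<Rightarrow> 'e \<Rightarrow> 'e \<Rightarrow> 'e"
type_synonym ('a, 'e) endofield = "'a \<Rightarrow> 'e \<Rightarrow> 'e"
type_synonym ('a, 'e) distribution = "'a \<Rightarrow> 'e set"

definition vfield_in ::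
  "('a, 'e::euclidean_space) chart set \<Rightarrow> ('a, 'e) chart \<Rightarrow> ('a, 'e) vfield \<Rightarrow> 'e \<Rightarrow> 'e" where
  "vfield_in A c X \<xi> = (let x = chart_inv c \<xi> in change (chart_at A x) c x (X x))"

definition tensor_in ::
  "('a, 'e::euclidean_space) chart set \<Rightarrow> ('a, 'e) chart \<Rightarrow> ('a, 'e) tensor02 \<Rightarrow> 'e \<Rightarrow> 'e \<Rightarrow> 'e \<Rightarrow> real"
  where
  "tensor_in A c b \<xi> u v = (let x = chart_inv c \<xi>; J = change c (chart_at A x) x in b x (J u) (J v))"

definition smooth_vfield_on ::
  "('a::topological_space, 'e::euclidean_space) chart set \<Rightarrow> 'a set \<Rightarrow> ('a, 'e) vfield \<Rightarrow> bool" where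
  "smooth_vfield_on A W X \<longleftrightarrow>
     open W \<and> (\<forall>c\<in>A. smooth_on (snd c ` (fst c \<inter> W)) (vfield_in A c X))"

section \<open>Distributions\<close>

definition smooth_distribution ::
  "('a::topological_space, 'e::euclidean_space) chart set \<Rightarrow> nat \<Rightarrow> ('a, 'e) distribution \<Rightarrow> bool" where
  "smooth_distribution A n P \<longleftrightarrow>
     (\<forall>x. subspace (P x) \<and> dim (P x) = n) \<and>
     (\<forall>x. \<exists>W X. x \<in> W \<and> (\<forall>a<n. smooth_vfield_on A W (X a)) \<and> open W \<and>
        (\<forall>y\<in>W. P y = span ((\<lambda>a. X a y) ` {..<n})))"

definition local_section ::
  "('a::topological_space, 'e::euclidean_space) chart set \<Rightarrow> ('a, 'e) distribution \<Rightarrow> 'a \<Rightarrow> 'e \<Rightarrow>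
     ('a, 'e) vfield \<Rightarrow> bool" where
  "local_section A P x u X \<longleftrightarrow>
     X x = u \<and> (\<exists>W. x \<in> W \<and> smooth_vfield_on A W X \<and> (\<forall>y\<in>W. X y \<in> P y))"

text \<open>The component in \<open>P\<close> with respect to the splitting of the tangent bundle into \<open>P\<close> and \<open>Q\<close>.\<close>

definition component :: "('a, 'e::euclidean_space) distribution \<Rightarrow> ('a, 'e) distribution \<Rightarrow> ('a, 'e) endofield"
  where "component P Q x v = (THE u. u \<in> P x \<and> v - u \<in> Q x)"

section \<open>Pseudo-Riemannian metrics\<close>

definition nondegenerate_on :: "('e::euclidean_space \<Rightarrow> 'e \<Rightarrow> real) \<Rightarrow> 'e set \<Rightarrow> bool" where
  "nondegenerate_on b V \<longleftrightarrow> (\<forall>u\<in>V. (\<forall>v\<in>V. b u v = 0) \<longrightarrow> u = 0)"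

definition pseudo_metric ::
  "('a::topological_space, 'e::euclidean_space) chart set \<Rightarrow> ('a, 'e) tensor02 \<Rightarrow> bool" where
  "pseudo_metric A g \<longleftrightarrow>
     (\<forall>x. bilinear (g x) \<and> (\<forall>u v. g x u v = g x v u) \<and> nondegenerate_on (g x) UNIV) \<and>
     (\<forall>c\<in>A. \<forall>u v. smooth_on (snd c ` fst c) (\<lambda>\<xi>. tensor_in A c g \<xi> u v))"

definition orth_complement ::
  "('a, 'e::euclidean_space) tensor02 \<Rightarrow> ('a, 'e) distribution \<Rightarrow> ('a, 'e) distribution" where
  "orth_complement g P x = {v. \<forall>u\<in>P x. g x v u = 0}"

definition sharp :: "('a, 'e::euclidean_space) tensor02 \<Rightarrow> ('a, 'e) tensor02 \<Rightarrow> ('a, 'e) endofield" where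
  "sharp g b x u = (THE w. \<forall>v. g x w v = b x u v)"

definition flat :: "('a, 'e::euclidean_space) tensor02 \<Rightarrow> ('a, 'e) endofield \<Rightarrow> ('a, 'e) tensor02" where
  "flat g F x u v = g x (F x u) v"

definition tr :: "('e::euclidean_space \<Rightarrow> 'e) \<Rightarrow> real" where
  "tr F = (\<Sum>b\<in>Basis. F b \<bullet> b)"

definition pairing :: "('a, 'e::euclidean_space) tensor02 \<Rightarrow> ('a, 'e) tensor02 \<Rightarrow> ('a, 'e) tensor02 \<Rightarrow> 'a \<Rightarrow> real"
  where "pairing g C S x = tr (sharp g C x \<circ> sharp g S x)"

section \<open>Lie bracket and Levi-Civita connection\<close>

text \<open>
  At \<open>x\<close> both are computed in the chart \<open>chart_at A x\<close>. The Christoffel symbols, as a bilinear map,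
  are \<open>christoffel A g x u v\<close>; in the formula \<open>G \<xi> v w\<close> is the coefficient \<open>g\<^sub>\<xi>(v, w)\<close> for constant
  \<open>v, w\<close>, so that with \<open>u, v, z\<close> from the standard basis it reads
  \<open>g\<^sub>k\<^sub>l \<Gamma>\<^sup>l\<^sub>i\<^sub>j = (\<partial>\<^sub>i g\<^sub>j\<^sub>k + \<partial>\<^sub>j g\<^sub>i\<^sub>k - \<partial>\<^sub>k g\<^sub>i\<^sub>j) / 2\<close>.
\<close>

definition dir_deriv ::
  "('a, 'e::euclidean_space) chart set \<Rightarrow> 'a \<Rightarrow> 'e \<Rightarrow> ('a \<Rightarrow> real) \<Rightarrow> real" where
  "dir_deriv A x v f =
     (let c = chart_at A x in frechet_derivative (f \<circ> chart_inv c) (at (snd c x)) v)"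

definition lie_bracket ::
  "('a, 'e::euclidean_space) chart set \<Rightarrow> ('a, 'e) vfield \<Rightarrow> ('a, 'e) vfield \<Rightarrow> ('a, 'e) vfield" where
  "lie_bracket A X Y x =
     (let c = chart_at A x; \<xi> = snd c x in
        frechet_derivative (vfield_in A c Y) (at \<xi>) (X x)
      - frechet_derivative (vfield_in A c X) (at \<xi>) (Y x))"

definition christoffel ::
  "('a, 'e::euclidean_space) chart set \<Rightarrow> ('a, 'e) tensor02 \<Rightarrow> ('a, 'e) tensor12" where
  "christoffel A g x u v =
     (let c = chart_at A x; \<xi> = snd c x; G = tensor_in A c g in
        THE w. \<forall>z. g x w z =
          (frechet_derivative (\<lambda>\<eta>. G \<eta> v z) (at \<xi>) u
         + frechet_derivative (\<lambda>\<eta>. G \<eta> u z) (at \<xi>) v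
         - frechet_derivative (\<lambda>\<eta>. G \<eta> u v) (at \<xi>) z) / 2)"

definition nabla ::
  "('a, 'e::euclidean_space) chart set \<Rightarrow> ('a, 'e) tensor02 \<Rightarrow> 'a \<Rightarrow> 'e \<Rightarrow> ('a, 'e) vfield \<Rightarrow> 'e" where
  "nabla A g x v Y =
     (let c = chart_at A x in
        frechet_derivative (vfield_in A c Y) (at (snd c x)) v + christoffel A g x v (Y x))"

definition nabla_tensor12 ::
  "('a::topological_space, 'e::euclidean_space) chart set \<Rightarrow> ('a, 'e) tensor02 \<Rightarrow> ('a, 'e) tensor12 \<Rightarrow>
     'a \<Rightarrow> 'e \<Rightarrow> 'e \<Rightarrow> 'e \<Rightarrow> 'e" where
  "nabla_tensor12 A g K x z u v =
     (THE w. \<forall>X Y. local_section A (\<lambda>_. UNIV) x u X \<longrightarrow> local_section A (\<lambda>_. UNIV) x v Y \<longrightarrow>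
        w = nabla A g x z (\<lambda>y. K y (X y) (Y y))
          - K x (nabla A g x z X) v - K x u (nabla A g x z Y))"

section \<open>The connection is torsion-free and metric\<close>

lemma smooth_on_differentiable: "smooth_on S f \<Longrightarrow> x \<in> S \<Longrightarrow> f differentiable (at x)"
  unfolding smooth_on_def by (metis continuously_diff_on.simps(2))

lemma chart_at_in:
  assumes "smooth_atlas A"
  shows "chart_at A x \<in> A" "x \<in> fst (chart_at A x)"
proof -
  have "\<exists>c. c \<in> A \<and> x \<in> fst c" using assms unfolding smooth_atlas_def by blast
  from someI_ex[OF this] show "chart_at A x \<in> A" "x \<in> fst (chart_at A x)"
    unfolding chart_at_def by auto
qed

lemma chart_inv_chart:
  assumes "smooth_atlas A" "c \<in> A" "x \<in> fst c"
  shows "chart_inv c (snd c x) = x"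
  using assms unfolding smooth_atlas_def is_chart_def homeomorphism_def by blast

lemma open_chart_image:
  assumes "smooth_atlas A" "c \<in> A" "open W"
  shows "open (snd c ` (fst c \<inter> W))"
proof -
  have c: "open (fst c)" "open (snd c ` fst c)"
    "homeomorphism (fst c) (snd c ` fst c) (snd c) (chart_inv c)"
    using assms unfolding smooth_atlas_def is_chart_def by auto
  have "openin (top_of_set (fst c)) (fst c \<inter> W)"
    using assms(3) by (simp add: openin_open_Int)
  from homeomorphism_imp_open_map[OF c(3) this] c(2) show ?thesis
    using openin_open_trans by blast
qed

lemma transition_differentiable:
  assumes "smooth_atlas A" "c \<in> A" "d \<in> A" "x \<in> fst c" "x \<in> fst d"
  shows "(snd d \<circ> chart_inv c) differentiable (at (snd c x))"
  using assms smooth_on_differentiable[of "snd c ` (fst c \<inter> fst d)" "snd d \<circ> chart_inv c" "snd c x"]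
  unfolding smooth_atlas_def by blast

lemma linear_change:
  assumes "smooth_atlas A" "c \<in> A" "d \<in> A" "x \<in> fst c" "x \<in> fst d"
  shows "linear (change c d x)"
  using linear_frechet_derivative[OF transition_differentiable[OF assms]]
  unfolding change_def by simp

lemma change_change:
  assumes A: "smooth_atlas A" "c \<in> A" "d \<in> A" "x \<in> fst c" "x \<in> fst d"
  shows "change d c x (change c d x v) = v"
proof -
  let ?f = "snd d \<circ> chart_inv c" and ?g = "snd c \<circ> chart_inv d" and ?\<xi> = "snd c x"
  have fx: "?f ?\<xi> = snd d x" using chart_inv_chart A by (metis comp_apply)
  have f: "(?f has_derivative change c d x) (at ?\<xi>)"
    using transition_differentiable[OF A] unfolding change_def frechet_derivative_works by simp
  have g: "(?g has_derivative change d c x) (at (?f ?\<xi>))"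
    using transition_differentiable[of A d c x] A
    unfolding change_def fx frechet_derivative_works by simp
  have 1: "(?g \<circ> ?f has_derivative change d c x \<circ> change c d x) (at ?\<xi>)"
    by (rule diff_chain_at[OF f g])
  have "open (fst d)" using A unfolding smooth_atlas_def is_chart_def by blast
  then have op: "open (snd c ` (fst c \<inter> fst d))" using open_chart_image[of A c] A by blast
  have "(?g \<circ> ?f has_derivative (\<lambda>v. v)) (at ?\<xi>)"
  proof (rule has_derivative_transform_within_open[OF has_derivative_ident op])
    show "?\<xi> \<in> snd c ` (fst c \<inter> fst d)" using A by blast
    fix \<eta> assume "\<eta> \<in> snd c ` (fst c \<inter> fst d)"
    then obtain y where y: "y \<in> fst c" "y \<in> fst d" "\<eta> = snd c y" by blast
    then show "\<eta> = (?g \<circ> ?f) \<eta>" using chart_inv_chart A by (metis comp_apply)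
  qed
  then show ?thesis using fun_cong[OF has_derivative_unique[OF 1], of "\<lambda>v. v" v] by simp
qed

lemma bilinear_tensor_in:
  assumes A: "smooth_atlas A" "c \<in> A" "\<xi> \<in> snd c ` fst c" and b: "\<And>x. bilinear (b x)"
  shows "bilinear (tensor_in A c b \<xi>)"
proof -
  obtain y where y: "y \<in> fst c" "\<xi> = snd c y" using A by blast
  have e: "chart_inv c \<xi> = y" using chart_inv_chart A y by metis
  have J: "linear (change c (chart_at A y) y)"
    by (rule linear_change[OF A(1,2)]) (use chart_at_in[OF A(1)] y in auto)
  show ?thesis unfolding bilinear_def tensor_in_def e Let_def
    using linear_compose[OF J, of "b y _"] linear_compose[OF J, of "\<lambda>u. b y u _"] b[of y]
    unfolding bilinear_def o_def by simp
qed

lemma change_self: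
  assumes A: "smooth_atlas A" "c \<in> A" "x \<in> fst c"
  shows "change c c x v = v"
proof -
  have op: "open (snd c ` fst c)" using A unfolding smooth_atlas_def is_chart_def by blast
  have d: "(snd c \<circ> chart_inv c has_derivative (\<lambda>v. v)) (at (snd c x))"
  proof (rule has_derivative_transform_within_open[OF has_derivative_ident op])
    show "snd c x \<in> snd c ` fst c" using A by blast
    fix \<eta> assume "\<eta> \<in> snd c ` fst c"
    then show "\<eta> = (snd c \<circ> chart_inv c) \<eta>" using chart_inv_chart A by fastforce
  qed
  show ?thesis unfolding change_def by (simp only: frechet_derivative_at[OF d, symmetric])
qed

lemma nondegenerate_representation:
  fixes b :: "'e::euclidean_space \<Rightarrow> 'e \<Rightarrow> real"
  assumes b: "bilinear b" "nondegenerate_on b UNIV" and l: "linear (l :: 'e \<Rightarrow> real)"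
  shows "\<exists>!w. \<forall>z. b w z = l z"
proof -
  define F where "F w = (\<Sum>k\<in>Basis. b w k *\<^sub>R k)" for w
  have lin: "linear F"
    unfolding F_def using b(1)
    by (intro linearI) (simp_all add: bilinear_ladd bilinear_lmul scaleR_add_left sum.distrib scaleR_sum_right)
  have bF: "b w z = F w \<bullet> z" for w z
  proof -
    have "b w z = b w (\<Sum>k\<in>Basis. (z \<bullet> k) *\<^sub>R k)" by (simp add: euclidean_representation)
    also have "\<dots> = (\<Sum>k\<in>Basis. (z \<bullet> k) * b w k)"
    proof -
      have "linear (b w)" using b(1) unfolding bilinear_def by blast
      then show ?thesis by (simp add: linear_sum linear_cmul)
    qed
    also have "\<dots> = F w \<bullet> z" unfolding F_def inner_sum_left
      by (simp add: mult.commute inner_commute)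
    finally show ?thesis .
  qed
  have "inj F" unfolding linear_injective_0[OF lin]
    using b(2) bF unfolding nondegenerate_on_def by simp
  then have "surj F" using linear_injective_imp_surjective[OF lin] by blast
  define y where "y = (\<Sum>k\<in>Basis. l k *\<^sub>R k)"
  have ly: "l z = y \<bullet> z" for z
  proof -
    have "l z = l (\<Sum>k\<in>Basis. (z \<bullet> k) *\<^sub>R k)" by (simp add: euclidean_representation)
    also have "\<dots> = (\<Sum>k\<in>Basis. (z \<bullet> k) * l k)" using l by (simp add: linear_sum linear_cmul)
    also have "\<dots> = y \<bullet> z" unfolding y_def inner_sum_left
      by (simp add: mult.commute inner_commute)
    finally show ?thesis .
  qed
  from \<open>surj F\<close> obtain w where w: "F w = y" by (metis surjD)
  show ?thesis
  proof (rule ex1I[of _ w])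
    show "\<forall>z. b w z = l z" using bF ly w by simp
    fix w' assume "\<forall>z. b w' z = l z"
    then have "F w' \<bullet> z = F w \<bullet> z" for z using bF ly w by simp
    then have "F w' = F w" by (metis vector_eq_rdot)
    then show "w' = w" using \<open>inj F\<close> by (simp add: inj_eq)
  qed
qed

lemma tensor_in_derivative:
  assumes A: "smooth_atlas A" "pseudo_metric A g" and c: "c = chart_at A x" 
  shows "((\<lambda>\<eta>. tensor_in A c g \<eta> u v) has_derivative
           frechet_derivative (\<lambda>\<eta>. tensor_in A c g \<eta> u v) (at (snd c x))) (at (snd c x))"
proof -
  have "smooth_on (snd c ` fst c) (\<lambda>\<eta>. tensor_in A c g \<eta> u v)"
    using A chart_at_in[OF A(1)] unfolding pseudo_metric_def c by blast
  moreover have "snd c x \<in> snd c ` fst c" using chart_at_in[OF A(1), of x] c by blast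
  ultimately show ?thesis
    unfolding frechet_derivative_works[symmetric] by (rule smooth_on_differentiable)
qed

lemma christoffel_eq:
  assumes A: "smooth_atlas A" "pseudo_metric A g" and c: "c = chart_at A x"
  shows "g x (christoffel A g x u v) z =
          (frechet_derivative (\<lambda>\<eta>. tensor_in A c g \<eta> v z) (at (snd c x)) u
         + frechet_derivative (\<lambda>\<eta>. tensor_in A c g \<eta> u z) (at (snd c x)) v
         - frechet_derivative (\<lambda>\<eta>. tensor_in A c g \<eta> u v) (at (snd c x)) z) / 2"
proof -
  let ?D = "\<lambda>u v. frechet_derivative (\<lambda>\<eta>. tensor_in A c g \<eta> u v) (at (snd c x))"
  note D = tensor_in_derivative[OF A c]
  have cA: "c \<in> A" "x \<in> fst c" using chart_at_in[OF A(1), of x] c by auto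
  have op: "open (snd c ` fst c)" using A(1) cA unfolding smooth_atlas_def is_chart_def by blast
  have g: "\<And>y. bilinear (g y)" "nondegenerate_on (g x) UNIV"
    using A(2) unfolding pseudo_metric_def by blast+
  have bil: "\<eta> \<in> snd c ` fst c \<Longrightarrow> bilinear (tensor_in A c g \<eta>)" for \<eta>
    using bilinear_tensor_in[OF A(1) cA(1)] g by blast
  have x: "snd c x \<in> snd c ` fst c" using cA by blast
  have add: "?D u (z + z') w = ?D u z w + ?D u z' w" for u z z' w
  proof -
    have "((\<lambda>\<eta>. tensor_in A c g \<eta> u (z + z')) has_derivative (\<lambda>w. ?D u z w + ?D u z' w)) (at (snd c x))"
      by (rule has_derivative_transform_within_open[OF has_derivative_add[OF D D] op x])
        (simp add: bil bilinear_radd)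
    then show ?thesis using fun_cong[OF has_derivative_unique[OF D]] by blast
  qed
  have scale: "?D u (r *\<^sub>R z) w = r * ?D u z w" for u z r w
  proof -
    have "((\<lambda>\<eta>. tensor_in A c g \<eta> u (r *\<^sub>R z)) has_derivative (\<lambda>w. r * ?D u z w)) (at (snd c x))"
      by (rule has_derivative_transform_within_open[OF has_derivative_mult_right[OF D] op x])
        (simp add: bil bilinear_rmul)
    then show ?thesis using fun_cong[OF has_derivative_unique[OF D]] by blast
  qed
  have lin: "linear (?D u v)" for u v using has_derivative_linear[OF D] .
  have "linear (\<lambda>z. (?D v z u + ?D u z v - ?D u v z) / 2)"
    by (intro linearI) (simp_all add: add scale linear_add[OF lin] linear_cmul[OF lin] field_simps)
  from theI'[OF nondegenerate_representation[OF g(1) g(2) this]]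
  show ?thesis unfolding christoffel_def Let_def c by blast
qed

lemma christoffel_sym:
  assumes "pseudo_metric A g" 
  shows "christoffel A g x u v = christoffel A g x v u"
proof -
  have "tensor_in A c g \<eta> u v = tensor_in A c g \<eta> v u" for c \<eta> u v
    using assms unfolding pseudo_metric_def tensor_in_def Let_def by blast
  then show ?thesis unfolding christoffel_def Let_def
    by (simp add: add.commute)
qed

lemma nabla_torsion_free:
  assumes "pseudo_metric A g"
  shows "nabla A g x (X x) Y - nabla A g x (Y x) X = lie_bracket A X Y x"
  using christoffel_sym[OF assms, of x "X x" "Y x"]
  unfolding nabla_def lie_bracket_def Let_def by simp

lemma vfield_in_at:
  assumes "smooth_atlas A"
  shows "vfield_in A (chart_at A x) X (snd (chart_at A x) x) = X x"
proof -
  have "chart_inv (chart_at A x) (snd (chart_at A x) x) = x"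
    by (rule chart_inv_chart) (use assms chart_at_in in auto)
  then show ?thesis
    by (simp add: vfield_in_def Let_def change_self[OF assms chart_at_in[OF assms]])
qed

lemma tensor_in_at:
  assumes "smooth_atlas A"
  shows "tensor_in A (chart_at A x) b (snd (chart_at A x) x) = b x"
proof -
  have "chart_inv (chart_at A x) (snd (chart_at A x) x) = x"
    by (rule chart_inv_chart) (use assms chart_at_in in auto)
  then show ?thesis
    by (simp add: fun_eq_iff tensor_in_def Let_def change_self[OF assms chart_at_in[OF assms]])
qed

lemma nabla_metric:
  assumes A: "smooth_atlas A" "pseudo_metric A g"
    and W: "x \<in> W" "smooth_vfield_on A W Y" "smooth_vfield_on A W Z"
  shows "dir_deriv A x v (\<lambda>y. g y (Y y) (Z y)) =
           g x (nabla A g x v Y) (Z x) + g x (Y x) (nabla A g x v Z)"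
proof -
  define c where c: "c = chart_at A x"
  define \<xi> where \<xi>: "\<xi> = snd c x"
  let ?G = "tensor_in A c g" and ?Y = "vfield_in A c Y" and ?Z = "vfield_in A c Z"
  let ?D = "\<lambda>u v. frechet_derivative (\<lambda>\<eta>. tensor_in A c g \<eta> u v) (at \<xi>)"
  let ?DY = "frechet_derivative ?Y (at \<xi>)" and ?DZ = "frechet_derivative ?Z (at \<xi>)"
  have D: "((\<lambda>\<eta>. ?G \<eta> u v) has_derivative ?D u v) (at \<xi>)" for u v
    using tensor_in_derivative[OF A c] \<xi> by simp
  have cA: "c \<in> A" "x \<in> fst c" using chart_at_in[OF A(1), of x] c by auto
  have oW: "open (snd c ` (fst c \<inter> W))" using W open_chart_image[OF A(1) cA(1)]
    unfolding smooth_vfield_on_def by blast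
  have op: "open (snd c ` fst c)" using A(1) cA unfolding smooth_atlas_def is_chart_def by blast
  have x: "\<xi> \<in> snd c ` (fst c \<inter> W)" using cA W(1) \<xi> by blast
  have x': "\<xi> \<in> snd c ` fst c" using x by blast
  have Yd: "(?Y has_derivative ?DY) (at \<xi>)" "(?Z has_derivative ?DZ) (at \<xi>)"
    unfolding frechet_derivative_works[symmetric]
    using W cA x smooth_on_differentiable[of "snd c ` (fst c \<inter> W)"]
    unfolding smooth_vfield_on_def by blast+
  have g: "\<And>y. bilinear (g y)" "\<And>y u v. g y u v = g y v u"
    using A(2) unfolding pseudo_metric_def by blast+
  have bil: "\<eta> \<in> snd c ` fst c \<Longrightarrow> bilinear (?G \<eta>)" for \<eta>
    using bilinear_tensor_in[OF A(1) cA(1)] g by blast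
  have exp: "?G \<eta> u v = (\<Sum>i\<in>Basis. \<Sum>j\<in>Basis. (u \<bullet> i) * (v \<bullet> j) * ?G \<eta> i j)"
    if "\<eta> \<in> snd c ` fst c" for \<eta> u v
  proof -
    have "?G \<eta> u v = ?G \<eta> (\<Sum>i\<in>Basis. (u \<bullet> i) *\<^sub>R i) (\<Sum>j\<in>Basis. (v \<bullet> j) *\<^sub>R j)"
      by (simp add: euclidean_representation)
    also have "\<dots> = (\<Sum>(i,j)\<in>Basis \<times> Basis. ?G \<eta> ((u \<bullet> i) *\<^sub>R i) ((v \<bullet> j) *\<^sub>R j))"
      by (rule bilinear_sum[OF bil[OF that]])
    also have "\<dots> = (\<Sum>i\<in>Basis. \<Sum>j\<in>Basis. (u \<bullet> i) * (v \<bullet> j) * ?G \<eta> i j)"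
      by (simp add: sum.cartesian_product bilinear_lmul[OF bil[OF that]] bilinear_rmul[OF bil[OF that]] mult_ac)
    finally show ?thesis .
  qed
  have fG: "g y (Y y) (Z y) = ?G \<eta> (?Y \<eta>) (?Z \<eta>)" if "\<eta> \<in> snd c ` fst c" "y = chart_inv c \<eta>" for \<eta> y
  proof -
    have y: "y \<in> fst c" using that chart_inv_chart[OF A(1) cA(1)] by auto
    have "change c (chart_at A y) y (change (chart_at A y) c y u) = u" for u
      by (rule change_change[OF A(1)]) (use chart_at_in[OF A(1)] cA y in auto)
    then show ?thesis unfolding tensor_in_def vfield_in_def Let_def that(2)[symmetric] by simp
  qed
  have at: "?Y \<xi> = Y x" "?Z \<xi> = Z x" "?G \<xi> = g x"
    unfolding c \<xi> using vfield_in_at[OF A(1)] tensor_in_at[OF A(1)] by auto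
  have Dexp: "?D u w v = (\<Sum>i\<in>Basis. \<Sum>j\<in>Basis. (u \<bullet> i) * (w \<bullet> j) * ?D i j v)" for u w v
  proof -
    have "((\<lambda>\<eta>. \<Sum>i\<in>Basis. \<Sum>j\<in>Basis. (u \<bullet> i) * (w \<bullet> j) * ?G \<eta> i j)
        has_derivative (\<lambda>v. \<Sum>i\<in>Basis. \<Sum>j\<in>Basis. (u \<bullet> i) * (w \<bullet> j) * ?D i j v)) (at \<xi>)"
      by (intro has_derivative_sum has_derivative_mult_right D)
    then have "((\<lambda>\<eta>. ?G \<eta> u w) has_derivative
        (\<lambda>v. \<Sum>i\<in>Basis. \<Sum>j\<in>Basis. (u \<bullet> i) * (w \<bullet> j) * ?D i j v)) (at \<xi>)"
      by (rule has_derivative_transform_within_open[OF _ op x']) (simp add: exp[symmetric])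
    then show ?thesis using fun_cong[OF has_derivative_unique[OF D]] by blast
  qed
  let ?S = "\<lambda>v. \<Sum>i\<in>Basis. \<Sum>j\<in>Basis. (Y x \<bullet> i) * (Z x \<bullet> j) * ?D i j v
      + ((?DY v \<bullet> i) * (Z x \<bullet> j) * g x i j + (Y x \<bullet> i) * (?DZ v \<bullet> j) * g x i j)"
  have "((\<lambda>\<eta>. \<Sum>i\<in>Basis. \<Sum>j\<in>Basis. (?Y \<eta> \<bullet> i) * (?Z \<eta> \<bullet> j) * ?G \<eta> i j) has_derivative ?S) (at \<xi>)"
  proof (rule has_derivative_eq_rhs)
    show "((\<lambda>\<eta>. \<Sum>i\<in>Basis. \<Sum>j\<in>Basis. (?Y \<eta> \<bullet> i) * (?Z \<eta> \<bullet> j) * ?G \<eta> i j) has_derivative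
        (\<lambda>v. \<Sum>i\<in>Basis. \<Sum>j\<in>Basis. (?Y \<xi> \<bullet> i) * (?Z \<xi> \<bullet> j) * ?D i j v
          + ((?Y \<xi> \<bullet> i) * (?DZ v \<bullet> j) + (?DY v \<bullet> i) * (?Z \<xi> \<bullet> j)) * ?G \<xi> i j)) (at \<xi>)"
      by (intro has_derivative_sum has_derivative_mult has_derivative_inner_left D Yd)
  qed (simp add: at algebra_simps)
  then have f': "((\<lambda>y. g y (Y y) (Z y)) \<circ> chart_inv c has_derivative ?S) (at \<xi>)"
    by (rule has_derivative_transform_within_open[OF _ op x']) (simp add: fG exp[symmetric])
  have "dir_deriv A x v (\<lambda>y. g y (Y y) (Z y)) = ?S v"
    unfolding dir_deriv_def Let_def c[symmetric] \<xi>[symmetric]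
    by (simp only: frechet_derivative_at[OF f', symmetric])
  also have "\<dots> = ?D (Y x) (Z x) v + (g x (?DY v) (Z x) + g x (Y x) (?DZ v))"
    unfolding sum.distrib Dexp[symmetric]
    using exp[OF x', of "?DY v" "Z x"] exp[OF x', of "Y x" "?DZ v"] at by simp
  finally have L: "dir_deriv A x v (\<lambda>y. g y (Y y) (Z y)) =
     ?D (Y x) (Z x) v + (g x (?DY v) (Z x) + g x (Y x) (?DZ v))" .
  have s: "?D u w = ?D w u" for u w
  proof -
    have "?G \<eta> u w = ?G \<eta> w u" for \<eta> unfolding tensor_in_def Let_def using g(2) by blast
    then show ?thesis by simp
  qed
  have "g x (christoffel A g x v (Y x)) (Z x) + g x (christoffel A g x v (Z x)) (Y x) = ?D (Y x) (Z x) v"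
    unfolding christoffel_eq[OF A c] \<xi>[symmetric] s[of "Z x" "Y x"] by (simp add: field_simps)
  then show ?thesis unfolding L nabla_def Let_def c[symmetric] \<xi>[symmetric]
    using g(2)[of x "Y x" "christoffel A g x v (Z x)"]
    by (simp add: bilinear_ladd[OF g(1)] bilinear_radd[OF g(1)])
qed

section \<open>Orthonormal frames\<close>

definition orthonormal_frame :: "('e::euclidean_space \<Rightarrow> 'e \<Rightarrow> real) \<Rightarrow> 'e set \<Rightarrow> (nat \<Rightarrow> 'e) \<Rightarrow> bool" where
  "orthonormal_frame b V E \<longleftrightarrow>
     (\<forall>a<dim V. E a \<in> V \<and> \<bar>b (E a) (E a)\<bar> = 1) \<and>
     (\<forall>a<dim V. \<forall>a'<dim V. a \<noteq> a' \<longrightarrow> b (E a) (E a') = 0)"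

text \<open>
  All expressions below that contain frames are traces, so they do not depend on the choice made
  here, which is independent at every point.
\<close>

definition frame :: "('a, 'e::euclidean_space) tensor02 \<Rightarrow> ('a, 'e) distribution \<Rightarrow> 'a \<Rightarrow> nat \<Rightarrow> 'e" where
  "frame g P x = (SOME E. orthonormal_frame (g x) (P x) E)"

definition frame_sign :: "('a, 'e::euclidean_space) tensor02 \<Rightarrow> ('a, 'e) distribution \<Rightarrow> 'a \<Rightarrow> nat \<Rightarrow> real" where
  "frame_sign g P x a = g x (frame g P x a) (frame g P x a)"

definition trace_on ::
  "('a, 'e::euclidean_space) tensor02 \<Rightarrow> ('a, 'e) distribution \<Rightarrow> ('a \<Rightarrow> 'e \<Rightarrow> 'e \<Rightarrow> 'c::real_vector) \<Rightarrow> 'a \<Rightarrow> 'c"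
  where
  "trace_on g P b x =
     (let E = frame g P x; \<epsilon> = frame_sign g P x in \<Sum>a<dim (P x). \<epsilon> a *\<^sub>R b x (E a) (E a))"

definition full_frame ::
  "('a, 'e::euclidean_space) tensor02 \<Rightarrow> ('a, 'e) distribution \<Rightarrow> ('a, 'e) distribution \<Rightarrow> 'a \<Rightarrow> nat \<Rightarrow> 'e" where
  "full_frame g P Q x l =
     (if l < dim (P x) then frame g P x l else frame g Q x (l - dim (P x)))"

definition divergence ::
  "('a, 'e::euclidean_space) chart set \<Rightarrow> ('a, 'e) distribution \<Rightarrow> ('a, 'e) distribution \<Rightarrow>
     ('a, 'e) tensor02 \<Rightarrow> ('a, 'e) vfield \<Rightarrow> 'a \<Rightarrow> real" where
  "divergence A P Q g X x =
     (let e = full_frame g P Q x in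
        \<Sum>l<dim (P x) + dim (Q x). g x (e l) (e l) * g x (nabla A g x (e l) X) (e l))"

section \<open>Extrinsic geometry of a distribution\<close>

text \<open>
  In the following \<open>P\<close> and \<open>Q\<close> are complementary orthogonal distributions. The objects belong to
  \<open>P\<close>: for \<open>P = Dt\<close> and \<open>Q = D\<close> they are \<open>h\<close>, \<open>T\<close>, \<open>H\<close>, ..., and for \<open>P = D\<close> and \<open>Q = Dt\<close> those
  with a tilde. The values at a pair of tangent vectors are obtained from sections of \<open>P\<close> through
  the components in \<open>P\<close> of these vectors, which includes the extension by zero.
\<close>

definition second_ff ::
  "('a::topological_space, 'e::euclidean_space) chart set \<Rightarrow> ('a, 'e) distribution \<Rightarrow>
     ('a, 'e) distribution \<Rightarrow> ('a, 'e) tensor02 \<Rightarrow> ('a, 'e) tensor12" where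
  "second_ff A P Q g x u v =
     (THE w. \<forall>X Y. local_section A P x (component P Q x u) X \<longrightarrow>
                   local_section A P x (component P Q x v) Y \<longrightarrow>
        w = component Q P x ((1/2) *\<^sub>R (nabla A g x (X x) Y + nabla A g x (Y x) X)))"

definition integrability ::
  "('a::topological_space, 'e::euclidean_space) chart set \<Rightarrow> ('a, 'e) distribution \<Rightarrow>
     ('a, 'e) distribution \<Rightarrow> ('a, 'e) tensor12" where
  "integrability A P Q x u v =
     (THE w. \<forall>X Y. local_section A P x (component P Q x u) X \<longrightarrow>
                   local_section A P x (component P Q x v) Y \<longrightarrow>
        w = (1/2) *\<^sub>R component Q P x (lie_bracket A X Y x))"

definition mean_curvature ::
  "('a::topological_space, 'e::euclidean_space) chart set \<Rightarrow> ('a, 'e) distribution \<Rightarrow>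
     ('a, 'e) distribution \<Rightarrow> ('a, 'e) tensor02 \<Rightarrow> ('a, 'e) vfield" where
  "mean_curvature A P Q g = trace_on g P (second_ff A P Q g)"

definition norm2_on ::
  "('a, 'e::euclidean_space) tensor02 \<Rightarrow> ('a, 'e) distribution \<Rightarrow> ('a, 'e) tensor12 \<Rightarrow> 'a \<Rightarrow> real" where
  "norm2_on g P K x =
     (let E = frame g P x; \<epsilon> = frame_sign g P x in
        \<Sum>a<dim (P x). \<Sum>b<dim (P x). \<epsilon> a * \<epsilon> b * g x (K x (E a) (E b)) (K x (E a) (E b)))"

text \<open>
  For \<open>K = h\<close> this is the shape operator \<open>A\<^sub>Z\<close>, for \<open>K = T\<close> it is \<open>T\<^sup>\<sharp>\<^sub>Z\<close>, extended by zero
  (which is part of \<open>K\<close>).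
\<close>

definition weingarten ::
  "('a, 'e::euclidean_space) tensor02 \<Rightarrow> ('a, 'e) distribution \<Rightarrow> ('a, 'e) tensor12 \<Rightarrow> 'a \<Rightarrow> 'e \<Rightarrow> 'e \<Rightarrow> 'e" where
  "weingarten g P K x z u = (THE w. w \<in> P x \<and> (\<forall>v\<in>P x. g x w v = g x (K x u v) z))"

definition cal_T ::
  "('a::topological_space, 'e::euclidean_space) chart set \<Rightarrow> ('a, 'e) distribution \<Rightarrow>
     ('a, 'e) distribution \<Rightarrow> ('a, 'e) tensor02 \<Rightarrow> ('a, 'e) endofield" where
  "cal_T A P Q g x u =
     (let \<E> = frame g Q x; \<epsilon> = frame_sign g Q x; Ts = weingarten g P (integrability A P Q) x in
        \<Sum>i<dim (Q x). \<epsilon> i *\<^sub>R Ts (\<E> i) (Ts (\<E> i) u))"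

definition cal_K ::
  "('a::topological_space, 'e::euclidean_space) chart set \<Rightarrow> ('a, 'e) distribution \<Rightarrow>
     ('a, 'e) distribution \<Rightarrow> ('a, 'e) tensor02 \<Rightarrow> ('a, 'e) endofield" where
  "cal_K A P Q g x u =
     (let \<E> = frame g Q x; \<epsilon> = frame_sign g Q x;
          Ts = weingarten g P (integrability A P Q) x;
          As = weingarten g P (second_ff A P Q g) x in
        \<Sum>i<dim (Q x). \<epsilon> i *\<^sub>R (Ts (\<E> i) (As (\<E> i) u) - As (\<E> i) (Ts (\<E> i) u)))"

text \<open>The vector field \<open>\<langle>h, B\<rangle>\<close>.\<close>

definition h_contract ::
  "('a::topological_space, 'e::euclidean_space) chart set \<Rightarrow> ('a, 'e) distribution \<Rightarrow>
     ('a, 'e) distribution \<Rightarrow> ('a, 'e) tensor02 \<Rightarrow> ('a, 'e) tensor02 \<Rightarrow> ('a, 'e) vfield" where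
  "h_contract A P Q g B x =
     (let E = frame g P x; \<epsilon> = frame_sign g P x in
        \<Sum>a<dim (P x). \<Sum>b<dim (P x).
          (\<epsilon> a * \<epsilon> b * B x (E a) (E b)) *\<^sub>R second_ff A P Q g x (E a) (E b))"

definition div_h ::
  "('a::topological_space, 'e::euclidean_space) chart set \<Rightarrow> ('a, 'e) distribution \<Rightarrow>
     ('a, 'e) distribution \<Rightarrow> ('a, 'e) tensor02 \<Rightarrow> ('a, 'e) tensor02" where
  "div_h A P Q g x u v =
     (let e = full_frame g P Q x in
        \<Sum>l<dim (P x) + dim (Q x). g x (e l) (e l) *
          g x (nabla_tensor12 A g (second_ff A P Q g) x (e l) (component P Q x u) (component P Q x v)) (e l))"

text \<open>
  \<open>Phi_h A P Q g S x\<close> and \<open>Phi_T A P Q g S x\<close> are the pairings of \<open>S\<close> with the tensors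
  \<open>\<Phi>\<^sub>h\<close> and \<open>\<Phi>\<^sub>T\<close> of \<open>P\<close>.
\<close>

definition Phi_h ::
  "('a::topological_space, 'e::euclidean_space) chart set \<Rightarrow> ('a, 'e) distribution \<Rightarrow>
     ('a, 'e) distribution \<Rightarrow> ('a, 'e) tensor02 \<Rightarrow> ('a, 'e) tensor02 \<Rightarrow> 'a \<Rightarrow> real" where
  "Phi_h A P Q g S x =
     (let \<E> = frame g P x; \<epsilon> = frame_sign g P x; h = second_ff A P Q g x; H = mean_curvature A P Q g x in
        S x H H - (\<Sum>i<dim (P x). \<Sum>j<dim (P x). \<epsilon> i * \<epsilon> j * S x (h (\<E> i) (\<E> j)) (h (\<E> i) (\<E> j))))"

definition Phi_T ::
  "('a::topological_space, 'e::euclidean_space) chart set \<Rightarrow> ('a, 'e) distribution \<Rightarrow>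
     ('a, 'e) distribution \<Rightarrow> ('a, 'e) tensor02 \<Rightarrow> ('a, 'e) tensor02 \<Rightarrow> 'a \<Rightarrow> real" where
  "Phi_T A P Q g S x =
     (let \<E> = frame g P x; \<epsilon> = frame_sign g P x; T = integrability A P Q x in
        - (\<Sum>i<dim (P x). \<Sum>j<dim (P x). \<epsilon> i * \<epsilon> j * S x (T (\<E> i) (\<E> j)) (T (\<E> i) (\<E> j))))"

section \<open>Variations of the metric\<close>

definition smooth_metric_family ::
  "('a::topological_space, 'e::euclidean_space) chart set \<Rightarrow> real \<Rightarrow> (real \<Rightarrow> ('a, 'e) tensor02) \<Rightarrow> bool" where
  "smooth_metric_family A \<epsilon> g \<longleftrightarrow>
     (\<forall>t. \<bar>t\<bar> < \<epsilon> \<longrightarrow> pseudo_metric A (g t)) \<and>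
     (\<forall>c\<in>A. \<forall>u v. smooth_on ({-\<epsilon><..<\<epsilon>} \<times> snd c ` fst c) (\<lambda>(t, \<xi>). tensor_in A c (g t) \<xi> u v))"

definition metric_velocity :: "(real \<Rightarrow> ('a, 'e) tensor02) \<Rightarrow> real \<Rightarrow> ('a, 'e) tensor02" where
  "metric_velocity g t x u v = deriv (\<lambda>s. g s x u v) t"

definition gtop_variation ::
  "('a::topological_space, 'e::euclidean_space) chart set \<Rightarrow> ('a, 'e) distribution \<Rightarrow>
     ('a, 'e) tensor02 \<Rightarrow> real \<Rightarrow> (real \<Rightarrow> ('a, 'e) tensor02) \<Rightarrow> bool" where
  "gtop_variation A Dt g0 \<epsilon> g \<longleftrightarrow>
     0 < \<epsilon> \<and> g 0 = g0 \<and> smooth_metric_family A \<epsilon> g \<and>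
     (\<forall>t x. \<bar>t\<bar> < \<epsilon> \<longrightarrow>
        nondegenerate_on (g t x) (Dt x) \<and>
        (\<forall>u\<in>Dt x. \<forall>v\<in>orth_complement g0 Dt x. g t x u v = 0) \<and>
        (\<forall>u\<in>orth_complement g0 Dt x. \<forall>v\<in>orth_complement g0 Dt x. g t x u v = g0 x u v)) \<and>
     (\<exists>\<Omega>. open \<Omega> \<and> connected \<Omega> \<and> compact (closure \<Omega>) \<and>
        (\<forall>t x u v. \<bar>t\<bar> < \<epsilon> \<longrightarrow> x \<notin> \<Omega> \<longrightarrow> metric_velocity g t x u v = 0))"

end

theory Submission
  imports Defs
begin

text \<open>
  For sections \<open>X, Y\<close> of a distribution and \<open>Z\<close> orthogonal to it, \<open>2 g(h(X, Y), Z) = -(L\<^sub>Z g)(X, Y)\<close>,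
  which contains no connection. As \<open>g\<^sub>s\<close> does not vary on \<open>D\<close>, the covectors
  \<open>g\<^sub>s(h, \<cdot>)\<close> of the second fundamental form and mean curvature of \<open>D\<close> are constant on \<open>Dt\<close>, and only the metric
  that measures them contributes \<open>-B\<close>. For \<open>Dt\<close>, the traces are differentiated in an orthonormal
  frame of \<open>g\<^sub>t\<close>, made orthonormal for \<open>g\<^sub>s\<close> by Gram-Schmidt, and \<open>\<partial>\<^sub>t h\<close> is \<open>-1/2\<close> times \<open>(L\<^sub>Z B)(X, Y)\<close>.
  In a local orthonormal frame adapted to the splitting, with connection coefficients \<open>\<omega>\<close> of \<open>Dt\<close>, the
  derivative of \<open>B\<close> is absorbed into the divergence, the terms in \<open>\<omega>\<close> are those of \<open>div h\<close>, and what
  is left is the commutator \<open>cal_K\<close>. The identities for \<open>H\<close> and \<open>T\<close> are the trace and the algebraic part of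
  the same computation.
\<close>

section \<open>Calculus of smooth maps\<close>

text \<open>The definitions pick a frame by \<open>SOME\<close> separately at every point and every
  time, and several tensors by \<open>THE\<close> over all local sections, so nothing can be
  differentiated as it is written. Two layers of work remove this obstacle: pairing with a section
  of the complementary distribution shows that the \<open>THE\<close> values are tensorial, and
  traces are shown to be independent of the frame, so that one depending regularly on the point or
  on the time may be substituted. All metrics of the family share one splitting and agree as soon as
  one argument lies in \<open>D\<close>. Hence a frame of \<open>D\<close> stays orthonormal,
  \<open>B\<close> vanishes when one argument is in \<open>D\<close>, and a \<open>D\<close>-valued
  object is recorded by its components in a frame of \<open>D\<close> that does not move. In the
  derivative of \<open>\<langle>h, h\<rangle>\<close> the terms quadratic in \<open>h\<close> and
  linear in \<open>B\<close> occur twice: from the bracket inside \<open>h\<close>, and from the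
  motion of the frame of \<open>Dt\<close>. They cancel exactly; otherwise neither the commutator
  nor the divergence alone could account for the result.\<close>

lemma frechet_derivative_cong_open:
  assumes "open S" "x \<in> S" "\<And>y. y \<in> S \<Longrightarrow> f y = g y"
  shows "frechet_derivative f (at x) = frechet_derivative g (at x)"
proof -
  have "(f has_derivative f') (at x) \<longleftrightarrow> (g has_derivative f') (at x)" for f'
    using has_derivative_transform_within_open[OF _ assms(1,2), of f f' UNIV g]
      has_derivative_transform_within_open[OF _ assms(1,2), of g f' UNIV f] assms(3) by auto
  then show ?thesis unfolding frechet_derivative_def by simp
qed

lemma differentiable_cong_open:
  assumes "open S" "x \<in> S" "\<And>y. y \<in> S \<Longrightarrow> f y = g y" "f differentiable (at x)"
  shows "g differentiable (at x)"
  using has_derivative_transform_within_open[OF _ assms(1,2), of f _ UNIV g] assms(3,4)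
  unfolding differentiable_def by auto

lemma frechet_derivative_eqI:
  "(f has_derivative f') (at x) \<Longrightarrow> frechet_derivative f (at x) v = f' v"
  using frechet_derivative_at by metis

lemma cd_cong:
  assumes "open S" "\<And>y. y \<in> S \<Longrightarrow> f y = g y" "continuously_diff_on k S f"
  shows "continuously_diff_on k S g"
  using assms(2,3)
proof (induction k arbitrary: f g)
  case 0
  then show ?case using continuous_on_cong by (metis continuously_diff_on.simps(1))
next
  case (Suc k)
  have "g differentiable (at x)" if "x \<in> S" for x
    using differentiable_cong_open[OF assms(1) that] Suc.prems that by (metis continuously_diff_on.simps(2))
  moreover have "continuously_diff_on k S (\<lambda>x. frechet_derivative g (at x) v)" for v
  proof (rule Suc.IH[of "\<lambda>x. frechet_derivative f (at x) v"])
    show "frechet_derivative f (at y) v = frechet_derivative g (at y) v" if "y \<in> S" for y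
      using frechet_derivative_cong_open[OF assms(1) that] Suc.prems by metis
  qed (use Suc.prems in simp)
  ultimately show ?case by simp
qed

lemma cd_SucD: "continuously_diff_on (Suc k) S f \<Longrightarrow> continuously_diff_on k S f"
proof (induction k arbitrary: f)
  case 0
  then show ?case
    by (simp add: continuous_at_imp_continuous_on differentiable_imp_continuous_within)
next
  case (Suc k)
  then show ?case by (metis continuously_diff_on.simps(2))
qed

lemma cd_subset: "continuously_diff_on k S f \<Longrightarrow> T \<subseteq> S \<Longrightarrow> continuously_diff_on k T f"
proof (induction k arbitrary: f)
  case 0
  then show ?case using continuous_on_subset by auto
next
  case (Suc k)
  then show ?case by (metis continuously_diff_on.simps(2) subset_iff)
qed

text \<open>The recursion of \<open>continuously_diff_on\<close> runs through
  \<open>frechet_derivative\<close>. This rule admits a derivative in any closed form, and the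
  inductions below choose forms built from functions to which the induction hypothesis
  applies.\<close>

lemma cd_SucI:
  assumes "open S" "\<And>x. x \<in> S \<Longrightarrow> (f has_derivative f' x) (at x)"
    "\<And>v. continuously_diff_on k S (\<lambda>x. f' x v)"
  shows "continuously_diff_on (Suc k) S f"
proof -
  have "continuously_diff_on k S (\<lambda>x. frechet_derivative f (at x) v)" for v
    by (rule cd_cong[OF assms(1) _ assms(3)]) (simp add: frechet_derivative_eqI[OF assms(2)])
  then show ?thesis using assms(2) unfolding continuously_diff_on.simps differentiable_def by blast
qed

lemma cd_derivative:
  "continuously_diff_on (Suc k) S f \<Longrightarrow> x \<in> S \<Longrightarrow>
     (f has_derivative frechet_derivative f (at x)) (at x)"
  using frechet_derivative_works by auto

lemma cd_const: "continuously_diff_on k S (\<lambda>x. a)"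
proof (induction k arbitrary: a)
  case (Suc k)
  have "frechet_derivative (\<lambda>x::'a. a) (at x) v = 0" for x v
    by (rule frechet_derivative_eqI) (rule has_derivative_const)
  then show ?case using Suc by simp
qed simp

lemma cd_add:
  assumes "open S" "continuously_diff_on k S f" "continuously_diff_on k S g"
  shows "continuously_diff_on k S (\<lambda>x. f x + g x)"
  using assms(2,3)
proof (induction k arbitrary: f g)
  case 0
  then show ?case by (simp add: continuous_on_add)
next
  case (Suc k)
  show ?case
  proof (rule cd_SucI[OF assms(1)])
    show "((\<lambda>x. f x + g x) has_derivative
      (\<lambda>v. frechet_derivative f (at x) v + frechet_derivative g (at x) v)) (at x)" if "x \<in> S" for x
      using Suc.prems that by (intro has_derivative_add cd_derivative)
    show "continuously_diff_on k S (\<lambda>x. frechet_derivative f (at x) v + frechet_derivative g (at x) v)" for v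
      using Suc.prems by (intro Suc.IH) simp_all
  qed
qed

lemma cd_bilinear:
  assumes "bounded_bilinear B" "open S" "continuously_diff_on k S f" "continuously_diff_on k S g"
  shows "continuously_diff_on k S (\<lambda>x. B (f x) (g x))"
  using assms(3,4)
proof (induction k arbitrary: f g)
  case 0
  then show ?case using bounded_bilinear.continuous_on[OF assms(1)] by simp
next
  case (Suc k)
  show ?case
  proof (rule cd_SucI[OF assms(2)])
    show "((\<lambda>x. B (f x) (g x)) has_derivative
      (\<lambda>v. B (f x) (frechet_derivative g (at x) v) + B (frechet_derivative f (at x) v) (g x))) (at x)"
      if "x \<in> S" for x
      using Suc.prems that by (intro bounded_bilinear.FDERIV[OF assms(1)] cd_derivative)
    show "continuously_diff_on k S
      (\<lambda>x. B (f x) (frechet_derivative g (at x) v) + B (frechet_derivative f (at x) v) (g x))" for v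
      using Suc.prems by (intro cd_add assms(2) Suc.IH) (auto intro: cd_SucD simp del: continuously_diff_on.simps, simp_all)
  qed
qed

lemma smooth_on_cong:
  "open S \<Longrightarrow> (\<And>y. y \<in> S \<Longrightarrow> f y = g y) \<Longrightarrow> smooth_on S f \<Longrightarrow> smooth_on S g"
  unfolding smooth_on_def using cd_cong by blast

lemma smooth_on_subset: "smooth_on S f \<Longrightarrow> T \<subseteq> S \<Longrightarrow> smooth_on T f"
  unfolding smooth_on_def using cd_subset by blast

lemma smooth_on_const: "smooth_on S (\<lambda>x. a)"
  unfolding smooth_on_def using cd_const by blast

lemma smooth_on_add:
  "open S \<Longrightarrow> smooth_on S f \<Longrightarrow> smooth_on S g \<Longrightarrow> smooth_on S (\<lambda>x. f x + g x)"
  unfolding smooth_on_def using cd_add by blast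

lemma smooth_on_bilinear:
  "bounded_bilinear B \<Longrightarrow> open S \<Longrightarrow> smooth_on S f \<Longrightarrow> smooth_on S g \<Longrightarrow> smooth_on S (\<lambda>x. B (f x) (g x))"
  unfolding smooth_on_def using cd_bilinear by blast

lemmas smooth_on_mult = smooth_on_bilinear[OF bounded_bilinear_mult]
lemmas smooth_on_scaleR = smooth_on_bilinear[OF bounded_bilinear_scaleR]

lemma smooth_on_inner_const: "open S \<Longrightarrow> smooth_on S f \<Longrightarrow> smooth_on S (\<lambda>x. f x \<bullet> a)"
  using smooth_on_bilinear[OF bounded_bilinear_inner _ _ smooth_on_const] by blast

lemma smooth_on_sum:
  assumes "open S" "\<And>i. i \<in> I \<Longrightarrow> smooth_on S (f i)"
  shows "smooth_on S (\<lambda>x. \<Sum>i\<in>I. f i x)"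
  using assms(2) by (induction I rule: infinite_finite_induct) (auto intro: smooth_on_const smooth_on_add assms(1))

lemma smooth_on_diff:
  assumes "open S" "smooth_on S f" "smooth_on S g"
  shows "smooth_on S (\<lambda>x. f x - g x)"
proof -
  have "smooth_on S (\<lambda>x. f x + (-1) *\<^sub>R g x)"
    by (intro smooth_on_add smooth_on_scaleR smooth_on_const assms)
  then show ?thesis by simp
qed

lemma smooth_on_frechet: "smooth_on S f \<Longrightarrow> smooth_on S (\<lambda>x. frechet_derivative f (at x) v)"
  unfolding smooth_on_def by (metis continuously_diff_on.simps(2))

lemma smooth_on_has_derivative:
  "smooth_on S f \<Longrightarrow> x \<in> S \<Longrightarrow> (f has_derivative frechet_derivative f (at x)) (at x)"
  using smooth_on_differentiable frechet_derivative_works by blast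

lemma smooth_on_continuous: "smooth_on S f \<Longrightarrow> continuous_on S f"
  unfolding smooth_on_def by (metis continuously_diff_on.simps(1))

lemma linear_basis_expansion:
  fixes L :: "'b::euclidean_space \<Rightarrow> 'c::real_vector"
  assumes "linear L"
  shows "L v = (\<Sum>i\<in>Basis. (v \<bullet> i) *\<^sub>R L i)"
proof -
  have "L v = L (\<Sum>i\<in>Basis. (v \<bullet> i) *\<^sub>R i)" by (simp add: euclidean_representation)
  then show ?thesis using assms by (simp add: linear_sum linear_cmul)
qed

text \<open>Smoothness provides only derivatives in a fixed direction as functions of the point. A
  moving direction is expanded in the standard basis, which makes its coefficients smooth
  factors.\<close>

lemma smooth_on_frechet_along:
  fixes f :: "'b::euclidean_space \<Rightarrow> 'c::real_normed_vector"
  assumes "open S" "smooth_on S f" "smooth_on S X"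
  shows "smooth_on S (\<lambda>x. frechet_derivative f (at x) (X x))"
proof (rule smooth_on_cong[OF assms(1)])
  show "smooth_on S (\<lambda>x. \<Sum>i\<in>Basis. (X x \<bullet> i) *\<^sub>R frechet_derivative f (at x) i)"
    by (intro smooth_on_sum smooth_on_scaleR smooth_on_inner_const smooth_on_frechet assms)
  fix y assume "y \<in> S"
  then have "linear (frechet_derivative f (at y))"
    using assms(2) smooth_on_has_derivative has_derivative_linear by blast
  from linear_basis_expansion[OF this, of "X y"]
  show "(\<Sum>i\<in>Basis. (X y \<bullet> i) *\<^sub>R frechet_derivative f (at y) i) = frechet_derivative f (at y) (X y)" by simp
qed

text \<open>The induction varies only the outer function: by the chain rule the derivative is a sum
  of products of a smooth factor with a partial derivative of \<open>f\<close> composed with the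
  same \<open>\<phi>\<close>, of lower order.\<close>

lemma smooth_on_compose:
  fixes \<phi> :: "'b::real_normed_vector \<Rightarrow> 'm::euclidean_space" and f :: "'m \<Rightarrow> 'c::real_normed_vector"
  assumes S: "open S" and f: "smooth_on T f" and \<phi>: "smooth_on S \<phi>" "\<phi> ` S \<subseteq> T"
  shows "smooth_on S (\<lambda>x. f (\<phi> x))"
proof -
  have "continuously_diff_on k S (\<lambda>x. f (\<phi> x))" for k
    using f
  proof (induction k arbitrary: f)
    case 0
    then show ?case
      using \<phi> continuous_on_compose2[OF smooth_on_continuous smooth_on_continuous] by auto
  next
    case (Suc k)
    show ?case
    proof (rule cd_SucI[OF S])
      fix x assume x: "x \<in> S"
      then have fx: "(f has_derivative frechet_derivative f (at (\<phi> x))) (at (\<phi> x))"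
        using Suc.prems \<phi> by (intro smooth_on_has_derivative) auto
      have "((\<lambda>x. f (\<phi> x)) has_derivative
          (\<lambda>v. frechet_derivative f (at (\<phi> x)) (frechet_derivative \<phi> (at x) v))) (at x)"
        using diff_chain_at[OF smooth_on_has_derivative[OF \<phi>(1) x] fx] by (simp add: o_def)
      then show "((\<lambda>x. f (\<phi> x)) has_derivative (\<lambda>v. \<Sum>i\<in>Basis.
          (frechet_derivative \<phi> (at x) v \<bullet> i) *\<^sub>R frechet_derivative f (at (\<phi> x)) i)) (at x)"
        unfolding linear_basis_expansion[OF has_derivative_linear[OF fx], of "frechet_derivative \<phi> (at x) _"] .
    next
      fix v
      have "continuously_diff_on k S (\<lambda>x. (frechet_derivative \<phi> (at x) v \<bullet> i) *\<^sub>R frechet_derivative f (at (\<phi> x)) i)" for i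
        using smooth_on_inner_const[OF S smooth_on_frechet[OF \<phi>(1)]] Suc.IH[OF smooth_on_frechet[OF Suc.prems]]
        unfolding smooth_on_def by (intro cd_bilinear[OF bounded_bilinear_scaleR S]) auto
      then have "continuously_diff_on k S (\<lambda>x. \<Sum>i\<in>I.
          (frechet_derivative \<phi> (at x) v \<bullet> i) *\<^sub>R frechet_derivative f (at (\<phi> x)) i)" for I
        by (induction I rule: infinite_finite_induct) (auto intro: cd_const cd_add S)
      then show "continuously_diff_on k S (\<lambda>x. \<Sum>i\<in>Basis.
          (frechet_derivative \<phi> (at x) v \<bullet> i) *\<^sub>R frechet_derivative f (at (\<phi> x)) i)" .
    qed
  qed
  then show ?thesis unfolding smooth_on_def by blast
qed

text \<open>The derivative is written as a product of copies of the function itself and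
  \<open>f'\<close>, so that the induction on the order of differentiability in the next lemma
  closes on itself.\<close>

lemma has_derivative_inverse_sqrt:
  fixes f :: "'b::real_normed_vector \<Rightarrow> real"
  assumes "(f has_derivative f') (at x)" "f x > 0"
  shows "((\<lambda>x. 1 / sqrt (f x)) has_derivative
    (\<lambda>v. (- 1/2) * (1 / sqrt (f x) * (1 / sqrt (f x) * (1 / sqrt (f x) * f' v))))) (at x)"
proof -
  have "((\<lambda>u. 1 / sqrt u) has_real_derivative (- 1/2) * (1 / sqrt (f x)) ^ 3) (at (f x))"
    using assms(2) by (auto intro!: derivative_eq_intros simp: field_simps power2_eq_square power3_eq_cube)
  then have "((\<lambda>u. 1 / sqrt u) has_derivative (*) ((- 1/2) * (1 / sqrt (f x)) ^ 3)) (at (f x))"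
    by (simp add: has_field_derivative_def)
  from diff_chain_at[OF assms(1) this] show ?thesis
    unfolding o_def by (rule has_derivative_eq_rhs) (simp only: power3_eq_cube mult.assoc)
qed

lemma smooth_on_inverse_sqrt:
  fixes f :: "'b::real_normed_vector \<Rightarrow> real"
  assumes S: "open S" and f: "smooth_on S f" "\<And>x. x \<in> S \<Longrightarrow> f x > 0"
  shows "smooth_on S (\<lambda>x. 1 / sqrt (f x))"
proof -
  have "continuously_diff_on k S (\<lambda>x. 1 / sqrt (f x))" for k
  proof (induction k)
    case 0
    have "\<forall>x\<in>S. sqrt (f x) \<noteq> 0" using f(2) by (auto simp: less_le)
    then show ?case using smooth_on_continuous[OF f(1)]
      by (auto intro!: continuous_intros)
  next
    case (Suc k)
    show ?case
    proof (rule cd_SucI[OF S has_derivative_inverse_sqrt])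
      show "continuously_diff_on k S (\<lambda>x. (- 1/2) * (1 / sqrt (f x) * (1 / sqrt (f x) *
          (1 / sqrt (f x) * frechet_derivative f (at x) v))))" for v
        using smooth_on_frechet[OF f(1), of v] unfolding smooth_on_def
        by (intro cd_bilinear[OF bounded_bilinear_mult S] Suc cd_const) blast
    qed (use f smooth_on_has_derivative in auto)
  qed
  then show ?thesis unfolding smooth_on_def by blast
qed

subsection \<open>Symmetry of second derivatives\<close>

text \<open>Applying the mean value theorem twice to the second difference of \<open>f\<close> over the
  parallelogram spanned by \<open>h u\<close> and \<open>h v\<close>.\<close>

lemma second_difference_mvt:
  fixes f :: "'b::real_normed_vector \<Rightarrow> real"
  assumes f: "smooth_on S f" and h: "h > 0"
    and sub: "\<And>a b. a \<in> {0..h} \<Longrightarrow> b \<in> {0..h} \<Longrightarrow> x + a *\<^sub>R u + b *\<^sub>R v \<in> S"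
  obtains a b where "a \<in> {0<..<h}" "b \<in> {0<..<h}"
    "f (x + h *\<^sub>R u + h *\<^sub>R v) - f (x + h *\<^sub>R u) - f (x + h *\<^sub>R v) + f x =
       h * h * frechet_derivative (\<lambda>y. frechet_derivative f (at y) u) (at (x + a *\<^sub>R u + b *\<^sub>R v)) v"
proof -
  let ?D = "\<lambda>u y. frechet_derivative f (at y) u"
  have line: "((\<lambda>s. F (p + s *\<^sub>R w)) has_real_derivative frechet_derivative F (at (p + s *\<^sub>R w)) w) (at s)"
    if "smooth_on S F" "p + s *\<^sub>R w \<in> S" for F :: "'b \<Rightarrow> real" and p w s
  proof -
    have *: "((\<lambda>s. p + s *\<^sub>R w) has_derivative (\<lambda>r. r *\<^sub>R w)) (at s)"
      by (auto intro!: derivative_eq_intros)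
    note F = smooth_on_has_derivative[OF that]
    from diff_chain_at[OF * F] show ?thesis
      using linear_cmul[OF has_derivative_linear[OF F]]
      by (simp add: o_def has_field_derivative_def mult.commute[of _ "frechet_derivative F (at (p + s *\<^sub>R w)) w"])
  qed
  let ?\<phi> = "\<lambda>a. f ((x + h *\<^sub>R v) + a *\<^sub>R u) - f (x + a *\<^sub>R u)"
  have "\<exists>a. 0 < a \<and> a < h \<and> ?\<phi> h - ?\<phi> 0 = (h - 0) * (?D u ((x + h *\<^sub>R v) + a *\<^sub>R u) - ?D u (x + a *\<^sub>R u))"
  proof (rule MVT2[OF h])
    fix a assume "0 \<le> a" "a \<le> h"
    then show "(?\<phi> has_real_derivative ?D u ((x + h *\<^sub>R v) + a *\<^sub>R u) - ?D u (x + a *\<^sub>R u)) (at a)"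
      using sub[of a h] sub[of a 0] h by (intro derivative_intros line[OF f]) (auto simp: add_ac)
  qed
  then obtain a where a: "0 < a" "a < h"
    and ea: "?\<phi> h - ?\<phi> 0 = h * (?D u ((x + h *\<^sub>R v) + a *\<^sub>R u) - ?D u (x + a *\<^sub>R u))" by auto
  have "\<exists>b. 0 < b \<and> b < h \<and> ?D u ((x + a *\<^sub>R u) + h *\<^sub>R v) - ?D u ((x + a *\<^sub>R u) + 0 *\<^sub>R v) =
      (h - 0) * frechet_derivative (?D u) (at ((x + a *\<^sub>R u) + b *\<^sub>R v)) v"
  proof (rule MVT2[OF h])
    fix b assume "0 \<le> b" "b \<le> h"
    then show "((\<lambda>b. ?D u ((x + a *\<^sub>R u) + b *\<^sub>R v)) has_real_derivative
        frechet_derivative (?D u) (at ((x + a *\<^sub>R u) + b *\<^sub>R v)) v) (at b)"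
      using sub[of a b] a by (intro line[OF smooth_on_frechet[OF f]]) auto
  qed
  then obtain b where b: "0 < b" "b < h"
    and eb: "?D u ((x + a *\<^sub>R u) + h *\<^sub>R v) - ?D u (x + a *\<^sub>R u) =
      h * frechet_derivative (?D u) (at (x + a *\<^sub>R u + b *\<^sub>R v)) v" by auto
  have "?\<phi> h - ?\<phi> 0 = h * (h * frechet_derivative (?D u) (at (x + a *\<^sub>R u + b *\<^sub>R v)) v)"
    unfolding ea eb[symmetric] by (simp add: add_ac)
  then show ?thesis using that[of a b] a b by (simp add: algebra_simps)
qed

text \<open>The second difference over the parallelogram does not change when \<open>u\<close> and
  \<open>v\<close> are exchanged. So both mixed derivatives take a common value at points
  arbitrarily near \<open>x\<close>, and continuity carries the equality to
  \<open>x\<close>.\<close>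

lemma second_derivative_symmetric_real:
  fixes f :: "'b::real_normed_vector \<Rightarrow> real"
  assumes S: "open S" "x \<in> S" and f: "smooth_on S f"
  shows "frechet_derivative (\<lambda>y. frechet_derivative f (at y) u) (at x) v =
         frechet_derivative (\<lambda>y. frechet_derivative f (at y) v) (at x) u"
proof -
  let ?DD = "\<lambda>u v y. frechet_derivative (\<lambda>y. frechet_derivative f (at y) u) (at y) v"
  have le: "\<bar>?DD u v x - ?DD v u x\<bar> \<le> e" if e: "e > 0" for e
  proof -
    have cont: "\<exists>d>0. \<forall>y. dist y x < d \<longrightarrow> dist (?DD u v y) (?DD u v x) < e/2" for u v
    proof -
      have "isCont (?DD u v) x"
        using smooth_on_continuous[OF smooth_on_frechet[OF smooth_on_frechet[OF f]]] S
        by (simp add: continuous_on_eq_continuous_at)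
      then show ?thesis using e unfolding continuous_at_eps_delta by (metis half_gt_zero)
    qed
    obtain d1 where d1: "d1 > 0" "\<And>y. dist y x < d1 \<Longrightarrow> dist (?DD u v y) (?DD u v x) < e/2"
      using cont by blast
    obtain d2 where d2: "d2 > 0" "\<And>y. dist y x < d2 \<Longrightarrow> dist (?DD v u y) (?DD v u x) < e/2"
      using cont by blast
    obtain d3 where d3: "d3 > 0" "ball x d3 \<subseteq> S" using S openE by blast
    define d where "d = min d1 (min d2 d3)"
    \<comment> \<open>This keeps the whole parallelogram within distance \<open>d / 2\<close> of
      \<open>x\<close>; the summand 1 avoids a division by zero when both directions vanish.\<close>
    define h where "h = d / (2 * (norm u + norm v + 1))"
    have d: "d > 0" using d1 d2 d3 unfolding d_def by auto
    have nn: "norm u + norm v + 1 > 0" using norm_ge_zero[of u] norm_ge_zero[of v] by linarith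
    then have h: "h > 0" using d unfolding h_def by auto
    have near: "dist (x + a *\<^sub>R u' + b *\<^sub>R v') x < d"
      if "a \<in> {0..h}" "b \<in> {0..h}" "norm u' + norm v' = norm u + norm v" for a b u' v'
    proof -
      have "dist (x + a *\<^sub>R u' + b *\<^sub>R v') x \<le> a * norm u' + b * norm v'"
        using that norm_triangle_ineq[of "a *\<^sub>R u'" "b *\<^sub>R v'"] by (simp add: dist_norm add.assoc)
      also have "\<dots> \<le> h * norm u' + h * norm v'" using that by (intro add_mono mult_right_mono) auto
      also have "\<dots> = h * (norm u + norm v)" using that(3) by (simp add: distrib_left[symmetric])
      also have "\<dots> < h * (norm u + norm v + 1)" using h by simp
      also have "\<dots> = d / 2" unfolding h_def using nn by (simp add: field_simps)
      finally show ?thesis using d by linarith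
    qed
    have inS: "x + a *\<^sub>R u' + b *\<^sub>R v' \<in> S"
      if "a \<in> {0..h}" "b \<in> {0..h}" "norm u' + norm v' = norm u + norm v" for a b u' v'
      using near[OF that] d3 unfolding d_def by (auto simp: dist_commute mem_ball subset_iff)
    obtain a b where ab: "a \<in> {0<..<h}" "b \<in> {0<..<h}"
      "f (x + h *\<^sub>R u + h *\<^sub>R v) - f (x + h *\<^sub>R u) - f (x + h *\<^sub>R v) + f x = h * h * ?DD u v (x + a *\<^sub>R u + b *\<^sub>R v)"
      using second_difference_mvt[OF f h, of x u v] inS by (metis (no_types, lifting))
    obtain a' b' where ab': "a' \<in> {0<..<h}" "b' \<in> {0<..<h}"
      "f (x + h *\<^sub>R v + h *\<^sub>R u) - f (x + h *\<^sub>R v) - f (x + h *\<^sub>R u) + f x = h * h * ?DD v u (x + a' *\<^sub>R v + b' *\<^sub>R u)"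
      using second_difference_mvt[OF f h, of x v u] inS by (metis (no_types, lifting) add.commute)
    have c: "x + h *\<^sub>R v + h *\<^sub>R u = x + h *\<^sub>R u + h *\<^sub>R v" by simp
    have "h * h * ?DD u v (x + a *\<^sub>R u + b *\<^sub>R v) = h * h * ?DD v u (x + a' *\<^sub>R v + b' *\<^sub>R u)"
      using ab(3) ab'(3) unfolding c by linarith
    then have eq: "?DD u v (x + a *\<^sub>R u + b *\<^sub>R v) = ?DD v u (x + a' *\<^sub>R v + b' *\<^sub>R u)" using h by simp
    have "dist (x + a *\<^sub>R u + b *\<^sub>R v) x < d1" "dist (x + a' *\<^sub>R v + b' *\<^sub>R u) x < d2"
      using near[of a b u v] near[of a' b' v u] ab ab' unfolding d_def by (auto simp: add.commute)
    from d1(2)[OF this(1)] d2(2)[OF this(2)]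
    have "\<bar>?DD v u (x + a' *\<^sub>R v + b' *\<^sub>R u) - ?DD u v x\<bar> < e/2"
      "\<bar>?DD v u (x + a' *\<^sub>R v + b' *\<^sub>R u) - ?DD v u x\<bar> < e/2"
      by (simp_all only: eq dist_real_def)
    then show ?thesis by linarith
  qed
  have "\<bar>?DD u v x - ?DD v u x\<bar> \<le> 0" by (rule field_le_epsilon) (simp only: le add_0)
  then show ?thesis unfolding abs_le_zero_iff right_minus_eq .
qed

lemma second_derivative_symmetric:
  fixes f :: "'b::real_normed_vector \<Rightarrow> 'c::real_inner"
  assumes S: "open S" "x \<in> S" and f: "smooth_on S f"
  shows "frechet_derivative (\<lambda>y. frechet_derivative f (at y) u) (at x) v =
         frechet_derivative (\<lambda>y. frechet_derivative f (at y) v) (at x) u"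
proof -
  have 1: "frechet_derivative (\<lambda>y. F y \<bullet> w) (at y) u = frechet_derivative F (at y) u \<bullet> w"
    if "smooth_on S F" "y \<in> S" for F :: "'b \<Rightarrow> 'c" and w y u
    by (rule frechet_derivative_eqI) (intro has_derivative_inner_left smooth_on_has_derivative[OF that])
  have "frechet_derivative (\<lambda>y. frechet_derivative f (at y) u) (at x) v \<bullet> w =
        frechet_derivative (\<lambda>y. frechet_derivative (\<lambda>y. f y \<bullet> w) (at y) u) (at x) v" for u v w
    using frechet_derivative_cong_open[OF S, of "\<lambda>y. frechet_derivative (\<lambda>y. f y \<bullet> w) (at y) u"
        "\<lambda>y. frechet_derivative f (at y) u \<bullet> w"] 1[OF f] 1[OF smooth_on_frechet[OF f] S(2)]
    by simp
  then have "frechet_derivative (\<lambda>y. frechet_derivative f (at y) u) (at x) v \<bullet> w =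
        frechet_derivative (\<lambda>y. frechet_derivative f (at y) v) (at x) u \<bullet> w" for w
    using second_derivative_symmetric_real[OF S smooth_on_inner_const[OF _ f]] S by metis
  then show ?thesis by (metis vector_eq_rdot)
qed

section \<open>Orthonormal families\<close>

lemma bilinear_sum_left: "bilinear b \<Longrightarrow> b (\<Sum>i\<in>I. f i) v = (\<Sum>i\<in>I. b (f i) v)"
  unfolding bilinear_def using linear_sum by blast

lemma bilinear_sum_right: "bilinear b \<Longrightarrow> b v (\<Sum>i\<in>I. f i) = (\<Sum>i\<in>I. b v (f i))"
  unfolding bilinear_def using linear_sum by blast

lemmas bilinear_expand =
  bilinear_sum_left bilinear_sum_right bilinear_ladd bilinear_radd bilinear_lmul bilinear_rmul
  bilinear_lsub bilinear_rsub bilinear_lneg bilinear_rneg bilinear_lzero bilinear_rzero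

lemma bilinearI:
  assumes "\<And>u u' v. F (u + u') v = F u v + F u' v" "\<And>r u v. F (r *\<^sub>R u) v = r *\<^sub>R F u v"
    "\<And>u v v'. F u (v + v') = F u v + F u v'" "\<And>r u v. F u (r *\<^sub>R v) = r *\<^sub>R F u v"
  shows "bilinear F"
  unfolding bilinear_def using assms by (auto intro: linearI)

text \<open>The signs are a separate argument instead of being read off from the vectors: one and
  the same \<open>\<sigma>\<close> then serves on a whole neighbourhood and at all nearby times. The
  free index set allows restriction to the part of a full frame that spans one distribution.\<close>

definition orthonormal_family :: "('e::real_vector \<Rightarrow> 'e \<Rightarrow> real) \<Rightarrow> nat set \<Rightarrow> (nat \<Rightarrow> 'e) \<Rightarrow> (nat \<Rightarrow> real) \<Rightarrow> bool" where
  "orthonormal_family b I e \<sigma> \<longleftrightarrow>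
     (\<forall>l\<in>I. \<bar>\<sigma> l\<bar> = 1) \<and> (\<forall>l\<in>I. \<forall>m\<in>I. b (e l) (e m) = (if l = m then \<sigma> l else 0))"

lemma orthonormal_familyD:
  assumes "orthonormal_family b I e \<sigma>"
  shows "l \<in> I \<Longrightarrow> m \<in> I \<Longrightarrow> b (e l) (e m) = (if l = m then \<sigma> l else 0)"
    "l \<in> I \<Longrightarrow> \<sigma> l * \<sigma> l = 1" "l \<in> I \<Longrightarrow> \<sigma> l * (\<sigma> l * r) = r"
proof -
  show "l \<in> I \<Longrightarrow> m \<in> I \<Longrightarrow> b (e l) (e m) = (if l = m then \<sigma> l else 0)"
    using assms unfolding orthonormal_family_def by blast
  show 1: "l \<in> I \<Longrightarrow> \<sigma> l * \<sigma> l = 1"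
    using assms unfolding orthonormal_family_def by (metis abs_mult_self_eq mult.right_neutral)
  show "l \<in> I \<Longrightarrow> \<sigma> l * (\<sigma> l * r) = r" using 1 by (metis mult.assoc mult_1)
qed

lemma orthonormal_family_subset:
  "orthonormal_family b I e \<sigma> \<Longrightarrow> J \<subseteq> I \<Longrightarrow> orthonormal_family b J e \<sigma>"
  unfolding orthonormal_family_def by blast

lemma orthonormal_frame_family:
  "orthonormal_frame b V E \<longleftrightarrow>
    (\<forall>a<dim V. E a \<in> V) \<and> orthonormal_family b {..<dim V} E (\<lambda>a. b (E a) (E a))"
  unfolding orthonormal_frame_def orthonormal_family_def by auto

lemma orthonormal_coefficient:
  assumes b: "bilinear b" and I: "finite I" and e: "orthonormal_family b I e \<sigma>" and m: "m \<in> I"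
  shows "b (\<Sum>l\<in>I. f l *\<^sub>R e l) (e m) = f m * \<sigma> m"
proof -
  have "b (\<Sum>l\<in>I. f l *\<^sub>R e l) (e m) = (\<Sum>l\<in>I. if l = m then f m * \<sigma> m else 0)"
    unfolding bilinear_expand[OF b] by (rule sum.cong) (use e m in \<open>auto simp: orthonormal_familyD\<close>)
  then show ?thesis using I m by simp
qed

text \<open>Pairing with \<open>e m\<close> recovers the coefficients of a linear combination, so
  the family is independent; having \<open>dim V\<close> members it spans \<open>V\<close>, and the
  same pairing then identifies the coefficients of \<open>v\<close>.\<close>

lemma orthonormal_expansion:
  fixes b :: "'e::euclidean_space \<Rightarrow> 'e \<Rightarrow> real"
  assumes b: "bilinear b" and I: "finite I" and e: "orthonormal_family b I e \<sigma>"
    and V: "subspace V" "\<And>l. l \<in> I \<Longrightarrow> e l \<in> V" "dim V = card I" and v: "v \<in> V"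
  shows "v = (\<Sum>l\<in>I. (\<sigma> l * b v (e l)) *\<^sub>R e l)"
proof -
  have nz: "\<sigma> l \<noteq> 0" if "l \<in> I" for l using orthonormal_familyD(2)[OF e that] by auto
  have inj: "inj_on e I"
  proof (rule inj_onI)
    fix l m assume "l \<in> I" "m \<in> I" "e l = e m"
    then show "l = m" using orthonormal_familyD(1)[OF e, of l m] orthonormal_familyD(1)[OF e, of l l] nz
      by (auto split: if_splits)
  qed
  have reindex: "(\<Sum>w\<in>e ` I. f w *\<^sub>R w) = (\<Sum>l\<in>I. f (e l) *\<^sub>R e l)" for f
    by (simp add: sum.reindex[OF inj])
  have "independent (e ` I)"
  proof (rule independent_if_scalars_zero)
    fix f w assume 0: "(\<Sum>w\<in>e ` I. f w *\<^sub>R w) = 0" and w: "w \<in> e ` I"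
    then obtain m where m: "m \<in> I" "w = e m" by blast
    have "f (e m) * \<sigma> m = b 0 (e m)"
      using orthonormal_coefficient[OF b I e m(1), of "\<lambda>l. f (e l)"] 0 unfolding reindex by simp
    then show "f w = 0" using nz[OF m(1)] m(2) by (simp add: bilinear_lzero[OF b])
  qed (use I in simp)
  then have "V \<subseteq> span (e ` I)"
    by (rule card_ge_dim_independent[rotated]) (use V in \<open>auto simp: card_image[OF inj]\<close>)
  then obtain f where f: "v = (\<Sum>l\<in>I. f (e l) *\<^sub>R e l)"
    using v I span_finite[of "e ` I"] unfolding reindex by auto
  have "\<sigma> l * b v (e l) = f (e l)" if "l \<in> I" for l
    unfolding f orthonormal_coefficient[OF b I e that, of "\<lambda>l. f (e l)"] using orthonormal_familyD(2)[OF e that]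
    by (simp add: mult.commute mult.left_commute)
  then show ?thesis using f by simp
qed

text \<open>This licenses replacing the frames chosen in the definitions by any others, even with a
  different order of signs. Each \<open>f m\<close> is expanded in the frame \<open>e\<close>;
  summing over \<open>m\<close> reassembles \<open>b (e l) (e k)\<close>, which is diagonal.\<close>

lemma trace_frame_independent:
  fixes b :: "'e::euclidean_space \<Rightarrow> 'e \<Rightarrow> real" and F :: "'e \<Rightarrow> 'e \<Rightarrow> 'c::real_vector"
  assumes b: "bilinear b" "\<And>u v. b u v = b v u" and F: "bilinear F" and V: "subspace V"
    and I: "finite I" "orthonormal_family b I e \<sigma>" "\<And>l. l \<in> I \<Longrightarrow> e l \<in> V" "dim V = card I"
    and J: "finite J" "orthonormal_family b J f \<tau>" "\<And>l. l \<in> J \<Longrightarrow> f l \<in> V" "dim V = card J"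
  shows "(\<Sum>m\<in>J. \<tau> m *\<^sub>R F (f m) (f m)) = (\<Sum>l\<in>I. \<sigma> l *\<^sub>R F (e l) (e l))"
proof -
  have eI: "v = (\<Sum>l\<in>I. (\<sigma> l * b v (e l)) *\<^sub>R e l)" if "v \<in> V" for v
    by (rule orthonormal_expansion[OF b(1) I(1,2) V _ I(4) that]) (use I in auto)
  have eJ: "v = (\<Sum>m\<in>J. (\<tau> m * b v (f m)) *\<^sub>R f m)" if "v \<in> V" for v
    by (rule orthonormal_expansion[OF b(1) J(1,2) V _ J(4) that]) (use J in auto)
  have "F (f m) (f m) = (\<Sum>l\<in>I. \<Sum>k\<in>I. (\<sigma> l * \<sigma> k * (b (f m) (e l) * b (f m) (e k))) *\<^sub>R F (e l) (e k))"
    if "m \<in> J" for m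
  proof -
    have "F (f m) (f m) = F (\<Sum>l\<in>I. (\<sigma> l * b (f m) (e l)) *\<^sub>R e l) (\<Sum>l\<in>I. (\<sigma> l * b (f m) (e l)) *\<^sub>R e l)"
      using eI[OF J(3)[OF that]] by simp
    then show ?thesis unfolding bilinear_expand[OF F]
      by (simp add: scaleR_sum_right) (subst sum.swap, simp add: mult_ac)
  qed
  then have "(\<Sum>m\<in>J. \<tau> m *\<^sub>R F (f m) (f m)) =
    (\<Sum>m\<in>J. \<Sum>l\<in>I. \<Sum>k\<in>I. (\<sigma> l * \<sigma> k * (\<tau> m * b (f m) (e l) * b (f m) (e k))) *\<^sub>R F (e l) (e k))"
    by (simp add: scaleR_sum_right mult_ac)
  also have "\<dots> = (\<Sum>l\<in>I. \<Sum>k\<in>I. \<Sum>m\<in>J. (\<sigma> l * \<sigma> k * (\<tau> m * b (f m) (e l) * b (f m) (e k))) *\<^sub>R F (e l) (e k))"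
    by (subst sum.swap, rule sum.cong[OF refl], subst sum.swap, rule refl)
  \<comment> \<open>The inner sum over \<open>m\<close> is the expansion of \<open>e l\<close> in
    the other frame, paired with \<open>e k\<close>.\<close>
  also have "\<dots> = (\<Sum>l\<in>I. \<Sum>k\<in>I. (\<sigma> l * \<sigma> k * b (e l) (e k)) *\<^sub>R F (e l) (e k))"
  proof (intro sum.cong refl)
    fix l k assume lk: "l \<in> I" "k \<in> I"
    have "b (e l) (e k) = b (\<Sum>m\<in>J. (\<tau> m * b (e l) (f m)) *\<^sub>R f m) (e k)"
      using eJ[OF I(3)[OF lk(1)]] by simp
    also have "\<dots> = (\<Sum>m\<in>J. \<tau> m * b (f m) (e l) * b (f m) (e k))"
      unfolding bilinear_expand[OF b(1)] using b(2)[of "e l"] by simp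
    finally show "(\<Sum>m\<in>J. (\<sigma> l * \<sigma> k * (\<tau> m * b (f m) (e l) * b (f m) (e k))) *\<^sub>R F (e l) (e k)) =
       (\<sigma> l * \<sigma> k * b (e l) (e k)) *\<^sub>R F (e l) (e k)"
      by (simp add: scaleR_sum_left[symmetric] sum_distrib_left[symmetric])
  qed
  also have "\<dots> = (\<Sum>l\<in>I. \<Sum>k\<in>I. if k = l then \<sigma> l *\<^sub>R F (e l) (e l) else 0)"
    by (intro sum.cong refl) (auto simp: orthonormal_familyD[OF I(2)] mult.assoc)
  finally show ?thesis using I(1) by simp
qed

text \<open>\<open>tr\<close> is defined with the Euclidean standard basis, which has no relation to
  the metric. As the trace of an endomorphism depends on no inner product, a
  \<open>b\<close>-orthonormal basis computes it as well.\<close>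

lemma trace_eq_orthonormal:
  fixes b :: "'e::euclidean_space \<Rightarrow> 'e \<Rightarrow> real"
  assumes b: "bilinear b" "\<And>u v. b u v = b v u" and F: "linear F"
    and I: "finite I" "orthonormal_family b I e \<sigma>" "DIM('e) = card I"
  shows "tr F = (\<Sum>l\<in>I. \<sigma> l * b (F (e l)) (e l))"
proof -
  have ex: "v = (\<Sum>l\<in>I. (\<sigma> l * b v (e l)) *\<^sub>R e l)" for v
    by (rule orthonormal_expansion[OF b(1) I(1,2) subspace_UNIV]) (auto simp: I(3)[symmetric])
  have "F k \<bullet> k = (\<Sum>l\<in>I. \<sigma> l * (b k (e l) * (F (e l) \<bullet> k)))" for k
  proof -
    have "F k = F (\<Sum>l\<in>I. (\<sigma> l * b k (e l)) *\<^sub>R e l)" using ex[of k] by simp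
    then show ?thesis by (simp add: linear_sum[OF F] linear_cmul[OF F] inner_sum_left mult_ac)
  qed
  then have "tr F = (\<Sum>l\<in>I. \<sigma> l * (\<Sum>k\<in>Basis. b k (e l) * (F (e l) \<bullet> k)))"
    unfolding tr_def by (simp add: sum_distrib_left sum.swap[of _ I])
  also have "\<dots> = (\<Sum>l\<in>I. \<sigma> l * b (F (e l)) (e l))"
  proof (intro sum.cong refl)
    fix l
    have "b (F (e l)) (e l) = b (\<Sum>k\<in>Basis. (F (e l) \<bullet> k) *\<^sub>R k) (e l)" by (simp add: euclidean_representation)
    then show "\<sigma> l * (\<Sum>k\<in>Basis. b k (e l) * (F (e l) \<bullet> k)) = \<sigma> l * b (F (e l)) (e l)"
      unfolding bilinear_expand[OF b(1)] by (simp add: mult.commute)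
  qed
  finally show ?thesis .
qed

lemma orthonormal_frame_exists:
  fixes b :: "'e::euclidean_space \<Rightarrow> 'e \<Rightarrow> real"
  assumes b: "bilinear b" "\<And>u v. b u v = b v u" and V: "subspace V" "nondegenerate_on b V"
  shows "\<exists>E. orthonormal_frame b V E"
  using V
proof (induction "dim V" arbitrary: V)
  case 0
  then have "dim V = 0" by simp
  then show ?case unfolding orthonormal_frame_def by (metis less_nat_zero_code)
next
  case (Suc m)
  note V = Suc.prems
  obtain u where u: "u \<in> V" "u \<noteq> 0"
  proof -
    have "\<not> V \<subseteq> {0}" using Suc.hyps(2) dim_eq_0[of V] by (metis nat.distinct(1))
    then show thesis using that by blast
  qed
  \<comment> \<open>In indefinite signature the nonzero vector \<open>u\<close> may be null. If all
    vectors of \<open>V\<close> were null, polarisation would make \<open>b\<close> vanish on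
    \<open>V\<close>, and \<open>u\<close> would contradict nondegeneracy.\<close>
  have "\<exists>v\<in>V. b v v \<noteq> 0"
  proof (rule ccontr)
    assume "\<not> ?thesis"
    then have z: "b v v = 0" if "v \<in> V" for v using that by blast
    have "b u v = 0" if v: "v \<in> V" for v
      using z[OF subspace_add[OF V(1) u(1) v]] z[OF u(1)] z[OF v] b(2)[of u v]
      by (simp add: bilinear_ladd[OF b(1)] bilinear_radd[OF b(1)])
    then show False using V(2) u unfolding nondegenerate_on_def by blast
  qed
  then obtain v where v: "v \<in> V" "b v v \<noteq> 0" by blast
  define e where "e = (1 / sqrt \<bar>b v v\<bar>) *\<^sub>R v"
  have e: "e \<in> V" unfolding e_def using v V(1) subspace_scale by blast
  have "b e e = b v v / \<bar>b v v\<bar>"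
    unfolding e_def bilinear_lmul[OF b(1)] bilinear_rmul[OF b(1)] by simp
  then have be: "\<bar>b e e\<bar> = 1" using v by simp
  then have ee: "b e e * b e e = 1" by (metis abs_mult_self_eq mult.right_neutral)
  have bez: "b e e \<noteq> 0" using be by auto
  define V' where "V' = {w\<in>V. b w e = 0}"
  have V': "subspace V'" unfolding subspace_def V'_def
    using V(1) by (auto simp: subspace_0 subspace_add subspace_scale bilinear_lzero[OF b(1)]
      bilinear_ladd[OF b(1)] bilinear_lmul[OF b(1)])
  have split: "w - (b e e * b w e) *\<^sub>R e \<in> V'" if "w \<in> V" for w
    using that e V(1) ee unfolding V'_def
    by (auto intro!: subspace_diff subspace_scale
      simp: bilinear_lsub[OF b(1)] bilinear_lmul[OF b(1)] algebra_simps)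
  have nd: "nondegenerate_on b V'" unfolding nondegenerate_on_def
  proof (intro ballI impI)
    fix w assume w: "w \<in> V'" "\<forall>w'\<in>V'. b w w' = 0"
    have "b w z = 0" if "z \<in> V" for z
    proof -
      have "b w (z - (b e e * b z e) *\<^sub>R e) = 0" using w split[OF that] by blast
      then show ?thesis using w(1) unfolding V'_def by (simp add: bilinear_rsub[OF b(1)] bilinear_rmul[OF b(1)])
    qed
    then show "w = 0" using V(2) w(1) unfolding nondegenerate_on_def V'_def by blast
  qed
  have "V \<subseteq> span (insert e V')"
  proof
    fix w assume "w \<in> V"
    then have "w - (b e e * b w e) *\<^sub>R e \<in> span (insert e V')" using split span_base by blast
    moreover have "(b e e * b w e) *\<^sub>R e \<in> span (insert e V')" by (simp add: span_base span_scale)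
    ultimately show "w \<in> span (insert e V')" using span_add by fastforce
  qed
  moreover have "span (insert e V') \<subseteq> V" using e V(1) unfolding V'_def by (intro span_minimal) auto
  ultimately have "dim V = dim (insert e V')" by (metis dim_span subset_antisym)
  moreover have "e \<notin> span V'"
  proof -
    have "e \<notin> V'" using bez unfolding V'_def by simp
    then show ?thesis by (simp only: span_eq_iff[THEN iffD2, OF V'] not_False_eq_True)
  qed
  ultimately have dim: "dim V' = m" using Suc.hyps(2) by (simp add: dim_insert)
  then obtain E where E: "orthonormal_frame b V' E" using Suc.hyps(1)[OF dim[symmetric] V' nd] by blast
  have z: "w \<in> V \<and> b e w = 0 \<and> b w e = 0" if "w \<in> V'" for w
    using that b(2)[of e w] unfolding V'_def by simp
  have "orthonormal_frame b V (case_nat e E)"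
    using E e be z unfolding orthonormal_frame_def dim Suc.hyps(2)[symmetric]
    by (auto split: nat.splits)
  then show ?case by blast
qed

section \<open>Gram-Schmidt orthonormalisation depending on a parameter\<close>

text \<open>\<open>N W f\<close> says that \<open>f\<close> is regular on the open set \<open>W\<close>. Orthonormal frames are made smooth
  along the manifold and differentiable in time by two instances of the same construction.\<close>

locale regular_functions =
  fixes N :: "'y::topological_space set \<Rightarrow> ('y \<Rightarrow> real) \<Rightarrow> bool"
  assumes const: "\<And>W c. open W \<Longrightarrow> N W (\<lambda>_. c)"
    and add: "\<And>W f g. N W f \<Longrightarrow> N W g \<Longrightarrow> N W (\<lambda>y. f y + g y)"
    and mult: "\<And>W f g. N W f \<Longrightarrow> N W g \<Longrightarrow> N W (\<lambda>y. f y * g y)"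
    and inverse_sqrt: "\<And>W f. N W f \<Longrightarrow> (\<And>y. y \<in> W \<Longrightarrow> f y > 0) \<Longrightarrow> N W (\<lambda>y. 1 / sqrt (f y))"
    and restrict: "\<And>W W' f. N W f \<Longrightarrow> open W' \<Longrightarrow> W' \<subseteq> W \<Longrightarrow> N W' f"
    and positive: "\<And>W f y. N W f \<Longrightarrow> y \<in> W \<Longrightarrow> f y > 0 \<Longrightarrow>
      \<exists>W'. open W' \<and> y \<in> W' \<and> W' \<subseteq> W \<and> (\<forall>z\<in>W'. f z > 0)"
begin

lemma sum:
  assumes "open W" "\<And>i. i \<in> I \<Longrightarrow> N W (f i)"
  shows "N W (\<lambda>y. \<Sum>i\<in>I. f i y)"
  using assms(2) by (induction I rule: infinite_finite_induct) (auto intro: const add assms(1))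

text \<open>In indefinite signature the process may meet a null vector. Here the family is already
  orthonormal at \<open>x\<close>, so every normalising factor is 1 there and stays positive nearby,
  with unchanged signs. The triangular shape of \<open>c\<close> is part of the conclusion because
  it keeps the first vectors inside any subspace that contains the first members of the original
  family.\<close>

lemma gram_schmidt:
  fixes b :: "'y \<Rightarrow> 'e::real_vector \<Rightarrow> 'e \<Rightarrow> real"
  assumes W: "open W" "x \<in> W"
    and b: "\<And>y. bilinear (b y)" "\<And>y u v. b y u v = b y v u"
    and reg: "\<And>j k. j < m \<Longrightarrow> k < m \<Longrightarrow> N W (\<lambda>y. b y (e j y) (e k y))"
    and orth: "orthonormal_family (b x) {..<m} (\<lambda>j. e j x) \<sigma>"
  shows "\<exists>W' c. open W' \<and> x \<in> W' \<and> W' \<subseteq> W \<and> (\<forall>k j. N W' (c k j)) \<and>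
    (\<forall>k<m. \<forall>j<m. c k j x = (if j = k then 1 else 0)) \<and>
    (\<forall>k j y. k < j \<longrightarrow> c k j y = 0) \<and>
    (\<forall>y\<in>W'. orthonormal_family (b y) {..<m} (\<lambda>k. \<Sum>j<m. c k j y *\<^sub>R e j y) \<sigma>)"
  using reg orth
proof (induction m)
  case 0
  show ?case
    by (rule exI[of _ W], rule exI[of _ "\<lambda>_ _ _. 0"]) (auto simp: W const orthonormal_family_def)
next
  case (Suc m)
  have "orthonormal_family (b x) {..<m} (\<lambda>j. e j x) \<sigma>"
    using Suc.prems(2) by (rule orthonormal_family_subset) auto
  then have "\<exists>W' c. open W' \<and> x \<in> W' \<and> W' \<subseteq> W \<and> (\<forall>k j. N W' (c k j)) \<and>
    (\<forall>k<m. \<forall>j<m. c k j x = (if j = k then 1 else 0)) \<and>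
    (\<forall>k j y. k < j \<longrightarrow> c k j y = 0) \<and>
    (\<forall>y\<in>W'. orthonormal_family (b y) {..<m} (\<lambda>k. \<Sum>j<m. c k j y *\<^sub>R e j y) \<sigma>)"
    by (intro Suc.IH Suc.prems(1)) simp_all
  then obtain W1 c where H: "open W1 \<and> x \<in> W1 \<and> W1 \<subseteq> W \<and> (\<forall>k j. N W1 (c k j)) \<and>
    (\<forall>k<m. \<forall>j<m. c k j x = (if j = k then 1 else 0)) \<and>
    (\<forall>k j y. k < j \<longrightarrow> c k j y = 0) \<and>
    (\<forall>y\<in>W1. orthonormal_family (b y) {..<m} (\<lambda>k. \<Sum>j<m. c k j y *\<^sub>R e j y) \<sigma>)"
    by (elim exE)
  have W1: "open W1" "x \<in> W1" "W1 \<subseteq> W" and c: "\<And>k j. N W1 (c k j)" using H by blast+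
  have cx: "\<And>k j. k < m \<Longrightarrow> j < m \<Longrightarrow> c k j x = (if j = k then 1 else 0)"
    and tri: "\<And>k j y. k < j \<Longrightarrow> c k j y = 0" using H by metis+
  have on: "\<And>y. y \<in> W1 \<Longrightarrow> orthonormal_family (b y) {..<m} (\<lambda>k. \<Sum>j<m. c k j y *\<^sub>R e j y) \<sigma>"
    using H by blast
  define V where "V k y = (\<Sum>j<m. c k j y *\<^sub>R e j y)" for k y
  define \<beta> where "\<beta> k y = b y (V k y) (e m y)" for k y
  \<comment> \<open>These are the coefficients, with respect to the original vectors
    \<open>e j\<close>, of \<open>e m\<close> minus its orthogonal projection to the span of the
    vectors \<open>V k\<close> already constructed.\<close>
  define d where "d j y = (if j = m then 1 else - (\<Sum>k<m. \<sigma> k * (\<beta> k y * c k j y)))" for j y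
  define U where "U y = (\<Sum>j<Suc m. d j y *\<^sub>R e j y)" for y
  have U: "U y = e m y - (\<Sum>k<m. (\<sigma> k * \<beta> k y) *\<^sub>R V k y)" for y
  proof -
    have "(\<Sum>k<m. (\<sigma> k * \<beta> k y) *\<^sub>R V k y) = (\<Sum>j<m. (\<Sum>k<m. \<sigma> k * (\<beta> k y * c k j y)) *\<^sub>R e j y)"
      unfolding V_def scaleR_sum_right scaleR_sum_left by (subst sum.swap) (simp add: mult.assoc)
    then show ?thesis unfolding U_def d_def by (simp add: sum_negf)
  qed
  have reg1: "N W1 (\<lambda>y. b y (e j y) (e k y))" if "j < Suc m" "k < Suc m" for j k
    using restrict[OF Suc.prems(1)[OF that] W1(1,3)] .
  have "N W1 (\<lambda>y. \<Sum>j<m. c k j y * b y (e j y) (e m y))" for k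
    by (intro sum W1 mult c reg1) auto
  then have \<beta>: "N W1 (\<beta> k)" for k
    unfolding \<beta>_def[abs_def] V_def bilinear_expand[OF b(1)] by simp
  have d: "N W1 (d j)" for j
  proof (cases "j = m")
    case False
    have "N W1 (\<lambda>y. (-1) * (\<Sum>k<m. \<sigma> k * (\<beta> k y * c k j y)))"
      by (intro sum W1 mult c \<beta> const)
    then show ?thesis using False unfolding d_def by (simp add: fun_eq_iff)
  next
    case True
    then have "d j = (\<lambda>_. 1)" by (simp add: d_def fun_eq_iff)
    then show ?thesis using const[OF W1(1)] by simp
  qed
  \<comment> \<open>The factor \<open>\<sigma> m\<close> makes \<open>q\<close> equal to 1 at
    \<open>x\<close> whatever the signature, hence positive on a neighbourhood, where
    \<open>U\<close> can be normalised.\<close>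
  define q where "q y = \<sigma> m * b y (U y) (U y)" for y
  have "N W1 (\<lambda>y. \<sigma> m * (\<Sum>j<Suc m. \<Sum>k<Suc m. d j y * (d k y * b y (e k y) (e j y))))"
    by (intro sum W1 mult const d reg1) auto
  moreover have "q = (\<lambda>y. \<sigma> m * (\<Sum>j<Suc m. \<Sum>k<Suc m. d j y * (d k y * b y (e k y) (e j y))))"
    unfolding q_def[abs_def] U_def bilinear_expand[OF b(1)] by (simp only: sum_distrib_left real_scaleR_def)
  ultimately have q: "N W1 q" by simp
  have Vx: "V k x = e k x" if "k < m" for k
    unfolding V_def using that cx[OF that] by (simp add: if_distrib[of "\<lambda>r. r *\<^sub>R _"] cong: if_cong)
  have \<beta>x: "\<beta> k x = 0" if "k < m" for k
    using orthonormal_familyD(1)[OF Suc.prems(2), of k m] that unfolding \<beta>_def Vx[OF that] by simp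
  have Ux: "U x = e m x" unfolding U using \<beta>x by simp
  have qx: "q x = 1" using orthonormal_familyD(1)[OF Suc.prems(2), of m m] orthonormal_familyD(2)[OF Suc.prems(2), of m]
    unfolding q_def Ux by simp
  then obtain W' where W': "open W'" "x \<in> W'" "W' \<subseteq> W1" and qpos: "\<And>y. y \<in> W' \<Longrightarrow> q y > 0"
    using positive[OF q W1(2)] by auto
  define c' where "c' k j y = (if k = m then 1 / sqrt (q y) * d j y
      else if j < m then c k j y else 0)" for k j y
  define c'' where "c'' k j y = (if k < j then 0 else c' k j y)" for k j y
  have r: "N W' (\<lambda>y. 1 / sqrt (q y))" by (intro inverse_sqrt qpos restrict[OF q] W')
  have c': "N W' (c' k j)" for k j
  proof -
    have "N W' (\<lambda>y. 1 / sqrt (q y) * d j y)" by (intro mult r restrict[OF d] W')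
    then show ?thesis unfolding c'_def using restrict[OF c W'(1,3), of k j] const[OF W'(1)] by (cases "k = m"; cases "j < m") auto
  qed
  have sumU: "(\<Sum>j<Suc m. c'' m j y *\<^sub>R e j y) = (1 / sqrt (q y)) *\<^sub>R U y" for y
    unfolding U_def scaleR_sum_right by (rule sum.cong) (auto simp: c'_def c''_def)
  have sumV: "(\<Sum>j<Suc m. c'' k j y *\<^sub>R e j y) = V k y" if "k < m" for k y
    using that tri unfolding V_def by (auto simp: c'_def c''_def intro!: sum.cong)
  have on': "orthonormal_family (b y) {..<Suc m} (\<lambda>k. \<Sum>j<Suc m. c'' k j y *\<^sub>R e j y) \<sigma>" if y: "y \<in> W'" for y
  proof -
    have onV: "orthonormal_family (b y) {..<m} (\<lambda>k. V k y) \<sigma>"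
      using on W' y unfolding V_def by blast
    have UV: "b y (V k y) (U y) = 0" if k: "k < m" for k
    proof -
      have "b y (V k y) (\<Sum>l<m. (\<sigma> l * \<beta> l y) *\<^sub>R V l y) = \<beta> k y"
        using orthonormal_coefficient[OF b(1) _ onV, of k "\<lambda>l. \<sigma> l * \<beta> l y"] k orthonormal_familyD(2)[OF onV, of k]
          b(2)[of y "V k y"] by (simp add: mult.commute mult.left_commute)
      then show ?thesis unfolding U bilinear_rsub[OF b(1)] \<beta>_def by simp
    qed
    have UU: "b y (U y) (U y) = \<sigma> m * q y"
      using orthonormal_familyD(3)[OF Suc.prems(2), of m] unfolding q_def by simp
    have "b y ((1 / sqrt (q y)) *\<^sub>R U y) ((1 / sqrt (q y)) *\<^sub>R U y) = \<sigma> m"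
      unfolding bilinear_lmul[OF b(1)] bilinear_rmul[OF b(1)] UU using qpos[OF y] by (simp add: field_simps)
    moreover have "b y ((1 / sqrt (q y)) *\<^sub>R U y) (V k y) = 0" "b y (V k y) ((1 / sqrt (q y)) *\<^sub>R U y) = 0" if "k < m" for k
      using UV[OF that] b(2)[of y "V k y" "U y"] unfolding bilinear_lmul[OF b(1)] bilinear_rmul[OF b(1)] by simp_all
    ultimately show ?thesis
      using onV Suc.prems(2) unfolding orthonormal_family_def
      by (auto simp: less_Suc_eq sumU[unfolded sum.lessThan_Suc] sumV[unfolded sum.lessThan_Suc])
  qed
  have N'': "N W' (c'' k j)" for k j
    unfolding c''_def using c'[of k j] const[OF W'(1)] by (cases "k < j") auto
  have "c'' k j x = (if j = k then 1 else 0)" if "k < Suc m" "j < Suc m" for k j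
    using that cx qx \<beta>x unfolding c''_def c'_def d_def by (auto simp: less_Suc_eq)
  moreover have "c'' k j y = 0" if "k < j" for k j y using that unfolding c''_def by simp
  moreover have "W' \<subseteq> W" using W1 W' by blast
  ultimately show ?case
    using W'(1,2) N'' on' by (intro exI[of _ W'] exI[of _ c'']) blast
qed

end

section \<open>Smooth functions and vector fields on a manifold\<close>

text \<open>Naturality of the bracket under a change of coordinates. Differentiating the
  transformation rule of a field produces a second derivative of \<open>\<phi>\<close>; it is
  symmetric in the two fields and cancels in the commutator.\<close>

lemma bracket_pushforward:
  fixes \<phi> :: "'b::euclidean_space \<Rightarrow> 'b"
  assumes S: "open S" "\<xi> \<in> S" and \<phi>: "smooth_on S \<phi>"
    and X: "X differentiable (at \<xi>)" "X' differentiable (at (\<phi> \<xi>))"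
      "\<And>\<zeta>. \<zeta> \<in> S \<Longrightarrow> X' (\<phi> \<zeta>) = frechet_derivative \<phi> (at \<zeta>) (X \<zeta>)"
    and Y: "Y differentiable (at \<xi>)" "Y' differentiable (at (\<phi> \<xi>))"
      "\<And>\<zeta>. \<zeta> \<in> S \<Longrightarrow> Y' (\<phi> \<zeta>) = frechet_derivative \<phi> (at \<zeta>) (Y \<zeta>)"
  shows "frechet_derivative Y' (at (\<phi> \<xi>)) (X' (\<phi> \<xi>)) - frechet_derivative X' (at (\<phi> \<xi>)) (Y' (\<phi> \<xi>)) =
    frechet_derivative \<phi> (at \<xi>) (frechet_derivative Y (at \<xi>) (X \<xi>) - frechet_derivative X (at \<xi>) (Y \<xi>))"
proof -
  let ?D = "frechet_derivative \<phi> (at \<xi>)"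
  let ?DD = "\<lambda>i u. frechet_derivative (\<lambda>\<zeta>. frechet_derivative \<phi> (at \<zeta>) i) (at \<xi>) u"
  have lin\<phi>: "linear (frechet_derivative \<phi> (at \<zeta>))" if "\<zeta> \<in> S" for \<zeta>
    using smooth_on_has_derivative[OF \<phi> that] by (rule has_derivative_linear)
  have dD: "((\<lambda>\<zeta>. frechet_derivative \<phi> (at \<zeta>) i) has_derivative ?DD i) (at \<xi>)" for i
    by (rule smooth_on_has_derivative[OF smooth_on_frechet[OF \<phi>] S(2)])
  have linDD: "linear (?DD i)" for i using dD by (rule has_derivative_linear)
  \<comment> \<open>Both sides are the derivative of \<open>X' \<circ> \<phi>\<close> at
    \<open>\<xi>\<close>: once by the chain rule, once by the product rule applied to the
    transformed components.\<close>
  have push: "frechet_derivative X' (at (\<phi> \<xi>)) (?D u) =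
      (\<Sum>i\<in>Basis. (X \<xi> \<bullet> i) *\<^sub>R ?DD i u) + ?D (frechet_derivative X (at \<xi>) u)"
    if X: "X differentiable (at \<xi>)" "X' differentiable (at (\<phi> \<xi>))"
      "\<And>\<zeta>. \<zeta> \<in> S \<Longrightarrow> X' (\<phi> \<zeta>) = frechet_derivative \<phi> (at \<zeta>) (X \<zeta>)" for X X' :: "'b \<Rightarrow> 'b" and u
  proof -
    have "(X' \<circ> \<phi> has_derivative frechet_derivative X' (at (\<phi> \<xi>)) \<circ> ?D) (at \<xi>)"
      by (rule diff_chain_at[OF smooth_on_has_derivative[OF \<phi> S(2)]])
        (use X(2) frechet_derivative_works in blast)
    moreover have "((\<lambda>\<zeta>. \<Sum>i\<in>Basis. (X \<zeta> \<bullet> i) *\<^sub>R frechet_derivative \<phi> (at \<zeta>) i) has_derivative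
        (\<lambda>u. \<Sum>i\<in>Basis. (X \<xi> \<bullet> i) *\<^sub>R ?DD i u + (frechet_derivative X (at \<xi>) u \<bullet> i) *\<^sub>R ?D i)) (at \<xi>)"
      by (intro has_derivative_sum has_derivative_scaleR has_derivative_inner_left dD
        X(1)[unfolded frechet_derivative_works])
    then have "(X' \<circ> \<phi> has_derivative
        (\<lambda>u. \<Sum>i\<in>Basis. (X \<xi> \<bullet> i) *\<^sub>R ?DD i u + (frechet_derivative X (at \<xi>) u \<bullet> i) *\<^sub>R ?D i)) (at \<xi>)"
      by (rule has_derivative_transform_within_open[OF _ S])
        (simp add: X(3) linear_basis_expansion[OF lin\<phi>, symmetric])
    ultimately have "frechet_derivative X' (at (\<phi> \<xi>)) (?D u) =
        (\<Sum>i\<in>Basis. (X \<xi> \<bullet> i) *\<^sub>R ?DD i u + (frechet_derivative X (at \<xi>) u \<bullet> i) *\<^sub>R ?D i)"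
      using has_derivative_unique by (metis (no_types, lifting) comp_apply)
    then show ?thesis
      unfolding sum.distrib linear_basis_expansion[OF lin\<phi>[OF S(2)], symmetric] .
  qed
  have sym: "(\<Sum>i\<in>Basis. (u \<bullet> i) *\<^sub>R ?DD i v) = (\<Sum>i\<in>Basis. (v \<bullet> i) *\<^sub>R ?DD i u)" for u v
  proof -
    have e: "(\<Sum>i\<in>Basis. (u \<bullet> i) *\<^sub>R ?DD i v) = (\<Sum>i\<in>Basis. \<Sum>j\<in>Basis. ((u \<bullet> i) * (v \<bullet> j)) *\<^sub>R ?DD i j)" for u v
      unfolding linear_basis_expansion[OF linDD, of _ v] by (simp add: scaleR_sum_right)
    have "?DD i j = ?DD j i" for i j by (rule second_derivative_symmetric[OF S \<phi>])
    then have "((u \<bullet> i) * (v \<bullet> j)) *\<^sub>R ?DD i j = ((v \<bullet> j) * (u \<bullet> i)) *\<^sub>R ?DD j i" for i j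
      by (metis mult.commute)
    then show ?thesis unfolding e[of u v] e[of v u] by (subst sum.swap) (intro sum.cong refl)
  qed
  have "frechet_derivative X' (at (\<phi> \<xi>)) (?D u) =
      (\<Sum>i\<in>Basis. (X \<xi> \<bullet> i) *\<^sub>R ?DD i u) + ?D (frechet_derivative X (at \<xi>) u)" for u
    by (rule push[OF X(1,2)]) (rule X(3))
  moreover have "frechet_derivative Y' (at (\<phi> \<xi>)) (?D u) =
      (\<Sum>i\<in>Basis. (Y \<xi> \<bullet> i) *\<^sub>R ?DD i u) + ?D (frechet_derivative Y (at \<xi>) u)" for u
    by (rule push[OF Y(1,2)]) (rule Y(3))
  ultimately show ?thesis
    unfolding X(3)[OF S(2)] Y(3)[OF S(2)] linear_diff[OF lin\<phi>[OF S(2)]]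
    using sym[of "X \<xi>" "Y \<xi>"] by simp
qed

definition smooth_fun_on ::
  "('a::topological_space, 'e::euclidean_space) chart set \<Rightarrow> 'a set \<Rightarrow> ('a \<Rightarrow> real) \<Rightarrow> bool" where
  "smooth_fun_on A W f \<longleftrightarrow> open W \<and> (\<forall>c\<in>A. smooth_on (snd c ` (fst c \<inter> W)) (f \<circ> chart_inv c))"

locale smooth_manifold =
  fixes A :: "('a::topological_space, 'e::euclidean_space) chart set"
  assumes atlas: "smooth_atlas A"
begin

lemma chart_image_inv:
  assumes "c \<in> A" "\<xi> \<in> snd c ` (fst c \<inter> W)"
  shows "chart_inv c \<xi> \<in> fst c" "chart_inv c \<xi> \<in> W" "snd c (chart_inv c \<xi>) = \<xi>"
  using assms chart_inv_chart[OF atlas assms(1)] by auto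

lemmas open_image = open_chart_image[OF atlas]
lemmas chart_at_A = chart_at_in[OF atlas]
lemmas inv_chart = chart_inv_chart[OF atlas]

lemma inv_chart_at: "chart_inv (chart_at A x) (snd (chart_at A x) x) = x"
  using inv_chart[OF chart_at_A] .

lemma open_chart: "c \<in> A \<Longrightarrow> open (fst c)"
  using atlas unfolding smooth_atlas_def is_chart_def by blast

lemma transition_smooth:
  "c \<in> A \<Longrightarrow> d \<in> A \<Longrightarrow> smooth_on (snd c ` (fst c \<inter> fst d)) (snd d \<circ> chart_inv c)"
  using atlas unfolding smooth_atlas_def by blast

lemma change_trans:
  assumes c: "c \<in> A" "y \<in> fst c" and d: "d \<in> A" "y \<in> fst d" and e: "e \<in> A" "y \<in> fst e"
  shows "change d e y (change c d y v) = change c e y v"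
proof -
  let ?f = "snd d \<circ> chart_inv c" and ?g = "snd e \<circ> chart_inv d" and ?\<xi> = "snd c y"
  have fx: "?f ?\<xi> = snd d y" using inv_chart c by simp
  have f: "(?f has_derivative change c d y) (at ?\<xi>)"
    using transition_differentiable[OF atlas c(1) d(1) c(2) d(2)]
    unfolding change_def frechet_derivative_works by simp
  have g: "(?g has_derivative change d e y) (at (?f ?\<xi>))"
    using transition_differentiable[OF atlas d(1) e(1) d(2) e(2)]
    unfolding change_def fx frechet_derivative_works by simp
  have op: "open (snd c ` (fst c \<inter> fst d))" by (intro open_image open_chart c d)
  have "(snd e \<circ> chart_inv c has_derivative change d e y \<circ> change c d y) (at ?\<xi>)"
  proof (rule has_derivative_transform_within_open[OF diff_chain_at[OF f g] op])
    show "?\<xi> \<in> snd c ` (fst c \<inter> fst d)" using c d by blast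
    fix \<eta> assume "\<eta> \<in> snd c ` (fst c \<inter> fst d)"
    then show "(?g \<circ> ?f) \<eta> = (snd e \<circ> chart_inv c) \<eta>"
      using inv_chart[OF c(1)] inv_chart[OF d(1)] by auto
  qed
  then show ?thesis unfolding change_def[of c e] by (simp only: frechet_derivative_at[symmetric] o_def)
qed

lemma vfield_in_chart:
  "c \<in> A \<Longrightarrow> y \<in> fst c \<Longrightarrow> vfield_in A c X (snd c y) = change (chart_at A y) c y (X y)"
  unfolding vfield_in_def Let_def by (simp add: inv_chart)

lemma linear_change_at: "c \<in> A \<Longrightarrow> y \<in> fst c \<Longrightarrow> linear (change (chart_at A y) c y)"
  by (rule linear_change[OF atlas chart_at_A(1) _ chart_at_A(2)])

lemma vfield_in_change:
  assumes "c \<in> A" "y \<in> fst c" "d \<in> A" "y \<in> fst d"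
  shows "vfield_in A d X (snd d y) = change c d y (vfield_in A c X (snd c y))"
  by (simp add: vfield_in_chart assms change_trans chart_at_A)

lemma change_vfield_in:
  assumes "c \<in> A" "y \<in> fst c"
  shows "change c (chart_at A y) y (vfield_in A c X (snd c y)) = X y"
  by (simp add: vfield_in_chart assms change_trans chart_at_A change_self[OF atlas])

subsection \<open>Smooth functions\<close>

lemma smooth_fun_onD:
  "smooth_fun_on A W f \<Longrightarrow> c \<in> A \<Longrightarrow> smooth_on (snd c ` (fst c \<inter> W)) (\<lambda>\<xi>. f (chart_inv c \<xi>))"
  unfolding smooth_fun_on_def o_def by blast

lemma smooth_fun_onI:
  "open W \<Longrightarrow> (\<And>c. c \<in> A \<Longrightarrow> smooth_on (snd c ` (fst c \<inter> W)) (\<lambda>\<xi>. f (chart_inv c \<xi>))) \<Longrightarrow> smooth_fun_on A W f"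
  unfolding smooth_fun_on_def o_def by blast

lemma smooth_fun_on_open: "smooth_fun_on A W f \<Longrightarrow> open W"
  unfolding smooth_fun_on_def by blast

lemma smooth_fun_on_combine:
  assumes F: "\<And>S (f :: 'e \<Rightarrow> real) g. open S \<Longrightarrow> smooth_on S f \<Longrightarrow> smooth_on S g \<Longrightarrow> smooth_on S (\<lambda>\<xi>. F (f \<xi>) (g \<xi>))"
    and f: "smooth_fun_on A W f" and g: "smooth_fun_on A W g"
  shows "smooth_fun_on A W (\<lambda>y. F (f y) (g y))"
proof (rule smooth_fun_onI[OF smooth_fun_on_open[OF f]])
  fix c assume c: "c \<in> A"
  show "smooth_on (snd c ` (fst c \<inter> W)) (\<lambda>\<xi>. F (f (chart_inv c \<xi>)) (g (chart_inv c \<xi>)))"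
    by (rule F[OF open_image[OF c smooth_fun_on_open[OF f]] smooth_fun_onD[OF f c] smooth_fun_onD[OF g c]])
qed

sublocale smooth_fun: regular_functions "smooth_fun_on A"
proof
  fix W :: "'a set" and f g :: "'a \<Rightarrow> real" and c :: real
  show "open W \<Longrightarrow> smooth_fun_on A W (\<lambda>_. c)"
    unfolding smooth_fun_on_def o_def by (simp add: smooth_on_const)
  show "smooth_fun_on A W f \<Longrightarrow> smooth_fun_on A W g \<Longrightarrow> smooth_fun_on A W (\<lambda>y. f y + g y)"
    by (rule smooth_fun_on_combine[OF smooth_on_add])
  show "smooth_fun_on A W f \<Longrightarrow> smooth_fun_on A W g \<Longrightarrow> smooth_fun_on A W (\<lambda>y. f y * g y)"
    by (rule smooth_fun_on_combine[OF smooth_on_mult])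
  show "smooth_fun_on A W (\<lambda>y. 1 / sqrt (f y))" if f: "smooth_fun_on A W f" and pos: "\<And>y. y \<in> W \<Longrightarrow> f y > 0"
  proof (rule smooth_fun_onI[OF smooth_fun_on_open[OF f]])
    fix c assume c: "c \<in> A"
    show "smooth_on (snd c ` (fst c \<inter> W)) (\<lambda>\<xi>. 1 / sqrt (f (chart_inv c \<xi>)))"
      by (rule smooth_on_inverse_sqrt[OF open_image[OF c smooth_fun_on_open[OF f]] smooth_fun_onD[OF f c]])
        (rule pos, rule chart_image_inv[OF c])
  qed
  fix W'
  show "smooth_fun_on A W' f" if "smooth_fun_on A W f" "open W'" "W' \<subseteq> W"
    by (rule smooth_fun_onI[OF that(2)], rule smooth_on_subset[OF smooth_fun_onD[OF that(1)]])
      (use that(3) in auto)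
next
  fix W :: "'a set" and f :: "'a \<Rightarrow> real" and y
  assume f: "smooth_fun_on A W f" and y: "y \<in> W" "f y > 0"
  define c where "c = chart_at A y"
  have c: "c \<in> A" "y \<in> fst c" unfolding c_def by (rule chart_at_A)+
  have W: "open W" using f smooth_fun_on_open by blast
  define U where "U = (\<lambda>\<xi>. f (chart_inv c \<xi>)) -` {0<..} \<inter> snd c ` (fst c \<inter> W)"
  have "open U" unfolding U_def
    using continuous_open_preimage[OF smooth_on_continuous[OF smooth_fun_onD[OF f c(1)]] open_image[OF c(1) W], of "{0<..}"]
    by (simp add: Int_commute)
  moreover have "continuous_on (fst c) (snd c)"
    using atlas c unfolding smooth_atlas_def is_chart_def homeomorphism_def by blast
  ultimately have "open (fst c \<inter> snd c -` U)" by (intro continuous_open_preimage open_chart c)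
  then have "open (fst c \<inter> snd c -` U \<inter> W)" using W by blast
  moreover have "y \<in> fst c \<inter> snd c -` U \<inter> W" using c y by (auto simp: U_def inv_chart)
  moreover have "f z > 0" if "z \<in> fst c \<inter> snd c -` U \<inter> W" for z
  proof -
    have "f (chart_inv c (snd c z)) > 0" using that unfolding U_def by blast
    then show ?thesis using that inv_chart[OF c(1)] by simp
  qed
  ultimately show "\<exists>W'. open W' \<and> y \<in> W' \<and> W' \<subseteq> W \<and> (\<forall>z\<in>W'. 0 < f z)" by blast
qed

lemma smooth_fun_on_cong:
  assumes f: "smooth_fun_on A W f" and eq: "\<And>y. y \<in> W \<Longrightarrow> f y = g y"
  shows "smooth_fun_on A W g"
proof (rule smooth_fun_onI[OF smooth_fun_on_open[OF f]])
  fix c assume c: "c \<in> A"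
  show "smooth_on (snd c ` (fst c \<inter> W)) (\<lambda>\<xi>. g (chart_inv c \<xi>))"
    by (rule smooth_on_cong[OF open_image[OF c smooth_fun_on_open[OF f]] _ smooth_fun_onD[OF f c]])
      (use eq chart_image_inv[OF c] in blast)
qed

subsection \<open>Smooth vector fields\<close>

lemma smooth_vfield_onD:
  "smooth_vfield_on A W X \<Longrightarrow> c \<in> A \<Longrightarrow> smooth_on (snd c ` (fst c \<inter> W)) (vfield_in A c X)"
  unfolding smooth_vfield_on_def by blast

lemma smooth_vfield_on_open: "smooth_vfield_on A W X \<Longrightarrow> open W"
  unfolding smooth_vfield_on_def by blast

lemma smooth_vfield_on_restrict:
  assumes "smooth_vfield_on A W X" "open W'" "W' \<subseteq> W"
  shows "smooth_vfield_on A W' X"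
  unfolding smooth_vfield_on_def
proof (intro conjI ballI assms)
  fix c assume "c \<in> A"
  then show "smooth_on (snd c ` (fst c \<inter> W')) (vfield_in A c X)"
    by (rule smooth_on_subset[OF smooth_vfield_onD[OF assms(1)]]) (use assms(3) in blast)
qed

lemma vfield_in_add:
  assumes "c \<in> A" "\<xi> \<in> snd c ` fst c"
  shows "vfield_in A c (\<lambda>y. X y + Y y) \<xi> = vfield_in A c X \<xi> + vfield_in A c Y \<xi>"
  using assms by (auto simp: vfield_in_chart linear_add[OF linear_change_at])

lemma vfield_in_scaleR:
  assumes "c \<in> A" "\<xi> \<in> snd c ` fst c"
  shows "vfield_in A c (\<lambda>y. f y *\<^sub>R X y) \<xi> = f (chart_inv c \<xi>) *\<^sub>R vfield_in A c X \<xi>"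
  using assms by (auto simp: vfield_in_chart linear_cmul[OF linear_change_at] inv_chart)

lemma smooth_vfield_on_add:
  assumes X: "smooth_vfield_on A W X" and Y: "smooth_vfield_on A W Y"
  shows "smooth_vfield_on A W (\<lambda>y. X y + Y y)"
  unfolding smooth_vfield_on_def
proof (intro conjI ballI smooth_vfield_on_open[OF X])
  fix c assume c: "c \<in> A"
  note op = open_image[OF c smooth_vfield_on_open[OF X]]
  show "smooth_on (snd c ` (fst c \<inter> W)) (vfield_in A c (\<lambda>y. X y + Y y))"
    by (rule smooth_on_cong[OF op _ smooth_on_add[OF op smooth_vfield_onD[OF X c] smooth_vfield_onD[OF Y c]]])
      (auto simp: vfield_in_add c)
qed

lemma smooth_vfield_on_scaleR:
  assumes f: "smooth_fun_on A W f" and X: "smooth_vfield_on A W X"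
  shows "smooth_vfield_on A W (\<lambda>y. f y *\<^sub>R X y)"
  unfolding smooth_vfield_on_def
proof (intro conjI ballI smooth_vfield_on_open[OF X])
  fix c assume c: "c \<in> A"
  note op = open_image[OF c smooth_vfield_on_open[OF X]]
  show "smooth_on (snd c ` (fst c \<inter> W)) (vfield_in A c (\<lambda>y. f y *\<^sub>R X y))"
    by (rule smooth_on_cong[OF op _ smooth_on_scaleR[OF op smooth_fun_onD[OF f c] smooth_vfield_onD[OF X c]]])
      (auto simp: vfield_in_scaleR c)
qed

lemma smooth_vfield_on_zero:
  assumes "open W"
  shows "smooth_vfield_on A W (\<lambda>y. 0)"
  unfolding smooth_vfield_on_def
proof (intro conjI ballI assms)
  fix c assume c: "c \<in> A"
  show "smooth_on (snd c ` (fst c \<inter> W)) (vfield_in A c (\<lambda>y. 0))"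
    by (rule smooth_on_cong[OF open_image[OF c assms] _ smooth_on_const[of _ 0]])
      (use c in \<open>auto simp: vfield_in_chart linear_0[OF linear_change_at]\<close>)
qed

lemma smooth_vfield_on_sum:
  assumes "open W" "\<And>i. i \<in> I \<Longrightarrow> smooth_vfield_on A W (X i)"
  shows "smooth_vfield_on A W (\<lambda>y. \<Sum>i\<in>I. X i y)"
  using assms(2) by (induction I rule: infinite_finite_induct)
    (auto intro: smooth_vfield_on_zero smooth_vfield_on_add assms(1))

lemma smooth_vfield_on_cong:
  assumes X: "smooth_vfield_on A W X" and eq: "\<And>y. y \<in> W \<Longrightarrow> X y = Y y"
  shows "smooth_vfield_on A W Y"
  unfolding smooth_vfield_on_def
proof (intro conjI ballI smooth_vfield_on_open[OF X])
  fix c assume c: "c \<in> A"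
  show "smooth_on (snd c ` (fst c \<inter> W)) (vfield_in A c Y)"
    by (rule smooth_on_cong[OF open_image[OF c smooth_vfield_on_open[OF X]] _ smooth_vfield_onD[OF X c]])
      (use c eq in \<open>auto simp: vfield_in_chart\<close>)
qed

text \<open>The field has constant components in the preferred chart of \<open>x\<close> and is
  converted to the preferred chart of each \<open>y\<close>. Its components in another chart are
  values of the derivative of a transition map, hence smooth. It need only live on the chart domain,
  so no cut-off function enters.\<close>

lemma coordinate_field:
  "\<exists>X. smooth_vfield_on A (fst (chart_at A x)) X \<and> X x = v"
proof -
  define c where "c = chart_at A x"
  have c: "c \<in> A" "x \<in> fst c" unfolding c_def by (rule chart_at_A)+
  define X where "X y = change c (chart_at A y) y v" for y
  have "X x = v" unfolding X_def c_def[symmetric] using change_self[OF atlas c] .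
  moreover have "smooth_vfield_on A (fst (chart_at A x)) X"
    unfolding smooth_vfield_on_def c_def[symmetric]
  proof (intro conjI ballI open_chart c)
    fix d assume d: "d \<in> A"
    have op: "open (snd d ` (fst d \<inter> fst c))" by (intro open_image open_chart c d)
    show "smooth_on (snd d ` (fst d \<inter> fst c)) (vfield_in A d X)"
    proof (rule smooth_on_cong[OF op])
      show "smooth_on (snd d ` (fst d \<inter> fst c))
        (\<lambda>\<xi>. frechet_derivative (snd d \<circ> chart_inv c) (at ((snd c \<circ> chart_inv d) \<xi>)) v)"
        by (rule smooth_on_compose[OF op smooth_on_frechet[OF transition_smooth[OF c(1) d]] transition_smooth[OF d c(1)]])
          (auto simp: inv_chart d)
      fix \<xi> assume "\<xi> \<in> snd d ` (fst d \<inter> fst c)"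
      then obtain y where y: "y \<in> fst d" "y \<in> fst c" "\<xi> = snd d y" by blast
      then have "vfield_in A d X \<xi> = change c d y v"
        unfolding y(3) vfield_in_chart[OF d y(1)] X_def by (intro change_trans c d chart_at_A)
      then show "frechet_derivative (snd d \<circ> chart_inv c) (at ((snd c \<circ> chart_inv d) \<xi>)) v = vfield_in A d X \<xi>"
        using y d unfolding change_def by (simp add: inv_chart)
    qed
  qed
  ultimately show ?thesis by blast
qed

text \<open>\<open>dir_deriv\<close> at \<open>y\<close> uses the preferred chart of
  \<open>y\<close>, which may jump from point to point. To see that a derivative is smooth in
  \<open>y\<close>, it must be rewritten in one fixed chart.\<close>

lemma dir_deriv_chart:
  assumes c: "c \<in> A" "y \<in> fst c" and f: "(\<lambda>\<xi>. f (chart_inv c \<xi>)) differentiable (at (snd c y))"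
  shows "dir_deriv A y v f = frechet_derivative (\<lambda>\<xi>. f (chart_inv c \<xi>)) (at (snd c y)) (change (chart_at A y) c y v)"
proof -
  define d where "d = chart_at A y"
  have d: "d \<in> A" "y \<in> fst d" unfolding d_def by (rule chart_at_A)+
  let ?\<phi> = "snd c \<circ> chart_inv d"
  have \<phi>: "(?\<phi> has_derivative change d c y) (at (snd d y))"
    using transition_differentiable[OF atlas d(1) c(1) d(2) c(2)]
    unfolding change_def frechet_derivative_works by simp
  have "?\<phi> (snd d y) = snd c y" using inv_chart d by simp
  then have "((\<lambda>\<xi>. f (chart_inv c \<xi>)) has_derivative
      frechet_derivative (\<lambda>\<xi>. f (chart_inv c \<xi>)) (at (snd c y))) (at (?\<phi> (snd d y)))"
    using f unfolding frechet_derivative_works by simp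
  note chain = diff_chain_at[OF \<phi> this]
  have "(f \<circ> chart_inv d has_derivative
      frechet_derivative (\<lambda>\<xi>. f (chart_inv c \<xi>)) (at (snd c y)) \<circ> change d c y) (at (snd d y))"
    by (rule has_derivative_transform_within_open[OF chain, of "snd d ` (fst d \<inter> fst c)"])
      (use c d in \<open>auto intro: open_image open_chart simp: inv_chart\<close>)
  from frechet_derivative_eqI[OF this] show ?thesis
    unfolding dir_deriv_def Let_def d_def by simp
qed

lemma smooth_fun_on_dir_deriv:
  assumes f: "smooth_fun_on A W f" and X: "smooth_vfield_on A W X"
  shows "smooth_fun_on A W (\<lambda>y. dir_deriv A y (X y) f)"
proof (rule smooth_fun_onI[OF smooth_vfield_on_open[OF X]])
  fix c assume c: "c \<in> A"
  note op = open_image[OF c smooth_vfield_on_open[OF X]]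
  show "smooth_on (snd c ` (fst c \<inter> W)) (\<lambda>\<xi>. dir_deriv A (chart_inv c \<xi>) (X (chart_inv c \<xi>)) f)"
  proof (rule smooth_on_cong[OF op _ smooth_on_frechet_along[OF op smooth_fun_onD[OF f c] smooth_vfield_onD[OF X c]]])
    fix \<xi> assume "\<xi> \<in> snd c ` (fst c \<inter> W)"
    then obtain y where y: "y \<in> fst c" "y \<in> W" "\<xi> = snd c y" by blast
    then have "(\<lambda>\<xi>. f (chart_inv c \<xi>)) differentiable (at \<xi>)"
      by (intro smooth_on_differentiable[OF smooth_fun_onD[OF f c]]) blast
    then show "frechet_derivative (\<lambda>\<xi>. f (chart_inv c \<xi>)) (at \<xi>) (vfield_in A c X \<xi>) =
        dir_deriv A (chart_inv c \<xi>) (X (chart_inv c \<xi>)) f"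
      using y c by (simp add: dir_deriv_chart inv_chart vfield_in_chart)
  qed
qed

text \<open>As for \<open>dir_deriv_chart\<close>: the bracket is defined in the preferred chart of
  each point, and naturality under the transition map gives the same formula in one fixed
  chart.\<close>

lemma vfield_in_lie_bracket:
  assumes X: "smooth_vfield_on A W X" and Y: "smooth_vfield_on A W Y"
    and c: "c \<in> A" and y: "y \<in> fst c" "y \<in> W"
  shows "vfield_in A c (lie_bracket A X Y) (snd c y) =
    frechet_derivative (vfield_in A c Y) (at (snd c y)) (vfield_in A c X (snd c y)) -
    frechet_derivative (vfield_in A c X) (at (snd c y)) (vfield_in A c Y (snd c y))"
proof -
  define d where "d = chart_at A y"
  have d: "d \<in> A" "y \<in> fst d" unfolding d_def by (rule chart_at_A)+
  let ?\<phi> = "snd d \<circ> chart_inv c" and ?S = "snd c ` (fst c \<inter> (fst d \<inter> W))"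
  have \<phi>y: "?\<phi> (snd c y) = snd d y" using inv_chart c y by simp
  have diff: "vfield_in A e Z differentiable (at (snd e y))" if "smooth_vfield_on A W Z" "e \<in> A" "y \<in> fst e" for Z e
    by (rule smooth_on_differentiable[OF smooth_vfield_onD[OF that(1,2)]]) (use that(3) y in blast)
  have push: "vfield_in A d Z (?\<phi> \<zeta>) = frechet_derivative ?\<phi> (at \<zeta>) (vfield_in A c Z \<zeta>)" if "\<zeta> \<in> ?S" for Z \<zeta>
  proof -
    obtain z where z: "z \<in> fst c" "z \<in> fst d" "\<zeta> = snd c z" using \<open>\<zeta> \<in> ?S\<close> by blast
    then have "?\<phi> \<zeta> = snd d z" using inv_chart[OF c] by simp
    then show ?thesis using vfield_in_change[OF c z(1) d(1) z(2)] z(3) by (simp add: change_def)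
  qed
  have "lie_bracket A X Y y = change c d y
    (frechet_derivative (vfield_in A c Y) (at (snd c y)) (vfield_in A c X (snd c y)) -
     frechet_derivative (vfield_in A c X) (at (snd c y)) (vfield_in A c Y (snd c y)))"
    unfolding change_def
  proof (subst bracket_pushforward[symmetric, of ?S])
    show "open ?S" using smooth_vfield_on_open[OF X] by (intro open_image open_Int open_chart c d)
    show "smooth_on ?S ?\<phi>" by (rule smooth_on_subset[OF transition_smooth[OF c d(1)]]) blast
    show "snd c y \<in> ?S" using y d by blast
    show "lie_bracket A X Y y = frechet_derivative (vfield_in A d Y) (at (?\<phi> (snd c y))) (vfield_in A d X (?\<phi> (snd c y)))
      - frechet_derivative (vfield_in A d X) (at (?\<phi> (snd c y))) (vfield_in A d Y (?\<phi> (snd c y)))"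
      unfolding \<phi>y unfolding d_def lie_bracket_def Let_def vfield_in_at[OF atlas] ..
    show "vfield_in A c X differentiable (at (snd c y))" "vfield_in A c Y differentiable (at (snd c y))"
      by (intro diff X Y c y)+
    show "vfield_in A d X differentiable (at (?\<phi> (snd c y)))" "vfield_in A d Y differentiable (at (?\<phi> (snd c y)))"
      unfolding \<phi>y by (intro diff X Y d)+
  qed (rule push, assumption)+
  then show ?thesis
    unfolding vfield_in_chart[OF c y(1)] d_def[symmetric]
    using change_change[OF atlas c d(1) y(1) d(2)] by simp
qed

lemma smooth_vfield_on_lie_bracket:
  assumes X: "smooth_vfield_on A W X" and Y: "smooth_vfield_on A W Y"
  shows "smooth_vfield_on A W (lie_bracket A X Y)"
  unfolding smooth_vfield_on_def
proof (intro conjI ballI smooth_vfield_on_open[OF X])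
  fix c assume c: "c \<in> A"
  note op = open_image[OF c smooth_vfield_on_open[OF X]]
  note sm = smooth_vfield_onD[OF X c] smooth_vfield_onD[OF Y c]
  show "smooth_on (snd c ` (fst c \<inter> W)) (vfield_in A c (lie_bracket A X Y))"
    by (rule smooth_on_cong[OF op _ smooth_on_diff[OF op smooth_on_frechet_along[OF op sm(2,1)] smooth_on_frechet_along[OF op sm]]])
      (auto simp: vfield_in_lie_bracket[OF X Y c])
qed

lemma tensor_in_vfields:
  assumes "c \<in> A" "y \<in> fst c"
  shows "tensor_in A c b (snd c y) (vfield_in A c X (snd c y)) (vfield_in A c Y (snd c y)) = b y (X y) (Y y)"
  unfolding tensor_in_def Let_def inv_chart[OF assms] by (simp add: change_vfield_in[OF assms])

lemma tensor_in_expansion: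
  assumes c: "c \<in> A" "y \<in> fst c" and b: "\<And>y. bilinear (b y)"
  shows "b y (X y) (Y y) = (\<Sum>i\<in>Basis. \<Sum>j\<in>Basis.
    (vfield_in A c X (snd c y) \<bullet> i) * ((vfield_in A c Y (snd c y) \<bullet> j) * tensor_in A c b (snd c y) i j))"
proof -
  let ?G = "tensor_in A c b (snd c y)"
  have G: "bilinear ?G" by (rule bilinear_tensor_in[OF atlas c(1) _ b]) (use c in blast)
  have "?G u v = (\<Sum>i\<in>Basis. \<Sum>j\<in>Basis. (u \<bullet> i) * ((v \<bullet> j) * ?G i j))" for u v
  proof -
    have "?G u v = ?G (\<Sum>i\<in>Basis. (u \<bullet> i) *\<^sub>R i) (\<Sum>j\<in>Basis. (v \<bullet> j) *\<^sub>R j)"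
      by (simp add: euclidean_representation)
    then show ?thesis
      unfolding bilinear_sum_left[OF G] bilinear_lmul[OF G] unfolding bilinear_sum_right[OF G] bilinear_rmul[OF G]
      by (simp add: sum_distrib_left)
  qed
  then show ?thesis unfolding tensor_in_vfields[OF c, symmetric] .
qed

lemma smooth_fun_on_metric:
  assumes g: "pseudo_metric A g" and X: "smooth_vfield_on A W X" and Y: "smooth_vfield_on A W Y"
  shows "smooth_fun_on A W (\<lambda>y. g y (X y) (Y y))"
proof (rule smooth_fun_onI[OF smooth_vfield_on_open[OF X]])
  fix c assume c: "c \<in> A"
  note op = open_image[OF c smooth_vfield_on_open[OF X]]
  have b: "bilinear (g y)" for y using g unfolding pseudo_metric_def by blast
  have G: "smooth_on (snd c ` (fst c \<inter> W)) (\<lambda>\<xi>. tensor_in A c g \<xi> i j)" for i j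
    by (rule smooth_on_subset[of "snd c ` fst c"]) (use g c in \<open>auto simp: pseudo_metric_def\<close>)
  have "smooth_on (snd c ` (fst c \<inter> W)) (\<lambda>\<xi>. \<Sum>i\<in>Basis. \<Sum>j\<in>Basis.
    (vfield_in A c X \<xi> \<bullet> i) * ((vfield_in A c Y \<xi> \<bullet> j) * tensor_in A c g \<xi> i j))"
    by (intro smooth_on_sum smooth_on_mult smooth_on_inner_const smooth_vfield_onD[OF X c] smooth_vfield_onD[OF Y c] G op)
  then show "smooth_on (snd c ` (fst c \<inter> W)) (\<lambda>\<xi>. g (chart_inv c \<xi>) (X (chart_inv c \<xi>)) (Y (chart_inv c \<xi>)))"
    by (rule smooth_on_cong[OF op, rotated]) (auto simp: inv_chart[OF c] intro!: tensor_in_expansion[OF c _ b, symmetric])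
qed

end

section \<open>Covariant derivatives at a point\<close>

text \<open>Product and sum rules will be applied to components of \<open>B t\<close>, for which
  only differentiability at a point gets established. The calculus is therefore built on this notion
  rather than on smoothness in a neighbourhood.\<close>

definition fun_differentiable_at ::
  "('a::topological_space, 'e::euclidean_space) chart set \<Rightarrow> 'a \<Rightarrow> ('a \<Rightarrow> real) \<Rightarrow> bool" where
  "fun_differentiable_at A x f \<longleftrightarrow>
     (\<lambda>\<xi>. f (chart_inv (chart_at A x) \<xi>)) differentiable (at (snd (chart_at A x) x))"

definition vfield_differentiable_at ::
  "('a::topological_space, 'e::euclidean_space) chart set \<Rightarrow> 'a \<Rightarrow> ('a, 'e) vfield \<Rightarrow> bool" where
  "vfield_differentiable_at A x X \<longleftrightarrow>
     vfield_in A (chart_at A x) X differentiable (at (snd (chart_at A x) x))"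

context smooth_manifold
begin

lemma fun_differentiable_smooth:
  assumes "smooth_fun_on A W f" "x \<in> W"
  shows "fun_differentiable_at A x f"
  unfolding fun_differentiable_at_def
  by (rule smooth_on_differentiable[OF smooth_fun_onD[OF assms(1) chart_at_A(1)]])
    (use assms(2) chart_at_A in blast)

lemma vfield_differentiable_smooth:
  assumes "smooth_vfield_on A W X" "x \<in> W"
  shows "vfield_differentiable_at A x X"
  unfolding vfield_differentiable_at_def
  by (rule smooth_on_differentiable[OF smooth_vfield_onD[OF assms(1) chart_at_A(1)]])
    (use assms(2) chart_at_A in blast)

lemma dir_deriv_has_derivative:
  "fun_differentiable_at A x f \<Longrightarrow>
    ((\<lambda>\<xi>. f (chart_inv (chart_at A x) \<xi>)) has_derivative (\<lambda>v. dir_deriv A x v f)) (at (snd (chart_at A x) x))"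
  unfolding fun_differentiable_at_def frechet_derivative_works dir_deriv_def Let_def o_def .

lemma dir_deriv_eqI:
  assumes "((\<lambda>\<xi>. f (chart_inv (chart_at A x) \<xi>)) has_derivative f') (at (snd (chart_at A x) x))"
  shows "dir_deriv A x v f = f' v" "fun_differentiable_at A x f"
  using frechet_derivative_eqI[OF assms] assms
  unfolding dir_deriv_def Let_def o_def fun_differentiable_at_def differentiable_def by auto

lemma linear_dir_deriv: "fun_differentiable_at A x f \<Longrightarrow> linear (\<lambda>v. dir_deriv A x v f)"
  by (rule has_derivative_linear[OF dir_deriv_has_derivative])

lemma dir_deriv_const: "dir_deriv A x v (\<lambda>_. r) = 0" "fun_differentiable_at A x (\<lambda>_. r)"
  by (rule dir_deriv_eqI, rule has_derivative_const)+

lemma dir_deriv_mult: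
  assumes "fun_differentiable_at A x f" "fun_differentiable_at A x g"
  shows "dir_deriv A x v (\<lambda>y. f y * g y) = f x * dir_deriv A x v g + dir_deriv A x v f * g x"
    "fun_differentiable_at A x (\<lambda>y. f y * g y)"
  using dir_deriv_eqI[OF has_derivative_mult[OF dir_deriv_has_derivative[OF assms(1)] dir_deriv_has_derivative[OF assms(2)]]]
  by (simp_all add: inv_chart_at)

lemma dir_deriv_sum:
  assumes "\<And>i. i \<in> I \<Longrightarrow> fun_differentiable_at A x (f i)"
  shows "dir_deriv A x v (\<lambda>y. \<Sum>i\<in>I. f i y) = (\<Sum>i\<in>I. dir_deriv A x v (f i))"
    "fun_differentiable_at A x (\<lambda>y. \<Sum>i\<in>I. f i y)"
proof -
  have "((\<lambda>\<xi>. \<Sum>i\<in>I. f i (chart_inv (chart_at A x) \<xi>)) has_derivative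
      (\<lambda>v. \<Sum>i\<in>I. dir_deriv A x v (f i))) (at (snd (chart_at A x) x))"
    by (intro has_derivative_sum dir_deriv_has_derivative assms)
  from dir_deriv_eqI[OF this]
  show "dir_deriv A x v (\<lambda>y. \<Sum>i\<in>I. f i y) = (\<Sum>i\<in>I. dir_deriv A x v (f i))"
    "fun_differentiable_at A x (\<lambda>y. \<Sum>i\<in>I. f i y)" .
qed

lemma dir_deriv_cong:
  assumes "open W" "x \<in> W" "\<And>y. y \<in> W \<Longrightarrow> f y = g y"
  shows "dir_deriv A x v f = dir_deriv A x v g"
  unfolding dir_deriv_def Let_def
  by (subst frechet_derivative_cong_open[OF open_image[OF chart_at_A(1) assms(1)], of _ _ _ "g \<circ> chart_inv (chart_at A x)"])
    (use assms chart_at_A in \<open>auto simp: inv_chart\<close>)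

lemma vfield_add_has_derivative:
  assumes "vfield_differentiable_at A x X" "vfield_differentiable_at A x Y"
  defines "c \<equiv> chart_at A x"
  shows "(vfield_in A c (\<lambda>y. X y + Y y) has_derivative
    (\<lambda>v. frechet_derivative (vfield_in A c X) (at (snd c x)) v + frechet_derivative (vfield_in A c Y) (at (snd c x)) v))
    (at (snd c x))"
  by (rule has_derivative_transform_within_open[OF has_derivative_add, of _ _ _ _ _ _ "snd c ` fst c"])
    (use assms(1,2) chart_at_A[of x] in \<open>auto simp: c_def vfield_differentiable_at_def frechet_derivative_works
      vfield_in_add intro: open_image[OF _ open_UNIV, simplified]\<close>)

lemma vfield_scaleR_has_derivative:
  assumes "fun_differentiable_at A x f" "vfield_differentiable_at A x X"
  defines "c \<equiv> chart_at A x"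
  shows "(vfield_in A c (\<lambda>y. f y *\<^sub>R X y) has_derivative
    (\<lambda>v. f x *\<^sub>R frechet_derivative (vfield_in A c X) (at (snd c x)) v + dir_deriv A x v f *\<^sub>R X x)) (at (snd c x))"
proof -
  have "((\<lambda>\<xi>. f (chart_inv c \<xi>) *\<^sub>R vfield_in A c X \<xi>) has_derivative
    (\<lambda>v. f (chart_inv c (snd c x)) *\<^sub>R frechet_derivative (vfield_in A c X) (at (snd c x)) v
      + dir_deriv A x v f *\<^sub>R vfield_in A c X (snd c x))) (at (snd c x))"
    by (rule has_derivative_scaleR)
      (use assms dir_deriv_has_derivative[OF assms(1)] in \<open>auto simp: vfield_differentiable_at_def frechet_derivative_works\<close>)
  then have "((\<lambda>\<xi>. f (chart_inv c \<xi>) *\<^sub>R vfield_in A c X \<xi>) has_derivative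
    (\<lambda>v. f x *\<^sub>R frechet_derivative (vfield_in A c X) (at (snd c x)) v + dir_deriv A x v f *\<^sub>R X x)) (at (snd c x))"
    unfolding c_def vfield_in_at[OF atlas] inv_chart_at .
  then show ?thesis
    by (rule has_derivative_transform_within_open[of _ _ _ _ "snd c ` fst c"])
      (use chart_at_A[of x] in \<open>auto simp: c_def vfield_in_scaleR intro: open_image[OF _ open_UNIV, simplified]\<close>)
qed

lemma nabla_cong:
  assumes "open W" "x \<in> W" "\<And>y. y \<in> W \<Longrightarrow> X y = Y y"
  shows "nabla A g x v X = nabla A g x v Y"
proof -
  have "frechet_derivative (vfield_in A (chart_at A x) X) (at (snd (chart_at A x) x)) =
      frechet_derivative (vfield_in A (chart_at A x) Y) (at (snd (chart_at A x) x))"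
    by (rule frechet_derivative_cong_open[OF open_image[OF chart_at_A(1) assms(1)]])
      (use assms chart_at_A[of x] in \<open>auto simp: vfield_in_chart\<close>)
  then show ?thesis unfolding nabla_def Let_def using assms by simp
qed

end

locale metric_manifold = smooth_manifold A for A :: "('a::topological_space, 'e::euclidean_space) chart set" +
  fixes g :: "('a, 'e) tensor02"
  assumes metric: "pseudo_metric A g"
begin

lemma bil: "bilinear (g y)"
  and sym: "g y u v = g y v u"
  and nondegenerate: "nondegenerate_on (g y) UNIV"
  using metric unfolding pseudo_metric_def by blast+

lemmas g_simps = bilinear_ladd[OF bil] bilinear_radd[OF bil] bilinear_lmul[OF bil] bilinear_rmul[OF bil]
  bilinear_lsub[OF bil] bilinear_rsub[OF bil] bilinear_lneg[OF bil] bilinear_rneg[OF bil]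
  bilinear_lzero[OF bil] bilinear_rzero[OF bil] bilinear_sum_left[OF bil] bilinear_sum_right[OF bil]

lemma metric_eqI: "(\<And>v. g x u v = g x w v) \<Longrightarrow> u = w"
  using nondegenerate[of x] unfolding nondegenerate_on_def by (metis UNIV_I bilinear_lsub[OF bil] right_minus_eq)

lemma tensor_derivative_linear:
  fixes x
  defines "D \<equiv> \<lambda>u v. frechet_derivative (\<lambda>\<eta>. tensor_in A (chart_at A x) g \<eta> u v) (at (snd (chart_at A x) x))"
  shows "D (u + u') v w = D u v w + D u' v w" "D (r *\<^sub>R u) v w = r * D u v w" "D u v w = D v u w"
proof -
  let ?c = "chart_at A x"
  have d: "((\<lambda>\<eta>. tensor_in A ?c g \<eta> u v) has_derivative D u v) (at (snd ?c x))" for u v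
    unfolding D_def by (rule tensor_in_derivative[OF atlas metric refl])
  have op: "open (snd ?c ` fst ?c)" using open_image[OF chart_at_A(1) open_UNIV] by simp
  have x: "snd ?c x \<in> snd ?c ` fst ?c" using chart_at_A by blast
  have b: "bilinear (tensor_in A ?c g \<eta>)" if "\<eta> \<in> snd ?c ` fst ?c" for \<eta>
    by (rule bilinear_tensor_in[OF atlas chart_at_A(1) that bil])
  have "((\<lambda>\<eta>. tensor_in A ?c g \<eta> (u + u') v) has_derivative (\<lambda>w. D u v w + D u' v w)) (at (snd ?c x))"
    by (rule has_derivative_transform_within_open[OF has_derivative_add[OF d d] op x]) (simp add: b bilinear_ladd)
  then show "D (u + u') v w = D u v w + D u' v w" unfolding D_def by (rule frechet_derivative_eqI)
  have "((\<lambda>\<eta>. tensor_in A ?c g \<eta> (r *\<^sub>R u) v) has_derivative (\<lambda>w. r * D u v w)) (at (snd ?c x))"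
    by (rule has_derivative_transform_within_open[OF has_derivative_mult_right[OF d] op x]) (simp add: b bilinear_lmul)
  then show "D (r *\<^sub>R u) v w = r * D u v w" unfolding D_def by (rule frechet_derivative_eqI)
  have "tensor_in A ?c g \<eta> u v = tensor_in A ?c g \<eta> v u" for \<eta> unfolding tensor_in_def Let_def by (rule sym)
  then show "D u v w = D v u w" unfolding D_def by simp
qed

lemma christoffel_linear:
  "christoffel A g x (u + u') v = christoffel A g x u v + christoffel A g x u' v"
  "christoffel A g x (r *\<^sub>R u) v = r *\<^sub>R christoffel A g x u v"
proof -
  have lin: "linear (frechet_derivative (\<lambda>\<eta>. tensor_in A (chart_at A x) g \<eta> u v) (at (snd (chart_at A x) x)))" for u v
    by (rule has_derivative_linear[OF tensor_in_derivative[OF atlas metric refl]])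
  note T = tensor_derivative_linear(1,2)
  show "christoffel A g x (u + u') v = christoffel A g x u v + christoffel A g x u' v"
    by (rule metric_eqI[of x]) (simp add: g_simps christoffel_eq[OF atlas metric refl] T linear_add[OF lin] field_simps)
  show "christoffel A g x (r *\<^sub>R u) v = r *\<^sub>R christoffel A g x u v"
    by (rule metric_eqI[of x]) (simp add: g_simps christoffel_eq[OF atlas metric refl] T linear_cmul[OF lin] field_simps)
qed

lemma christoffel_linear_right:
  "christoffel A g x v (u + u') = christoffel A g x v u + christoffel A g x v u'"
  "christoffel A g x v (r *\<^sub>R u) = r *\<^sub>R christoffel A g x v u"
  unfolding christoffel_sym[OF metric, of x v] by (rule christoffel_linear)+

lemma nabla_add:
  assumes "vfield_differentiable_at A x X" "vfield_differentiable_at A x Y"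
  shows "nabla A g x v (\<lambda>y. X y + Y y) = nabla A g x v X + nabla A g x v Y"
    "vfield_differentiable_at A x (\<lambda>y. X y + Y y)"
proof -
  note d = vfield_add_has_derivative[OF assms]
  show "nabla A g x v (\<lambda>y. X y + Y y) = nabla A g x v X + nabla A g x v Y"
    unfolding nabla_def Let_def frechet_derivative_eqI[OF d] christoffel_linear_right by simp
  show "vfield_differentiable_at A x (\<lambda>y. X y + Y y)"
    unfolding vfield_differentiable_at_def differentiable_def using d by blast
qed

lemma nabla_scaleR:
  assumes "fun_differentiable_at A x f" "vfield_differentiable_at A x X"
  shows "nabla A g x v (\<lambda>y. f y *\<^sub>R X y) = dir_deriv A x v f *\<^sub>R X x + f x *\<^sub>R nabla A g x v X"
    "vfield_differentiable_at A x (\<lambda>y. f y *\<^sub>R X y)"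
proof -
  note d = vfield_scaleR_has_derivative[OF assms]
  show "nabla A g x v (\<lambda>y. f y *\<^sub>R X y) = dir_deriv A x v f *\<^sub>R X x + f x *\<^sub>R nabla A g x v X"
    unfolding nabla_def Let_def frechet_derivative_eqI[OF d] christoffel_linear_right
    by (simp add: scaleR_add_right)
  show "vfield_differentiable_at A x (\<lambda>y. f y *\<^sub>R X y)"
    unfolding vfield_differentiable_at_def differentiable_def using d by blast
qed

lemma vfield_differentiable_zero: "vfield_differentiable_at A x (\<lambda>y. 0)"
  by (rule vfield_differentiable_smooth[OF smooth_vfield_on_zero[OF open_UNIV]]) simp

lemma nabla_zero: "nabla A g x v (\<lambda>y. 0) = 0"
  using nabla_add(1)[OF vfield_differentiable_zero vfield_differentiable_zero, of x v] by simp

lemma nabla_sum: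
  assumes "\<And>i. i \<in> I \<Longrightarrow> vfield_differentiable_at A x (X i)"
  shows "nabla A g x v (\<lambda>y. \<Sum>i\<in>I. X i y) = (\<Sum>i\<in>I. nabla A g x v (X i))"
    "vfield_differentiable_at A x (\<lambda>y. \<Sum>i\<in>I. X i y)"
proof -
  have "nabla A g x v (\<lambda>y. \<Sum>i\<in>I. X i y) = (\<Sum>i\<in>I. nabla A g x v (X i)) \<and>
      vfield_differentiable_at A x (\<lambda>y. \<Sum>i\<in>I. X i y)"
    using assms
    by (induction I rule: infinite_finite_induct)
      (simp_all add: vfield_differentiable_zero nabla_zero nabla_add)
  then show "nabla A g x v (\<lambda>y. \<Sum>i\<in>I. X i y) = (\<Sum>i\<in>I. nabla A g x v (X i))"
    "vfield_differentiable_at A x (\<lambda>y. \<Sum>i\<in>I. X i y)" by auto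
qed

lemma linear_nabla:
  assumes "vfield_differentiable_at A x X"
  shows "linear (\<lambda>v. nabla A g x v X)"
proof -
  have "linear (frechet_derivative (vfield_in A (chart_at A x) X) (at (snd (chart_at A x) x)))"
    using assms unfolding vfield_differentiable_at_def frechet_derivative_works by (rule has_derivative_linear)
  then show ?thesis
    unfolding nabla_def Let_def
    by (intro linearI) (simp_all add: linear_add linear_cmul christoffel_linear scaleR_add_right)
qed

end

section \<open>Pairs of orthogonal complementary distributions\<close>

lemma orthonormal_family_reindex:
  assumes "orthonormal_family b (f ` I) e \<sigma>" "inj_on f I"
  shows "orthonormal_family b I (\<lambda>i. e (f i)) (\<lambda>i. \<sigma> (f i))"
  using assms unfolding orthonormal_family_def by (auto simp: inj_on_eq_iff)

lemma local_sectionE: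
  assumes "local_section A P x u X"
  obtains W where "x \<in> W" "smooth_vfield_on A W X" "\<And>y. y \<in> W \<Longrightarrow> X y \<in> P y" "X x = u" "u \<in> P x"
  using assms unfolding local_section_def by blast

lemma local_sectionI:
  "x \<in> W \<Longrightarrow> smooth_vfield_on A W X \<Longrightarrow> (\<And>y. y \<in> W \<Longrightarrow> X y \<in> P y) \<Longrightarrow> X x = u \<Longrightarrow> local_section A P x u X"
  unfolding local_section_def by blast

context smooth_manifold
begin

text \<open>The coefficients of \<open>u\<close> in the local spanning fields at \<open>x\<close>
  are simply kept constant.\<close>

lemma local_section_exists:
  assumes P: "smooth_distribution A n P" and u: "u \<in> P x"
  shows "\<exists>X. local_section A P x u X"
proof -
  obtain W X where W: "x \<in> W" "open W" and X: "\<And>a. a < n \<Longrightarrow> smooth_vfield_on A W (X a)"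
    and span: "\<And>y. y \<in> W \<Longrightarrow> P y = span ((\<lambda>a. X a y) ` {..<n})"
    using P unfolding smooth_distribution_def by metis
  have "\<exists>r. u = (\<Sum>a<n. r a *\<^sub>R X a x)" if "u \<in> span ((\<lambda>a. X a x) ` {..<n})" for u
    using that
  proof (induction rule: span_induct_alt)
    case base
    show ?case by (rule exI[of _ "\<lambda>_. 0"]) simp
  next
    case (step c v w)
    then obtain r a where "w = (\<Sum>a<n. r a *\<^sub>R X a x)" "a < n" "v = X a x" by blast
    then have "c *\<^sub>R v + w = (\<Sum>b<n. (r b + (if b = a then c else 0)) *\<^sub>R X b x)"
      by (simp add: scaleR_add_left sum.distrib if_distrib[of "\<lambda>r. r *\<^sub>R _"] cong: if_cong)
    then show ?case by (intro exI[of _ "\<lambda>b. r b + (if b = a then c else 0)"])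
  qed
  then obtain r where r: "u = (\<Sum>a<n. r a *\<^sub>R X a x)" using u span[OF W(1)] by blast
  have "local_section A P x u (\<lambda>y. \<Sum>a<n. r a *\<^sub>R X a y)"
  proof (rule local_sectionI[OF W(1)])
    show "smooth_vfield_on A W (\<lambda>y. \<Sum>a<n. r a *\<^sub>R X a y)"
      by (intro smooth_vfield_on_sum W smooth_vfield_on_scaleR smooth_fun.const X) auto
    show "(\<Sum>a<n. r a *\<^sub>R X a y) \<in> P y" if "y \<in> W" for y
      unfolding span[OF that] by (intro span_sum span_scale span_base) auto
  qed (simp add: r)
  then show ?thesis by blast
qed

lemma local_section_restrict:
  assumes "local_section A P x u X" "open W" "x \<in> W"
  obtains W' where "open W'" "x \<in> W'" "W' \<subseteq> W" "smooth_vfield_on A W' X" "\<And>y. y \<in> W' \<Longrightarrow> X y \<in> P y"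
proof -
  obtain W1 where W1: "x \<in> W1" "smooth_vfield_on A W1 X" "\<And>y. y \<in> W1 \<Longrightarrow> X y \<in> P y"
    using assms(1) unfolding local_section_def by blast
  have op: "open (W1 \<inter> W)" using assms(2) smooth_vfield_on_open[OF W1(2)] by blast
  show ?thesis
    by (rule that[OF op _ _ smooth_vfield_on_restrict[OF W1(2) op]]) (use W1 assms in auto)
qed

end

context metric_manifold
begin

text \<open>The instance of \<open>gram_schmidt\<close> along the manifold. The statement about
  spans is the triangularity of the coefficients; it guarantees that fields which begin in a
  distribution remain in it.\<close>

lemma local_orthonormal_frame:
  assumes W: "open W" "x \<in> W" and X: "\<And>l. l < m \<Longrightarrow> smooth_vfield_on A W (X l)"
    and orth: "orthonormal_family (g x) {..<m} (\<lambda>l. X l x) \<sigma>"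
  obtains W' V where "open W'" "x \<in> W'" "W' \<subseteq> W" "\<And>l. l < m \<Longrightarrow> smooth_vfield_on A W' (V l)"
    "\<And>l. l < m \<Longrightarrow> V l x = X l x" "\<And>l y. l < m \<Longrightarrow> V l y \<in> span ((\<lambda>j. X j y) ` {..l})"
    "\<And>y. y \<in> W' \<Longrightarrow> orthonormal_family (g y) {..<m} (\<lambda>l. V l y) \<sigma>"
proof -
  have "\<exists>W' c. open W' \<and> x \<in> W' \<and> W' \<subseteq> W \<and> (\<forall>k j. smooth_fun_on A W' (c k j)) \<and>
    (\<forall>k<m. \<forall>j<m. c k j x = (if j = k then 1 else 0)) \<and>
    (\<forall>k j y. k < j \<longrightarrow> c k j y = 0) \<and>
    (\<forall>y\<in>W'. orthonormal_family (g y) {..<m} (\<lambda>k. \<Sum>j<m. c k j y *\<^sub>R X j y) \<sigma>)"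
    by (rule smooth_fun.gram_schmidt[where b = g and e = X, OF W])
      (intro smooth_fun_on_metric metric X bil sym orth | assumption)+
  then obtain W' c where c: "open W' \<and> x \<in> W' \<and> W' \<subseteq> W \<and> (\<forall>k j. smooth_fun_on A W' (c k j)) \<and>
    (\<forall>k<m. \<forall>j<m. c k j x = (if j = k then 1 else 0)) \<and>
    (\<forall>k j y. k < j \<longrightarrow> c k j y = 0) \<and>
    (\<forall>y\<in>W'. orthonormal_family (g y) {..<m} (\<lambda>k. \<Sum>j<m. c k j y *\<^sub>R X j y) \<sigma>)"
    by (elim exE)
  show thesis
  proof (rule that[of W' "\<lambda>k y. \<Sum>j<m. c k j y *\<^sub>R X j y"])
    show W': "open W'" "x \<in> W'" "W' \<subseteq> W" using c by blast+
    show "smooth_vfield_on A W' (\<lambda>y. \<Sum>j<m. c l j y *\<^sub>R X j y)" if "l < m" for l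
      using c by (intro smooth_vfield_on_sum W' smooth_vfield_on_scaleR smooth_vfield_on_restrict[OF X W'(1,3)]) auto
    show "(\<Sum>j<m. c l j x *\<^sub>R X j x) = X l x" if "l < m" for l
    proof -
      have "(\<Sum>j<m. c l j x *\<^sub>R X j x) = (\<Sum>j<m. if j = l then X j x else 0)"
        by (rule sum.cong) (use c that in auto)
      then show ?thesis using that by simp
    qed
    show "(\<Sum>j<m. c l j y *\<^sub>R X j y) \<in> span ((\<lambda>j. X j y) ` {..l})" if "l < m" for l y
    proof (rule span_sum)
      fix j assume "j \<in> {..<m}"
      show "c l j y *\<^sub>R X j y \<in> span ((\<lambda>j. X j y) ` {..l})"
      proof (cases "l < j")
        case True
        then show ?thesis using c by (simp add: span_zero)
      next
        case False
        then show ?thesis by (intro span_scale span_base) auto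
      qed
    qed
    show "orthonormal_family (g y) {..<m} (\<lambda>k. \<Sum>j<m. c k j y *\<^sub>R X j y) \<sigma>" if "y \<in> W'" for y
      using c that by blast
  qed
qed

lemma frame_orthonormal:
  assumes "subspace (P x)" "nondegenerate_on (g x) (P x)"
  shows "orthonormal_family (g x) {..<dim (P x)} (frame g P x) (frame_sign g P x)"
    "a < dim (P x) \<Longrightarrow> frame g P x a \<in> P x"
proof -
  have "orthonormal_frame (g x) (P x) (frame g P x)"
    unfolding frame_def using orthonormal_frame_exists[OF bil sym assms] by (rule someI_ex)
  then show "orthonormal_family (g x) {..<dim (P x)} (frame g P x) (frame_sign g P x)"
    "a < dim (P x) \<Longrightarrow> frame g P x a \<in> P x"
    unfolding orthonormal_frame_family frame_sign_def by auto
qed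

end

text \<open>Nothing in the assumptions distinguishes the two distributions, so every result for
  \<open>P\<close> holds for \<open>Q\<close> through \<open>swap\<close>. This supplies the
  geometry with and without tilde from a single development.\<close>

locale split_metric = metric_manifold A g
  for A :: "('a::topological_space, 'e::euclidean_space) chart set" and g :: "('a, 'e) tensor02" +
  fixes P Q :: "('a, 'e) distribution" and n p :: nat
  assumes smooth_P: "smooth_distribution A n P" and smooth_Q: "smooth_distribution A p Q"
    and dim_sum: "DIM('e) = n + p"
    and orth: "\<And>y u v. u \<in> P y \<Longrightarrow> v \<in> Q y \<Longrightarrow> g y u v = 0"
    and nondegenerate_P: "\<And>y. nondegenerate_on (g y) (P y)"
    and nondegenerate_Q: "\<And>y. nondegenerate_on (g y) (Q y)"
begin

lemma orth': "u \<in> Q y \<Longrightarrow> v \<in> P y \<Longrightarrow> g y u v = 0"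
  using orth sym by metis

lemma swap: "split_metric A g Q P p n"
proof
  show "DIM('e) = p + n" using dim_sum by simp
qed (fact smooth_P smooth_Q orth' nondegenerate_P nondegenerate_Q)+

lemma subspace_P: "subspace (P y)" and dim_P: "dim (P y) = n"
  and subspace_Q: "subspace (Q y)" and dim_Q: "dim (Q y) = p"
  using smooth_P smooth_Q unfolding smooth_distribution_def by auto

lemma frame_P: "orthonormal_family (g y) {..<n} (frame g P y) (frame_sign g P y)" "a < n \<Longrightarrow> frame g P y a \<in> P y"
  using frame_orthonormal[of P y] by (simp_all add: subspace_P nondegenerate_P dim_P)

lemma frame_Q: "orthonormal_family (g y) {..<p} (frame g Q y) (frame_sign g Q y)" "a < p \<Longrightarrow> frame g Q y a \<in> Q y"
  using frame_orthonormal[of Q y] by (simp_all add: subspace_Q nondegenerate_Q dim_Q)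

lemma orthonormal_join:
  assumes e: "orthonormal_family (g y) {..<n} e \<sigma>" "\<And>l. l < n \<Longrightarrow> e l \<in> P y"
    and f: "orthonormal_family (g y) {..<p} f \<tau>" "\<And>l. l < p \<Longrightarrow> f l \<in> Q y"
  shows "orthonormal_family (g y) {..<n+p} (\<lambda>l. if l < n then e l else f (l - n))
    (\<lambda>l. if l < n then \<sigma> l else \<tau> (l - n))"
proof -
  have "g y (f k) (f l) = (if k = l then \<tau> k else 0)" if "k < p" "l < p" for k l
    using orthonormal_familyD(1)[OF f(1), of k l] that by simp
  moreover have "g y (e k) (e l) = (if k = l then \<sigma> k else 0)" if "k < n" "l < n" for k l
    using orthonormal_familyD(1)[OF e(1), of k l] that by simp
  moreover have "\<bar>\<sigma> l\<bar> = 1" if "l < n" for l using e(1) that unfolding orthonormal_family_def by blast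
  moreover have "\<bar>\<tau> l\<bar> = 1" if "l < p" for l using f(1) that unfolding orthonormal_family_def by blast
  ultimately show ?thesis
    using orth[OF e(2) f(2)] orth'[OF f(2) e(2)] unfolding orthonormal_family_def by auto
qed

lemma full_frame_orthonormal:
  "orthonormal_family (g y) {..<n+p} (full_frame g P Q y) (\<lambda>l. g y (full_frame g P Q y l) (full_frame g P Q y l))"
proof -
  have "full_frame g P Q y = (\<lambda>l. if l < n then frame g P y l else frame g Q y (l - n))"
    unfolding full_frame_def dim_P by (rule ext) simp
  moreover have "(\<lambda>l. if l < n then frame_sign g P y l else frame_sign g Q y (l - n)) =
    (\<lambda>l. g y (full_frame g P Q y l) (full_frame g P Q y l))"
    unfolding full_frame_def dim_P frame_sign_def by (rule ext) simp
  ultimately show ?thesis using orthonormal_join[OF frame_P frame_Q, of y] by simp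
qed

lemma full_frame_P: "l < n \<Longrightarrow> full_frame g P Q y l \<in> P y"
  unfolding full_frame_def dim_P using frame_P by simp

lemma full_frame_Q: "l \<in> {n..<n+p} \<Longrightarrow> full_frame g P Q y l \<in> Q y"
  unfolding full_frame_def dim_P using frame_Q(2)[of "l - n" y] by (simp add: less_diff_conv2)

lemma component_unique:
  assumes u: "u \<in> P y" "v - u \<in> Q y"
  shows "component P Q y v = u"
proof -
  have "w = u" if w: "w \<in> P y \<and> v - w \<in> Q y" for w
  proof -
    have "w - u \<in> P y" using u w subspace_P subspace_diff by blast
    moreover have "w - u = (v - u) - (v - w)" by simp
    then have "w - u \<in> Q y" using u w subspace_Q subspace_diff by metis
    ultimately have "w - u = 0" using nondegenerate_P[of y] orth' unfolding nondegenerate_on_def by blast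
    then show ?thesis by simp
  qed
  then show ?thesis unfolding component_def using u by (intro the_equality conjI) blast+
qed

lemma component_expansion:
  assumes e: "orthonormal_family (g y) {..<n+p} e \<sigma>" "\<And>l. l < n \<Longrightarrow> e l \<in> P y" "\<And>l. l \<in> {n..<n+p} \<Longrightarrow> e l \<in> Q y"
  shows "component P Q y v = (\<Sum>l<n. (\<sigma> l * g y v (e l)) *\<^sub>R e l)"
    "v - component P Q y v = (\<Sum>l\<in>{n..<n+p}. (\<sigma> l * g y v (e l)) *\<^sub>R e l)"
proof -
  let ?u = "\<Sum>l<n. (\<sigma> l * g y v (e l)) *\<^sub>R e l" and ?w = "\<Sum>l\<in>{n..<n+p}. (\<sigma> l * g y v (e l)) *\<^sub>R e l"
  have "v = (\<Sum>l<n+p. (\<sigma> l * g y v (e l)) *\<^sub>R e l)"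
    by (rule orthonormal_expansion[OF bil _ e(1) subspace_UNIV]) (simp_all add: dim_sum)
  also have "\<dots> = ?u + ?w"
    by (subst sum.union_disjoint[symmetric]) (auto intro: sum.cong)
  finally have diff: "v - ?u = ?w" by (simp add: algebra_simps)
  have "?w \<in> Q y" by (intro subspace_sum subspace_scale subspace_Q e(3))
  moreover have "?u \<in> P y" by (intro subspace_sum subspace_scale subspace_P) (simp add: e(2))
  ultimately have "component P Q y v = ?u" by (intro component_unique) (simp_all only: diff)
  then show "component P Q y v = ?u" "v - component P Q y v = ?w" by (simp_all only: diff)
qed

lemma component_frame:
  "component P Q y v = (\<Sum>l<n. (g y (full_frame g P Q y l) (full_frame g P Q y l) * g y v (full_frame g P Q y l)) *\<^sub>R full_frame g P Q y l)"
  "v - component P Q y v = (\<Sum>l\<in>{n..<n+p}. (g y (full_frame g P Q y l) (full_frame g P Q y l) * g y v (full_frame g P Q y l)) *\<^sub>R full_frame g P Q y l)"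
  by (rule component_expansion, fact full_frame_orthonormal, fact full_frame_P, fact full_frame_Q)+

lemma component_in_P: "component P Q y v \<in> P y"
  unfolding component_frame(1) by (intro subspace_sum subspace_scale subspace_P) (simp add: full_frame_P)

lemma component_compl: "v - component P Q y v \<in> Q y"
  unfolding component_frame(2) by (intro subspace_sum subspace_scale subspace_Q full_frame_Q)

lemma component_P: "u \<in> P y \<Longrightarrow> component P Q y u = u"
  by (rule component_unique) (simp_all add: subspace_0[OF subspace_Q])

lemma component_Q: "u \<in> Q y \<Longrightarrow> component P Q y u = 0"
  by (rule component_unique) (simp_all add: subspace_0[OF subspace_P])

lemma component_component: "component P Q y (component P Q y v) = component P Q y v"
  by (rule component_P[OF component_in_P])

lemma linear_component: "linear (component P Q y)"
proof (rule linearI)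
  fix u v r
  have "(u + v) - (component P Q y u + component P Q y v) = (u - component P Q y u) + (v - component P Q y v)" by simp
  then show "component P Q y (u + v) = component P Q y u + component P Q y v"
    using subspace_add[OF subspace_Q component_compl component_compl]
    by (intro component_unique subspace_add[OF subspace_P] component_in_P) (simp only:)
  have "r *\<^sub>R u - r *\<^sub>R component P Q y u = r *\<^sub>R (u - component P Q y u)" by (simp add: scaleR_diff_right)
  then show "component P Q y (r *\<^sub>R u) = r *\<^sub>R component P Q y u"
    using subspace_scale[OF subspace_Q component_compl]
    by (intro component_unique subspace_scale[OF subspace_P] component_in_P) (simp only:)
qed

lemma inner_component: "w \<in> P y \<Longrightarrow> g y (component P Q y v) w = g y v w"
  using orth'[OF component_compl, of w y v] by (simp add: bilinear_lsub[OF bil])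

lemma P_eqI: "u \<in> P y \<Longrightarrow> w \<in> P y \<Longrightarrow> (\<And>v. v \<in> P y \<Longrightarrow> g y u v = g y w v) \<Longrightarrow> u = w"
proof -
  assume "u \<in> P y" "w \<in> P y" and eq: "\<And>v. v \<in> P y \<Longrightarrow> g y u v = g y w v"
  then have "u - w \<in> P y" by (intro subspace_diff[OF subspace_P])
  moreover have "\<forall>v\<in>P y. g y (u - w) v = 0" using eq by (simp add: bilinear_lsub[OF bil])
  ultimately have "u - w = 0" using nondegenerate_P unfolding nondegenerate_on_def by blast
  then show "u = w" by simp
qed

end

section \<open>The second fundamental form and the integrability tensor as tensors\<close>

context split_metric
begin

interpretation swapped: split_metric A g Q P p n by (rule swap)

lemma section_P: "u \<in> P x \<Longrightarrow> \<exists>X. local_section A P x u X"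
  by (rule local_section_exists[OF smooth_P])

lemma section_Q: "u \<in> Q x \<Longrightarrow> \<exists>X. local_section A Q x u X"
  by (rule local_section_exists[OF smooth_Q])

lemma local_section_differentiable: "local_section A R x u X \<Longrightarrow> vfield_differentiable_at A x X"
  by (elim local_sectionE) (rule vfield_differentiable_smooth)

lemma dir_deriv_inner:
  assumes X: "local_section A R x u X" and Y: "local_section A S x v Y"
  shows "dir_deriv A x z (\<lambda>y. g y (X y) (Y y)) = g x (nabla A g x z X) v + g x u (nabla A g x z Y)"
proof -
  obtain W1 where W1: "x \<in> W1" "smooth_vfield_on A W1 X" "X x = u" using X by (rule local_sectionE)
  obtain W2 where W2: "x \<in> W2" "smooth_vfield_on A W2 Y" "Y x = v" using Y by (rule local_sectionE)
  have op: "open (W1 \<inter> W2)" using W1 W2 smooth_vfield_on_open by blast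
  have X': "smooth_vfield_on A (W1 \<inter> W2) X" by (rule smooth_vfield_on_restrict[OF W1(2) op]) blast
  have Y': "smooth_vfield_on A (W1 \<inter> W2) Y" by (rule smooth_vfield_on_restrict[OF W2(2) op]) blast
  have "x \<in> W1 \<inter> W2" using W1 W2 by blast
  from nabla_metric[OF atlas metric this X' Y', of z] show ?thesis unfolding W1(3) W2(3) .
qed

text \<open>Differentiate \<open>g(X, Z) = 0\<close>.\<close>

lemma nabla_orthogonal:
  assumes X: "local_section A P x u X" and Z: "local_section A Q x z Z"
  shows "g x (nabla A g x v X) z = - g x u (nabla A g x v Z)"
proof -
  obtain W1 where W1: "x \<in> W1" "smooth_vfield_on A W1 X" "\<And>y. y \<in> W1 \<Longrightarrow> X y \<in> P y"
    using X unfolding local_section_def by blast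
  obtain W2 where W2: "x \<in> W2" "smooth_vfield_on A W2 Z" "\<And>y. y \<in> W2 \<Longrightarrow> Z y \<in> Q y"
    using Z unfolding local_section_def by blast
  have "dir_deriv A x v (\<lambda>y. g y (X y) (Z y)) = dir_deriv A x v (\<lambda>_. 0)"
    by (rule dir_deriv_cong[of "W1 \<inter> W2"])
      (use W1 W2 smooth_vfield_on_open orth in blast)+
  then show ?thesis unfolding dir_deriv_const dir_deriv_inner[OF X Z] by simp
qed

lemma lie_bracket_nabla:
  "lie_bracket A X Y x = nabla A g x (X x) Y - nabla A g x (Y x) X"
  using nabla_torsion_free[OF metric] by metis

lemma Q_projection_unique:
  assumes "\<And>z Z. local_section A Q x z Z \<Longrightarrow> g x u z = g x w z"
  shows "component Q P x u = component Q P x w"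
proof (rule swapped.P_eqI)
  fix z assume z: "z \<in> Q x"
  with section_Q obtain Z where "local_section A Q x z Z" by blast
  from assms[OF this] show "g x (component Q P x u) z = g x (component Q P x w) z"
    using z by (simp add: swapped.inner_component)
qed (rule swapped.component_in_P)+

text \<open>Pairing with a section \<open>Z\<close> of \<open>Q\<close> moves the derivative from
  \<open>X\<close> and \<open>Y\<close> to \<open>Z\<close> by \<open>nabla_orthogonal\<close>. What
  remains depends on \<open>X\<close> and \<open>Y\<close> only through their values at
  \<open>x\<close>, so the description by \<open>THE\<close> denotes the expected vector.\<close>

lemma second_ff_eq:
  assumes X: "local_section A P x (component P Q x u) X" and Y: "local_section A P x (component P Q x v) Y"
  shows "second_ff A P Q g x u v = component Q P x ((1/2) *\<^sub>R (nabla A g x (X x) Y + nabla A g x (Y x) X))"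
proof -
  have val: "X x = component P Q x u" if "local_section A P x (component P Q x u) X" for X u
    using that by (rule local_sectionE)
  have inner: "g x ((1/2) *\<^sub>R (nabla A g x (X x) Y + nabla A g x (Y x) X)) z =
      - (1/2) * (g x (component P Q x v) (nabla A g x (component P Q x u) Z) +
        g x (component P Q x u) (nabla A g x (component P Q x v) Z))"
    if "local_section A P x (component P Q x u) X" "local_section A P x (component P Q x v) Y"
      "local_section A Q x z Z" for X Y z Z
    using nabla_orthogonal[OF that(1,3)] nabla_orthogonal[OF that(2,3)] val[OF that(1)] val[OF that(2)]
    by (simp add: bilinear_lmul[OF bil] bilinear_ladd[OF bil] field_simps)
  have "component Q P x ((1/2) *\<^sub>R (nabla A g x (X x) Y + nabla A g x (Y x) X)) =
        component Q P x ((1/2) *\<^sub>R (nabla A g x (X' x) Y' + nabla A g x (Y' x) X'))"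
    if "local_section A P x (component P Q x u) X'" "local_section A P x (component P Q x v) Y'" for X' Y'
    by (rule Q_projection_unique) (simp only: inner[OF X Y] inner[OF that])
  then show ?thesis unfolding second_ff_def using X Y by (intro the_equality) blast+
qed

lemma second_ff_in_Q: "second_ff A P Q g x u v \<in> Q x"
proof -
  obtain X Y where "local_section A P x (component P Q x u) X" "local_section A P x (component P Q x v) Y"
    using section_P component_in_P by metis
  from second_ff_eq[OF this] show ?thesis by (simp add: swapped.component_in_P)
qed

lemma second_ff_inner:
  assumes Z: "local_section A Q x z Z"
  shows "g x (second_ff A P Q g x u v) z = - (1/2) *
    (g x (component P Q x v) (nabla A g x (component P Q x u) Z) +
     g x (component P Q x u) (nabla A g x (component P Q x v) Z))"
proof -
  obtain X Y where XY: "local_section A P x (component P Q x u) X" "local_section A P x (component P Q x v) Y"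
    using section_P component_in_P by metis
  have v: "X x = component P Q x u" "Y x = component P Q x v" "z \<in> Q x"
    using XY Z by (auto elim: local_sectionE)
  show ?thesis
    unfolding second_ff_eq[OF XY] swapped.inner_component[OF v(3)]
    using nabla_orthogonal[OF XY(1) Z] nabla_orthogonal[OF XY(2) Z] v
    by (simp add: bilinear_lmul[OF bil] bilinear_ladd[OF bil] field_simps)
qed

lemma second_ff_component: "second_ff A P Q g x (component P Q x u) (component P Q x v) = second_ff A P Q g x u v"
  unfolding second_ff_def component_component ..

text \<open>The argument of \<open>second_ff_eq\<close> with a difference in place of the sum: the
  bracket is the commutator of covariant derivatives because the connection is torsion-free.\<close>

lemma integrability_eq:
  assumes X: "local_section A P x (component P Q x u) X" and Y: "local_section A P x (component P Q x v) Y"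
  shows "integrability A P Q x u v = (1/2) *\<^sub>R component Q P x (lie_bracket A X Y x)"
proof -
  have val: "X x = component P Q x u" if "local_section A P x (component P Q x u) X" for X u
    using that by (rule local_sectionE)
  have inner: "g x (lie_bracket A X Y x) z =
      - g x (component P Q x v) (nabla A g x (component P Q x u) Z) +
        g x (component P Q x u) (nabla A g x (component P Q x v) Z)"
    if "local_section A P x (component P Q x u) X" "local_section A P x (component P Q x v) Y"
      "local_section A Q x z Z" for X Y z Z
    using nabla_orthogonal[OF that(1,3)] nabla_orthogonal[OF that(2,3)] val[OF that(1)] val[OF that(2)]
    by (simp add: lie_bracket_nabla bilinear_lsub[OF bil])
  have "component Q P x (lie_bracket A X Y x) = component Q P x (lie_bracket A X' Y' x)"
    if "local_section A P x (component P Q x u) X'" "local_section A P x (component P Q x v) Y'" for X' Y'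
    by (rule Q_projection_unique) (simp only: inner[OF X Y] inner[OF that])
  then have "(1/2) *\<^sub>R component Q P x (lie_bracket A X Y x) = (1/2) *\<^sub>R component Q P x (lie_bracket A X' Y' x)"
    if "local_section A P x (component P Q x u) X'" "local_section A P x (component P Q x v) Y'" for X' Y'
    using that by metis
  then show ?thesis unfolding integrability_def using X Y by (intro the_equality) blast+
qed

lemma integrability_in_Q: "integrability A P Q x u v \<in> Q x"
proof -
  obtain X Y where "local_section A P x (component P Q x u) X" "local_section A P x (component P Q x v) Y"
    using section_P component_in_P by metis
  from integrability_eq[OF this] show ?thesis by (simp add: swapped.component_in_P subspace_scale[OF subspace_Q])
qed

lemma integrability_inner:
  assumes Z: "local_section A Q x z Z"
  shows "g x (integrability A P Q x u v) z = (1/2) *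
    (- g x (component P Q x v) (nabla A g x (component P Q x u) Z) +
     g x (component P Q x u) (nabla A g x (component P Q x v) Z))"
proof -
  obtain X Y where XY: "local_section A P x (component P Q x u) X" "local_section A P x (component P Q x v) Y"
    using section_P component_in_P by metis
  have v: "X x = component P Q x u" "Y x = component P Q x v" "z \<in> Q x"
    using XY Z by (auto elim: local_sectionE)
  show ?thesis
    unfolding integrability_eq[OF XY] bilinear_lmul[OF bil] swapped.inner_component[OF v(3)]
    using nabla_orthogonal[OF XY(1) Z] nabla_orthogonal[OF XY(2) Z] v
    by (simp add: lie_bracket_nabla bilinear_lsub[OF bil])
qed

lemma Q_valued_eqI:
  assumes "u \<in> Q x" "w \<in> Q x" "\<And>z Z. local_section A Q x z Z \<Longrightarrow> g x u z = g x w z"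
  shows "u = w"
  using Q_projection_unique[OF assms(3)] assms(1,2) by (simp add: swapped.component_P)

lemma second_ff_sym: "second_ff A P Q g x u v = second_ff A P Q g x v u"
  by (rule Q_valued_eqI[OF second_ff_in_Q second_ff_in_Q]) (simp add: second_ff_inner)

lemma bilinear_nabla_form:
  assumes "local_section A Q x z Z"
  shows "bilinear (\<lambda>u v. g x (component P Q x v) (nabla A g x (component P Q x u) Z))"
  by (intro bilinearI)
    (simp_all add: linear_add[OF linear_component] linear_cmul[OF linear_component]
      linear_add[OF linear_nabla[OF local_section_differentiable[OF assms]]]
      linear_cmul[OF linear_nabla[OF local_section_differentiable[OF assms]]]
      bilinear_ladd[OF bil] bilinear_radd[OF bil] bilinear_lmul[OF bil] bilinear_rmul[OF bil])

lemma bilinear_second_ff: "bilinear (second_ff A P Q g x)"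
proof (rule bilinearI)
  fix u u' v r
  note in_Q = second_ff_in_Q subspace_add[OF subspace_Q] subspace_scale[OF subspace_Q]
  show add: "second_ff A P Q g x (u + u') v = second_ff A P Q g x u v + second_ff A P Q g x u' v" for u u' v
  proof (rule Q_valued_eqI)
    fix z Z assume Z: "local_section A Q x z Z"
    show "g x (second_ff A P Q g x (u + u') v) z = g x (second_ff A P Q g x u v + second_ff A P Q g x u' v) z"
      unfolding bilinear_ladd[OF bil] second_ff_inner[OF Z] bilinear_ladd[OF bilinear_nabla_form[OF Z]]
        bilinear_radd[OF bilinear_nabla_form[OF Z]] by (simp add: algebra_simps)
  qed (intro in_Q)+
  show scale: "second_ff A P Q g x (r *\<^sub>R u) v = r *\<^sub>R second_ff A P Q g x u v" for u v
  proof (rule Q_valued_eqI)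
    fix z Z assume Z: "local_section A Q x z Z"
    show "g x (second_ff A P Q g x (r *\<^sub>R u) v) z = g x (r *\<^sub>R second_ff A P Q g x u v) z"
      unfolding bilinear_lmul[OF bil] second_ff_inner[OF Z] bilinear_lmul[OF bilinear_nabla_form[OF Z]]
        bilinear_rmul[OF bilinear_nabla_form[OF Z]] by (simp add: algebra_simps)
  qed (intro in_Q)+
  show "second_ff A P Q g x u (v + u') = second_ff A P Q g x u v + second_ff A P Q g x u u'"
    unfolding second_ff_sym[of x u] by (rule add)
  show "second_ff A P Q g x u (r *\<^sub>R v) = r *\<^sub>R second_ff A P Q g x u v"
    unfolding second_ff_sym[of x u] by (rule scale)
qed

lemma integrability_antisym: "integrability A P Q x u v = - integrability A P Q x v u"
  by (rule Q_valued_eqI[OF integrability_in_Q subspace_neg[OF subspace_Q integrability_in_Q]])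
    (simp add: integrability_inner bilinear_lneg[OF bil] field_simps)

lemma bilinear_integrability: "bilinear (integrability A P Q x)"
proof (rule bilinearI)
  fix u u' v r
  note in_Q = integrability_in_Q subspace_add[OF subspace_Q] subspace_scale[OF subspace_Q]
  show add: "integrability A P Q x (u + u') v = integrability A P Q x u v + integrability A P Q x u' v" for u u' v
  proof (rule Q_valued_eqI)
    fix z Z assume Z: "local_section A Q x z Z"
    show "g x (integrability A P Q x (u + u') v) z = g x (integrability A P Q x u v + integrability A P Q x u' v) z"
      unfolding bilinear_ladd[OF bil] integrability_inner[OF Z] bilinear_ladd[OF bilinear_nabla_form[OF Z]]
        bilinear_radd[OF bilinear_nabla_form[OF Z]] by (simp add: algebra_simps)
  qed (intro in_Q)+
  show scale: "integrability A P Q x (r *\<^sub>R u) v = r *\<^sub>R integrability A P Q x u v" for u v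
  proof (rule Q_valued_eqI)
    fix z Z assume Z: "local_section A Q x z Z"
    show "g x (integrability A P Q x (r *\<^sub>R u) v) z = g x (r *\<^sub>R integrability A P Q x u v) z"
      unfolding bilinear_lmul[OF bil] integrability_inner[OF Z] bilinear_lmul[OF bilinear_nabla_form[OF Z]]
        bilinear_rmul[OF bilinear_nabla_form[OF Z]] by (simp add: algebra_simps)
  qed (intro in_Q)+
  show "integrability A P Q x u (v + u') = integrability A P Q x u v + integrability A P Q x u u'"
    unfolding integrability_antisym[of x u] add by simp
  show "integrability A P Q x u (r *\<^sub>R v) = r *\<^sub>R integrability A P Q x u v"
    unfolding integrability_antisym[of x u] scale by simp
qed

text \<open>The form \<open>g x (nabla A g x u Z) v\<close> on \<open>P\<close> has a symmetric and
  a skew part; up to sign these are the components of \<open>second_ff\<close> and of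
  \<open>integrability\<close> along \<open>Z\<close>.\<close>

lemma second_ff_plus_integrability:
  assumes Z: "local_section A Q x z Z" and uv: "u \<in> P x" "v \<in> P x"
  shows "g x (nabla A g x u Z) v = - (g x (second_ff A P Q g x u v) z + g x (integrability A P Q x u v) z)"
  unfolding second_ff_inner[OF Z] integrability_inner[OF Z] component_P[OF uv(1)] component_P[OF uv(2)]
  using sym[of x v "nabla A g x u Z"] by (simp add: field_simps)

text \<open>The value of \<open>-(L\<^sub>Z g)(X, Y) / 2\<close>: no covariant derivative occurs, which makes the dependence
  on the metric explicit.\<close>

lemma second_ff_lie:
  assumes X: "local_section A P x u X" and Y: "local_section A P x v Y" and Z: "local_section A Q x z Z"
  shows "g x (second_ff A P Q g x u v) z = - (1/2) * (dir_deriv A x z (\<lambda>y. g y (X y) (Y y))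
    + g x v (lie_bracket A X Z x) + g x u (lie_bracket A Y Z x))"
proof -
  have v: "X x = u" "Y x = v" "Z x = z" "u \<in> P x" "v \<in> P x"
    using X Y Z by (auto elim: local_sectionE)
  show ?thesis
    unfolding second_ff_inner[OF Z] component_P[OF v(4)] component_P[OF v(5)] dir_deriv_inner[OF X Y] lie_bracket_nabla v
    using sym[of x v] by (simp add: bilinear_rsub[OF bil] algebra_simps)
qed

end

section \<open>Traces and pairings in orthonormal frames\<close>

context metric_manifold
begin

lemma sharp_inner:
  assumes "bilinear (b x)"
  shows "g x (sharp g b x u) v = b x u v"
proof -
  have "linear (b x u)" using assms unfolding bilinear_def by blast
  from theI'[OF nondegenerate_representation[OF bil nondegenerate this]]
  show ?thesis unfolding sharp_def by blast
qed

lemma linear_sharp: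
  assumes "bilinear (b x)"
  shows "linear (sharp g b x)"
  by (rule linearI; rule metric_eqI[of x])
    (simp_all add: bilinear_ladd[OF bil] bilinear_lmul[OF bil] sharp_inner[where b = b, OF assms]
      bilinear_ladd[OF assms] bilinear_lmul[OF assms])

lemma pairing_orthonormal:
  assumes C: "bilinear (C x)" and S: "bilinear (S x)"
    and e: "orthonormal_family (g x) {..<m} e \<sigma>" "DIM('e) = m"
  shows "pairing g C S x = (\<Sum>k<m. \<Sum>l<m. \<sigma> k * \<sigma> l * (C x (e k) (e l) * S x (e l) (e k)))"
proof -
  have ex: "v = (\<Sum>l<m. (\<sigma> l * g x v (e l)) *\<^sub>R e l)" for v
    by (rule orthonormal_expansion[OF bil _ e(1) subspace_UNIV]) (simp_all add: e(2)[symmetric])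
  have "pairing g C S x = (\<Sum>l<m. \<sigma> l * g x ((sharp g C x \<circ> sharp g S x) (e l)) (e l))"
    unfolding pairing_def
    by (rule trace_eq_orthonormal[OF bil sym linear_compose[OF linear_sharp[where b = S, OF S] linear_sharp[where b = C, OF C]] _ e(1)])
      (simp_all add: e(2))
  also have "\<dots> = (\<Sum>l<m. \<sigma> l * (\<Sum>k<m. \<sigma> k * (C x (e k) (e l) * S x (e l) (e k))))"
  proof (intro sum.cong refl)
    fix l
    have "C x (sharp g S x (e l)) (e l) = C x (\<Sum>k<m. (\<sigma> k * g x (sharp g S x (e l)) (e k)) *\<^sub>R e k) (e l)"
      using ex[of "sharp g S x (e l)"] by simp
    then show "\<sigma> l * g x ((sharp g C x \<circ> sharp g S x) (e l)) (e l) =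
        \<sigma> l * (\<Sum>k<m. \<sigma> k * (C x (e k) (e l) * S x (e l) (e k)))"
      by (simp add: sharp_inner[where b = C, OF C] sharp_inner[where b = S, OF S] bilinear_sum_left[OF C] bilinear_lmul[OF C] mult_ac)
  qed
  also have "\<dots> = (\<Sum>k<m. \<Sum>l<m. \<sigma> k * \<sigma> l * (C x (e k) (e l) * S x (e l) (e k)))"
    by (subst sum.swap) (simp add: sum_distrib_left mult_ac)
  finally show ?thesis .
qed

lemma local_frame_of_distribution:
  assumes P: "smooth_distribution A n P" and E: "orthonormal_family (g x) {..<n} E \<sigma>"
    and EP: "\<And>l. l < n \<Longrightarrow> E l \<in> P x"
  shows "\<exists>W V. open W \<and> x \<in> W \<and> (\<forall>l<n. smooth_vfield_on A W (V l) \<and> V l x = E l \<and> (\<forall>y\<in>W. V l y \<in> P y)) \<and>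
    (\<forall>y\<in>W. orthonormal_family (g y) {..<n} (\<lambda>l. V l y) \<sigma>)"
proof -
  have sub: "subspace (P y)" for y using P unfolding smooth_distribution_def by blast
  have "\<forall>l. \<exists>X W. l < n \<longrightarrow> x \<in> W \<and> smooth_vfield_on A W X \<and> (\<forall>y\<in>W. X y \<in> P y) \<and> X x = E l"
    using local_section_exists[OF P EP] unfolding local_section_def by blast
  then obtain X W where X: "\<And>l. l < n \<Longrightarrow> x \<in> W l \<and> smooth_vfield_on A (W l) (X l) \<and> (\<forall>y\<in>W l. X l y \<in> P y) \<and> X l x = E l"
    by metis
  define U where "U = (\<Inter>l<n. W l)"
  have "\<forall>l\<in>{..<n}. open (W l)" using X smooth_vfield_on_open by blast
  then have U: "open U" "x \<in> U" unfolding U_def using X by (auto intro: open_INT[rotated])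
  have XU: "smooth_vfield_on A U (X l)" if "l < n" for l
    by (rule smooth_vfield_on_restrict[of "W l"]) (use X[OF that] U that in \<open>auto simp: U_def\<close>)
  have on: "orthonormal_family (g x) {..<n} (\<lambda>l. X l x) \<sigma>"
    using E X unfolding orthonormal_family_def by simp
  show ?thesis
  proof (rule local_orthonormal_frame[where X = X, OF U _ on])
    show "smooth_vfield_on A U (X l)" if "l < n" for l using XU[OF that] .
  next
    fix W' V
    assume W': "open W'" "x \<in> W'" "W' \<subseteq> U" "\<And>l. l < n \<Longrightarrow> smooth_vfield_on A W' (V l)"
      and Vx: "\<And>l. l < n \<Longrightarrow> V l x = X l x" and span: "\<And>l y. l < n \<Longrightarrow> V l y \<in> span ((\<lambda>j. X j y) ` {..l})"
      and on: "\<And>y. y \<in> W' \<Longrightarrow> orthonormal_family (g y) {..<n} (\<lambda>l. V l y) \<sigma>"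
    have VP: "V l y \<in> P y" if l: "l < n" and y: "y \<in> W'" for l y
    proof -
      have "X j y \<in> P y" if j: "j \<le> l" for j
      proof -
        have "y \<in> W j" using y W'(3) j l unfolding U_def by auto
        then show ?thesis using X[of j] j l by simp
      qed
      then have "(\<lambda>j. X j y) ` {..l} \<subseteq> P y" by blast
      then show ?thesis using span[OF l] span_minimal[OF _ sub] by blast
    qed
    have "V l x = E l" if "l < n" for l using Vx[OF that] X[OF that] by simp
    then show ?thesis using W'(1,2,4) on VP by (intro exI[of _ W'] exI[of _ V]) blast
  qed
qed

end

context split_metric
begin

lemma trace_on_eq:
  assumes b: "bilinear (b y)" and e: "orthonormal_family (g y) {..<n} e \<sigma>" "\<And>l. l < n \<Longrightarrow> e l \<in> P y"
  shows "trace_on g P b y = (\<Sum>l<n. \<sigma> l *\<^sub>R b y (e l) (e l))"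
  unfolding trace_on_def Let_def dim_P
  by (rule trace_frame_independent[where V = "P y", OF bil sym b subspace_P _ e(1) _ _ _ frame_P(1)])
    (simp_all add: e(2) frame_P(2) dim_P)

text \<open>The four arguments form two pairs, each filled by one frame vector and its partner. The
  frame is exchanged in one pair at a time, so \<open>trace_frame_independent\<close> suffices for
  contractions in which the pairs are interleaved.\<close>

lemma double_trace_eq:
  fixes F :: "'e \<Rightarrow> 'e \<Rightarrow> 'e \<Rightarrow> 'e \<Rightarrow> 'c::real_vector"
  assumes F: "\<And>v v'. bilinear (\<lambda>u u'. F u u' v v')" "\<And>u u'. bilinear (F u u')"
    and e: "orthonormal_family (g y) {..<n} e \<sigma>" "\<And>l. l < n \<Longrightarrow> e l \<in> P y"
    and f: "orthonormal_family (g y) {..<n} f \<tau>" "\<And>l. l < n \<Longrightarrow> f l \<in> P y"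
  shows "(\<Sum>a<n. \<Sum>b<n. (\<tau> a * \<tau> b) *\<^sub>R F (f a) (f a) (f b) (f b)) =
    (\<Sum>a<n. \<Sum>b<n. (\<sigma> a * \<sigma> b) *\<^sub>R F (e a) (e a) (e b) (e b))"
proof -
  have tr: "(\<Sum>a<n. \<tau> a *\<^sub>R G (f a) (f a)) = (\<Sum>a<n. \<sigma> a *\<^sub>R G (e a) (e a))" if "bilinear G" for G :: "'e \<Rightarrow> 'e \<Rightarrow> 'c"
    by (rule trace_frame_independent[where V = "P y", OF bil sym that subspace_P _ e(1) _ _ _ f(1)]) (simp_all add: e(2) f(2) dim_P)
  have "(\<Sum>a<n. \<Sum>b<n. (\<tau> a * \<tau> b) *\<^sub>R F (f a) (f a) (f b) (f b)) = (\<Sum>a<n. \<tau> a *\<^sub>R (\<Sum>b<n. \<tau> b *\<^sub>R F (f a) (f a) (f b) (f b)))"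
    by (simp add: scaleR_sum_right)
  also have "\<dots> = (\<Sum>a<n. \<tau> a *\<^sub>R (\<Sum>b<n. \<sigma> b *\<^sub>R F (f a) (f a) (e b) (e b)))"
    by (simp only: tr[OF F(2)])
  also have "\<dots> = (\<Sum>b<n. \<sigma> b *\<^sub>R (\<Sum>a<n. \<tau> a *\<^sub>R F (f a) (f a) (e b) (e b)))"
    unfolding scaleR_sum_right by (subst sum.swap) (simp add: mult.commute)
  also have "\<dots> = (\<Sum>b<n. \<sigma> b *\<^sub>R (\<Sum>a<n. \<sigma> a *\<^sub>R F (e a) (e a) (e b) (e b)))"
    by (simp only: tr[OF F(1)])
  also have "\<dots> = (\<Sum>a<n. \<Sum>b<n. (\<sigma> a * \<sigma> b) *\<^sub>R F (e a) (e a) (e b) (e b))"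
    unfolding scaleR_sum_right by (subst sum.swap) (simp add: mult.commute)
  finally show ?thesis .
qed

lemma h_contract_eq:
  assumes B: "bilinear (B y)" and e: "orthonormal_family (g y) {..<n} e \<sigma>" "\<And>l. l < n \<Longrightarrow> e l \<in> P y"
  shows "h_contract A P Q g B y = (\<Sum>a<n. \<Sum>b<n. (\<sigma> a * \<sigma> b * B y (e a) (e b)) *\<^sub>R second_ff A P Q g y (e a) (e b))"
proof -
  define F where "F u u' v v' = B y u v *\<^sub>R second_ff A P Q g y u' v'" for u u' v v'
  note lin = bilinear_ladd[OF B] bilinear_radd[OF B] bilinear_lmul[OF B] bilinear_rmul[OF B]
    bilinear_ladd[OF bilinear_second_ff] bilinear_radd[OF bilinear_second_ff]
    bilinear_lmul[OF bilinear_second_ff] bilinear_rmul[OF bilinear_second_ff]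
  have "bilinear (\<lambda>u u'. F u u' v v')" for v v'
    unfolding F_def by (rule bilinearI) (simp_all add: lin scaleR_add_left scaleR_add_right mult.commute)
  moreover have "bilinear (F u u')" for u u'
    unfolding F_def by (rule bilinearI) (simp_all add: lin scaleR_add_left scaleR_add_right mult.commute)
  ultimately have "(\<Sum>a<n. \<Sum>b<n. (frame_sign g P y a * frame_sign g P y b) *\<^sub>R F (frame g P y a) (frame g P y a) (frame g P y b) (frame g P y b)) =
    (\<Sum>a<n. \<Sum>b<n. (\<sigma> a * \<sigma> b) *\<^sub>R F (e a) (e a) (e b) (e b))"
    by (rule double_trace_eq[OF _ _ e frame_P])
  then show ?thesis unfolding h_contract_def Let_def dim_P F_def by simp
qed

text \<open>As an iterated trace, the squared norm can be differentiated in time by applying the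
  rule for a single trace twice.\<close>

lemma norm2_on_trace:
  "norm2_on g P K y = trace_on g P (\<lambda>y u u'. trace_on g P (\<lambda>y v v'. g y (K y u v) (K y u' v')) y) y"
  unfolding norm2_on_def trace_on_def Let_def by (simp add: sum_distrib_left mult_ac)

lemma weingarten_char:
  assumes K: "bilinear (K x)"
  shows "weingarten g P K x z u \<in> P x \<and> (\<forall>v\<in>P x. g x (weingarten g P K x z u) v = g x (K x u v) z)"
proof -
  define w where "w = (\<Sum>a<n. (frame_sign g P x a * g x (K x u (frame g P x a)) z) *\<^sub>R frame g P x a)"
  have w: "w \<in> P x" unfolding w_def by (intro subspace_sum subspace_scale subspace_P) (simp add: frame_P)
  have inner: "g x w v = g x (K x u v) z" if v: "v \<in> P x" for v
  proof -
    have ex: "v = (\<Sum>a<n. (frame_sign g P x a * g x v (frame g P x a)) *\<^sub>R frame g P x a)"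
      by (rule orthonormal_expansion[OF bil _ frame_P(1) subspace_P _ _ v]) (simp_all add: frame_P dim_P)
    have "g x (K x u v) z = (\<Sum>a<n. frame_sign g P x a * g x v (frame g P x a) * g x (K x u (frame g P x a)) z)"
      by (subst ex) (simp add: bilinear_sum_right[OF K] bilinear_rmul[OF K] bilinear_sum_left[OF bil] bilinear_lmul[OF bil])
    moreover have "g x w v = (\<Sum>a<n. frame_sign g P x a * g x v (frame g P x a) * g x (K x u (frame g P x a)) z)"
      unfolding w_def using sym[of x v] by (simp add: bilinear_sum_left[OF bil] bilinear_lmul[OF bil] mult_ac)
    ultimately show ?thesis by simp
  qed
  have "weingarten g P K x z u = w"
    unfolding weingarten_def
  proof (rule the_equality)
    fix w' assume "w' \<in> P x \<and> (\<forall>v\<in>P x. g x w' v = g x (K x u v) z)"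
    then show "w' = w" using inner by (intro P_eqI[OF _ w]) auto
  qed (use w inner in blast)
  then show ?thesis using w inner by blast
qed

lemma weingarten_in_P: "bilinear (K x) \<Longrightarrow> weingarten g P K x z u \<in> P x"
  and weingarten_inner: "bilinear (K x) \<Longrightarrow> v \<in> P x \<Longrightarrow> g x (weingarten g P K x z u) v = g x (K x u v) z"
  using weingarten_char by blast+

lemma linear_weingarten:
  assumes K: "bilinear (K x)"
  shows "linear (weingarten g P K x z)"
proof (rule linearI)
  fix u v r
  note in_P = weingarten_in_P[where K = K, OF K] subspace_add[OF subspace_P] subspace_scale[OF subspace_P]
  note inner = weingarten_inner[where K = K, OF K] bilinear_ladd[OF K] bilinear_lmul[OF K] bilinear_ladd[OF bil] bilinear_lmul[OF bil]
  show "weingarten g P K x z (u + v) = weingarten g P K x z u + weingarten g P K x z v"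
    by (rule P_eqI[of _ x], intro in_P, intro in_P, simp add: inner)
  show "weingarten g P K x z (r *\<^sub>R u) = r *\<^sub>R weingarten g P K x z u"
    by (rule P_eqI[of _ x], intro in_P, intro in_P, simp add: inner)
qed

lemma weingarten_compose:
  assumes K: "bilinear (K x)" "bilinear (L x)" and v: "v \<in> P x"
    and e: "orthonormal_family (g x) {..<n} e \<sigma>" "\<And>l. l < n \<Longrightarrow> e l \<in> P x"
  shows "g x (weingarten g P K x z (weingarten g P L x z u)) v =
    (\<Sum>c<n. \<sigma> c * (g x (L x u (e c)) z * g x (K x (e c) v) z))"
proof -
  have ex: "weingarten g P L x z u = (\<Sum>c<n. (\<sigma> c * g x (weingarten g P L x z u) (e c)) *\<^sub>R e c)"
    by (rule orthonormal_expansion[OF bil _ e(1) subspace_P _ _ weingarten_in_P[where K = L, OF K(2)]]) (simp_all add: e(2) dim_P)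
  have "g x (weingarten g P K x z (weingarten g P L x z u)) v = g x (K x (weingarten g P L x z u) v) z"
    by (rule weingarten_inner[where K = K, OF K(1) v])
  also have "\<dots> = (\<Sum>c<n. \<sigma> c * (g x (weingarten g P L x z u) (e c) * g x (K x (e c) v) z))"
    by (subst ex) (simp add: bilinear_sum_left[OF K(1)] bilinear_lmul[OF K(1)] bilinear_sum_left[OF bil] bilinear_lmul[OF bil] mult_ac)
  finally show ?thesis using e(2) by (simp add: weingarten_inner[where K = L, OF K(2)])
qed

lemma pairing_P:
  assumes C: "bilinear (C x)" and S: "bilinear (S x)" "\<And>u v. S x u v = S x v u" "\<And>u v. v \<in> Q x \<Longrightarrow> S x u v = 0"
    and e: "orthonormal_family (g x) {..<n+p} e \<sigma>" "\<And>l. l \<in> {n..<n+p} \<Longrightarrow> e l \<in> Q x"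
  shows "pairing g C S x = (\<Sum>a<n. \<Sum>b<n. \<sigma> a * \<sigma> b * (C x (e a) (e b) * S x (e a) (e b)))"
proof -
  have z: "S x (e l) (e k) = 0" if "l \<in> {n..<n+p} \<or> k \<in> {n..<n+p}" for k l
    using that e(2)[of l] e(2)[of k] S(3)[of "e k" "e l"] S(3)[of "e l" "e k"] S(2)[of "e l" "e k"] by auto
  have "pairing g C S x = (\<Sum>k<n+p. \<Sum>l<n+p. \<sigma> k * \<sigma> l * (C x (e k) (e l) * S x (e l) (e k)))"
    by (rule pairing_orthonormal[where C = C and S = S, OF C S(1) e(1) dim_sum])
  also have "\<dots> = (\<Sum>k<n. \<Sum>l<n+p. \<sigma> k * \<sigma> l * (C x (e k) (e l) * S x (e l) (e k)))"
    by (rule sum.mono_neutral_right) (auto simp: z)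
  also have "\<dots> = (\<Sum>k<n. \<Sum>l<n. \<sigma> k * \<sigma> l * (C x (e k) (e l) * S x (e l) (e k)))"
    by (intro sum.cong refl sum.mono_neutral_right) (auto simp: z)
  also have "\<dots> = (\<Sum>a<n. \<Sum>b<n. \<sigma> a * \<sigma> b * (C x (e a) (e b) * S x (e a) (e b)))"
    by (intro sum.cong refl) (metis S(2))
  finally show ?thesis .
qed

text \<open>The local frame takes at \<open>x\<close> exactly the values selected by
  \<open>full_frame\<close>. The sums in \<open>divergence\<close> and \<open>div_h\<close> at
  \<open>x\<close> thus already run over it, and the signs can be fixed once at
  \<open>x\<close>.\<close>

lemma adapted_frame_exists:
  "\<exists>W e. open W \<and> x \<in> W \<and> (\<forall>l<n+p. smooth_vfield_on A W (e l) \<and> e l x = full_frame g P Q x l) \<and>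
    (\<forall>y\<in>W. (\<forall>l<n. e l y \<in> P y) \<and> (\<forall>l\<in>{n..<n+p}. e l y \<in> Q y) \<and>
      orthonormal_family (g y) {..<n+p} (\<lambda>l. e l y) (\<lambda>l. g x (full_frame g P Q x l) (full_frame g P Q x l)))"
proof -
  obtain W V where W: "open W" "x \<in> W" and V: "\<And>l. l < n \<Longrightarrow> smooth_vfield_on A W (V l)" "\<And>l. l < n \<Longrightarrow> V l x = frame g P x l"
      "\<And>l y. l < n \<Longrightarrow> y \<in> W \<Longrightarrow> V l y \<in> P y" "\<And>y. y \<in> W \<Longrightarrow> orthonormal_family (g y) {..<n} (\<lambda>l. V l y) (frame_sign g P x)"
    using local_frame_of_distribution[OF smooth_P frame_P(1) frame_P(2), of x] by metis
  obtain W' V' where W': "open W'" "x \<in> W'" and V': "\<And>l. l < p \<Longrightarrow> smooth_vfield_on A W' (V' l)" "\<And>l. l < p \<Longrightarrow> V' l x = frame g Q x l"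
      "\<And>l y. l < p \<Longrightarrow> y \<in> W' \<Longrightarrow> V' l y \<in> Q y" "\<And>y. y \<in> W' \<Longrightarrow> orthonormal_family (g y) {..<p} (\<lambda>l. V' l y) (frame_sign g Q x)"
    using local_frame_of_distribution[OF smooth_Q frame_Q(1) frame_Q(2), of x] by metis
  define e where "e l y = (if l < n then V l y else V' (l - n) y)" for l y
  have op: "open (W \<inter> W')" using W W' by blast
  have "smooth_vfield_on A (W \<inter> W') (e l)" if "l < n + p" for l
  proof (cases "l < n")
    case True
    then have "e l = V l" unfolding e_def by auto
    then show ?thesis using smooth_vfield_on_restrict[OF V(1)[OF True] op] by simp
  next
    case False
    then have "e l = V' (l - n)" "l - n < p" using that unfolding e_def by auto
    then show ?thesis using smooth_vfield_on_restrict[OF V'(1) op] by simp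
  qed
  moreover have "e l x = full_frame g P Q x l" if "l < n + p" for l
    unfolding e_def full_frame_def dim_P using V(2) V'(2) that by auto
  moreover have "e l y \<in> P y" if "y \<in> W \<inter> W'" "l < n" for l y using that V(3) unfolding e_def by auto
  moreover have "e l y \<in> Q y" if "y \<in> W \<inter> W'" "l \<in> {n..<n+p}" for l y using that V'(3) unfolding e_def by auto
  moreover have "orthonormal_family (g y) {..<n+p} (\<lambda>l. e l y) (\<lambda>l. g x (full_frame g P Q x l) (full_frame g P Q x l))"
    if "y \<in> W \<inter> W'" for y
  proof -
    have "(\<lambda>l. g x (full_frame g P Q x l) (full_frame g P Q x l)) = (\<lambda>l. if l < n then frame_sign g P x l else frame_sign g Q x (l - n))"
      unfolding full_frame_def dim_P frame_sign_def by (rule ext) simp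
    moreover have "orthonormal_family (g y) {..<n+p} (\<lambda>l. if l < n then V l y else V' (l - n) y)
        (\<lambda>l. if l < n then frame_sign g P x l else frame_sign g Q x (l - n))"
      by (rule orthonormal_join) (use that V(3,4) V'(3,4) in auto)
    ultimately show ?thesis unfolding e_def by simp
  qed
  ultimately show ?thesis using op W W' by (intro exI[of _ "W \<inter> W'"] exI[of _ e]) auto
qed

end

section \<open>Divergences in an adapted frame\<close>

lemma bilinear_linear_products:
  fixes S :: "'i \<Rightarrow> 'j \<Rightarrow> 'c::real_vector"
  assumes c: "\<And>l. linear (c l :: 'b::real_vector \<Rightarrow> real)" and d: "\<And>m. linear (d m :: 'b \<Rightarrow> real)"
  shows "bilinear (\<lambda>u v. \<Sum>l\<in>I. \<Sum>m\<in>J. (c l u * d m v) *\<^sub>R S l m)"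
  by (rule bilinearI)
    (simp_all add: linear_add[OF c] linear_add[OF d] linear_cmul[OF c] linear_cmul[OF d]
      distrib_left distrib_right scaleR_add_left sum.distrib scaleR_sum_right mult.assoc mult.left_commute)

locale adapted_frame = split_metric A g P Q n p
  for A :: "('a::topological_space, 'e::euclidean_space) chart set" and g P Q n p +
  fixes x :: 'a and W :: "'a set" and e :: "nat \<Rightarrow> ('a, 'e) vfield"
  assumes W: "open W" "x \<in> W"
    and smooth_e: "\<And>l. l < n + p \<Longrightarrow> smooth_vfield_on A W (e l)"
    and e_x: "\<And>l. l < n + p \<Longrightarrow> e l x = full_frame g P Q x l"
    and e_P: "\<And>y l. y \<in> W \<Longrightarrow> l < n \<Longrightarrow> e l y \<in> P y"
    and e_Q: "\<And>y l. y \<in> W \<Longrightarrow> l \<in> {n..<n+p} \<Longrightarrow> e l y \<in> Q y"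
    and e_orthonormal: "\<And>y. y \<in> W \<Longrightarrow> orthonormal_family (g y) {..<n+p} (\<lambda>l. e l y)
      (\<lambda>l. g x (full_frame g P Q x l) (full_frame g P Q x l))"
begin

interpretation swapped: split_metric A g Q P p n by (rule swap)

definition \<sigma> :: "nat \<Rightarrow> real" where
  "\<sigma> l = g x (full_frame g P Q x l) (full_frame g P Q x l)"

definition H :: "nat \<Rightarrow> nat \<Rightarrow> 'a \<Rightarrow> 'e" where
  "H a b y = second_ff A P Q g y (e a y) (e b y)"

definition hh :: "nat \<Rightarrow> nat \<Rightarrow> nat \<Rightarrow> real" where
  "hh i a b = g x (second_ff A P Q g x (e a x) (e b x)) (e i x)"

definition tt :: "nat \<Rightarrow> nat \<Rightarrow> nat \<Rightarrow> real" where
  "tt i a b = g x (integrability A P Q x (e a x) (e b x)) (e i x)"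

text \<open>The coefficients of the connection induced on \<open>P\<close>, in directions of
  \<open>Q\<close>. They depend on the first derivatives of the frame and are no tensor, so they
  have to disappear from every final formula.\<close>

definition \<omega> :: "nat \<Rightarrow> nat \<Rightarrow> nat \<Rightarrow> real" where
  "\<omega> i a c = g x (nabla A g x (e i x) (e a)) (e c x)"

lemma on: "y \<in> W \<Longrightarrow> orthonormal_family (g y) {..<n+p} (\<lambda>l. e l y) \<sigma>"
  using e_orthonormal unfolding \<sigma>_def[abs_def] .

lemma on_P: "y \<in> W \<Longrightarrow> orthonormal_family (g y) {..<n} (\<lambda>l. e l y) \<sigma>"
  by (rule orthonormal_family_subset[OF on]) auto

lemma expansion: "y \<in> W \<Longrightarrow> v = (\<Sum>l<n+p. (\<sigma> l * g y v (e l y)) *\<^sub>R e l y)"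
  by (rule orthonormal_expansion[OF bil _ on subspace_UNIV]) (simp_all add: dim_sum)

lemma expansion_P: "y \<in> W \<Longrightarrow> component P Q y v = (\<Sum>l<n. (\<sigma> l * g y v (e l y)) *\<^sub>R e l y)"
  by (rule component_expansion(1)[OF on]) (simp_all add: e_P e_Q)

lemma expansion_Q:
  assumes y: "y \<in> W" and v: "v \<in> Q y"
  shows "v = (\<Sum>l\<in>{n..<n+p}. (\<sigma> l * g y v (e l y)) *\<^sub>R e l y)"
proof -
  have "v - component P Q y v = (\<Sum>l\<in>{n..<n+p}. (\<sigma> l * g y v (e l y)) *\<^sub>R e l y)"
    by (rule component_expansion(2)[OF on[OF y]]) (simp_all add: e_P e_Q y)
  then show ?thesis using component_Q[OF v] by simp
qed

lemma section_e_P: "y \<in> W \<Longrightarrow> a < n \<Longrightarrow> local_section A P y (e a y) (e a)"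
  by (rule local_sectionI[of _ W]) (simp_all add: smooth_e e_P)

lemma section_e_Q: "y \<in> W \<Longrightarrow> i \<in> {n..<n+p} \<Longrightarrow> local_section A Q y (e i y) (e i)"
  by (rule local_sectionI[of _ W]) (simp_all add: smooth_e e_Q)

lemma section_e: "l < n + p \<Longrightarrow> local_section A (\<lambda>_. UNIV) x (e l x) (e l)"
  by (rule local_sectionI[OF W(2) smooth_e]) simp_all

text \<open>\<open>second_ff\<close> is given pointwise by \<open>THE\<close>, which says nothing
  about neighbouring points. The formula with brackets, \<open>second_ff_lie\<close>, expresses the
  coefficient by operations known to preserve smoothness.\<close>

lemma smooth_second_ff_coefficient:
  assumes ab: "a < n" "b < n" and i: "i \<in> {n..<n+p}"
  shows "smooth_fun_on A W (\<lambda>y. g y (H a b y) (e i y))"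
proof (rule smooth_fun_on_cong)
  have e: "smooth_vfield_on A W (e a)" "smooth_vfield_on A W (e b)" "smooth_vfield_on A W (e i)"
    using ab i by (simp_all add: smooth_e)
  show "smooth_fun_on A W (\<lambda>y. - (1/2) * (dir_deriv A y (e i y) (\<lambda>y. g y (e a y) (e b y))
    + g y (e b y) (lie_bracket A (e a) (e i) y) + g y (e a y) (lie_bracket A (e b) (e i) y)))"
    by (intro smooth_fun.mult smooth_fun.add smooth_fun.const W smooth_fun_on_dir_deriv
      smooth_fun_on_metric metric smooth_vfield_on_lie_bracket e)
  show "- (1/2) * (dir_deriv A y (e i y) (\<lambda>y. g y (e a y) (e b y))
    + g y (e b y) (lie_bracket A (e a) (e i) y) + g y (e a y) (lie_bracket A (e b) (e i) y)) =
    g y (H a b y) (e i y)" if y: "y \<in> W" for y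
    unfolding H_def using second_ff_lie[OF section_e_P[OF y ab(1)] section_e_P[OF y ab(2)] section_e_Q[OF y i]] by simp
qed

text \<open>Indices beyond \<open>n\<close> are included because \<open>nabla_tensor12\<close> tests
  with sections of the whole tangent bundle, whose expansion also involves frame fields of
  \<open>Q\<close>; there \<open>H\<close> is zero by the extension convention.\<close>

lemma smooth_H:
  assumes ab: "a < n + p" "b < n + p"
  shows "smooth_vfield_on A W (H a b)"
proof (cases "a < n \<and> b < n")
  case True
  show ?thesis
  proof (rule smooth_vfield_on_cong)
    show "smooth_vfield_on A W (\<lambda>y. \<Sum>i\<in>{n..<n+p}. (\<sigma> i * g y (H a b y) (e i y)) *\<^sub>R e i y)"
      using True by (intro smooth_vfield_on_sum W smooth_vfield_on_scaleR smooth_fun.mult smooth_fun.const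
        smooth_second_ff_coefficient smooth_e) auto
    show "(\<Sum>i\<in>{n..<n+p}. (\<sigma> i * g y (H a b y) (e i y)) *\<^sub>R e i y) = H a b y" if "y \<in> W" for y
      using expansion_Q[OF that second_ff_in_Q] unfolding H_def by simp
  qed
next
  case False
  show ?thesis
  proof (rule smooth_vfield_on_cong[OF smooth_vfield_on_zero[OF W(1)]])
    fix y assume y: "y \<in> W"
    then have "component P Q y (e a y) = 0 \<or> component P Q y (e b y) = 0"
      using False ab component_Q[OF e_Q[OF y]] by auto
    moreover have "H a b y = second_ff A P Q g y (component P Q y (e a y)) (component P Q y (e b y))"
      unfolding H_def second_ff_component ..
    ultimately show "0 = H a b y"
      using bilinear_lzero[OF bilinear_second_ff] bilinear_rzero[OF bilinear_second_ff] by metis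
  qed
qed

text \<open>The Leibniz expression inside \<open>nabla_tensor12\<close> with the sections left as
  arguments, before it is known to depend only on their values at \<open>x\<close>.\<close>

definition nabla_h :: "'e \<Rightarrow> ('a, 'e) vfield \<Rightarrow> ('a, 'e) vfield \<Rightarrow> 'e" where
  "nabla_h z X Y = nabla A g x z (\<lambda>y. second_ff A P Q g y (X y) (Y y))
    - second_ff A P Q g x (nabla A g x z X) (Y x) - second_ff A P Q g x (X x) (nabla A g x z Y)"

text \<open>Tensoriality of the covariant derivative of \<open>h\<close>: the right-hand side
  contains only the values \<open>u\<close> and \<open>v\<close>, hence any two choices of sections
  give the same result.\<close>

lemma nabla_h_expand:
  assumes X: "local_section A (\<lambda>_. UNIV) x u X" and Y: "local_section A (\<lambda>_. UNIV) x v Y"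
  shows "nabla_h z X Y = (\<Sum>l<n+p. \<Sum>m<n+p. ((\<sigma> l * g x u (e l x)) * (\<sigma> m * g x v (e m x))) *\<^sub>R nabla_h z (e l) (e m))"
proof -
  define f where "f l y = \<sigma> l * g y (X y) (e l y)" for l y
  define k where "k m y = \<sigma> m * g y (Y y) (e m y)" for m y
  obtain W1 where W1: "open W1" "x \<in> W1" "W1 \<subseteq> W" "smooth_vfield_on A W1 X"
    using X W by (rule local_section_restrict)
  obtain U where U: "open U" "x \<in> U" "U \<subseteq> W1" "smooth_vfield_on A U Y"
    using Y W1(1,2) by (rule local_section_restrict)
  have XU: "smooth_vfield_on A U X" by (rule smooth_vfield_on_restrict[OF W1(4) U(1,3)])
  have eU: "smooth_vfield_on A U (e l)" if "l < n + p" for l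
    by (rule smooth_vfield_on_restrict[OF smooth_e[OF that] U(1)]) (use U W1 in auto)
  have HU: "smooth_vfield_on A U (H l m)" if "l < n + p" "m < n + p" for l m
    by (rule smooth_vfield_on_restrict[OF smooth_H[OF that] U(1)]) (use U W1 in auto)
  have df: "fun_differentiable_at A x (f l)" "fun_differentiable_at A x (k l)" if "l < n + p" for l
  proof -
    have "smooth_fun_on A U (f l)" "smooth_fun_on A U (k l)" unfolding f_def k_def
      by (intro smooth_fun.mult smooth_fun.const U smooth_fun_on_metric metric XU eU that)+
    then show "fun_differentiable_at A x (f l)" "fun_differentiable_at A x (k l)"
      using U(2) by (auto intro: fun_differentiable_smooth)
  qed
  have de: "vfield_differentiable_at A x (e l)" if "l < n + p" for l
    by (rule vfield_differentiable_smooth[OF eU[OF that] U(2)])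
  have dH: "vfield_differentiable_at A x (H l m)" if "l < n + p" "m < n + p" for l m
    by (rule vfield_differentiable_smooth[OF HU[OF that] U(2)])
  have UW: "y \<in> W" if "y \<in> U" for y using that U W1 by blast
  have Xe: "X y = (\<Sum>l<n+p. f l y *\<^sub>R e l y)" if "y \<in> U" for y
    unfolding f_def using expansion[OF UW[OF that], of "X y"] by simp
  have Ye: "Y y = (\<Sum>l<n+p. k l y *\<^sub>R e l y)" if "y \<in> U" for y
    unfolding k_def using expansion[OF UW[OF that], of "Y y"] by simp
  note lin = bilinear_sum_left[OF bilinear_second_ff] bilinear_lmul[OF bilinear_second_ff]
    bilinear_ladd[OF bilinear_second_ff]
  note lin' = bilinear_sum_right[OF bilinear_second_ff] bilinear_rmul[OF bilinear_second_ff]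
    bilinear_radd[OF bilinear_second_ff]
  have hXY: "second_ff A P Q g y (X y) (Y y) = (\<Sum>l<n+p. \<Sum>m<n+p. (f l y * k m y) *\<^sub>R H l m y)" if "y \<in> U" for y
    unfolding Xe[OF that] Ye[OF that] lin H_def by (simp add: lin' scaleR_sum_right)
  have nX: "nabla A g x z X = (\<Sum>l<n+p. dir_deriv A x z (f l) *\<^sub>R e l x + f l x *\<^sub>R nabla A g x z (e l))"
  proof -
    have "nabla A g x z X = nabla A g x z (\<lambda>y. \<Sum>l<n+p. f l y *\<^sub>R e l y)"
      by (rule nabla_cong[OF U(1,2) Xe])
    also have "\<dots> = (\<Sum>l<n+p. nabla A g x z (\<lambda>y. f l y *\<^sub>R e l y))"
      by (rule nabla_sum) (simp add: nabla_scaleR df de)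
    finally show ?thesis by (simp add: nabla_scaleR df de)
  qed
  have nY: "nabla A g x z Y = (\<Sum>m<n+p. dir_deriv A x z (k m) *\<^sub>R e m x + k m x *\<^sub>R nabla A g x z (e m))"
  proof -
    have "nabla A g x z Y = nabla A g x z (\<lambda>y. \<Sum>l<n+p. k l y *\<^sub>R e l y)"
      by (rule nabla_cong[OF U(1,2) Ye])
    also have "\<dots> = (\<Sum>l<n+p. nabla A g x z (\<lambda>y. k l y *\<^sub>R e l y))"
      by (rule nabla_sum) (simp add: nabla_scaleR df de)
    finally show ?thesis by (simp add: nabla_scaleR df de)
  qed
  have dfk: "fun_differentiable_at A x (\<lambda>y. f l y * k m y)" if "l < n + p" "m < n + p" for l m
    using that by (intro dir_deriv_mult df)
  have "nabla A g x z (\<lambda>y. second_ff A P Q g y (X y) (Y y)) = nabla A g x z (\<lambda>y. \<Sum>l<n+p. \<Sum>m<n+p. (f l y * k m y) *\<^sub>R H l m y)"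
    by (rule nabla_cong[OF U(1,2) hXY])
  also have "\<dots> = (\<Sum>l<n+p. nabla A g x z (\<lambda>y. \<Sum>m<n+p. (f l y * k m y) *\<^sub>R H l m y))"
    by (rule nabla_sum(1)) (auto intro!: nabla_sum nabla_scaleR dfk dH)
  also have "\<dots> = (\<Sum>l<n+p. \<Sum>m<n+p. nabla A g x z (\<lambda>y. (f l y * k m y) *\<^sub>R H l m y))"
    by (rule sum.cong[OF refl], rule nabla_sum(1)) (auto intro!: nabla_scaleR dfk dH)
  also have "\<dots> = (\<Sum>l<n+p. \<Sum>m<n+p. (f l x * dir_deriv A x z (k m) + dir_deriv A x z (f l) * k m x) *\<^sub>R H l m x
      + (f l x * k m x) *\<^sub>R nabla A g x z (H l m))"
    by (intro sum.cong refl) (simp add: nabla_scaleR(1)[OF dfk dH] dir_deriv_mult df)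
  finally have n1: "nabla A g x z (\<lambda>y. second_ff A P Q g y (X y) (Y y)) = \<dots>" .
  have n2: "second_ff A P Q g x (nabla A g x z X) (Y x) = (\<Sum>l<n+p. \<Sum>m<n+p. (dir_deriv A x z (f l) * k m x) *\<^sub>R H l m x
      + (f l x * k m x) *\<^sub>R second_ff A P Q g x (nabla A g x z (e l)) (e m x))"
    unfolding nX lin Ye[OF U(2)] by (simp add: lin' scaleR_sum_right sum.distrib H_def)
  have n3: "second_ff A P Q g x (X x) (nabla A g x z Y) = (\<Sum>l<n+p. \<Sum>m<n+p. (f l x * dir_deriv A x z (k m)) *\<^sub>R H l m x
      + (f l x * k m x) *\<^sub>R second_ff A P Q g x (e l x) (nabla A g x z (e m)))"
    unfolding nY Xe[OF U(2)] lin by (simp add: lin' scaleR_sum_right sum.distrib H_def scaleR_add_right)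
  \<comment> \<open>The derivatives of the coefficient functions in \<open>n1\<close> are exactly
    those subtracted in \<open>n2\<close> and \<open>n3\<close>.\<close>
  have "nabla_h z X Y = (\<Sum>l<n+p. \<Sum>m<n+p. (f l x * k m x) *\<^sub>R nabla_h z (e l) (e m))"
    unfolding nabla_h_def n1 n2 n3 sum_subtractf[symmetric] H_def[abs_def]
    by (intro sum.cong refl) (simp add: scaleR_add_left scaleR_add_right scaleR_diff_right algebra_simps)
  moreover have "X x = u" "Y x = v" using X Y by (auto elim: local_sectionE)
  ultimately show ?thesis unfolding f_def k_def by simp
qed

lemma nabla_tensor12_eq:
  assumes X: "local_section A (\<lambda>_. UNIV) x u X" and Y: "local_section A (\<lambda>_. UNIV) x v Y"
  shows "nabla_tensor12 A g (second_ff A P Q g) x z u v = nabla_h z X Y"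
proof -
  have val: "X x = u" if "local_section A (\<lambda>_. UNIV) x u X" for u X
    using that by (rule local_sectionE)
  have uniq: "nabla_h z X Y = nabla A g x z (\<lambda>y. second_ff A P Q g y (X' y) (Y' y))
    - second_ff A P Q g x (nabla A g x z X') v - second_ff A P Q g x u (nabla A g x z Y')"
    if "local_section A (\<lambda>_. UNIV) x u X'" "local_section A (\<lambda>_. UNIV) x v Y'" for X' Y'
  proof -
    have "nabla_h z X Y = nabla_h z X' Y'"
      by (simp only: nabla_h_expand[OF that] nabla_h_expand[OF X Y])
    then show ?thesis unfolding nabla_h_def[of z X'] val[OF that(1)] val[OF that(2)] .
  qed
  show ?thesis
    unfolding nabla_tensor12_def
  proof (rule the_equality)
    fix w
    assume w: "\<forall>X Y. local_section A (\<lambda>_. UNIV) x u X \<longrightarrow> local_section A (\<lambda>_. UNIV) x v Y \<longrightarrow>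
      w = nabla A g x z (\<lambda>y. second_ff A P Q g y (X y) (Y y))
        - second_ff A P Q g x (nabla A g x z X) v - second_ff A P Q g x u (nabla A g x z Y)"
    show "w = nabla_h z X Y" unfolding uniq[OF X Y] using w X Y by (elim allE impE)
  qed (intro allI impI uniq)
qed

lemma section_UNIV: "\<exists>X. local_section A (\<lambda>_. UNIV) x u X"
proof -
  obtain X where "smooth_vfield_on A (fst (chart_at A x)) X" "X x = u" using coordinate_field by metis
  then have "local_section A (\<lambda>_. UNIV) x u X" by (intro local_sectionI[OF chart_at_A(2)]) simp_all
  then show ?thesis by blast
qed

lemma nabla_tensor12_expand:
  "nabla_tensor12 A g (second_ff A P Q g) x z u v =
    (\<Sum>l<n+p. \<Sum>m<n+p. ((\<sigma> l * g x u (e l x)) * (\<sigma> m * g x v (e m x))) *\<^sub>R nabla_h z (e l) (e m))"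
proof -
  obtain X where X: "local_section A (\<lambda>_. UNIV) x u X" using section_UNIV by (rule exE)
  obtain Y where Y: "local_section A (\<lambda>_. UNIV) x v Y" using section_UNIV by (rule exE)
  show ?thesis unfolding nabla_tensor12_eq[OF X Y] by (rule nabla_h_expand[OF X Y])
qed

lemma nabla_tensor12_frame:
  "a < n + p \<Longrightarrow> b < n + p \<Longrightarrow>
    nabla_tensor12 A g (second_ff A P Q g) x z (e a x) (e b x) = nabla_h z (e a) (e b)"
  by (rule nabla_tensor12_eq) (rule section_e, assumption)+

lemma bilinear_div_h: "bilinear (div_h A P Q g x)"
proof -
  have lin: "linear (\<lambda>u. \<sigma> l * g x (component P Q x u) (e l x))" for l
    by (rule linearI) (simp_all add: linear_add[OF linear_component] linear_cmul[OF linear_component]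
      bilinear_ladd[OF bil] bilinear_lmul[OF bil] distrib_left mult.left_commute)
  have N: "bilinear (\<lambda>u v. nabla_tensor12 A g (second_ff A P Q g) x z (component P Q x u) (component P Q x v))" for z
    unfolding nabla_tensor12_expand by (rule bilinear_linear_products[OF lin lin])
  have lin_g: "linear (\<lambda>v. r * g x v w)" for r w
    by (rule linearI) (simp_all add: bilinear_ladd[OF bil] bilinear_lmul[OF bil] distrib_left mult.left_commute)
  show ?thesis
    unfolding div_h_def Let_def bilinear_def
    using N unfolding bilinear_def
    by (auto intro!: linear_compose_sum linear_compose[OF _ lin_g, unfolded o_def])
qed

lemma divergence_eq: "divergence A P Q g X x = (\<Sum>l<n+p. \<sigma> l * g x (nabla A g x (e l x) X) (e l x))"
  unfolding divergence_def Let_def dim_P dim_Q \<sigma>_def by (intro sum.cong refl) (simp add: e_x)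

lemma divergence_cong:
  assumes "\<And>y. y \<in> W \<Longrightarrow> X y = Y y"
  shows "divergence A P Q g X x = divergence A P Q g Y x"
  unfolding divergence_eq using nabla_cong[OF W assms] by simp

lemma divergence_sum:
  assumes "\<And>i. i \<in> I \<Longrightarrow> vfield_differentiable_at A x (X i)"
  shows "divergence A P Q g (\<lambda>y. \<Sum>i\<in>I. X i y) x = (\<Sum>i\<in>I. divergence A P Q g (X i) x)"
proof -
  have "nabla A g x z (\<lambda>y. \<Sum>i\<in>I. X i y) = (\<Sum>i\<in>I. nabla A g x z (X i))" for z
    using assms by (rule nabla_sum(1))
  then show ?thesis
    unfolding divergence_eq by (simp add: bilinear_sum_left[OF bil] sum_distrib_left) (rule sum.swap)
qed

lemma divergence_scaleR:
  assumes "fun_differentiable_at A x f" "vfield_differentiable_at A x X"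
  shows "divergence A P Q g (\<lambda>y. f y *\<^sub>R X y) x = dir_deriv A x (X x) f + f x * divergence A P Q g X x"
proof -
  have "dir_deriv A x (X x) f = dir_deriv A x (\<Sum>l<n+p. (\<sigma> l * g x (X x) (e l x)) *\<^sub>R e l x) f"
    using expansion[OF W(2), of "X x"] by simp
  also have "\<dots> = (\<Sum>l<n+p. (\<sigma> l * g x (X x) (e l x)) * dir_deriv A x (e l x) f)"
    by (simp add: linear_sum[OF linear_dir_deriv[OF assms(1)]] linear_cmul[OF linear_dir_deriv[OF assms(1)]])
  finally show ?thesis
    unfolding divergence_eq nabla_scaleR(1)[OF assms]
    by (simp add: bilinear_ladd[OF bil] bilinear_lmul[OF bil] algebra_simps sum.distrib sum_distrib_left)
qed

lemma sum_split: "(\<Sum>l<n+p. f l) = (\<Sum>l<n. f l) + (\<Sum>i\<in>{n..<n+p}. f i)" for f :: "nat \<Rightarrow> 'z::comm_monoid_add"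
proof -
  have "{..<n+p} = {..<n} \<union> {n..<n+p}" by auto
  then show ?thesis by (simp add: sum.union_disjoint ivl_disj_int)
qed

lemma sum_Q: "(\<Sum>i<p. f (n + i)) = (\<Sum>i\<in>{n..<n+p}. f i)" for f :: "nat \<Rightarrow> 'z::comm_monoid_add"
  by (rule sum.reindex_bij_witness[of _ "\<lambda>i. i - n" "\<lambda>i. n + i"]) auto

text \<open>As \<open>h\<close> is extended by zero, only the \<open>P\<close>-component of a
  covariant derivative inserted into it matters. In the frame this component has the coefficients
  \<open>\<omega>\<close>.\<close>

lemma second_ff_frame:
  assumes "z = (\<Sum>c<n. r c *\<^sub>R e c x)" "component P Q x u = z"
  shows "g x (second_ff A P Q g x u (e b x)) (e i x) = (\<Sum>c<n. r c * hh i c b)"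
proof -
  have "second_ff A P Q g x u (e b x) = second_ff A P Q g x z (e b x)"
    using second_ff_component[of x u "e b x"] second_ff_component[of x z "e b x"] component_component assms(2) by metis
  then show ?thesis
    unfolding assms(1) hh_def
    by (simp add: bilinear_sum_left[OF bilinear_second_ff] bilinear_lmul[OF bilinear_second_ff]
      bilinear_sum_left[OF bil] bilinear_lmul[OF bil])
qed

lemma hh_sym: "hh i a b = hh i b a"
  unfolding hh_def by (metis second_ff_sym)

text \<open>\<open>h\<close> has values in \<open>Q\<close>. In the contraction over
  \<open>l\<close> the two correction terms of the covariant derivative therefore vanish for
  directions in \<open>P\<close> and leave the terms in \<open>\<omega>\<close> for directions in
  \<open>Q\<close>, while the leading terms sum up to the divergence of the vector field
  \<open>H a b\<close>.\<close>

lemma div_h_frame: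
  assumes ab: "a < n" "b < n"
  shows "div_h A P Q g x (e a x) (e b x) = divergence A P Q g (H a b) x
    - (\<Sum>i\<in>{n..<n+p}. \<sigma> i * (\<Sum>c<n. \<sigma> c * (\<omega> i a c * hh i c b + \<omega> i b c * hh i a c)))"
proof -
  have e: "component P Q x (e l x) = e l x" if "l < n" for l using component_P[OF e_P[OF W(2) that]] .
  have tm: "g x (nabla_h (e i x) (e a) (e b)) (e i x) = g x (nabla A g x (e i x) (H a b)) (e i x)
      - (\<Sum>c<n. \<sigma> c * (\<omega> i a c * hh i c b + \<omega> i b c * hh i a c))" if "i \<in> {n..<n+p}" for i
  proof -
    have "g x (second_ff A P Q g x (nabla A g x (e i x) (e a)) (e b x)) (e i x) = (\<Sum>c<n. (\<sigma> c * \<omega> i a c) * hh i c b)"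
      unfolding \<omega>_def by (rule second_ff_frame[OF expansion_P[OF W(2)] refl])
    moreover have "g x (second_ff A P Q g x (nabla A g x (e i x) (e b)) (e a x)) (e i x) = (\<Sum>c<n. (\<sigma> c * \<omega> i b c) * hh i c a)"
      unfolding \<omega>_def by (rule second_ff_frame[OF expansion_P[OF W(2)] refl])
    ultimately show ?thesis
      unfolding nabla_h_def H_def[abs_def] bilinear_lsub[OF bil]
      using second_ff_sym[of x "e a x" "nabla A g x (e i x) (e b)"] hh_sym[of i a]
      by (simp add: sum.distrib algebra_simps)
  qed
  have zero: "g x (nabla_h (e l x) (e a) (e b)) (e l x) = g x (nabla A g x (e l x) (H a b)) (e l x)" if "l < n" for l
    unfolding nabla_h_def H_def[abs_def] bilinear_lsub[OF bil]
    using orth'[OF second_ff_in_Q e_P[OF W(2) that]] by simp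
  have "div_h A P Q g x (e a x) (e b x) = (\<Sum>l<n+p. \<sigma> l * g x (nabla_h (e l x) (e a) (e b)) (e l x))"
    unfolding div_h_def Let_def dim_P dim_Q e[OF ab(1)] e[OF ab(2)]
    using ab by (intro sum.cong refl) (simp add: nabla_tensor12_frame e_x[symmetric] \<sigma>_def)
  also have "\<dots> = (\<Sum>l<n+p. \<sigma> l * g x (nabla A g x (e l x) (H a b)) (e l x))
    - (\<Sum>i\<in>{n..<n+p}. \<sigma> i * (\<Sum>c<n. \<sigma> c * (\<omega> i a c * hh i c b + \<omega> i b c * hh i a c)))"
    unfolding sum_split by (simp add: zero tm sum_subtractf right_diff_distrib)
  finally show ?thesis unfolding divergence_eq .
qed

lemma cal_K_frame:
  assumes ab: "a < n" "b < n"
  shows "g x (cal_K A P Q g x (e a x)) (e b x) =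
    (\<Sum>i\<in>{n..<n+p}. \<sigma> i * (\<Sum>c<n. \<sigma> c * (hh i a c * tt i c b - tt i a c * hh i c b)))"
proof -
  have fr: "frame g Q x i = e (n + i) x" "frame_sign g Q x i = \<sigma> (n + i)" if "i < p" for i
    using that e_x[of "n + i"] unfolding \<sigma>_def frame_sign_def full_frame_def dim_P by auto
  note wc = weingarten_compose[OF bilinear_integrability bilinear_second_ff e_P[OF W(2) ab(2)] on_P[OF W(2)]]
    weingarten_compose[OF bilinear_second_ff bilinear_integrability e_P[OF W(2) ab(2)] on_P[OF W(2)]]
  have "g x (cal_K A P Q g x (e a x)) (e b x) = (\<Sum>i<p. \<sigma> (n + i) *
      (\<Sum>c<n. \<sigma> c * (hh (n + i) a c * tt (n + i) c b - tt (n + i) a c * hh (n + i) c b)))"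
    unfolding cal_K_def Let_def dim_Q bilinear_sum_left[OF bil] bilinear_lmul[OF bil] bilinear_lsub[OF bil]
    by (intro sum.cong refl)
      (simp add: fr wc e_P W hh_def tt_def sum_subtractf right_diff_distrib)
  then show ?thesis unfolding sum_Q[symmetric] .
qed

lemma cal_T_frame:
  assumes ab: "a < n" "b < n"
  shows "g x (cal_T A P Q g x (e a x)) (e b x) =
    (\<Sum>i\<in>{n..<n+p}. \<sigma> i * (\<Sum>c<n. \<sigma> c * (tt i a c * tt i c b)))"
proof -
  have fr: "frame g Q x i = e (n + i) x" "frame_sign g Q x i = \<sigma> (n + i)" if "i < p" for i
    using that e_x[of "n + i"] unfolding \<sigma>_def frame_sign_def full_frame_def dim_P by auto
  note wc = weingarten_compose[OF bilinear_integrability bilinear_integrability e_P[OF W(2) ab(2)] on_P[OF W(2)]]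
  have "g x (cal_T A P Q g x (e a x)) (e b x) = (\<Sum>i<p. \<sigma> (n + i) *
      (\<Sum>c<n. \<sigma> c * (tt (n + i) a c * tt (n + i) c b)))"
    unfolding cal_T_def Let_def dim_Q bilinear_sum_left[OF bil] bilinear_lmul[OF bil]
    by (intro sum.cong refl) (simp add: fr wc e_P W tt_def)
  then show ?thesis unfolding sum_Q[symmetric] .
qed

lemma linear_cal_K: "linear (cal_K A P Q g x)"
proof -
  note lin = linear_weingarten[where K = "integrability A P Q", OF bilinear_integrability]
    linear_weingarten[where K = "second_ff A P Q g", OF bilinear_second_ff]
  show ?thesis unfolding cal_K_def[abs_def] Let_def
    by (rule linearI) (simp_all add: linear_add[OF lin(1)] linear_add[OF lin(2)] linear_cmul[OF lin(1)] linear_cmul[OF lin(2)]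
      algebra_simps sum.distrib scaleR_sum_right sum_subtractf)
qed

lemma linear_cal_T: "linear (cal_T A P Q g x)"
proof -
  note lin = linear_weingarten[where K = "integrability A P Q", OF bilinear_integrability]
  show ?thesis unfolding cal_T_def[abs_def] Let_def
    by (rule linearI) (simp_all add: linear_add[OF lin] linear_cmul[OF lin] algebra_simps sum.distrib scaleR_sum_right)
qed

lemma bilinear_flat: "linear (F x) \<Longrightarrow> bilinear (flat g F x)"
  unfolding flat_def by (rule bilinearI)
    (simp_all add: linear_add linear_cmul bilinear_ladd[OF bil] bilinear_radd[OF bil] bilinear_lmul[OF bil] bilinear_rmul[OF bil])

end

lemma sum3_rotate:
  "(\<Sum>a\<in>I. \<Sum>b\<in>I. \<Sum>c\<in>I. F a b c) = (\<Sum>a\<in>I. \<Sum>b\<in>I. \<Sum>c\<in>I. F c a b)" for F :: "'i \<Rightarrow> 'i \<Rightarrow> 'i \<Rightarrow> 'z::comm_monoid_add"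
proof -
  have "(\<Sum>a\<in>I. \<Sum>b\<in>I. \<Sum>c\<in>I. F c a b) = (\<Sum>a\<in>I. \<Sum>c\<in>I. \<Sum>b\<in>I. F c a b)"
    by (rule sum.cong[OF refl]) (rule sum.swap)
  also have "\<dots> = (\<Sum>c\<in>I. \<Sum>a\<in>I. \<Sum>b\<in>I. F c a b)" by (rule sum.swap)
  finally show ?thesis by simp
qed

lemma sum_pull_out:
  "(\<Sum>a\<in>I. \<Sum>b\<in>J. \<Sum>i\<in>K. F a b i) = (\<Sum>i\<in>K. \<Sum>a\<in>I. \<Sum>b\<in>J. F a b i)"
proof -
  have "(\<Sum>a\<in>I. \<Sum>b\<in>J. \<Sum>i\<in>K. F a b i) = (\<Sum>a\<in>I. \<Sum>i\<in>K. \<Sum>b\<in>J. F a b i)"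
    by (rule sum.cong[OF refl]) (rule sum.swap)
  also have "\<dots> = (\<Sum>i\<in>K. \<Sum>a\<in>I. \<Sum>b\<in>J. F a b i)" by (rule sum.swap)
  finally show ?thesis .
qed

lemma sum3_swap:
  "(\<Sum>a\<in>I. \<Sum>b\<in>I. \<Sum>c\<in>I. F a b c) = (\<Sum>a\<in>I. \<Sum>b\<in>I. \<Sum>c\<in>I. F b a c)" for F :: "'i \<Rightarrow> 'i \<Rightarrow> 'i \<Rightarrow> 'z::comm_monoid_add"
  by (rule sum.swap)

text \<open>With \<open>q Z = \<Sum> \<sigma>\<^sub>a \<sigma>\<^sub>b \<sigma>\<^sub>c h\<^sub>a\<^sub>b s\<^sub>b\<^sub>c Z\<^sub>a\<^sub>c\<close>, both sides are \<open>2 q t + 2 q \<omega> - \<Sum> \<sigma>\<^sub>a \<sigma>\<^sub>b h\<^sub>a\<^sub>b \<beta>\<^sub>a\<^sub>b\<close>.\<close>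

lemma contraction_identity:
  fixes \<sigma> :: "nat \<Rightarrow> real" and h t \<omega> s \<beta> k :: "nat \<Rightarrow> nat \<Rightarrow> real"
  assumes h: "\<And>a b. h a b = h b a" and s: "\<And>a b. s a b = s b a"
    and t: "\<And>a b. t a b = - t b a" and \<omega>: "\<And>a b. a < n \<Longrightarrow> b < n \<Longrightarrow> \<omega> a b = - \<omega> b a"
    and k: "\<And>a b. a < n \<Longrightarrow> b < n \<Longrightarrow> k a b = - (1/2) * (\<beta> a b - (\<Sum>c<n. \<sigma> c * (s b c * (h a c + t a c + \<omega> a c)))
      - (\<Sum>c<n. \<sigma> c * (s a c * (h b c + t b c + \<omega> b c))))"
  shows "(\<Sum>a<n. \<Sum>b<n. \<sigma> a * \<sigma> b * (2 * (h a b * k a b)))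
      - (\<Sum>a<n. \<Sum>b<n. \<Sum>c<n. \<sigma> a * \<sigma> b * \<sigma> c * (s b c * h a b * h a c))
      - (\<Sum>a<n. \<Sum>b<n. \<Sum>c<n. \<sigma> a * \<sigma> b * \<sigma> c * (s a c * h a b * h c b)) =
    (\<Sum>a<n. \<Sum>b<n. \<sigma> a * \<sigma> b * (s a b * ((\<Sum>c<n. \<sigma> c * (h a c * t c b - t a c * h c b))
      - (\<Sum>c<n. \<sigma> c * (\<omega> a c * h c b + \<omega> b c * h a c)))))
    - (\<Sum>a<n. \<Sum>b<n. \<sigma> a * \<sigma> b * (h a b * \<beta> a b))"
proof -
  define w where "w a b c = \<sigma> a * \<sigma> b * \<sigma> c" for a b c
  define q where "q Z = (\<Sum>a<n. \<Sum>b<n. \<Sum>c<n. w a b c * (h a b * s b c * Z a c))" for Z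
  have w: "w b a c = w a b c" "w c a b = w a b c" "w a c b = w a b c" "w b c a = w a b c" "w c b a = w a b c" for a b c
    unfolding w_def by simp_all
  have q_alt: "(\<Sum>a<n. \<Sum>b<n. \<Sum>c<n. w a b c * (h a b * s a c * Z b c)) = q Z" for Z
    unfolding q_def by (subst sum3_swap) (intro sum.cong refl, metis w(1) h)
  have "(\<Sum>a<n. \<Sum>b<n. \<sigma> a * \<sigma> b * (2 * (h a b * k a b))) =
    (\<Sum>a<n. \<Sum>b<n. (\<Sum>c<n. w a b c * (h a b * s b c * (h a c + t a c + \<omega> a c)))
      + (\<Sum>c<n. w a b c * (h a b * s a c * (h b c + t b c + \<omega> b c))) - \<sigma> a * \<sigma> b * (h a b * \<beta> a b))"
  proof (intro sum.cong refl)
    fix a b assume ab: "a \<in> {..<n}" "b \<in> {..<n}"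
    define u where "u = (\<Sum>c<n. \<sigma> c * (s b c * (h a c + t a c + \<omega> a c)))"
    define v where "v = (\<Sum>c<n. \<sigma> c * (s a c * (h b c + t b c + \<omega> b c)))"
    have u: "(\<Sum>c<n. w a b c * (h a b * s b c * (h a c + t a c + \<omega> a c))) = \<sigma> a * \<sigma> b * h a b * u"
      unfolding u_def sum_distrib_left w_def by (intro sum.cong refl) (simp only: mult_ac)
    have v: "(\<Sum>c<n. w a b c * (h a b * s a c * (h b c + t b c + \<omega> b c))) = \<sigma> a * \<sigma> b * h a b * v"
      unfolding v_def sum_distrib_left w_def by (intro sum.cong refl) (simp only: mult_ac)
    have keq: "k a b = - (1/2) * (\<beta> a b - u - v)" unfolding u_def v_def using ab k by simp
    show "\<sigma> a * \<sigma> b * (2 * (h a b * k a b)) = (\<Sum>c<n. w a b c * (h a b * s b c * (h a c + t a c + \<omega> a c)))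
      + (\<Sum>c<n. w a b c * (h a b * s a c * (h b c + t b c + \<omega> b c))) - \<sigma> a * \<sigma> b * (h a b * \<beta> a b)"
      unfolding u v keq by (simp add: field_simps)
  qed
  also have "\<dots> = q (\<lambda>a c. h a c + t a c + \<omega> a c) + q (\<lambda>a c. h a c + t a c + \<omega> a c)
      - (\<Sum>a<n. \<Sum>b<n. \<sigma> a * \<sigma> b * (h a b * \<beta> a b))"
    unfolding sum.distrib sum_subtractf q_alt[of "\<lambda>a c. h a c + t a c + \<omega> a c"] q_def ..
  also have "q (\<lambda>a c. h a c + t a c + \<omega> a c) = q h + q t + q \<omega>"
    unfolding q_def by (simp add: distrib_left sum.distrib)
  finally have 1: "(\<Sum>a<n. \<Sum>b<n. \<sigma> a * \<sigma> b * (2 * (h a b * k a b))) =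
    2 * (q h + q t + q \<omega>) - (\<Sum>a<n. \<Sum>b<n. \<sigma> a * \<sigma> b * (h a b * \<beta> a b))" by simp
  \<comment> \<open>The sums in 2 and 3 will stem from the motion of the frame. Each equals
    \<open>q h\<close>; together they cancel the \<open>2 * q h\<close> in 1, which comes from the
    part \<open>h\<close> of the bracket.\<close>
  have 2: "(\<Sum>a<n. \<Sum>b<n. \<Sum>c<n. \<sigma> a * \<sigma> b * \<sigma> c * (s b c * h a b * h a c)) = q h"
    unfolding q_def w_def by (intro sum.cong refl) simp
  have 3: "(\<Sum>a<n. \<Sum>b<n. \<Sum>c<n. \<sigma> a * \<sigma> b * \<sigma> c * (s a c * h a b * h c b)) = q h"
    unfolding q_alt[symmetric] w_def by (intro sum.cong refl) (simp add: h[of _ b for b] mult_ac)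
  have 4: "(\<Sum>a<n. \<Sum>b<n. \<Sum>c<n. w a b c * (s a b * (h a c * Z c b))) = q Z" for Z
  proof -
    have "(\<Sum>a<n. \<Sum>b<n. \<Sum>c<n. w a b c * (s a b * (h a c * Z c b))) = (\<Sum>a<n. \<Sum>b<n. \<Sum>c<n. w b c a * (s b c * (h b a * Z a c)))"
      by (subst sum3_rotate, subst sum3_rotate) (rule refl)
    also have "\<dots> = q Z"
      unfolding q_def
    proof (intro sum.cong refl)
      fix a b c
      show "w b c a * (s b c * (h b a * Z a c)) = w a b c * (h a b * s b c * Z a c)"
        using w(4)[of b c a] h[of b a] by simp
    qed
    finally show ?thesis .
  qed
  \<comment> \<open>Compared with 4 the factors stand in the opposite order, and the skew symmetry
    of \<open>Z\<close> supplies a sign. Thus the two halves of the commutator add up to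
    \<open>2 * q t\<close> instead of cancelling; the two terms in \<open>\<omega>\<close> combine
    likewise.\<close>
  have 5: "(\<Sum>a<n. \<Sum>b<n. \<Sum>c<n. w a b c * (s a b * (Z a c * h c b))) = - q Z"
    if Z: "\<And>a b. a < n \<Longrightarrow> b < n \<Longrightarrow> Z a b = - Z b a" for Z
  proof -
    have "(\<Sum>a<n. \<Sum>b<n. \<Sum>c<n. w a b c * (s a b * (Z a c * h c b))) = (\<Sum>a<n. \<Sum>b<n. \<Sum>c<n. w c b a * (s c b * (Z c a * h a b)))"
      by (subst sum3_swap, subst sum3_rotate) (rule refl)
    also have "\<dots> = (\<Sum>a<n. \<Sum>b<n. \<Sum>c<n. - (w a b c * (h a b * s b c * Z a c)))"
    proof (intro sum.cong refl)
      fix a b c assume "a \<in> {..<n}" "b \<in> {..<n}" "c \<in> {..<n}"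
      then have "Z c a = - Z a c" by (intro Z) auto
      then show "w c b a * (s c b * (Z c a * h a b)) = - (w a b c * (h a b * s b c * Z a c))"
        using s[of c b] w(5)[of c b a] by simp
    qed
    finally show ?thesis unfolding q_def by (simp add: sum_negf)
  qed
  have 6: "(\<Sum>a<n. \<Sum>b<n. \<Sum>c<n. w a b c * (s a b * (\<omega> b c * h a c))) = - q \<omega>"
  proof -
    have "(\<Sum>a<n. \<Sum>b<n. \<Sum>c<n. w a b c * (s a b * (\<omega> b c * h a c))) =
      - (\<Sum>a<n. \<Sum>b<n. \<Sum>c<n. w a b c * (s a b * (h a c * \<omega> c b)))"
      unfolding sum_negf[symmetric]
    proof (intro sum.cong refl)
      fix a b c assume "a \<in> {..<n}" "b \<in> {..<n}" "c \<in> {..<n}"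
      then have "\<omega> b c = - \<omega> c b" by (intro \<omega>) auto
      then show "w a b c * (s a b * (\<omega> b c * h a c)) = - (w a b c * (s a b * (h a c * \<omega> c b)))" by simp
    qed
    then show ?thesis unfolding 4 .
  qed
  have "(\<Sum>a<n. \<Sum>b<n. \<sigma> a * \<sigma> b * (s a b * ((\<Sum>c<n. \<sigma> c * (h a c * t c b - t a c * h c b))
      - (\<Sum>c<n. \<sigma> c * (\<omega> a c * h c b + \<omega> b c * h a c))))) =
    (\<Sum>a<n. \<Sum>b<n. \<Sum>c<n. w a b c * (s a b * (h a c * t c b)))
    - (\<Sum>a<n. \<Sum>b<n. \<Sum>c<n. w a b c * (s a b * (t a c * h c b)))
    - (\<Sum>a<n. \<Sum>b<n. \<Sum>c<n. w a b c * (s a b * (\<omega> a c * h c b)))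
    - (\<Sum>a<n. \<Sum>b<n. \<Sum>c<n. w a b c * (s a b * (\<omega> b c * h a c)))"
    unfolding sum_subtractf[symmetric] by (intro sum.cong refl)
      (simp add: w_def sum_distrib_left sum_subtractf[symmetric] algebra_simps)
  moreover have "(\<Sum>a<n. \<Sum>b<n. \<Sum>c<n. w a b c * (s a b * (\<omega> a c * h c b))) = - q \<omega>"
    using \<omega> by (rule 5)
  moreover have "(\<Sum>a<n. \<Sum>b<n. \<Sum>c<n. w a b c * (s a b * (t a c * h c b))) = - q t"
    using t by (rule 5)
  ultimately show ?thesis unfolding 1 2 3 4 6 by simp
qed

section \<open>The right-hand sides of the identities for \<open>P\<close> in an adapted
  frame\<close>

context adapted_frame
begin

lemma dir_deriv_H:
  assumes ab: "a < n" "b < n" and f: "fun_differentiable_at A x f"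
  shows "dir_deriv A x (H a b x) f = (\<Sum>i\<in>{n..<n+p}. \<sigma> i * hh i a b * dir_deriv A x (e i x) f)"
proof -
  have "H a b x = (\<Sum>i\<in>{n..<n+p}. (\<sigma> i * hh i a b) *\<^sub>R e i x)"
    unfolding H_def hh_def by (rule expansion_Q[OF W(2) second_ff_in_Q])
  then show ?thesis by (simp add: linear_sum[OF linear_dir_deriv[OF f]] linear_cmul[OF linear_dir_deriv[OF f]])
qed

text \<open>\<open>S\<close> stands for the velocity \<open>B t\<close>: symmetric, vanishing on
  \<open>Q\<close>, with frame components that are differentiable at \<open>x\<close>.\<close>

context
  fixes S :: "('a, 'e) tensor02"
  assumes S_bil: "\<And>y. bilinear (S y)" and S_sym: "\<And>y u v. S y u v = S y v u"
    and S_Q: "\<And>y u v. v \<in> Q y \<Longrightarrow> S y u v = 0"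
    and S_diff: "\<And>a b. a < n \<Longrightarrow> b < n \<Longrightarrow> fun_differentiable_at A x (\<lambda>y. S y (e a y) (e b y))"
begin

lemma pairing_S:
  assumes "bilinear (C x)"
  shows "pairing g C S x = (\<Sum>a<n. \<Sum>b<n. \<sigma> a * \<sigma> b * (C x (e a x) (e b x) * S x (e a x) (e b x)))"
  by (rule pairing_P[where C = C and S = S and e = "\<lambda>l. e l x", OF assms S_bil S_sym S_Q on[OF W(2)]])
    (simp_all add: e_Q W)

lemma divergence_h_contract:
  "divergence A P Q g (h_contract A P Q g S) x =
    (\<Sum>a<n. \<Sum>b<n. \<sigma> a * \<sigma> b * (S x (e a x) (e b x) * divergence A P Q g (H a b) x
      + (\<Sum>i\<in>{n..<n+p}. \<sigma> i * hh i a b * dir_deriv A x (e i x) (\<lambda>y. S y (e a y) (e b y)))))"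
proof -
  have vd: "vfield_differentiable_at A x (H a b)" if "a < n" "b < n" for a b
    by (rule vfield_differentiable_smooth[OF smooth_H W(2)]) (use that in auto)
  have fd: "fun_differentiable_at A x (\<lambda>y. \<sigma> a * \<sigma> b * S y (e a y) (e b y))" if "a < n" "b < n" for a b
    by (intro dir_deriv_mult dir_deriv_const S_diff that)
  have dd: "dir_deriv A x z (\<lambda>y. \<sigma> a * \<sigma> b * S y (e a y) (e b y)) = \<sigma> a * \<sigma> b * dir_deriv A x z (\<lambda>y. S y (e a y) (e b y))"
    if "a < n" "b < n" for a b z
    using dir_deriv_mult(1)[OF dir_deriv_const(2) S_diff[OF that]] by (simp add: dir_deriv_const)
  have "divergence A P Q g (h_contract A P Q g S) x =
    divergence A P Q g (\<lambda>y. \<Sum>a<n. \<Sum>b<n. (\<sigma> a * \<sigma> b * S y (e a y) (e b y)) *\<^sub>R H a b y) x"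
    unfolding H_def by (rule divergence_cong) (rule h_contract_eq[OF S_bil on_P], simp_all add: e_P)
  also have "\<dots> = (\<Sum>a<n. divergence A P Q g (\<lambda>y. \<Sum>b<n. (\<sigma> a * \<sigma> b * S y (e a y) (e b y)) *\<^sub>R H a b y) x)"
    by (rule divergence_sum) (auto intro!: nabla_sum nabla_scaleR fd vd)
  also have "\<dots> = (\<Sum>a<n. \<Sum>b<n. divergence A P Q g (\<lambda>y. (\<sigma> a * \<sigma> b * S y (e a y) (e b y)) *\<^sub>R H a b y) x)"
    by (rule sum.cong[OF refl], rule divergence_sum) (auto intro!: nabla_scaleR fd vd)
  also have "\<dots> = (\<Sum>a<n. \<Sum>b<n. \<sigma> a * \<sigma> b * (S x (e a x) (e b x) * divergence A P Q g (H a b) x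
      + (\<Sum>i\<in>{n..<n+p}. \<sigma> i * hh i a b * dir_deriv A x (e i x) (\<lambda>y. S y (e a y) (e b y)))))"
  proof (intro sum.cong refl)
    fix a b assume "a \<in> {..<n}" "b \<in> {..<n}"
    then have ab: "a < n" "b < n" by auto
    show "divergence A P Q g (\<lambda>y. (\<sigma> a * \<sigma> b * S y (e a y) (e b y)) *\<^sub>R H a b y) x =
      \<sigma> a * \<sigma> b * (S x (e a x) (e b x) * divergence A P Q g (H a b) x
      + (\<Sum>i\<in>{n..<n+p}. \<sigma> i * hh i a b * dir_deriv A x (e i x) (\<lambda>y. S y (e a y) (e b y))))"
      unfolding divergence_scaleR[OF fd[OF ab] vd[OF ab]] dd[OF ab] dir_deriv_H[OF ab S_diff[OF ab]]
      by (simp add: sum_distrib_left distrib_left mult_ac)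
  qed
  finally show ?thesis .
qed

text \<open>\<open>S\<close> times the divergence of \<open>H a b\<close> occurs both in the pairing
  with \<open>div_h\<close> and in the divergence of the contraction, and cancels. There remain the
  commutator, the terms in \<open>\<omega>\<close> and the derivatives of the components of
  \<open>S\<close>, all grouped by the index \<open>i\<close> of the direction in
  \<open>Q\<close>.\<close>

lemma third_identity_rhs:
  "pairing g (\<lambda>y u v. div_h A P Q g y u v + flat g (cal_K A P Q g) y u v) S x
    - divergence A P Q g (h_contract A P Q g S) x =
   (\<Sum>i\<in>{n..<n+p}. \<sigma> i * (
     (\<Sum>a<n. \<Sum>b<n. \<sigma> a * \<sigma> b * (S x (e a x) (e b x) *
       ((\<Sum>c<n. \<sigma> c * (hh i a c * tt i c b - tt i a c * hh i c b))
        - (\<Sum>c<n. \<sigma> c * (\<omega> i a c * hh i c b + \<omega> i b c * hh i a c)))))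
     - (\<Sum>a<n. \<Sum>b<n. \<sigma> a * \<sigma> b * (hh i a b * dir_deriv A x (e i x) (\<lambda>y. S y (e a y) (e b y))))))"
proof -
  have bC: "bilinear (\<lambda>u v. div_h A P Q g x u v + flat g (cal_K A P Q g) x u v)"
    using bilinear_div_h bilinear_flat[where F = "cal_K A P Q g", OF linear_cal_K]
    unfolding bilinear_def by (auto intro: linear_compose_add)
  have "pairing g (\<lambda>y u v. div_h A P Q g y u v + flat g (cal_K A P Q g) y u v) S x
      - divergence A P Q g (h_contract A P Q g S) x =
    (\<Sum>a<n. \<Sum>b<n. \<Sum>i\<in>{n..<n+p}. \<sigma> i * (\<sigma> a * \<sigma> b * (S x (e a x) (e b x) *
       ((\<Sum>c<n. \<sigma> c * (hh i a c * tt i c b - tt i a c * hh i c b))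
        - (\<Sum>c<n. \<sigma> c * (\<omega> i a c * hh i c b + \<omega> i b c * hh i a c))))
       - \<sigma> a * \<sigma> b * (hh i a b * dir_deriv A x (e i x) (\<lambda>y. S y (e a y) (e b y)))))"
    unfolding pairing_S[where C = "\<lambda>y u v. div_h A P Q g y u v + flat g (cal_K A P Q g) y u v", OF bC]
      divergence_h_contract
  proof (rule trans[OF sum_subtractf[symmetric]], rule sum.cong[OF refl],
      rule trans[OF sum_subtractf[symmetric]], rule sum.cong[OF refl])
    fix a b assume "a \<in> {..<n}" "b \<in> {..<n}"
    then have ab: "a < n" "b < n" by auto
    let ?s = "S x (e a x) (e b x)"
    let ?k = "\<lambda>i. \<Sum>c<n. \<sigma> c * (hh i a c * tt i c b - tt i a c * hh i c b)"
    let ?o = "\<lambda>i. \<Sum>c<n. \<sigma> c * (\<omega> i a c * hh i c b + \<omega> i b c * hh i a c)"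
    let ?d = "\<lambda>i. dir_deriv A x (e i x) (\<lambda>y. S y (e a y) (e b y))"
    have K: "flat g (cal_K A P Q g) x (e a x) (e b x) = (\<Sum>i\<in>{n..<n+p}. \<sigma> i * ?k i)"
      unfolding flat_def by (rule cal_K_frame[OF ab])
    have gen: "(\<Sum>i\<in>{n..<n+p}. \<sigma> i * (r * (s * (k i - w i)) - r * (hh i a b * d i)))
        = r * (s * ((\<Sum>i\<in>{n..<n+p}. \<sigma> i * k i) - (\<Sum>i\<in>{n..<n+p}. \<sigma> i * w i)) - (\<Sum>i\<in>{n..<n+p}. \<sigma> i * hh i a b * d i))"
      for k w d :: "nat \<Rightarrow> real" and r s :: real
      unfolding sum_subtractf[symmetric] sum_distrib_left by (intro sum.cong refl) (simp add: algebra_simps)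
    show "\<sigma> a * \<sigma> b * ((div_h A P Q g x (e a x) (e b x) + flat g (cal_K A P Q g) x (e a x) (e b x)) * ?s)
        - \<sigma> a * \<sigma> b * (?s * divergence A P Q g (H a b) x + (\<Sum>i\<in>{n..<n+p}. \<sigma> i * hh i a b * ?d i)) =
      (\<Sum>i\<in>{n..<n+p}. \<sigma> i * (\<sigma> a * \<sigma> b * (?s * (?k i - ?o i)) - \<sigma> a * \<sigma> b * (hh i a b * ?d i)))"
      unfolding K div_h_frame[OF ab] gen[of "\<sigma> a * \<sigma> b" ?s ?k ?o ?d]
      by (simp only: left_diff_distrib right_diff_distrib distrib_left distrib_right mult.commute[of ?s])
  qed
  also have "\<dots> = (\<Sum>i\<in>{n..<n+p}. \<Sum>a<n. \<Sum>b<n. \<sigma> i * (\<sigma> a * \<sigma> b * (S x (e a x) (e b x) *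
       ((\<Sum>c<n. \<sigma> c * (hh i a c * tt i c b - tt i a c * hh i c b))
        - (\<Sum>c<n. \<sigma> c * (\<omega> i a c * hh i c b + \<omega> i b c * hh i a c))))
       - \<sigma> a * \<sigma> b * (hh i a b * dir_deriv A x (e i x) (\<lambda>y. S y (e a y) (e b y)))))"
    by (rule sum_pull_out)
  finally show ?thesis by (simp only: sum_distrib_left[symmetric] sum_subtractf)
qed

lemma mean_curvature_frame: "y \<in> W \<Longrightarrow> mean_curvature A P Q g y = (\<Sum>a<n. \<sigma> a *\<^sub>R H a a y)"
  unfolding mean_curvature_def H_def by (rule trace_on_eq[OF bilinear_second_ff on_P]) (simp_all add: e_P)

text \<open>By the product rule the divergence of the scaled mean curvature contains the trace of
  \<open>S\<close> times the divergence of the mean curvature. The pairing with the metric on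
  \<open>P\<close> is the same number, so only the derivative of the trace along the mean curvature
  is left.\<close>

lemma fourth_identity_rhs:
  "pairing g (\<lambda>y u v. divergence A P Q g (mean_curvature A P Q g) y * g y (component P Q y u) (component P Q y v)) S x
    - divergence A P Q g (\<lambda>y. trace_on g P S y *\<^sub>R mean_curvature A P Q g y) x =
   - (\<Sum>i\<in>{n..<n+p}. \<sigma> i * ((\<Sum>a<n. \<sigma> a * hh i a a) * (\<Sum>a<n. \<sigma> a * dir_deriv A x (e i x) (\<lambda>y. S y (e a y) (e a y)))))"
proof -
  let ?M = "\<lambda>y. \<Sum>a<n. \<sigma> a *\<^sub>R H a a y" and ?t = "\<lambda>y. \<Sum>a<n. \<sigma> a * S y (e a y) (e a y)"
  have vd: "vfield_differentiable_at A x (H a a)" if "a < n" for a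
    by (rule vfield_differentiable_smooth[OF smooth_H W(2)]) (use that in auto)
  have vM: "vfield_differentiable_at A x ?M"
    by (rule nabla_sum(2)) (auto intro!: nabla_scaleR(2) dir_deriv_const vd)
  have fd: "fun_differentiable_at A x (\<lambda>y. \<sigma> a * S y (e a y) (e a y))" if "a < n" for a
    by (intro dir_deriv_mult dir_deriv_const S_diff that)
  have ft: "fun_differentiable_at A x ?t" by (rule dir_deriv_sum(2)) (use fd in auto)
  have dt: "dir_deriv A x z ?t = (\<Sum>a<n. \<sigma> a * dir_deriv A x z (\<lambda>y. S y (e a y) (e a y)))" for z
  proof -
    have "dir_deriv A x z ?t = (\<Sum>a<n. dir_deriv A x z (\<lambda>y. \<sigma> a * S y (e a y) (e a y)))"
      by (rule dir_deriv_sum(1)) (use fd in auto)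
    also have "\<dots> = (\<Sum>a<n. \<sigma> a * dir_deriv A x z (\<lambda>y. S y (e a y) (e a y)))"
      by (intro sum.cong refl) (simp add: dir_deriv_mult(1)[OF dir_deriv_const(2) S_diff] dir_deriv_const)
    finally show ?thesis .
  qed
  have tr: "trace_on g P S y = ?t y" if "y \<in> W" for y
    using trace_on_eq[where b = S, OF S_bil on_P[OF that] e_P[OF that]] by simp
  have div: "divergence A P Q g (\<lambda>y. trace_on g P S y *\<^sub>R mean_curvature A P Q g y) x =
      dir_deriv A x (?M x) ?t + ?t x * divergence A P Q g (mean_curvature A P Q g) x"
  proof -
    have "divergence A P Q g (\<lambda>y. trace_on g P S y *\<^sub>R mean_curvature A P Q g y) x = divergence A P Q g (\<lambda>y. ?t y *\<^sub>R ?M y) x"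
      by (rule divergence_cong) (simp add: tr mean_curvature_frame)
    moreover have "divergence A P Q g (mean_curvature A P Q g) x = divergence A P Q g ?M x"
      by (rule divergence_cong) (rule mean_curvature_frame)
    ultimately show ?thesis by (simp add: divergence_scaleR[OF ft vM])
  qed
  have "dir_deriv A x (?M x) ?t = (\<Sum>a<n. \<sigma> a * dir_deriv A x (H a a x) ?t)"
    by (simp add: linear_sum[OF linear_dir_deriv[OF ft]] linear_cmul[OF linear_dir_deriv[OF ft]])
  also have "\<dots> = (\<Sum>a<n. \<Sum>i\<in>{n..<n+p}. \<sigma> i * (\<sigma> a * hh i a a * dir_deriv A x (e i x) ?t))"
    by (intro sum.cong refl) (simp add: dir_deriv_H[OF _ _ ft] sum_distrib_left mult_ac)
  also have "\<dots> = (\<Sum>i\<in>{n..<n+p}. \<sigma> i * ((\<Sum>a<n. \<sigma> a * hh i a a) * dir_deriv A x (e i x) ?t))"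
    by (subst sum.swap) (simp add: sum_distrib_left sum_distrib_right)
  finally have dM: "dir_deriv A x (?M x) ?t = \<dots>" .
  have bC: "bilinear (\<lambda>u v. divergence A P Q g (mean_curvature A P Q g) x * g x (component P Q x u) (component P Q x v))"
    by (rule bilinearI) (simp_all add: linear_add[OF linear_component] linear_cmul[OF linear_component]
      bilinear_ladd[OF bil] bilinear_radd[OF bil] bilinear_lmul[OF bil] bilinear_rmul[OF bil] distrib_left)
  have "pairing g (\<lambda>y u v. divergence A P Q g (mean_curvature A P Q g) y * g y (component P Q y u) (component P Q y v)) S x =
    (\<Sum>a<n. \<Sum>b<n. if a = b then divergence A P Q g (mean_curvature A P Q g) x * (\<sigma> b * S x (e b x) (e b x)) else 0)"
    unfolding pairing_S[where C = "\<lambda>y u v. divergence A P Q g (mean_curvature A P Q g) y * g y (component P Q y u) (component P Q y v)", OF bC]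
    by (intro sum.cong refl)
      (use orthonormal_familyD[OF on_P[OF W(2)]] in \<open>auto simp: component_P e_P W mult_ac\<close>)
  also have "\<dots> = ?t x * divergence A P Q g (mean_curvature A P Q g) x"
    by (simp add: sum_distrib_left mult.commute)
  finally show ?thesis unfolding div dM unfolding dt by simp
qed

lemma sixth_identity_rhs:
  "pairing g (flat g (cal_T A P Q g)) S x = (\<Sum>i\<in>{n..<n+p}. \<sigma> i *
    (\<Sum>a<n. \<Sum>b<n. \<sigma> a * \<sigma> b * (S x (e a x) (e b x) * (\<Sum>c<n. \<sigma> c * (tt i a c * tt i c b)))))"
proof -
  have "pairing g (flat g (cal_T A P Q g)) S x = (\<Sum>a<n. \<Sum>b<n. \<Sum>i\<in>{n..<n+p}. \<sigma> i *
      (\<sigma> a * \<sigma> b * (S x (e a x) (e b x) * (\<Sum>c<n. \<sigma> c * (tt i a c * tt i c b)))))"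
    unfolding pairing_S[where C = "flat g (cal_T A P Q g)", OF bilinear_flat[where F = "cal_T A P Q g", OF linear_cal_T]]
  proof (intro sum.cong refl)
    fix a b assume "a \<in> {..<n}" "b \<in> {..<n}"
    then have T: "flat g (cal_T A P Q g) x (e a x) (e b x) =
        (\<Sum>i\<in>{n..<n+p}. \<sigma> i * (\<Sum>c<n. \<sigma> c * (tt i a c * tt i c b)))"
      unfolding flat_def by (intro cal_T_frame) auto
    show "\<sigma> a * \<sigma> b * (flat g (cal_T A P Q g) x (e a x) (e b x) * S x (e a x) (e b x)) = (\<Sum>i\<in>{n..<n+p}. \<sigma> i *
        (\<sigma> a * \<sigma> b * (S x (e a x) (e b x) * (\<Sum>c<n. \<sigma> c * (tt i a c * tt i c b)))))"
      unfolding T sum_distrib_right unfolding sum_distrib_left[of "\<sigma> a * \<sigma> b" _ "{n..<n+p}"]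
      by (intro sum.cong refl) (simp only: mult_ac)
  qed
  also have "\<dots> = (\<Sum>i\<in>{n..<n+p}. \<Sum>a<n. \<Sum>b<n. \<sigma> i *
      (\<sigma> a * \<sigma> b * (S x (e a x) (e b x) * (\<Sum>c<n. \<sigma> c * (tt i a c * tt i c b)))))"
    by (rule sum_pull_out)
  finally show ?thesis by (simp only: sum_distrib_left[symmetric])
qed

end

end

section \<open>The orthogonal complement of a distribution\<close>

context metric_manifold
begin

context
  fixes P :: "('a, 'e) distribution" and n p :: nat
  assumes P: "smooth_distribution A n P" and nd: "\<And>y. nondegenerate_on (g y) (P y)" and dim_sum: "DIM('e) = n + p"
begin

lemma orth_complement_orthogonal: "u \<in> P y \<Longrightarrow> v \<in> orth_complement g P y \<Longrightarrow> g y u v = 0"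
  unfolding orth_complement_def using sym by auto

lemma subspace_orth_complement: "subspace (orth_complement g P y)"
  unfolding orth_complement_def subspace_def
  by (simp add: bilinear_lzero[OF bil] bilinear_ladd[OF bil] bilinear_lmul[OF bil])

lemma orth_complement_decomposition: "\<exists>u\<in>P y. \<exists>w\<in>orth_complement g P y. v = u + w"
proof -
  have sub: "subspace (P y)" and dP: "dim (P y) = n" using P unfolding smooth_distribution_def by auto
  note E = frame_orthonormal[where P = P, OF sub nd]
  let ?E = "frame g P y" and ?s = "frame_sign g P y"
  define u where "u = (\<Sum>l<dim (P y). (?s l * g y v (?E l)) *\<^sub>R ?E l)"
  have u: "u \<in> P y" unfolding u_def by (intro subspace_sum subspace_scale sub) (simp add: E(2))
  have frame: "g y u (?E l) = g y v (?E l)" if "l < dim (P y)" for l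
    unfolding u_def using orthonormal_coefficient[OF bil _ E(1), of l "\<lambda>l. ?s l * g y v (?E l)"] that
      orthonormal_familyD(2)[OF E(1), of l] by (simp add: mult.commute mult.left_commute)
  have "g y (v - u) z = 0" if z: "z \<in> P y" for z
  proof -
    have "z = (\<Sum>l<dim (P y). (?s l * g y z (?E l)) *\<^sub>R ?E l)"
      by (rule orthonormal_expansion[OF bil _ E(1) sub _ _ z]) (simp_all add: E(2))
    then have "g y (v - u) z = g y (v - u) (\<Sum>l<dim (P y). (?s l * g y z (?E l)) *\<^sub>R ?E l)" by simp
    then show ?thesis
      unfolding bilinear_sum_right[OF bil] bilinear_rmul[OF bil] by (simp add: bilinear_lsub[OF bil] frame)
  qed
  then have "v - u \<in> orth_complement g P y" unfolding orth_complement_def by simp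
  then show ?thesis using u by (intro bexI[of _ u] bexI[of _ "v - u"]) simp_all
qed

lemma dim_orth_complement: "dim (orth_complement g P y) = p"
proof -
  have sub: "subspace (P y)" and dP: "dim (P y) = n" using P unfolding smooth_distribution_def by auto
  have "P y \<inter> orth_complement g P y = {0}"
  proof -
    have "u = 0" if "u \<in> P y" "u \<in> orth_complement g P y" for u
      using nd[of y] that unfolding nondegenerate_on_def orth_complement_def by blast
    then show ?thesis using subspace_0[OF sub] subspace_0[OF subspace_orth_complement] by blast
  qed
  moreover have "{u + w |u w. u \<in> P y \<and> w \<in> orth_complement g P y} = UNIV"
    using orth_complement_decomposition by blast
  ultimately show ?thesis
    using dim_sums_Int[OF sub subspace_orth_complement, of y] dim_sum dP by (simp add: dim_UNIV)
qed

lemma nondegenerate_orth_complement: "nondegenerate_on (g y) (orth_complement g P y)"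
  unfolding nondegenerate_on_def
proof (intro ballI impI)
  fix w assume w: "w \<in> orth_complement g P y" "\<forall>v\<in>orth_complement g P y. g y w v = 0"
  show "w = 0"
  proof (rule metric_eqI[of y])
    fix v
    obtain u z where "u \<in> P y" "z \<in> orth_complement g P y" "v = u + z"
      using orth_complement_decomposition by blast
    then show "g y w v = g y 0 v"
      using w unfolding orth_complement_def by (simp add: bilinear_radd[OF bil] bilinear_lzero[OF bil])
  qed
qed

text \<open>A local orthonormal frame of \<open>P\<close> is completed by coordinate fields that
  form an orthonormal frame of the complement at \<open>x\<close> only, and the whole is
  orthonormalised. Triangularity keeps the first \<open>n\<close> fields in \<open>P\<close>, where
  they span; the other \<open>p\<close> are then orthogonal to \<open>P\<close> near
  \<open>x\<close>.\<close>

lemma smooth_orth_complement: "smooth_distribution A p (orth_complement g P)"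
  unfolding smooth_distribution_def
proof (intro conjI allI subspace_orth_complement dim_orth_complement)
  fix x
  let ?Q = "orth_complement g P"
  have sub: "subspace (P y)" and dP: "dim (P y) = n" for y using P unfolding smooth_distribution_def by auto
  have EP: "orthonormal_family (g x) {..<n} (frame g P x) (frame_sign g P x)" "\<And>l. l < n \<Longrightarrow> frame g P x l \<in> P x"
    using frame_orthonormal[where P = P and x = x, OF sub nd] dP by auto
  have EQ: "orthonormal_family (g x) {..<p} (frame g ?Q x) (frame_sign g ?Q x)" "\<And>l. l < p \<Longrightarrow> frame g ?Q x l \<in> ?Q x"
    using frame_orthonormal[where P = ?Q and x = x, OF subspace_orth_complement nondegenerate_orth_complement]
      dim_orth_complement by auto
  obtain W V where W: "open W" "x \<in> W" and V: "\<And>l. l < n \<Longrightarrow> smooth_vfield_on A W (V l)" "\<And>l. l < n \<Longrightarrow> V l x = frame g P x l"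
      "\<And>l y. l < n \<Longrightarrow> y \<in> W \<Longrightarrow> V l y \<in> P y" "\<And>y. y \<in> W \<Longrightarrow> orthonormal_family (g y) {..<n} (\<lambda>l. V l y) (frame_sign g P x)"
    using local_frame_of_distribution[OF P EP(1) EP(2)] by metis
  have "\<forall>l. \<exists>X. smooth_vfield_on A (fst (chart_at A x)) X \<and> X x = frame g ?Q x l" using coordinate_field by blast
  then obtain C where C: "\<And>l. smooth_vfield_on A (fst (chart_at A x)) (C l)" "\<And>l. C l x = frame g ?Q x l" by metis
  define U where "U = W \<inter> fst (chart_at A x)"
  have U: "open U" "x \<in> U" unfolding U_def using W open_chart[OF chart_at_A(1)] chart_at_A(2) by (auto intro: open_Int)
  define X where "X l = (if l < n then V l else C (l - n))" for l
  define \<sigma> where "\<sigma> l = (if l < n then frame_sign g P x l else frame_sign g ?Q x (l - n))" for l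
  have XU: "smooth_vfield_on A U (X l)" if "l < n + p" for l
  proof (cases "l < n")
    case True
    show ?thesis unfolding X_def if_P[OF True]
      by (rule smooth_vfield_on_restrict[OF V(1)[OF True] U(1)]) (simp add: U_def)
  next
    case False
    show ?thesis unfolding X_def if_not_P[OF False]
      by (rule smooth_vfield_on_restrict[OF C(1) U(1)]) (simp add: U_def)
  qed
  have on: "orthonormal_family (g x) {..<n+p} (\<lambda>l. X l x) \<sigma>"
  proof -
    have X: "X l x = (if l < n then frame g P x l else frame g ?Q x (l - n))" for l
      unfolding X_def using V(2) C(2) by simp
    have pq: "g x (frame g P x k) (frame g ?Q x l) = 0" "g x (frame g ?Q x l) (frame g P x k) = 0" if "k < n" "l < p" for k l
      using orth_complement_orthogonal[OF EP(2)[OF that(1)] EQ(2)[OF that(2)]] sym[of x "frame g P x k"] by simp_all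
    have pp: "g x (frame g P x k) (frame g P x l) = (if k = l then frame_sign g P x k else 0)" if "k < n" "l < n" for k l
      using orthonormal_familyD(1)[OF EP(1), of k l] that by simp
    have qq: "g x (frame g ?Q x k) (frame g ?Q x l) = (if k = l then frame_sign g ?Q x k else 0)" if "k < p" "l < p" for k l
      using orthonormal_familyD(1)[OF EQ(1), of k l] that by simp
    have "\<bar>\<sigma> l\<bar> = 1" if "l < n + p" for l
      using EP(1) EQ(1) that unfolding orthonormal_family_def \<sigma>_def by auto
    moreover have "g x (X k x) (X l x) = (if k = l then \<sigma> k else 0)" if "k < n + p" "l < n + p" for k l
      using that unfolding X \<sigma>_def by (auto simp: pq pp qq)
    ultimately show ?thesis unfolding orthonormal_family_def by auto
  qed
  show "\<exists>W X. x \<in> W \<and> (\<forall>a<p. smooth_vfield_on A W (X a)) \<and> open W \<and>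
      (\<forall>y\<in>W. ?Q y = span ((\<lambda>a. X a y) ` {..<p}))"
  proof (rule local_orthonormal_frame[where X = X, OF U _ on])
    show "smooth_vfield_on A U (X l)" if "l < n + p" for l using XU[OF that] .
  next
    fix W' F
    assume W': "open W'" "x \<in> W'" "W' \<subseteq> U" and F: "\<And>l. l < n + p \<Longrightarrow> smooth_vfield_on A W' (F l)"
      and Fx: "\<And>l. l < n + p \<Longrightarrow> F l x = X l x"
      and span: "\<And>l y. l < n + p \<Longrightarrow> F l y \<in> span ((\<lambda>j. X j y) ` {..l})"
      and Fon: "\<And>y. y \<in> W' \<Longrightarrow> orthonormal_family (g y) {..<n+p} (\<lambda>l. F l y) \<sigma>"
    have FP: "F l y \<in> P y" if l: "l < n" and y: "y \<in> W'" for l y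
    proof -
      have yW: "y \<in> W" using y W'(3) unfolding U_def by blast
      have "X j y \<in> P y" if j: "j \<le> l" for j using V(3)[OF _ yW, of j] j l unfolding X_def by simp
      then have "(\<lambda>j. X j y) ` {..l} \<subseteq> P y" by blast
      moreover have "F l y \<in> span ((\<lambda>j. X j y) ` {..l})" using l by (intro span) simp
      ultimately show ?thesis using span_minimal[OF _ sub] by blast
    qed
    have FQ: "F (n + a) y \<in> ?Q y" if a: "a < p" and y: "y \<in> W'" for a y
      unfolding orth_complement_def
    proof (intro CollectI ballI)
      fix u assume u: "u \<in> P y"
      have "u = (\<Sum>l<n. (\<sigma> l * g y u (F l y)) *\<^sub>R F l y)"
        by (rule orthonormal_expansion[OF bil _ orthonormal_family_subset[OF Fon[OF y]] sub _ _ u])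
          (auto simp: FP y dP)
      then have "g y (F (n + a) y) u = g y (F (n + a) y) (\<Sum>l<n. (\<sigma> l * g y u (F l y)) *\<^sub>R F l y)" by simp
      also have "\<dots> = 0"
        unfolding bilinear_sum_right[OF bil] bilinear_rmul[OF bil]
        using orthonormal_familyD(1)[OF Fon[OF y], of "n + a"] a by simp
      finally show "g y (F (n + a) y) u = 0" .
    qed
    have "?Q y = span ((\<lambda>a. F (n + a) y) ` {..<p})" if y: "y \<in> W'" for y
    proof
      show "span ((\<lambda>a. F (n + a) y) ` {..<p}) \<subseteq> ?Q y"
        using FQ y by (intro span_minimal subspace_orth_complement) auto
      have on': "orthonormal_family (g y) {..<p} (\<lambda>a. F (n + a) y) (\<lambda>a. \<sigma> (n + a))"
        by (rule orthonormal_family_reindex[where f = "\<lambda>a. n + a", OF orthonormal_family_subset[OF Fon[OF y]]]) (auto simp: inj_on_def)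
      show "?Q y \<subseteq> span ((\<lambda>a. F (n + a) y) ` {..<p})"
      proof
        fix v assume v: "v \<in> ?Q y"
        have "v = (\<Sum>a<p. (\<sigma> (n + a) * g y v (F (n + a) y)) *\<^sub>R F (n + a) y)"
          by (rule orthonormal_expansion[OF bil _ on' subspace_orth_complement _ _ v]) (auto simp: FQ y dim_orth_complement)
        moreover have "\<dots> \<in> span ((\<lambda>a. F (n + a) y) ` {..<p})" by (intro span_sum span_scale span_base) auto
        ultimately show "v \<in> span ((\<lambda>a. F (n + a) y) ` {..<p})" by simp
      qed
    qed
    moreover have "\<forall>a<p. smooth_vfield_on A W' (F (n + a))" using F by simp
    ultimately show ?thesis using W'(1,2) by (intro exI[of _ W'] exI[of _ "\<lambda>a. F (n + a)"] conjI ballI)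
  qed
qed

end

end

section \<open>Differentiation in time\<close>

lemma time_slice_derivative:
  assumes "smooth_on S F" "(t, \<xi>) \<in> S"
  shows "((\<lambda>s. F (s, \<xi>)) has_real_derivative frechet_derivative F (at (t, \<xi>)) (1, 0)) (at t)"
proof -
  note F = smooth_on_has_derivative[OF assms]
  have "((\<lambda>s. (s, \<xi>)) has_derivative (\<lambda>r. (r, 0))) (at t)" by (auto intro!: derivative_eq_intros)
  from diff_chain_at[OF this F] have "((\<lambda>s. F (s, \<xi>)) has_derivative (\<lambda>r. frechet_derivative F (at (t, \<xi>)) (r, 0))) (at t)"
    by (simp add: o_def)
  moreover have "frechet_derivative F (at (t, \<xi>)) (r, 0) = frechet_derivative F (at (t, \<xi>)) (1, 0) * r" for r
    using linear_cmul[OF has_derivative_linear[OF F], of r "(1, 0)"] by simp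
  then have "(\<lambda>r. frechet_derivative F (at (t, \<xi>)) (r, 0)) = (*) (frechet_derivative F (at (t, \<xi>)) (1, 0))"
    by (rule ext)
  ultimately show ?thesis unfolding has_field_derivative_def by (simp only:)
qed

lemma space_slice_derivative:
  assumes "smooth_on S F" "(t, \<xi>) \<in> S"
  shows "((\<lambda>\<eta>. F (t, \<eta>)) has_derivative (\<lambda>w. frechet_derivative F (at (t, \<xi>)) (0, w))) (at \<xi>)"
proof -
  have "((\<lambda>\<eta>. (t, \<eta>)) has_derivative (\<lambda>w. (0, w))) (at \<xi>)" by (auto intro!: derivative_eq_intros)
  from diff_chain_at[OF this smooth_on_has_derivative[OF assms]] show ?thesis by (simp add: o_def)
qed

text \<open>Symmetry of the second derivative of \<open>F\<close> on the product, for the directions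
  \<open>(1, 0)\<close> and \<open>(0, w)\<close>.\<close>

lemma mixed_time_space_derivative:
  fixes F :: "real \<times> 'b::real_normed_vector \<Rightarrow> real"
  assumes I: "open I" "t \<in> I" and S: "open S" "\<xi> \<in> S" and F: "smooth_on (I \<times> S) F"
  shows "(\<lambda>\<eta>. deriv (\<lambda>s. F (s, \<eta>)) t) differentiable (at \<xi>)"
    "((\<lambda>s. frechet_derivative (\<lambda>\<eta>. F (s, \<eta>)) (at \<xi>) w) has_real_derivative
      frechet_derivative (\<lambda>\<eta>. deriv (\<lambda>s. F (s, \<eta>)) t) (at \<xi>) w) (at t)"
proof -
  let ?T = "\<lambda>z. frechet_derivative F (at z) (1, 0)" and ?X = "\<lambda>z. frechet_derivative F (at z) (0, w)"
  have mem: "(t, \<xi>) \<in> I \<times> S" using I S by blast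
  have "deriv (\<lambda>s. F (s, \<eta>)) t = ?T (t, \<eta>)" if "\<eta> \<in> S" for \<eta>
    by (rule DERIV_imp_deriv[OF time_slice_derivative[OF F]]) (use I that in blast)
  then have T: "((\<lambda>\<eta>. deriv (\<lambda>s. F (s, \<eta>)) t) has_derivative (\<lambda>w. frechet_derivative ?T (at (t, \<xi>)) (0, w))) (at \<xi>)"
    by (intro has_derivative_transform_within_open[OF space_slice_derivative[OF smooth_on_frechet[OF F] mem] S]) simp
  then show "(\<lambda>\<eta>. deriv (\<lambda>s. F (s, \<eta>)) t) differentiable (at \<xi>)" unfolding differentiable_def by blast
  have "frechet_derivative (\<lambda>\<eta>. F (s, \<eta>)) (at \<xi>) w = ?X (s, \<xi>)" if "s \<in> I" for s
    by (rule frechet_derivative_eqI[OF space_slice_derivative[OF F]]) (use S that in blast)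
  then have "((\<lambda>s. frechet_derivative (\<lambda>\<eta>. F (s, \<eta>)) (at \<xi>) w) has_real_derivative frechet_derivative ?X (at (t, \<xi>)) (1, 0)) (at t)"
    by (intro has_field_derivative_transform_within_open[OF time_slice_derivative[OF smooth_on_frechet[OF F] mem] I]) simp
  moreover have "frechet_derivative ?X (at (t, \<xi>)) (1, 0) = frechet_derivative ?T (at (t, \<xi>)) (0, w)"
    by (rule second_derivative_symmetric[OF open_Times[OF I(1) S(1)] mem F])
  ultimately show "((\<lambda>s. frechet_derivative (\<lambda>\<eta>. F (s, \<eta>)) (at \<xi>) w) has_real_derivative
      frechet_derivative (\<lambda>\<eta>. deriv (\<lambda>s. F (s, \<eta>)) t) (at \<xi>) w) (at t)"
    unfolding frechet_derivative_eqI[OF T] by simp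
qed

context smooth_manifold
begin

text \<open>The formula is linear in the entries of the tensor and in their spatial derivatives.
  Differentiating it in time for \<open>g s\<close> entry by entry hence yields the same formula for
  the velocity.\<close>

lemma dir_deriv_tensor:
  fixes x
  defines "c \<equiv> chart_at A x" and "\<xi> \<equiv> snd (chart_at A x) x"
  assumes b: "\<And>y. bilinear (b y)" and G: "\<And>i j. (\<lambda>\<eta>. tensor_in A c b \<eta> i j) differentiable (at \<xi>)"
    and X: "vfield_differentiable_at A x X" and Y: "vfield_differentiable_at A x Y"
  shows "dir_deriv A x z (\<lambda>y. b y (X y) (Y y)) = (\<Sum>i\<in>Basis. \<Sum>j\<in>Basis.
      (vfield_in A c X \<xi> \<bullet> i) * ((vfield_in A c Y \<xi> \<bullet> j) * frechet_derivative (\<lambda>\<eta>. tensor_in A c b \<eta> i j) (at \<xi>) z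
        + (frechet_derivative (vfield_in A c Y) (at \<xi>) z \<bullet> j) * tensor_in A c b \<xi> i j)
      + (frechet_derivative (vfield_in A c X) (at \<xi>) z \<bullet> i) * ((vfield_in A c Y \<xi> \<bullet> j) * tensor_in A c b \<xi> i j))"
    "fun_differentiable_at A x (\<lambda>y. b y (X y) (Y y))"
proof -
  have c: "c \<in> A" "x \<in> fst c" unfolding c_def by (rule chart_at_A)+
  have op: "open (snd c ` fst c)" using open_image[OF c(1) open_UNIV] by simp
  have mem: "\<xi> \<in> snd c ` fst c" using c(2) unfolding \<xi>_def c_def by blast
  have "((\<lambda>\<eta>. \<Sum>i\<in>Basis. \<Sum>j\<in>Basis. (vfield_in A c X \<eta> \<bullet> i) * ((vfield_in A c Y \<eta> \<bullet> j) * tensor_in A c b \<eta> i j)) has_derivative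
    (\<lambda>z. \<Sum>i\<in>Basis. \<Sum>j\<in>Basis.
      (vfield_in A c X \<xi> \<bullet> i) * ((vfield_in A c Y \<xi> \<bullet> j) * frechet_derivative (\<lambda>\<eta>. tensor_in A c b \<eta> i j) (at \<xi>) z
        + (frechet_derivative (vfield_in A c Y) (at \<xi>) z \<bullet> j) * tensor_in A c b \<xi> i j)
      + (frechet_derivative (vfield_in A c X) (at \<xi>) z \<bullet> i) * ((vfield_in A c Y \<xi> \<bullet> j) * tensor_in A c b \<xi> i j))) (at \<xi>)"
    by (intro has_derivative_sum has_derivative_mult has_derivative_inner_left G[unfolded frechet_derivative_works])
      (use X Y in \<open>simp_all add: vfield_differentiable_at_def c_def \<xi>_def frechet_derivative_works\<close>)
  then have "((\<lambda>\<eta>. b (chart_inv c \<eta>) (X (chart_inv c \<eta>)) (Y (chart_inv c \<eta>))) has_derivative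
    (\<lambda>z. \<Sum>i\<in>Basis. \<Sum>j\<in>Basis.
      (vfield_in A c X \<xi> \<bullet> i) * ((vfield_in A c Y \<xi> \<bullet> j) * frechet_derivative (\<lambda>\<eta>. tensor_in A c b \<eta> i j) (at \<xi>) z
        + (frechet_derivative (vfield_in A c Y) (at \<xi>) z \<bullet> j) * tensor_in A c b \<xi> i j)
      + (frechet_derivative (vfield_in A c X) (at \<xi>) z \<bullet> i) * ((vfield_in A c Y \<xi> \<bullet> j) * tensor_in A c b \<xi> i j))) (at \<xi>)"
    by (rule has_derivative_transform_within_open[OF _ op mem])
      (auto simp: inv_chart[OF c(1)] intro!: tensor_in_expansion[OF c(1) _ b, symmetric])
  from dir_deriv_eqI[OF this[unfolded c_def \<xi>_def]]
  show "dir_deriv A x z (\<lambda>y. b y (X y) (Y y)) = (\<Sum>i\<in>Basis. \<Sum>j\<in>Basis.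
      (vfield_in A c X \<xi> \<bullet> i) * ((vfield_in A c Y \<xi> \<bullet> j) * frechet_derivative (\<lambda>\<eta>. tensor_in A c b \<eta> i j) (at \<xi>) z
        + (frechet_derivative (vfield_in A c Y) (at \<xi>) z \<bullet> j) * tensor_in A c b \<xi> i j)
      + (frechet_derivative (vfield_in A c X) (at \<xi>) z \<bullet> i) * ((vfield_in A c Y \<xi> \<bullet> j) * tensor_in A c b \<xi> i j))"
    "fun_differentiable_at A x (\<lambda>y. b y (X y) (Y y))" unfolding c_def \<xi>_def by auto
qed

end

section \<open>Variations of the metric\<close>

interpretation time_functions: regular_functions "\<lambda>S (f :: real \<Rightarrow> real). open S \<and> (\<forall>s\<in>S. f differentiable (at s))"
proof
  fix S :: "real set" and f :: "real \<Rightarrow> real" and y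
  assume f: "open S \<and> (\<forall>s\<in>S. f differentiable (at s))"
  {
    assume pos: "\<And>y. y \<in> S \<Longrightarrow> f y > 0"
    have "(\<lambda>y. 1 / sqrt (f y)) differentiable (at s)" if "s \<in> S" for s
      using has_derivative_inverse_sqrt[of f _ s] f pos[OF that] that unfolding differentiable_def by blast
    then show "open S \<and> (\<forall>s\<in>S. (\<lambda>y. 1 / sqrt (f y)) differentiable (at s))" using f by blast
  }
  {
    assume y: "y \<in> S" "f y > 0"
    have "continuous_on S f"
      using f by (simp add: continuous_at_imp_continuous_on differentiable_imp_continuous_within)
    then have "open (S \<inter> f -` {0<..})" using f by (intro continuous_open_preimage) auto
    then show "\<exists>W'. open W' \<and> y \<in> W' \<and> W' \<subseteq> S \<and> (\<forall>z\<in>W'. 0 < f z)"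
      using y by (intro exI[of _ "S \<inter> f -` {0<..}"]) auto
  }
qed (auto intro: differentiable_add differentiable_mult)

locale metric_variation = smooth_manifold A
  for A :: "('a::topological_space, 'e::euclidean_space) chart set" +
  fixes Dt D :: "('a, 'e) distribution" and g0 :: "('a, 'e) tensor02"
    and g :: "real \<Rightarrow> ('a, 'e) tensor02" and n p :: nat and \<epsilon> :: real
  assumes dim_sum: "DIM('e) = n + p"
    and smooth_Dt: "smooth_distribution A n Dt"
    and metric0: "pseudo_metric A g0"
    and nondegenerate_Dt: "\<And>y. nondegenerate_on (g0 y) (Dt y)"
    and D_def: "D = orth_complement g0 Dt"
    and variation: "gtop_variation A Dt g0 \<epsilon> g"
begin

abbreviation B :: "real \<Rightarrow> ('a, 'e) tensor02" where "B \<equiv> metric_velocity g"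

lemma metric_s: "\<bar>s\<bar> < \<epsilon> \<Longrightarrow> pseudo_metric A (g s)"
  and orthogonal_s: "\<bar>s\<bar> < \<epsilon> \<Longrightarrow> u \<in> Dt y \<Longrightarrow> v \<in> D y \<Longrightarrow> g s y u v = 0"
  and nondegenerate_s: "\<bar>s\<bar> < \<epsilon> \<Longrightarrow> nondegenerate_on (g s y) (Dt y)"
  and constant_on_D: "\<bar>s\<bar> < \<epsilon> \<Longrightarrow> u \<in> D y \<Longrightarrow> v \<in> D y \<Longrightarrow> g s y u v = g0 y u v"
  using variation unfolding gtop_variation_def smooth_metric_family_def D_def by blast+

text \<open>\<open>D\<close> is defined with \<open>g0\<close> but complements \<open>Dt\<close> for
  every metric of the family, and it stays nondegenerate because the metrics coincide on it. So the
  same local sections of \<open>Dt\<close> and \<open>D\<close> can be used with all of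
  them.\<close>

lemma split_s:
  assumes "\<bar>s\<bar> < \<epsilon>"
  shows "split_metric A (g s) Dt D n p"
proof -
  interpret g0: metric_manifold A g0 by unfold_locales (rule metric0)
  show ?thesis
  proof
    show "pseudo_metric A (g s)" by (rule metric_s[OF assms])
    show "smooth_distribution A n Dt" by (rule smooth_Dt)
    show "smooth_distribution A p D"
      unfolding D_def by (rule g0.smooth_orth_complement[OF smooth_Dt nondegenerate_Dt dim_sum])
    show "DIM('e) = n + p" by (rule dim_sum)
    show "g s y u v = 0" if "u \<in> Dt y" "v \<in> D y" for y u v by (rule orthogonal_s[OF assms that])
    show "nondegenerate_on (g s y) (Dt y)" for y by (rule nondegenerate_s[OF assms])
    have "nondegenerate_on (g0 y) (D y)" for y
      unfolding D_def by (rule g0.nondegenerate_orth_complement[OF smooth_Dt nondegenerate_Dt dim_sum])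
    then show "nondegenerate_on (g s y) (D y)" for y
      unfolding nondegenerate_on_def by (simp add: constant_on_D[OF assms])
  qed
qed

lemma bil_s: "\<bar>s\<bar> < \<epsilon> \<Longrightarrow> bilinear (g s y)"
  and sym_s: "\<bar>s\<bar> < \<epsilon> \<Longrightarrow> g s y u v = g s y v u"
  using metric_s unfolding pseudo_metric_def by blast+

text \<open>The variation fixes the metrics on \<open>D\<close> only for two arguments in
  \<open>D\<close>. The other argument may be arbitrary, since its \<open>Dt\<close>-component is
  orthogonal to \<open>v\<close> at all times.\<close>

lemma constant_D: "\<bar>s\<bar> < \<epsilon> \<Longrightarrow> \<bar>t\<bar> < \<epsilon> \<Longrightarrow> v \<in> D y \<Longrightarrow> g s y u v = g t y u v"
proof -
  assume s: "\<bar>s\<bar> < \<epsilon>" and t: "\<bar>t\<bar> < \<epsilon>" and v: "v \<in> D y"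
  interpret split_metric A "g s" Dt D n p by (rule split_s[OF s])
  let ?u = "component Dt D y u"
  have u: "u = ?u + (u - ?u)" by simp
  have "g r y u v = g0 y (u - ?u) v" if r: "\<bar>r\<bar> < \<epsilon>" for r
  proof -
    have "g r y u v = g r y ?u v + g r y (u - ?u) v"
      by (subst u) (rule bilinear_ladd[OF bil_s[OF r]])
    then show ?thesis
      using orthogonal_s[OF r component_in_P v] constant_on_D[OF r component_compl v] by simp
  qed
  from this[OF s] this[OF t] show "g s y u v = g t y u v" by simp
qed

lemma chart_smooth:
  "c \<in> A \<Longrightarrow> smooth_on ({-\<epsilon><..<\<epsilon>} \<times> snd c ` fst c) (\<lambda>(t, \<xi>). tensor_in A c (g t) \<xi> u v)"
  using variation unfolding gtop_variation_def smooth_metric_family_def by blast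

lemma time_interval: "\<bar>t\<bar> < \<epsilon> \<longleftrightarrow> t \<in> {-\<epsilon><..<\<epsilon>}" by auto

lemma chart_mem: "snd (chart_at A x) x \<in> snd (chart_at A x) ` fst (chart_at A x)"
  using chart_at_A by blast

lemma B_deriv:
  assumes t: "\<bar>t\<bar> < \<epsilon>"
  shows "((\<lambda>s. g s y u v) has_real_derivative B t y u v) (at t)"
proof -
  have "((\<lambda>s. tensor_in A (chart_at A y) (g s) (snd (chart_at A y) y) u v) has_real_derivative
      frechet_derivative (\<lambda>(t, \<xi>). tensor_in A (chart_at A y) (g t) \<xi> u v) (at (t, snd (chart_at A y) y)) (1, 0)) (at t)"
    using time_slice_derivative[OF chart_smooth[OF chart_at_A(1)], of t "snd (chart_at A y) y"] t chart_mem[of y]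
    by (simp add: time_interval)
  then have "(\<lambda>s. g s y u v) differentiable (at t)"
    unfolding tensor_in_at[OF atlas] real_differentiable_def by blast
  then show ?thesis
    unfolding metric_velocity_def by (simp add: DERIV_deriv_iff_real_differentiable)
qed

lemma B_eqI:
  assumes "\<bar>t\<bar> < \<epsilon>" "((\<lambda>s. g s y u v) has_real_derivative r) (at t)"
  shows "B t y u v = r"
  using DERIV_unique[OF B_deriv[OF assms(1)] assms(2)] .

lemma transform_time:
  assumes "(f has_real_derivative r) (at t)" "\<bar>t\<bar> < \<epsilon>" "\<And>s. \<bar>s\<bar> < \<epsilon> \<Longrightarrow> f s = f' s"
  shows "(f' has_real_derivative r) (at t)"
  by (rule has_field_derivative_transform_within_open[OF assms(1), of "{-\<epsilon><..<\<epsilon>}"])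
    (use assms(2,3) in auto)

lemma B_bilinear:
  assumes t: "\<bar>t\<bar> < \<epsilon>"
  shows "bilinear (B t y)"
proof (rule bilinearI)
  fix u u' v r
  show "B t y (u + u') v = B t y u v + B t y u' v"
    by (rule B_eqI[OF t transform_time[OF DERIV_add[OF B_deriv[OF t] B_deriv[OF t]] t]])
      (simp add: bilinear_ladd[OF bil_s])
  show "B t y (r *\<^sub>R u) v = r *\<^sub>R B t y u v"
    unfolding real_scaleR_def
    by (rule B_eqI[OF t transform_time[OF DERIV_cmult[OF B_deriv[OF t]] t]])
      (simp add: bilinear_lmul[OF bil_s])
  show "B t y u (v + u') = B t y u v + B t y u u'"
    by (rule B_eqI[OF t transform_time[OF DERIV_add[OF B_deriv[OF t] B_deriv[OF t]] t]])
      (simp add: bilinear_radd[OF bil_s])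
  show "B t y u (r *\<^sub>R v) = r *\<^sub>R B t y u v"
    unfolding real_scaleR_def
    by (rule B_eqI[OF t transform_time[OF DERIV_cmult[OF B_deriv[OF t]] t]])
      (simp add: bilinear_rmul[OF bil_s])
qed

lemma B_sym: "\<bar>t\<bar> < \<epsilon> \<Longrightarrow> B t y u v = B t y v u"
  by (rule B_eqI, assumption, rule transform_time[OF B_deriv], assumption, assumption, rule sym_s)

lemma B_D: "\<bar>t\<bar> < \<epsilon> \<Longrightarrow> v \<in> D y \<Longrightarrow> B t y u v = 0"
proof -
  assume t: "\<bar>t\<bar> < \<epsilon>" and v: "v \<in> D y"
  show "B t y u v = 0"
    by (rule B_eqI[OF t transform_time[OF DERIV_const t]]) (rule constant_D[OF t _ v])
qed

text \<open>Interchange of the derivative in time with the derivative along \<open>z\<close>. In one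
  chart it reduces to \<open>mixed_time_space_derivative\<close> for the entries of the metric, as
  the components of \<open>X\<close> and \<open>Y\<close> do not depend on time.\<close>

lemma dir_deriv_variation:
  assumes t: "\<bar>t\<bar> < \<epsilon>" and X: "vfield_differentiable_at A x X" and Y: "vfield_differentiable_at A x Y"
  shows "((\<lambda>s. dir_deriv A x z (\<lambda>y. g s y (X y) (Y y))) has_real_derivative
      dir_deriv A x z (\<lambda>y. B t y (X y) (Y y))) (at t)"
    "fun_differentiable_at A x (\<lambda>y. B t y (X y) (Y y))"
proof -
  let ?c = "chart_at A x" and ?\<xi> = "snd (chart_at A x) x"
  let ?F = "\<lambda>i j (t, \<xi>). tensor_in A ?c (g t) \<xi> i j"
  have I: "open {-\<epsilon><..<\<epsilon>}" "t \<in> {-\<epsilon><..<\<epsilon>}" using t by auto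
  have S: "open (snd ?c ` fst ?c)" using open_image[OF chart_at_A(1) open_UNIV] by simp
  note mixed = mixed_time_space_derivative[OF I S chart_mem chart_smooth[OF chart_at_A(1)], simplified]
  have velocity: "deriv (\<lambda>s. tensor_in A ?c (g s) \<eta> i j) t = tensor_in A ?c (B t) \<eta> i j" for \<eta> i j
    unfolding metric_velocity_def tensor_in_def Let_def ..
  have GB: "(\<lambda>\<eta>. tensor_in A ?c (B t) \<eta> i j) differentiable (at ?\<xi>)" for i j
    using mixed(1)[of i j] unfolding velocity .
  have DG: "((\<lambda>s. frechet_derivative (\<lambda>\<eta>. tensor_in A ?c (g s) \<eta> i j) (at ?\<xi>) z) has_real_derivative
      frechet_derivative (\<lambda>\<eta>. tensor_in A ?c (B t) \<eta> i j) (at ?\<xi>) z) (at t)" for i j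
    using mixed(2)[of i j z] unfolding velocity .
  have G: "((\<lambda>s. tensor_in A ?c (g s) ?\<xi> i j) has_real_derivative tensor_in A ?c (B t) ?\<xi> i j) (at t)" for i j
    unfolding tensor_in_at[OF atlas] by (rule B_deriv[OF t])
  show "fun_differentiable_at A x (\<lambda>y. B t y (X y) (Y y))"
    by (rule dir_deriv_tensor(2)[OF B_bilinear[OF t] GB X Y])
  have expand: "dir_deriv A x z (\<lambda>y. g s y (X y) (Y y)) = (\<Sum>i\<in>Basis. \<Sum>j\<in>Basis.
      (vfield_in A ?c X ?\<xi> \<bullet> i) * ((vfield_in A ?c Y ?\<xi> \<bullet> j) * frechet_derivative (\<lambda>\<eta>. tensor_in A ?c (g s) \<eta> i j) (at ?\<xi>) z
        + (frechet_derivative (vfield_in A ?c Y) (at ?\<xi>) z \<bullet> j) * tensor_in A ?c (g s) ?\<xi> i j)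
      + (frechet_derivative (vfield_in A ?c X) (at ?\<xi>) z \<bullet> i) * ((vfield_in A ?c Y ?\<xi> \<bullet> j) * tensor_in A ?c (g s) ?\<xi> i j))"
    if s: "\<bar>s\<bar> < \<epsilon>" for s
  proof (rule dir_deriv_tensor(1)[OF bil_s[OF s] _ X Y])
    show "(\<lambda>\<eta>. tensor_in A ?c (g s) \<eta> i j) differentiable (at ?\<xi>)" for i j
      using tensor_in_derivative[OF atlas metric_s[OF s] refl] unfolding differentiable_def by blast
  qed
  have "((\<lambda>s. \<Sum>i\<in>Basis. \<Sum>j\<in>Basis.
      (vfield_in A ?c X ?\<xi> \<bullet> i) * ((vfield_in A ?c Y ?\<xi> \<bullet> j) * frechet_derivative (\<lambda>\<eta>. tensor_in A ?c (g s) \<eta> i j) (at ?\<xi>) z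
        + (frechet_derivative (vfield_in A ?c Y) (at ?\<xi>) z \<bullet> j) * tensor_in A ?c (g s) ?\<xi> i j)
      + (frechet_derivative (vfield_in A ?c X) (at ?\<xi>) z \<bullet> i) * ((vfield_in A ?c Y ?\<xi> \<bullet> j) * tensor_in A ?c (g s) ?\<xi> i j))
    has_real_derivative dir_deriv A x z (\<lambda>y. B t y (X y) (Y y))) (at t)"
    unfolding dir_deriv_tensor(1)[OF B_bilinear[OF t] GB X Y]
    by (intro DERIV_sum DERIV_add DERIV_cmult DG G)
  then show "((\<lambda>s. dir_deriv A x z (\<lambda>y. g s y (X y) (Y y))) has_real_derivative
      dir_deriv A x z (\<lambda>y. B t y (X y) (Y y))) (at t)"
    by (rule transform_time[OF _ t]) (simp only: expand)
qed

text \<open>The trace is computed in a frame \<open>E\<^sub>a(s) = \<Sum>\<^sub>j c\<^sub>a\<^sub>j(s) e\<^sub>j\<close> obtained from the Gram-Schmidt process;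
  differentiating \<open>g\<^sub>s(E\<^sub>a, E\<^sub>b)\<close> shows that \<open>\<sigma>\<^sub>a c'\<^sub>a\<^sub>b + \<sigma>\<^sub>b c'\<^sub>b\<^sub>a = - \<sigma>\<^sub>a \<sigma>\<^sub>b B(e\<^sub>a, e\<^sub>b)\<close>.\<close>

lemma trace_derivative:
  assumes t: "\<bar>t\<bar> < \<epsilon>" and e: "orthonormal_family (g t x) {..<n} e \<sigma>" "\<And>a. a < n \<Longrightarrow> e a \<in> Dt x"
    and f: "\<And>s. \<bar>s\<bar> < \<epsilon> \<Longrightarrow> bilinear (f s x)"
    and f': "\<And>a b. a < n \<Longrightarrow> b < n \<Longrightarrow> ((\<lambda>s. f s x (e a) (e b)) has_real_derivative f' a b) (at t)"
  shows "((\<lambda>s. trace_on (g s) Dt (f s) x) has_real_derivative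
    (\<Sum>a<n. \<sigma> a * f' a a) - (\<Sum>a<n. \<Sum>b<n. \<sigma> a * \<sigma> b * (B t x (e a) (e b) * f t x (e a) (e b)))) (at t)"
proof -
  \<comment> \<open>\<open>gram_schmidt\<close> asks for a symmetric bilinear form at every real
    parameter, but the family is controlled only for times below \<open>\<epsilon>\<close>;
    elsewhere it is frozen at \<open>g t\<close>.\<close>
  define b where "b s = (if \<bar>s\<bar> < \<epsilon> then g s x else g t x)" for s
  let ?I = "{-\<epsilon><..<\<epsilon>}"
  have b: "bilinear (b s)" "b s u v = b s v u" for s u v
    unfolding b_def using bil_s t sym_s by auto
  have bt: "b t = g t x" unfolding b_def using t by simp
  have I: "open ?I" "t \<in> ?I" using t by auto
  have reg: "open ?I \<and> (\<forall>s\<in>?I. (\<lambda>s. b s (e j) (e k)) differentiable (at s))" for j k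
  proof (intro conjI I ballI)
    fix s assume s: "s \<in> ?I"
    have "((\<lambda>s. b s (e j) (e k)) has_real_derivative B s x (e j) (e k)) (at s)"
      by (rule transform_time[OF B_deriv]) (use s in \<open>auto simp: b_def\<close>)
    then show "(\<lambda>s. b s (e j) (e k)) differentiable (at s)" unfolding real_differentiable_def by blast
  qed
  have "\<exists>W' c. open W' \<and> t \<in> W' \<and> W' \<subseteq> ?I \<and> (\<forall>k j. open W' \<and> (\<forall>s\<in>W'. c k j differentiable (at s))) \<and>
    (\<forall>k<n. \<forall>j<n. c k j t = (if j = k then 1 else 0)) \<and>
    (\<forall>k j y. k < j \<longrightarrow> c k j y = 0) \<and>
    (\<forall>y\<in>W'. orthonormal_family (b y) {..<n} (\<lambda>k. \<Sum>j<n. c k j y *\<^sub>R e j) \<sigma>)"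
    using e(1) by (intro time_functions.gram_schmidt[where e = "\<lambda>j _. e j", OF I b reg]) (simp add: bt)
  then obtain W c where H: "open W \<and> t \<in> W \<and> W \<subseteq> ?I \<and> (\<forall>k j. open W \<and> (\<forall>s\<in>W. c k j differentiable (at s))) \<and>
    (\<forall>k<n. \<forall>j<n. c k j t = (if j = k then 1 else 0)) \<and>
    (\<forall>k j y. k < j \<longrightarrow> c k j y = 0) \<and>
    (\<forall>y\<in>W. orthonormal_family (b y) {..<n} (\<lambda>k. \<Sum>j<n. c k j y *\<^sub>R e j) \<sigma>)"
    by (elim exE)
  have W: "open W" "t \<in> W" "W \<subseteq> ?I" using H by blast+
  have W_eps: "\<bar>s\<bar> < \<epsilon>" if "s \<in> W" for s using that W(3) time_interval by blast
  have ct: "c k j t = (if j = k then 1 else 0)" if "k < n" "j < n" for k j using H that by blast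
  define m where "m k j = deriv (c k j) t" for k j
  have dc: "(c k j has_real_derivative m k j) (at t)" for k j
    unfolding m_def DERIV_deriv_iff_real_differentiable using H by blast
  define E where "E k s = (\<Sum>j<n. c k j s *\<^sub>R e j)" for k s
  have Eon: "orthonormal_family (g s x) {..<n} (\<lambda>k. E k s) \<sigma>" if "s \<in> W" for s
  proof -
    have bs: "b s = g s x" unfolding b_def using W_eps[OF that] by simp
    have "orthonormal_family (b s) {..<n} (\<lambda>k. \<Sum>j<n. c k j s *\<^sub>R e j) \<sigma>" using H that by blast
    then show ?thesis unfolding E_def bs .
  qed
  have ED: "E k s \<in> Dt x" for k s
  proof -
    have "subspace (Dt x)" using smooth_Dt unfolding smooth_distribution_def by blast
    then show ?thesis unfolding E_def using e(2) by (intro subspace_sum subspace_scale) auto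
  qed
  \<comment> \<open>At time \<open>t\<close> the matrix \<open>c\<close> is the identity, so the
    product rule leaves a single term for the derivative of each of the three factors.\<close>
  have double: "((\<lambda>s. \<Sum>j<n. \<Sum>k<n. c a j s * (c b k s * \<psi> s j k)) has_real_derivative
      (\<Sum>j<n. m a j * \<psi> t j b) + (\<Sum>k<n. m b k * \<psi> t a k) + \<psi>' a b) (at t)"
    if ab: "a < n" "b < n" and \<psi>: "\<And>j k. j < n \<Longrightarrow> k < n \<Longrightarrow> ((\<lambda>s. \<psi> s j k) has_real_derivative \<psi>' j k) (at t)"
    for a b \<psi> \<psi>'
  proof -
    have "((\<lambda>s. \<Sum>j<n. \<Sum>k<n. c a j s * (c b k s * \<psi> s j k)) has_real_derivative
      (\<Sum>j<n. \<Sum>k<n. c a j t * (c b k t * \<psi>' j k + m b k * \<psi> t j k) + m a j * (c b k t * \<psi> t j k))) (at t)"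
      by (intro DERIV_sum DERIV_mult' dc \<psi>) auto
    moreover have "(\<Sum>j<n. \<Sum>k<n. c a j t * (c b k t * \<psi>' j k + m b k * \<psi> t j k) + m a j * (c b k t * \<psi> t j k)) =
      (\<Sum>j<n. \<Sum>k<n. (if j = a then if k = b then \<psi>' a b else 0 else 0) + (if j = a then m b k * \<psi> t a k else 0)
        + (if k = b then m a j * \<psi> t j b else 0))"
      by (intro sum.cong refl) (simp add: ct ab)
    moreover have "(\<Sum>j<n. \<Sum>k<n. if j = a then X k else 0) = (\<Sum>k<n. X k)" for X :: "nat \<Rightarrow> real"
      using ab by (subst sum.swap) simp
    ultimately show ?thesis using ab by (simp add: sum.distrib add_ac)
  qed
  have rel: "m a d * \<sigma> d + m d a * \<sigma> a = - B t x (e a) (e d)" if ad: "a < n" "d < n" for a d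
  proof -
    have "((\<lambda>s. \<Sum>j<n. \<Sum>k<n. c a j s * (c d k s * g s x (e j) (e k))) has_real_derivative
      (\<Sum>j<n. m a j * g t x (e j) (e d)) + (\<Sum>k<n. m d k * g t x (e a) (e k)) + B t x (e a) (e d)) (at t)"
      by (rule double[OF ad B_deriv[OF t]])
    then have "((\<lambda>s. if a = d then \<sigma> a else 0) has_real_derivative
      (\<Sum>j<n. m a j * g t x (e j) (e d)) + (\<Sum>k<n. m d k * g t x (e a) (e k)) + B t x (e a) (e d)) (at t)"
    proof (rule has_field_derivative_transform_within_open[OF _ W(1,2)])
      fix s assume s: "s \<in> W"
      then have bs: "bilinear (g s x)" by (intro bil_s W_eps)
      have "g s x (E a s) (E d s) = (\<Sum>j<n. \<Sum>k<n. c a j s * (c d k s * g s x (e j) (e k)))"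
        unfolding E_def bilinear_sum_left[OF bs] bilinear_lmul[OF bs]
        unfolding bilinear_sum_right[OF bs] bilinear_rmul[OF bs]
        by (simp add: sum_distrib_left)
      then show "(\<Sum>j<n. \<Sum>k<n. c a j s * (c d k s * g s x (e j) (e k))) = (if a = d then \<sigma> a else 0)"
        using orthonormal_familyD(1)[OF Eon[OF s], of a d] ad by simp
    qed
    then have "(\<Sum>j<n. m a j * g t x (e j) (e d)) + (\<Sum>k<n. m d k * g t x (e a) (e k)) + B t x (e a) (e d) = 0"
      using DERIV_unique[OF _ DERIV_const] by blast
    moreover have "(\<Sum>j<n. m a j * g t x (e j) (e d)) = (\<Sum>j<n. if j = d then m a d * \<sigma> d else 0)"
      by (intro sum.cong refl) (use orthonormal_familyD(1)[OF e(1)] ad in auto)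
    moreover have "(\<Sum>k<n. m d k * g t x (e a) (e k)) = (\<Sum>k<n. if k = a then m d a * \<sigma> a else 0)"
      by (intro sum.cong refl) (use orthonormal_familyD(1)[OF e(1)] ad in auto)
    ultimately show ?thesis using ad by simp
  qed
  let ?\<phi> = "\<lambda>j k. f t x (e j) (e k)"
  have "((\<lambda>s. \<Sum>a<n. \<sigma> a * (\<Sum>j<n. \<Sum>k<n. c a j s * (c a k s * f s x (e j) (e k)))) has_real_derivative
      (\<Sum>a<n. \<sigma> a * ((\<Sum>j<n. m a j * ?\<phi> j a) + (\<Sum>k<n. m a k * ?\<phi> a k) + f' a a))) (at t)"
    by (intro DERIV_sum DERIV_cmult double f') auto
  then have main: "((\<lambda>s. trace_on (g s) Dt (f s) x) has_real_derivative
      (\<Sum>a<n. \<sigma> a * ((\<Sum>j<n. m a j * ?\<phi> j a) + (\<Sum>k<n. m a k * ?\<phi> a k) + f' a a))) (at t)"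
  proof (rule has_field_derivative_transform_within_open[OF _ W(1,2)])
    fix s assume s: "s \<in> W"
    then have s': "\<bar>s\<bar> < \<epsilon>" by (rule W_eps)
    interpret s: split_metric A "g s" Dt D n p by (rule split_s[OF s'])
    note fs = f[OF s']
    have "trace_on (g s) Dt (f s) x = (\<Sum>a<n. \<sigma> a *\<^sub>R f s x (E a s) (E a s))"
      by (rule s.trace_on_eq[where b = "f s", OF fs Eon[OF s] ED])
    also have "\<dots> = (\<Sum>a<n. \<sigma> a * (\<Sum>j<n. \<Sum>k<n. c a j s * (c a k s * f s x (e j) (e k))))"
      unfolding E_def bilinear_sum_left[OF fs] bilinear_lmul[OF fs]
        unfolding bilinear_sum_right[OF fs] bilinear_rmul[OF fs]
      by (simp add: sum_distrib_left)
    finally show "(\<Sum>a<n. \<sigma> a * (\<Sum>j<n. \<Sum>k<n. c a j s * (c a k s * f s x (e j) (e k)))) = trace_on (g s) Dt (f s) x"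
      by simp
  qed
  \<comment> \<open>The matrix \<open>m\<close> itself depends on how the frame was orthonormalised.
    After renaming the indices it enters only through the symmetric combination that
    \<open>rel\<close> determines.\<close>
  have "(\<Sum>a<n. \<Sum>j<n. \<sigma> a * m a j * ?\<phi> j a) + (\<Sum>a<n. \<Sum>k<n. \<sigma> a * m a k * ?\<phi> a k) =
    (\<Sum>a<n. \<Sum>k<n. \<sigma> k * m k a * ?\<phi> a k) + (\<Sum>a<n. \<Sum>k<n. \<sigma> a * m a k * ?\<phi> a k)"
    by (subst (1) sum.swap) (rule refl)
  also have "\<dots> = (\<Sum>a<n. \<Sum>k<n. - (\<sigma> a * \<sigma> k * (B t x (e a) (e k) * ?\<phi> a k)))"
    unfolding sum.distrib[symmetric]
  proof (intro sum.cong refl)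
    fix a k assume "a \<in> {..<n}" "k \<in> {..<n}"
    then have ak: "a < n" "k < n" by auto
    have "\<sigma> k * m k a + \<sigma> a * m a k = \<sigma> a * \<sigma> k * (m a k * \<sigma> k + m k a * \<sigma> a)"
      using ak by (simp add: algebra_simps orthonormal_familyD(3)[OF e(1)])
    also have "\<dots> = - (\<sigma> a * \<sigma> k * B t x (e a) (e k))" unfolding rel[OF ak] by simp
    finally have "(\<sigma> k * m k a + \<sigma> a * m a k) * ?\<phi> a k = - (\<sigma> a * \<sigma> k * B t x (e a) (e k)) * ?\<phi> a k" by simp
    then show "\<sigma> k * m k a * ?\<phi> a k + \<sigma> a * m a k * ?\<phi> a k = - (\<sigma> a * \<sigma> k * (B t x (e a) (e k) * ?\<phi> a k))"
      by (simp add: distrib_right mult.assoc)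
  qed
  finally have L: "(\<Sum>a<n. \<Sum>j<n. \<sigma> a * m a j * ?\<phi> j a) + (\<Sum>a<n. \<Sum>k<n. \<sigma> a * m a k * ?\<phi> a k) =
    - (\<Sum>a<n. \<Sum>k<n. \<sigma> a * \<sigma> k * (B t x (e a) (e k) * ?\<phi> a k))" by (simp add: sum_negf)
  have "(\<Sum>a<n. \<sigma> a * ((\<Sum>j<n. m a j * ?\<phi> j a) + (\<Sum>k<n. m a k * ?\<phi> a k) + f' a a)) =
    (\<Sum>a<n. \<Sum>j<n. \<sigma> a * m a j * ?\<phi> j a) + (\<Sum>a<n. \<Sum>k<n. \<sigma> a * m a k * ?\<phi> a k) + (\<Sum>a<n. \<sigma> a * f' a a)"
    by (simp add: distrib_left sum.distrib sum_distrib_left mult.assoc)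
  then show ?thesis using main unfolding L by simp
qed

end

section \<open>Time derivatives of squared norms\<close>

context metric_variation
begin

text \<open>If \<open>g\<^sub>s(w\<^sub>s, \<cdot>)\<close> is a constant covector on \<open>Dt\<close>, then \<open>g\<^sub>s(w\<^sub>s, w\<^sub>s)\<close> is a trace of a constant form.\<close>

lemma constant_covector_derivative:
  assumes t: "\<bar>t\<bar> < \<epsilon>" and w: "\<And>s. \<bar>s\<bar> < \<epsilon> \<Longrightarrow> w s \<in> Dt x"
    and const: "\<And>s v. \<bar>s\<bar> < \<epsilon> \<Longrightarrow> v \<in> Dt x \<Longrightarrow> g s x (w s) v = g t x (w t) v"
  shows "((\<lambda>s. g s x (w s) (w s)) has_real_derivative - B t x (w t) (w t)) (at t)"
proof -
  interpret t: split_metric A "g t" Dt D n p by (rule split_s[OF t])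
  let ?l = "\<lambda>v. g t x (w t) (component Dt D x v)"
  define f :: "real \<Rightarrow> ('a, 'e) tensor02" where "f s y u v = ?l u * ?l v" for s y u v
  have f: "bilinear (f s x)" for s
    unfolding f_def by (rule bilinearI)
      (simp_all add: linear_add[OF t.linear_component] linear_cmul[OF t.linear_component]
        bilinear_radd[OF t.bil] bilinear_rmul[OF t.bil] distrib_left distrib_right mult_ac)
  let ?E = "frame (g t) Dt x" and ?s = "frame_sign (g t) Dt x"
  have "((\<lambda>s. f s x (?E a) (?E b)) has_real_derivative 0) (at t)" for a b
    unfolding f_def by (rule DERIV_const)
  from trace_derivative[where f = f and x = x, OF t t.frame_P f this]
  have "((\<lambda>s. trace_on (g s) Dt (f s) x) has_real_derivative
    - (\<Sum>a<n. \<Sum>b<n. ?s a * ?s b * (B t x (?E a) (?E b) * f t x (?E a) (?E b)))) (at t)" by simp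
  moreover have "(\<Sum>a<n. \<Sum>b<n. ?s a * ?s b * (B t x (?E a) (?E b) * f t x (?E a) (?E b))) = B t x (w t) (w t)"
  proof -
    have ex: "w t = (\<Sum>a<n. (?s a * g t x (w t) (?E a)) *\<^sub>R ?E a)"
      by (rule orthonormal_expansion[OF t.bil _ t.frame_P(1) t.subspace_P _ _ w[OF t]]) (simp_all add: t.frame_P t.dim_P)
    have "B t x (w t) (w t) = B t x (\<Sum>a<n. (?s a * g t x (w t) (?E a)) *\<^sub>R ?E a) (\<Sum>a<n. (?s a * g t x (w t) (?E a)) *\<^sub>R ?E a)"
      using ex by simp
    also have "\<dots> = (\<Sum>a<n. \<Sum>b<n. ?s a * ?s b * (B t x (?E a) (?E b) * f t x (?E a) (?E b)))"
    proof -
      note Bb = B_bilinear[OF t, of x]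
      have "B t x (\<Sum>a<n. r a *\<^sub>R ?E a) (\<Sum>a<n. r a *\<^sub>R ?E a) = (\<Sum>a<n. \<Sum>b<n. r a * (r b * B t x (?E a) (?E b)))" for r
        unfolding bilinear_sum_left[OF Bb] bilinear_lmul[OF Bb]
        unfolding bilinear_sum_right[OF Bb] bilinear_rmul[OF Bb]
        by (simp add: sum_distrib_left)
      then show ?thesis by (auto intro!: sum.cong simp: f_def t.component_P t.frame_P mult_ac)
    qed
    finally show ?thesis by simp
  qed
  ultimately have D: "((\<lambda>s. trace_on (g s) Dt (f s) x) has_real_derivative - B t x (w t) (w t)) (at t)" by simp
  show ?thesis
  proof (rule transform_time[OF D t])
    fix s assume s: "\<bar>s\<bar> < \<epsilon>"
    interpret s: split_metric A "g s" Dt D n p by (rule split_s[OF s])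
    let ?E = "frame (g s) Dt x" and ?s = "frame_sign (g s) Dt x"
    have "g s x (w s) (w s) = g s x (w s) (\<Sum>a<n. (?s a * g s x (w s) (?E a)) *\<^sub>R ?E a)"
      using orthonormal_expansion[OF s.bil _ s.frame_P(1) s.subspace_P _ _ w[OF s]] by (simp add: s.frame_P s.dim_P)
    also have "\<dots> = (\<Sum>a<n. ?s a * (g s x (w s) (?E a) * g s x (w s) (?E a)))"
      unfolding bilinear_sum_right[OF s.bil] bilinear_rmul[OF s.bil] by (simp add: mult_ac)
    also have "\<dots> = trace_on (g s) Dt (f s) x"
      unfolding trace_on_def Let_def s.dim_P f_def
      by (intro sum.cong refl) (simp add: s.frame_P t.component_P const[OF s])
    finally show "trace_on (g s) Dt (f s) x = g s x (w s) (w s)" by simp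
  qed
qed

text \<open>By \<open>constant_D\<close> the vectors \<open>e i\<close> of \<open>D\<close>,
  orthonormal at time \<open>t\<close>, compute inner products with \<open>D\<close>-valued vectors
  at every time \<open>s\<close>, with the same signs. In such products only the components
  move.\<close>

lemma inner_D_expansion:
  assumes t: "\<bar>t\<bar> < \<epsilon>" and e: "orthonormal_family (g t x) {..<n+p} e \<sigma>" "\<And>a. a < n \<Longrightarrow> e a \<in> Dt x"
      "\<And>i. i \<in> {n..<n+p} \<Longrightarrow> e i \<in> D x"
    and s: "\<bar>s\<bar> < \<epsilon>" and w': "w' \<in> D x"
  shows "g s x w w' = (\<Sum>i\<in>{n..<n+p}. \<sigma> i * (g s x w (e i) * g s x w' (e i)))"
proof -
  interpret t: split_metric A "g t" Dt D n p by (rule split_s[OF t])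
  have "w' = w' - component Dt D x w'" using t.component_Q[OF w'] by simp
  also have "\<dots> = (\<Sum>i\<in>{n..<n+p}. (\<sigma> i * g t x w' (e i)) *\<^sub>R e i)"
    by (rule t.component_expansion(2)[OF e])
  also have "\<dots> = (\<Sum>i\<in>{n..<n+p}. (\<sigma> i * g s x w' (e i)) *\<^sub>R e i)"
    by (intro sum.cong refl) (simp add: constant_D[OF t s e(3)])
  finally have "g s x w w' = g s x w (\<Sum>i\<in>{n..<n+p}. (\<sigma> i * g s x w' (e i)) *\<^sub>R e i)" by simp
  then show ?thesis unfolding bilinear_sum_right[OF bil_s[OF s]] bilinear_rmul[OF bil_s[OF s]] by (simp add: mult_ac)
qed

text \<open>\<open>trace_derivative\<close> is applied first to the inner and then to the outer
  trace of \<open>norm2_on_trace\<close>. Each application contributes one triple sum in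
  \<open>B\<close>, for the slot over which it traces; the components \<open>k\<close> contribute
  the factor 2 by the product rule.\<close>

lemma norm2_derivative:
  fixes K :: "real \<Rightarrow> ('a, 'e) tensor12" and e :: "nat \<Rightarrow> 'e"
  assumes t: "\<bar>t\<bar> < \<epsilon>" and e: "orthonormal_family (g t x) {..<n+p} e \<sigma>" "\<And>a. a < n \<Longrightarrow> e a \<in> Dt x"
      "\<And>i. i \<in> {n..<n+p} \<Longrightarrow> e i \<in> D x"
    and K: "\<And>s. \<bar>s\<bar> < \<epsilon> \<Longrightarrow> bilinear (K s x)" "\<And>s u v. \<bar>s\<bar> < \<epsilon> \<Longrightarrow> K s x u v \<in> D x"
    and k': "\<And>i a b. i \<in> {n..<n+p} \<Longrightarrow> a < n \<Longrightarrow> b < n \<Longrightarrow>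
      ((\<lambda>s. g s x (K s x (e a) (e b)) (e i)) has_real_derivative k' i a b) (at t)"
  defines "k \<equiv> \<lambda>i a b. g t x (K t x (e a) (e b)) (e i)"
  shows "((\<lambda>s. norm2_on (g s) Dt (K s) x) has_real_derivative
    (\<Sum>i\<in>{n..<n+p}. \<sigma> i * ((\<Sum>a<n. \<Sum>b<n. \<sigma> a * \<sigma> b * (2 * (k i a b * k' i a b)))
      - (\<Sum>a<n. \<Sum>b<n. \<Sum>c<n. \<sigma> a * \<sigma> b * \<sigma> c * (B t x (e b) (e c) * k i a b * k i a c))
      - (\<Sum>a<n. \<Sum>b<n. \<Sum>c<n. \<sigma> a * \<sigma> b * \<sigma> c * (B t x (e a) (e c) * k i a b * k i c b))))) (at t)"
proof -
  interpret t: split_metric A "g t" Dt D n p by (rule split_s[OF t])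
  let ?Q = "{n..<n+p}"
  have onP: "orthonormal_family (g t x) {..<n} e \<sigma>" by (rule orthonormal_family_subset[OF e(1)]) auto
  have inner: "g s x w w' = (\<Sum>i\<in>?Q. \<sigma> i * (g s x w (e i) * g s x w' (e i)))"
    if s: "\<bar>s\<bar> < \<epsilon>" and w: "w \<in> D x" "w' \<in> D x" for s w w'
    by (rule inner_D_expansion[OF t e s w(2)])
  define G :: "real \<Rightarrow> 'e \<Rightarrow> 'e \<Rightarrow> ('a, 'e) tensor02" where "G s u u' y v v' = g s y (K s y u v) (K s y u' v')" for s u u' y v v'
  define F :: "real \<Rightarrow> ('a, 'e) tensor02" where "F s y u u' = trace_on (g s) Dt (G s u u') y" for s y u u'
  have G: "bilinear (G s u u' x)" "bilinear (\<lambda>u u'. G s u u' x v v')" if s: "\<bar>s\<bar> < \<epsilon>" for s u u' v v'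
    unfolding G_def by (rule bilinearI, simp_all add: bilinear_ladd[OF K(1)[OF s]] bilinear_radd[OF K(1)[OF s]]
      bilinear_lmul[OF K(1)[OF s]] bilinear_rmul[OF K(1)[OF s]] bilinear_ladd[OF bil_s[OF s]] bilinear_radd[OF bil_s[OF s]]
      bilinear_lmul[OF bil_s[OF s]] bilinear_rmul[OF bil_s[OF s]])+
  have F: "bilinear (F s x)" if s: "\<bar>s\<bar> < \<epsilon>" for s
    unfolding F_def trace_on_def Let_def
    by (rule bilinearI) (simp_all add: bilinear_ladd[OF G(2)[OF s]] bilinear_radd[OF G(2)[OF s]]
      bilinear_lmul[OF G(2)[OF s]] bilinear_rmul[OF G(2)[OF s]] distrib_left sum.distrib sum_distrib_left mult.left_commute)
  have Gd: "((\<lambda>s. G s (e a) (e c) x (e b) (e d)) has_real_derivative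
      (\<Sum>i\<in>?Q. \<sigma> i * (k i a b * k' i c d + k' i a b * k i c d))) (at t)"
    if abcd: "a < n" "b < n" "c < n" "d < n" for a b c d
  proof (rule transform_time[OF _ t])
    show "((\<lambda>s. \<Sum>i\<in>?Q. \<sigma> i * (g s x (K s x (e a) (e b)) (e i) * g s x (K s x (e c) (e d)) (e i))) has_real_derivative
      (\<Sum>i\<in>?Q. \<sigma> i * (k i a b * k' i c d + k' i a b * k i c d))) (at t)"
      unfolding k_def using abcd by (intro DERIV_sum DERIV_cmult DERIV_mult' k')
  qed (simp only: G_def inner K(2))
  have Gt: "G t (e a) (e c) x (e b) (e d) = (\<Sum>i\<in>?Q. \<sigma> i * (k i a b * k i c d))" for a b c d
    unfolding G_def k_def by (rule inner[OF t K(2)[OF t] K(2)[OF t]])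
  have Fd: "((\<lambda>s. F s x (e a) (e c)) has_real_derivative
      (\<Sum>b<n. \<sigma> b * (\<Sum>i\<in>?Q. \<sigma> i * (k i a b * k' i c b + k' i a b * k i c b)))
      - (\<Sum>b<n. \<Sum>d<n. \<sigma> b * \<sigma> d * (B t x (e b) (e d) * (\<Sum>i\<in>?Q. \<sigma> i * (k i a b * k i c d))))) (at t)"
    if ac: "a < n" "c < n" for a c
    unfolding F_def Gt[symmetric]
    by (rule trace_derivative[where f = "\<lambda>s. G s (e a) (e c)", OF t onP e(2) G(1)]) (use Gd ac in auto)
  have Ft: "F t x (e a) (e c) = (\<Sum>b<n. \<sigma> b * (\<Sum>i\<in>?Q. \<sigma> i * (k i a b * k i c b)))" for a c
    unfolding F_def Gt[symmetric] using t.trace_on_eq[where b = "G t (e a) (e c)", OF G(1)[OF t] onP e(2)] by simp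
  have main: "((\<lambda>s. trace_on (g s) Dt (F s) x) has_real_derivative
    (\<Sum>a<n. \<sigma> a * ((\<Sum>b<n. \<sigma> b * (\<Sum>i\<in>?Q. \<sigma> i * (k i a b * k' i a b + k' i a b * k i a b)))
      - (\<Sum>b<n. \<Sum>d<n. \<sigma> b * \<sigma> d * (B t x (e b) (e d) * (\<Sum>i\<in>?Q. \<sigma> i * (k i a b * k i a d))))))
    - (\<Sum>a<n. \<Sum>c<n. \<sigma> a * \<sigma> c * (B t x (e a) (e c) * (\<Sum>b<n. \<sigma> b * (\<Sum>i\<in>?Q. \<sigma> i * (k i a b * k i c b)))))) (at t)"
    unfolding Ft[symmetric] by (rule trace_derivative[where f = F, OF t onP e(2) F Fd])
  have eq: "(\<Sum>a<n. \<sigma> a * ((\<Sum>b<n. \<sigma> b * (\<Sum>i\<in>?Q. \<sigma> i * (k i a b * k' i a b + k' i a b * k i a b)))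
      - (\<Sum>b<n. \<Sum>d<n. \<sigma> b * \<sigma> d * (B t x (e b) (e d) * (\<Sum>i\<in>?Q. \<sigma> i * (k i a b * k i a d))))))
    - (\<Sum>a<n. \<Sum>c<n. \<sigma> a * \<sigma> c * (B t x (e a) (e c) * (\<Sum>b<n. \<sigma> b * (\<Sum>i\<in>?Q. \<sigma> i * (k i a b * k i c b))))) =
    (\<Sum>i\<in>?Q. \<sigma> i * ((\<Sum>a<n. \<Sum>b<n. \<sigma> a * \<sigma> b * (2 * (k i a b * k' i a b)))
      - (\<Sum>a<n. \<Sum>b<n. \<Sum>c<n. \<sigma> a * \<sigma> b * \<sigma> c * (B t x (e b) (e c) * k i a b * k i a c))
      - (\<Sum>a<n. \<Sum>b<n. \<Sum>c<n. \<sigma> a * \<sigma> b * \<sigma> c * (B t x (e a) (e c) * k i a b * k i c b))))"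
  proof -
    have 1: "(\<Sum>a<n. \<sigma> a * (\<Sum>b<n. \<sigma> b * (\<Sum>i\<in>?Q. \<sigma> i * (k i a b * k' i a b + k' i a b * k i a b)))) =
      (\<Sum>i\<in>?Q. \<sigma> i * (\<Sum>a<n. \<Sum>b<n. \<sigma> a * \<sigma> b * (2 * (k i a b * k' i a b))))"
      unfolding sum_distrib_left by (subst sum_pull_out) (intro sum.cong refl, simp add: mult_ac)
    have 2: "(\<Sum>a<n. \<sigma> a * (\<Sum>b<n. \<Sum>d<n. \<sigma> b * \<sigma> d * (B t x (e b) (e d) * (\<Sum>i\<in>?Q. \<sigma> i * (k i a b * k i a d))))) =
      (\<Sum>i\<in>?Q. \<sigma> i * (\<Sum>a<n. \<Sum>b<n. \<Sum>c<n. \<sigma> a * \<sigma> b * \<sigma> c * (B t x (e b) (e c) * k i a b * k i a c)))"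
    proof -
      have "(\<Sum>a<n. \<sigma> a * (\<Sum>b<n. \<Sum>d<n. \<sigma> b * \<sigma> d * (B t x (e b) (e d) * (\<Sum>i\<in>?Q. \<sigma> i * (k i a b * k i a d))))) =
        (\<Sum>a<n. \<Sum>i\<in>?Q. \<Sum>b<n. \<Sum>d<n. \<sigma> a * (\<sigma> b * \<sigma> d * (B t x (e b) (e d) * (\<sigma> i * (k i a b * k i a d)))))"
        unfolding sum_distrib_left by (intro sum.cong[OF refl] sum_pull_out)
      also have "\<dots> = (\<Sum>i\<in>?Q. \<Sum>a<n. \<Sum>b<n. \<Sum>d<n. \<sigma> a * (\<sigma> b * \<sigma> d * (B t x (e b) (e d) * (\<sigma> i * (k i a b * k i a d)))))"
        by (rule sum.swap)
      also have "\<dots> = (\<Sum>i\<in>?Q. \<sigma> i * (\<Sum>a<n. \<Sum>b<n. \<Sum>c<n. \<sigma> a * \<sigma> b * \<sigma> c * (B t x (e b) (e c) * k i a b * k i a c)))"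
        unfolding sum_distrib_left by (intro sum.cong refl) (simp only: mult_ac)
      finally show ?thesis .
    qed
    have 3: "(\<Sum>a<n. \<Sum>c<n. \<sigma> a * \<sigma> c * (B t x (e a) (e c) * (\<Sum>b<n. \<sigma> b * (\<Sum>i\<in>?Q. \<sigma> i * (k i a b * k i c b))))) =
      (\<Sum>i\<in>?Q. \<sigma> i * (\<Sum>a<n. \<Sum>b<n. \<Sum>c<n. \<sigma> a * \<sigma> b * \<sigma> c * (B t x (e a) (e c) * k i a b * k i c b)))"
    proof -
      have "(\<Sum>a<n. \<Sum>c<n. \<sigma> a * \<sigma> c * (B t x (e a) (e c) * (\<Sum>b<n. \<sigma> b * (\<Sum>i\<in>?Q. \<sigma> i * (k i a b * k i c b))))) =
        (\<Sum>a<n. \<Sum>i\<in>?Q. \<Sum>c<n. \<Sum>b<n. \<sigma> a * \<sigma> c * (B t x (e a) (e c) * (\<sigma> b * (\<sigma> i * (k i a b * k i c b)))))"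
        unfolding sum_distrib_left by (intro sum.cong[OF refl] sum_pull_out)
      also have "\<dots> = (\<Sum>i\<in>?Q. \<Sum>a<n. \<Sum>c<n. \<Sum>b<n. \<sigma> a * \<sigma> c * (B t x (e a) (e c) * (\<sigma> b * (\<sigma> i * (k i a b * k i c b)))))"
        by (rule sum.swap)
      also have "\<dots> = (\<Sum>i\<in>?Q. \<Sum>a<n. \<Sum>b<n. \<Sum>c<n. \<sigma> a * \<sigma> c * (B t x (e a) (e c) * (\<sigma> b * (\<sigma> i * (k i a b * k i c b)))))"
        by (intro sum.cong[OF refl] sum.swap)
      also have "\<dots> = (\<Sum>i\<in>?Q. \<sigma> i * (\<Sum>a<n. \<Sum>b<n. \<Sum>c<n. \<sigma> a * \<sigma> b * \<sigma> c * (B t x (e a) (e c) * k i a b * k i c b)))"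
        unfolding sum_distrib_left by (intro sum.cong refl) (simp only: mult_ac)
      finally show ?thesis .
    qed
    show ?thesis
      unfolding right_diff_distrib sum_subtractf 1 2 3 ..
  qed
  have "trace_on (g s) Dt (F s) x = norm2_on (g s) Dt (K s) x" if s: "\<bar>s\<bar> < \<epsilon>" for s
  proof -
    interpret s: split_metric A "g s" Dt D n p by (rule split_s[OF s])
    show ?thesis unfolding s.norm2_on_trace F_def[abs_def] G_def[abs_def] ..
  qed
  then show ?thesis by (rule transform_time[OF main[unfolded eq] t])
qed

end

lemma antisymmetric_contraction:
  fixes \<sigma> :: "nat \<Rightarrow> real"
  assumes s: "\<And>a b. s a b = s b a" and Z: "\<And>a b. a < n \<Longrightarrow> b < n \<Longrightarrow> Z a b = - Z b a"
  shows "(\<Sum>a<n. \<Sum>b<n. \<sigma> a * \<sigma> b * (s a b * Z a b)) = 0"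
proof -
  have "(\<Sum>a<n. \<Sum>b<n. \<sigma> a * \<sigma> b * (s a b * Z a b)) = (\<Sum>b<n. \<Sum>a<n. \<sigma> a * \<sigma> b * (s a b * Z a b))"
    by (rule sum.swap)
  also have "\<dots> = (\<Sum>b<n. \<Sum>a<n. - (\<sigma> b * \<sigma> a * (s b a * Z b a)))"
  proof (intro sum.cong refl)
    fix a b assume "a \<in> {..<n}" "b \<in> {..<n}"
    then have "Z a b = - Z b a" by (intro Z) auto
    then show "\<sigma> a * \<sigma> b * (s a b * Z a b) = - (\<sigma> b * \<sigma> a * (s b a * Z b a))" using s[of a b] by simp
  qed
  finally show ?thesis by (simp add: sum_negf)
qed

text \<open>The motion of the frame in each of the two slots of \<open>t\<close> gives the same
  contraction, because moving an index from one slot to the other only changes the sign. This is the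
  origin of the factor 2 in the identity for \<open>T\<close>.\<close>

lemma torsion_contraction:
  fixes \<sigma> :: "nat \<Rightarrow> real"
  assumes t: "\<And>a b. t a b = - t b a"
  shows "- (\<Sum>a<n. \<Sum>b<n. \<Sum>c<n. \<sigma> a * \<sigma> b * \<sigma> c * (s b c * t a b * t a c))
      - (\<Sum>a<n. \<Sum>b<n. \<Sum>c<n. \<sigma> a * \<sigma> b * \<sigma> c * (s a c * t a b * t c b)) =
    2 * (\<Sum>a<n. \<Sum>b<n. \<sigma> a * \<sigma> b * (s a b * (\<Sum>c<n. \<sigma> c * (t a c * t c b))))"
proof -
  let ?r = "\<Sum>a<n. \<Sum>b<n. \<Sum>c<n. \<sigma> a * \<sigma> b * \<sigma> c * (s a b * t a c * t c b)"
  have "(\<Sum>a<n. \<Sum>b<n. \<Sum>c<n. \<sigma> a * \<sigma> b * \<sigma> c * (s b c * t a b * t a c)) =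
      (\<Sum>a<n. \<Sum>b<n. \<Sum>c<n. \<sigma> c * \<sigma> a * \<sigma> b * (s a b * t c a * t c b))"
    by (rule sum3_rotate)
  also have "\<dots> = (\<Sum>a<n. \<Sum>b<n. \<Sum>c<n. - (\<sigma> a * \<sigma> b * \<sigma> c * (s a b * t a c * t c b)))"
  proof (intro sum.cong refl)
    fix a b c
    show "\<sigma> c * \<sigma> a * \<sigma> b * (s a b * t c a * t c b) = - (\<sigma> a * \<sigma> b * \<sigma> c * (s a b * t a c * t c b))"
      by (subst t[of c a]) simp
  qed
  also have "\<dots> = - ?r" by (simp only: sum_negf)
  finally have 1: "(\<Sum>a<n. \<Sum>b<n. \<Sum>c<n. \<sigma> a * \<sigma> b * \<sigma> c * (s b c * t a b * t a c)) = - ?r" .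
  have "(\<Sum>a<n. \<Sum>b<n. \<Sum>c<n. \<sigma> a * \<sigma> b * \<sigma> c * (s a c * t a b * t c b)) =
      (\<Sum>a<n. \<Sum>c<n. \<Sum>b<n. \<sigma> a * \<sigma> b * \<sigma> c * (s a c * t a b * t c b))"
    by (intro sum.cong[OF refl] sum.swap)
  also have "\<dots> = (\<Sum>a<n. \<Sum>c<n. \<Sum>b<n. - (\<sigma> a * \<sigma> c * \<sigma> b * (s a c * t a b * t b c)))"
  proof (intro sum.cong refl)
    fix a b c
    show "\<sigma> a * \<sigma> b * \<sigma> c * (s a c * t a b * t c b) = - (\<sigma> a * \<sigma> c * \<sigma> b * (s a c * t a b * t b c))"
      by (subst t[of c b]) simp
  qed
  also have "\<dots> = - ?r" by (simp only: sum_negf)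
  finally have 2: "(\<Sum>a<n. \<Sum>b<n. \<Sum>c<n. \<sigma> a * \<sigma> b * \<sigma> c * (s a c * t a b * t c b)) = - ?r" .
  have "(\<Sum>a<n. \<Sum>b<n. \<sigma> a * \<sigma> b * (s a b * (\<Sum>c<n. \<sigma> c * (t a c * t c b)))) = ?r"
    unfolding sum_distrib_left by (intro sum.cong refl) (simp only: mult_ac)
  then show ?thesis unfolding 1 2 by simp
qed

section \<open>The identities for the geometry of \<open>D\<close>\<close>

context metric_variation
begin

lemma split_swapped: "\<bar>s\<bar> < \<epsilon> \<Longrightarrow> split_metric A (g s) D Dt p n"
  by (rule split_metric.swap[OF split_s])

text \<open>The metrics agree on \<open>D\<close>, so the predicate \<open>orthonormal_frame\<close>
  for \<open>D\<close> is literally the same at both times, and \<open>SOME\<close> must select the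
  same frame. No differentiation of a frame is needed for \<open>D\<close>.\<close>

lemma frame_D:
  assumes s: "\<bar>s\<bar> < \<epsilon>" and t: "\<bar>t\<bar> < \<epsilon>"
  shows "frame (g s) D x = frame (g t) D x"
    "a < p \<Longrightarrow> frame_sign (g s) D x a = frame_sign (g t) D x a"
proof -
  interpret t: split_metric A "g t" D Dt p n by (rule split_swapped[OF t])
  have "orthonormal_frame (g r x) (D x) E" if "orthonormal_frame (g q x) (D x) E" "\<bar>r\<bar> < \<epsilon>" "\<bar>q\<bar> < \<epsilon>" for E r q
  proof -
    have "g r x (E a) (E b) = g q x (E a) (E b)" if b: "b < dim (D x)" for a b
      by (rule constant_D) (use that b \<open>orthonormal_frame (g q x) (D x) E\<close> \<open>\<bar>r\<bar> < \<epsilon>\<close> \<open>\<bar>q\<bar> < \<epsilon>\<close> in \<open>auto simp: orthonormal_frame_def\<close>)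
    then show ?thesis using that(1) unfolding orthonormal_frame_def by simp
  qed
  then have "orthonormal_frame (g s x) (D x) = orthonormal_frame (g t x) (D x)" using s t by (intro ext) blast
  then show eq: "frame (g s) D x = frame (g t) D x" unfolding frame_def by simp
  show "frame_sign (g s) D x a = frame_sign (g t) D x a" if "a < p"
    unfolding frame_sign_def eq by (rule constant_D[OF s t t.frame_P(2)[OF that]])
qed

text \<open>In \<open>second_ff_lie\<close> every metric term has an argument in \<open>D\<close>:
  one of the sections or one of their values. \<open>constant_D\<close> applies to each, although
  the brackets may have components in both distributions.\<close>

lemma second_ff_D_constant:
  assumes s: "\<bar>s\<bar> < \<epsilon>" and t: "\<bar>t\<bar> < \<epsilon>" and uv: "u \<in> D x" "v \<in> D x" and z: "z \<in> Dt x"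
  shows "g s x (second_ff A D Dt (g s) x u v) z = g t x (second_ff A D Dt (g t) x u v) z"
proof -
  interpret t: split_metric A "g t" D Dt p n by (rule split_swapped[OF t])
  interpret s: split_metric A "g s" D Dt p n by (rule split_swapped[OF s])
  obtain X Y Z where X: "local_section A D x u X" and Y: "local_section A D x v Y" and Z: "local_section A Dt x z Z"
    using t.section_P[OF uv(1)] t.section_P[OF uv(2)] t.section_Q[OF z] by blast
  obtain W where W: "x \<in> W" "smooth_vfield_on A W Y" "\<And>y. y \<in> W \<Longrightarrow> Y y \<in> D y"
    using Y unfolding local_section_def by blast
  have "dir_deriv A x z (\<lambda>y. g s y (X y) (Y y)) = dir_deriv A x z (\<lambda>y. g t y (X y) (Y y))"
    by (rule dir_deriv_cong[OF smooth_vfield_on_open[OF W(2)] W(1)]) (rule constant_D[OF s t W(3)])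
  moreover have "g s x w a = g t x w a" if "w \<in> D x" for w a
    using constant_D[OF s t that, of a] sym_s[OF s] sym_s[OF t] by metis
  ultimately show ?thesis unfolding s.second_ff_lie[OF X Y Z] t.second_ff_lie[OF X Y Z] using uv by simp
qed

text \<open>The subtracted term only removes the summand \<open>B(H, H)\<close> contained in
  \<open>Phi_h\<close>; the content is that each \<open>g(h, h)\<close> with fixed frame vectors has
  derivative \<open>- B(h, h)\<close>.\<close>

lemma first_identity:
  assumes t: "\<bar>t\<bar> < \<epsilon>"
  shows "((\<lambda>s. norm2_on (g s) D (second_ff A D Dt (g s)) x) has_real_derivative
        Phi_h A D Dt (g t) (B t) x
        - B t x (mean_curvature A D Dt (g t) x) (mean_curvature A D Dt (g t) x)) (at t)"
proof -
  interpret t: split_metric A "g t" D Dt p n by (rule split_swapped[OF t])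
  let ?E = "frame (g t) D x" and ?s = "frame_sign (g t) D x"
  let ?h = "\<lambda>s i j. second_ff A D Dt (g s) x (?E i) (?E j)"
  have "((\<lambda>s. g s x (?h s i j) (?h s i j)) has_real_derivative - B t x (?h t i j) (?h t i j)) (at t)"
    if "i < p" "j < p" for i j
  proof (rule constant_covector_derivative[OF t])
    fix s assume s: "\<bar>s\<bar> < \<epsilon>"
    interpret s: split_metric A "g s" D Dt p n by (rule split_swapped[OF s])
    show "?h s i j \<in> Dt x" by (rule s.second_ff_in_Q)
    show "g s x (?h s i j) v = g t x (?h t i j) v" if "v \<in> Dt x" for v
      by (rule second_ff_D_constant[OF s t _ _ that]) (simp_all add: t.frame_P \<open>i < p\<close> \<open>j < p\<close>)
  qed
  then have D: "((\<lambda>s. \<Sum>i<p. \<Sum>j<p. ?s i * ?s j * g s x (?h s i j) (?h s i j)) has_real_derivative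
      (\<Sum>i<p. \<Sum>j<p. ?s i * ?s j * - B t x (?h t i j) (?h t i j))) (at t)"
    by (intro DERIV_sum DERIV_cmult) auto
  have "((\<lambda>s. norm2_on (g s) D (second_ff A D Dt (g s)) x) has_real_derivative
      (\<Sum>i<p. \<Sum>j<p. ?s i * ?s j * - B t x (?h t i j) (?h t i j))) (at t)"
  proof (rule transform_time[OF D t])
    fix s assume s: "\<bar>s\<bar> < \<epsilon>"
    show "(\<Sum>i<p. \<Sum>j<p. ?s i * ?s j * g s x (?h s i j) (?h s i j)) = norm2_on (g s) D (second_ff A D Dt (g s)) x"
      unfolding norm2_on_def Let_def t.dim_P frame_D(1)[OF s t]
      by (intro sum.cong refl) (simp add: frame_D(2)[OF s t])
  qed
  then show ?thesis unfolding Phi_h_def Let_def t.dim_P by (simp add: sum_negf)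
qed

lemma second_identity:
  assumes t: "\<bar>t\<bar> < \<epsilon>"
  shows "((\<lambda>s. g s x (mean_curvature A D Dt (g s) x) (mean_curvature A D Dt (g s) x)) has_real_derivative
        - B t x (mean_curvature A D Dt (g t) x) (mean_curvature A D Dt (g t) x)) (at t)"
proof (rule constant_covector_derivative[OF t])
  interpret t: split_metric A "g t" D Dt p n by (rule split_swapped[OF t])
  let ?E = "frame (g t) D x" and ?s = "frame_sign (g t) D x"
  fix s assume s: "\<bar>s\<bar> < \<epsilon>"
  interpret s: split_metric A "g s" D Dt p n by (rule split_swapped[OF s])
  have M: "mean_curvature A D Dt (g r) x = (\<Sum>i<p. ?s i *\<^sub>R second_ff A D Dt (g r) x (?E i) (?E i))" if r: "\<bar>r\<bar> < \<epsilon>" for r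
    unfolding mean_curvature_def trace_on_def Let_def t.dim_P frame_D(1)[OF r t]
    by (intro sum.cong refl) (simp add: frame_D(2)[OF r t])
  show "mean_curvature A D Dt (g s) x \<in> Dt x"
    unfolding M[OF s] by (intro subspace_sum subspace_scale s.subspace_Q s.second_ff_in_Q)
  show "g s x (mean_curvature A D Dt (g s) x) v = g t x (mean_curvature A D Dt (g t) x) v" if v: "v \<in> Dt x" for v
  proof -
    have "g r x (mean_curvature A D Dt (g r) x) v = (\<Sum>i<p. ?s i * g r x (second_ff A D Dt (g r) x (?E i) (?E i)) v)"
      if r: "\<bar>r\<bar> < \<epsilon>" for r
      unfolding M[OF r] by (simp add: bilinear_sum_left[OF bil_s[OF r]] bilinear_lmul[OF bil_s[OF r]])
    moreover have "g s x (second_ff A D Dt (g s) x (?E i) (?E i)) v = g t x (second_ff A D Dt (g t) x (?E i) (?E i)) v"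
      if "i < p" for i
      by (rule second_ff_D_constant[OF s t t.frame_P(2)[OF that] t.frame_P(2)[OF that] v])
    ultimately show ?thesis using s t by simp
  qed
qed

text \<open>The integrability tensor involves no metric and the frame of \<open>D\<close> does not
  move, so only the metric that measures the values is differentiated.\<close>

lemma fifth_identity:
  assumes t: "\<bar>t\<bar> < \<epsilon>"
  shows "((\<lambda>s. norm2_on (g s) D (integrability A D Dt) x) has_real_derivative - Phi_T A D Dt (g t) (B t) x) (at t)"
proof -
  interpret t: split_metric A "g t" D Dt p n by (rule split_swapped[OF t])
  let ?E = "frame (g t) D x" and ?s = "frame_sign (g t) D x"
  let ?T = "\<lambda>i j. integrability A D Dt x (?E i) (?E j)"
  have D: "((\<lambda>s. \<Sum>i<p. \<Sum>j<p. ?s i * ?s j * g s x (?T i j) (?T i j)) has_real_derivative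
      (\<Sum>i<p. \<Sum>j<p. ?s i * ?s j * B t x (?T i j) (?T i j))) (at t)"
    by (intro DERIV_sum DERIV_cmult B_deriv t)
  have "((\<lambda>s. norm2_on (g s) D (integrability A D Dt) x) has_real_derivative
      (\<Sum>i<p. \<Sum>j<p. ?s i * ?s j * B t x (?T i j) (?T i j))) (at t)"
  proof (rule transform_time[OF D t])
    fix s assume s: "\<bar>s\<bar> < \<epsilon>"
    show "(\<Sum>i<p. \<Sum>j<p. ?s i * ?s j * g s x (?T i j) (?T i j)) = norm2_on (g s) D (integrability A D Dt) x"
      unfolding norm2_on_def Let_def t.dim_P frame_D(1)[OF s t]
      by (intro sum.cong refl) (simp add: frame_D(2)[OF s t])
  qed
  then show ?thesis unfolding Phi_T_def Let_def t.dim_P by simp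
qed

section \<open>The identities for the geometry of \<open>Dt\<close>, in a frame adapted at a fixed
  time\<close>

context
  fixes t :: real and x :: 'a and W :: "'a set" and e :: "nat \<Rightarrow> ('a, 'e) vfield"
  assumes t: "\<bar>t\<bar> < \<epsilon>" and adapted: "adapted_frame A (g t) Dt D n p x W e"
begin

interpretation f: adapted_frame A "g t" Dt D n p x W e by (rule adapted)

lemma e_differentiable: "l < n + p \<Longrightarrow> vfield_differentiable_at A x (e l)"
  by (rule vfield_differentiable_smooth[OF f.smooth_e f.W(2)])

text \<open>\<open>B\<close> ignores the \<open>D\<close>-component of the bracket. Of the
  \<open>Dt\<close>-component, the covariant derivative of \<open>e i\<close> along
  \<open>e a\<close> gives \<open>hh\<close> and \<open>tt\<close>, and the one of
  \<open>e a\<close> along \<open>e i\<close> gives \<open>\<omega>\<close>.\<close>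

lemma velocity_bracket:
  assumes a: "a < n" and i: "i \<in> {n..<n+p}"
  shows "B t x u (lie_bracket A (e a) (e i) x) =
    - (\<Sum>c<n. f.\<sigma> c * (B t x u (e c x) * (f.hh i a c + f.tt i a c + f.\<omega> i a c)))"
proof -
  let ?w = "lie_bracket A (e a) (e i) x"
  note Bb = B_bilinear[OF t, of x]
  have inner: "g t x ?w (e c x) = - (f.hh i a c + f.tt i a c + f.\<omega> i a c)" if c: "c < n" for c
    using f.second_ff_plus_integrability[OF f.section_e_Q[OF f.W(2) i] f.e_P[OF f.W(2) a] f.e_P[OF f.W(2) c]]
    unfolding f.lie_bracket_nabla bilinear_lsub[OF f.bil] f.hh_def f.tt_def f.\<omega>_def by (simp add: algebra_simps)
  have "B t x u ?w = B t x u (component Dt D x ?w) + B t x u (?w - component Dt D x ?w)"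
    unfolding bilinear_radd[OF Bb, symmetric] by simp
  also have "\<dots> = B t x u (\<Sum>c<n. (f.\<sigma> c * g t x ?w (e c x)) *\<^sub>R e c x)"
    using B_D[OF t f.component_compl] unfolding f.expansion_P[OF f.W(2), symmetric] by simp
  also have "\<dots> = (\<Sum>c<n. - (f.\<sigma> c * (B t x u (e c x) * (f.hh i a c + f.tt i a c + f.\<omega> i a c))))"
    unfolding bilinear_sum_right[OF Bb] bilinear_rmul[OF Bb]
    by (rule sum.cong[OF refl]) (simp add: inner algebra_simps)
  finally show ?thesis by (simp only: sum_negf)
qed

text \<open>The velocity of the component of \<open>h\<close> on frame vectors held fixed at their
  values for time \<open>t\<close>. The motion of the frame is accounted for separately, in
  \<open>trace_derivative\<close>.\<close>

definition hh' :: "nat \<Rightarrow> nat \<Rightarrow> nat \<Rightarrow> real" where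
  "hh' i a b = - (1/2) * (dir_deriv A x (e i x) (\<lambda>y. B t y (e a y) (e b y))
    - (\<Sum>c<n. f.\<sigma> c * (B t x (e b x) (e c x) * (f.hh i a c + f.tt i a c + f.\<omega> i a c)))
    - (\<Sum>c<n. f.\<sigma> c * (B t x (e a x) (e c x) * (f.hh i b c + f.tt i b c + f.\<omega> i b c))))"

lemma second_ff_derivative:
  assumes i: "i \<in> {n..<n+p}" and ab: "a < n" "b < n"
  shows "((\<lambda>s. g s x (second_ff A Dt D (g s) x (e a x) (e b x)) (e i x)) has_real_derivative hh' i a b) (at t)"
proof -
  have "((\<lambda>s. - (1/2) * (dir_deriv A x (e i x) (\<lambda>y. g s y (e a y) (e b y))
      + g s x (e b x) (lie_bracket A (e a) (e i) x) + g s x (e a x) (lie_bracket A (e b) (e i) x))) has_real_derivative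
    - (1/2) * (dir_deriv A x (e i x) (\<lambda>y. B t y (e a y) (e b y))
      + B t x (e b x) (lie_bracket A (e a) (e i) x) + B t x (e a x) (lie_bracket A (e b) (e i) x))) (at t)"
    using ab by (intro DERIV_cmult DERIV_add B_deriv dir_deriv_variation e_differentiable t) auto
  then have "((\<lambda>s. g s x (second_ff A Dt D (g s) x (e a x) (e b x)) (e i x)) has_real_derivative
    - (1/2) * (dir_deriv A x (e i x) (\<lambda>y. B t y (e a y) (e b y))
      + B t x (e b x) (lie_bracket A (e a) (e i) x) + B t x (e a x) (lie_bracket A (e b) (e i) x))) (at t)"
  proof (rule transform_time[OF _ t])
    fix s assume s: "\<bar>s\<bar> < \<epsilon>"
    interpret s: split_metric A "g s" Dt D n p by (rule split_s[OF s])
    show "- (1/2) * (dir_deriv A x (e i x) (\<lambda>y. g s y (e a y) (e b y))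
        + g s x (e b x) (lie_bracket A (e a) (e i) x) + g s x (e a x) (lie_bracket A (e b) (e i) x)) =
      g s x (second_ff A Dt D (g s) x (e a x) (e b x)) (e i x)"
      using s.second_ff_lie[OF f.section_e_P[OF f.W(2) ab(1)] f.section_e_P[OF f.W(2) ab(2)] f.section_e_Q[OF f.W(2) i]] by simp
  qed
  then show ?thesis unfolding hh'_def velocity_bracket[OF ab(1) i] velocity_bracket[OF ab(2) i] by simp
qed

lemma tt_antisym: "f.tt i a b = - f.tt i b a"
  unfolding f.tt_def using f.integrability_antisym[of x "e a x" "e b x"] by (simp add: bilinear_lneg[OF f.bil])

lemma \<omega>_antisym:
  assumes "a < n" "b < n"
  shows "f.\<omega> i a b = - f.\<omega> i b a"
proof -
  have "dir_deriv A x (e i x) (\<lambda>y. g t y (e a y) (e b y)) = dir_deriv A x (e i x) (\<lambda>_. if a = b then f.\<sigma> a else 0)"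
    by (rule dir_deriv_cong[OF f.W]) (use orthonormal_familyD(1)[OF f.on_P, of _ a b] assms in auto)
  then have "g t x (nabla A (g t) x (e i x) (e a)) (e b x) + g t x (e a x) (nabla A (g t) x (e i x) (e b)) = 0"
    unfolding f.dir_deriv_inner[OF f.section_e_P[OF f.W(2) assms(1)] f.section_e_P[OF f.W(2) assms(2)]] dir_deriv_const .
  then show ?thesis unfolding f.\<omega>_def using f.sym[of x "e a x"] by simp
qed

lemma velocity_differentiable: "a < n \<Longrightarrow> b < n \<Longrightarrow> fun_differentiable_at A x (\<lambda>y. B t y (e a y) (e b y))"
  by (rule dir_deriv_variation(2)[OF t]) (simp_all add: e_differentiable)

text \<open>Both sides are sums over the directions \<open>e i\<close> of \<open>D\<close>, and for
  each \<open>i\<close> they agree by \<open>contraction_identity\<close>, with the components of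
  \<open>B t\<close> as \<open>s\<close> and their derivatives along \<open>e i\<close> as
  \<open>\<beta>\<close>.\<close>

lemma third_identity_adapted:
  "((\<lambda>s. norm2_on (g s) Dt (second_ff A Dt D (g s)) x) has_real_derivative
        pairing (g t) (\<lambda>y u v. div_h A Dt D (g t) y u v + flat (g t) (cal_K A Dt D (g t)) y u v) (B t) x
        - divergence A Dt D (g t) (h_contract A Dt D (g t) (B t)) x) (at t)"
proof (rule DERIV_cong)
  show "((\<lambda>s. norm2_on (g s) Dt (second_ff A Dt D (g s)) x) has_real_derivative
    (\<Sum>i\<in>{n..<n+p}. f.\<sigma> i * ((\<Sum>a<n. \<Sum>b<n. f.\<sigma> a * f.\<sigma> b * (2 * (f.hh i a b * hh' i a b)))
      - (\<Sum>a<n. \<Sum>b<n. \<Sum>c<n. f.\<sigma> a * f.\<sigma> b * f.\<sigma> c * (B t x (e b x) (e c x) * f.hh i a b * f.hh i a c))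
      - (\<Sum>a<n. \<Sum>b<n. \<Sum>c<n. f.\<sigma> a * f.\<sigma> b * f.\<sigma> c * (B t x (e a x) (e c x) * f.hh i a b * f.hh i c b))))) (at t)"
    unfolding f.hh_def
  proof (rule norm2_derivative[where K = "\<lambda>s. second_ff A Dt D (g s)" and e = "\<lambda>l. e l x", OF t f.on[OF f.W(2)]])
    show "bilinear (second_ff A Dt D (g s) x)" if "\<bar>s\<bar> < \<epsilon>" for s
      by (rule split_metric.bilinear_second_ff[OF split_s[OF that]])
    show "second_ff A Dt D (g s) x u v \<in> D x" if "\<bar>s\<bar> < \<epsilon>" for s u v
      by (rule split_metric.second_ff_in_Q[OF split_s[OF that]])
  qed (simp_all add: f.e_P f.e_Q f.W second_ff_derivative)
  show "(\<Sum>i\<in>{n..<n+p}. f.\<sigma> i * ((\<Sum>a<n. \<Sum>b<n. f.\<sigma> a * f.\<sigma> b * (2 * (f.hh i a b * hh' i a b)))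
      - (\<Sum>a<n. \<Sum>b<n. \<Sum>c<n. f.\<sigma> a * f.\<sigma> b * f.\<sigma> c * (B t x (e b x) (e c x) * f.hh i a b * f.hh i a c))
      - (\<Sum>a<n. \<Sum>b<n. \<Sum>c<n. f.\<sigma> a * f.\<sigma> b * f.\<sigma> c * (B t x (e a x) (e c x) * f.hh i a b * f.hh i c b)))) =
    pairing (g t) (\<lambda>y u v. div_h A Dt D (g t) y u v + flat (g t) (cal_K A Dt D (g t)) y u v) (B t) x
        - divergence A Dt D (g t) (h_contract A Dt D (g t) (B t)) x"
  proof (rule trans[OF _ f.third_identity_rhs[where S = "B t", symmetric]], goal_cases)
    case 1
    show ?case
      by (intro sum.cong refl arg_cong2[where f = "(*)"] contraction_identity)
        (rule f.hh_sym B_sym[OF t] tt_antisym hh'_def | erule (1) \<omega>_antisym)+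
  qed (rule B_bilinear[OF t] B_sym[OF t] | erule B_D[OF t] | erule (1) velocity_differentiable)+
qed

text \<open>The components \<open>\<tau> i\<close> of the mean curvature along fixed vectors of
  \<open>D\<close> are traces. Each has derivative \<open>- (1/2) * \<beta> i\<close>, and squaring
  removes the factor 1/2.\<close>

lemma fourth_identity_adapted:
  "((\<lambda>s. g s x (mean_curvature A Dt D (g s) x) (mean_curvature A Dt D (g s) x)) has_real_derivative
        pairing (g t)
          (\<lambda>y u v. divergence A Dt D (g t) (mean_curvature A Dt D (g t)) y
             * g t y (component Dt D y u) (component Dt D y v)) (B t) x
        - divergence A Dt D (g t)
            (\<lambda>y. trace_on (g t) Dt (B t) y *\<^sub>R mean_curvature A Dt D (g t) y) x) (at t)"
proof -
  let ?Q = "{n..<n+p}"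
  define \<tau> where "\<tau> i s = g s x (mean_curvature A Dt D (g s) x) (e i x)" for i s
  define \<beta> where "\<beta> i = (\<Sum>a<n. f.\<sigma> a * dir_deriv A x (e i x) (\<lambda>y. B t y (e a y) (e a y)))" for i
  define F :: "nat \<Rightarrow> real \<Rightarrow> ('a, 'e) tensor02" where
    "F i s y u v = g s y (second_ff A Dt D (g s) y u v) (e i x)" for i s y u v
  have F: "bilinear (F i s x)" if s: "\<bar>s\<bar> < \<epsilon>" for i s
  proof -
    note h = split_metric.bilinear_second_ff[OF split_s[OF s], of x]
    show ?thesis unfolding F_def by (rule bilinearI)
      (simp_all add: bilinear_ladd[OF h] bilinear_radd[OF h] bilinear_lmul[OF h] bilinear_rmul[OF h]
        bilinear_ladd[OF bil_s[OF s]] bilinear_lmul[OF bil_s[OF s]])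
  qed
  have \<tau>F: "\<tau> i s = trace_on (g s) Dt (F i s) x" if s: "\<bar>s\<bar> < \<epsilon>" for i s
    unfolding \<tau>_def F_def mean_curvature_def trace_on_def Let_def bilinear_sum_left[OF bil_s[OF s]]
    by (simp add: bilinear_lmul[OF bil_s[OF s]])
  have \<tau>t: "\<tau> i t = (\<Sum>a<n. f.\<sigma> a * f.hh i a a)" for i
    unfolding \<tau>F[OF t] using f.trace_on_eq[where b = "F i t", OF F[OF t] f.on_P[OF f.W(2)] f.e_P[OF f.W(2)]]
    by (simp add: F_def f.hh_def)
  \<comment> \<open>In the trace of \<open>hh'\<close> the skew parts \<open>tt\<close> and
    \<open>\<omega>\<close> vanish against the symmetric \<open>B\<close>, and the part
    \<open>hh\<close> is cancelled by the subtracted sum, which is due to the motion of the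
    frame.\<close>
  have trace: "(\<Sum>a<n. f.\<sigma> a * hh' i a a) - (\<Sum>a<n. \<Sum>b<n. f.\<sigma> a * f.\<sigma> b * (B t x (e a x) (e b x) * f.hh i a b)) = - (1/2) * \<beta> i" for i
  proof -
    let ?B = "\<lambda>a b. B t x (e a x) (e b x)"
    have "f.\<sigma> a * hh' i a a = - (1/2) * (f.\<sigma> a * dir_deriv A x (e i x) (\<lambda>y. B t y (e a y) (e a y)))
        + ((\<Sum>b<n. f.\<sigma> a * f.\<sigma> b * (?B a b * f.hh i a b)) + (\<Sum>b<n. f.\<sigma> a * f.\<sigma> b * (?B a b * f.tt i a b))
          + (\<Sum>b<n. f.\<sigma> a * f.\<sigma> b * (?B a b * f.\<omega> i a b)))" for a
    proof -
      define u where "u = (\<Sum>c<n. f.\<sigma> c * (?B a c * (f.hh i a c + f.tt i a c + f.\<omega> i a c)))"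
      have "(\<Sum>b<n. f.\<sigma> a * f.\<sigma> b * (?B a b * f.hh i a b)) + (\<Sum>b<n. f.\<sigma> a * f.\<sigma> b * (?B a b * f.tt i a b))
          + (\<Sum>b<n. f.\<sigma> a * f.\<sigma> b * (?B a b * f.\<omega> i a b)) = f.\<sigma> a * u"
        unfolding u_def sum.distrib[symmetric] sum_distrib_left by (intro sum.cong refl) (simp add: algebra_simps)
      then show ?thesis unfolding hh'_def u_def[symmetric] by (simp add: field_simps)
    qed
    then have "(\<Sum>a<n. f.\<sigma> a * hh' i a a) = - (1/2) * \<beta> i
      + ((\<Sum>a<n. \<Sum>b<n. f.\<sigma> a * f.\<sigma> b * (?B a b * f.hh i a b)) + (\<Sum>a<n. \<Sum>b<n. f.\<sigma> a * f.\<sigma> b * (?B a b * f.tt i a b))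
          + (\<Sum>a<n. \<Sum>b<n. f.\<sigma> a * f.\<sigma> b * (?B a b * f.\<omega> i a b)))"
      unfolding \<beta>_def by (simp only: sum.distrib sum_distrib_left)
    moreover have "(\<Sum>a<n. \<Sum>b<n. f.\<sigma> a * f.\<sigma> b * (?B a b * f.tt i a b)) = 0"
      by (rule antisymmetric_contraction) (rule B_sym[OF t], rule tt_antisym)
    moreover have "(\<Sum>a<n. \<Sum>b<n. f.\<sigma> a * f.\<sigma> b * (?B a b * f.\<omega> i a b)) = 0"
      by (rule antisymmetric_contraction) (rule B_sym[OF t], rule \<omega>_antisym)
    ultimately show ?thesis by simp
  qed
  have D\<tau>: "(\<tau> i has_real_derivative - (1/2) * \<beta> i) (at t)" if i: "i \<in> ?Q" for i
  proof (rule transform_time[OF _ t])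
    have "((\<lambda>s. F i s x (e a x) (e b x)) has_real_derivative hh' i a b) (at t)" if "a < n" "b < n" for a b
      unfolding F_def by (rule second_ff_derivative[OF i that])
    from trace_derivative[where f = "F i" and e = "\<lambda>l. e l x", OF t f.on_P[OF f.W(2)] f.e_P[OF f.W(2)] F this]
    show "((\<lambda>s. trace_on (g s) Dt (F i s) x) has_real_derivative - (1/2) * \<beta> i) (at t)"
      unfolding trace[symmetric] by (simp add: F_def f.hh_def)
  qed (simp add: \<tau>F)
  have D: "((\<lambda>s. \<Sum>i\<in>?Q. f.\<sigma> i * (\<tau> i s * \<tau> i s)) has_real_derivative
      (\<Sum>i\<in>?Q. f.\<sigma> i * (\<tau> i t * (- (1/2) * \<beta> i) + - (1/2) * \<beta> i * \<tau> i t))) (at t)"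
    by (intro DERIV_sum DERIV_cmult DERIV_mult' D\<tau>)
  have "((\<lambda>s. g s x (mean_curvature A Dt D (g s) x) (mean_curvature A Dt D (g s) x)) has_real_derivative
      (\<Sum>i\<in>?Q. f.\<sigma> i * (\<tau> i t * (- (1/2) * \<beta> i) + - (1/2) * \<beta> i * \<tau> i t))) (at t)"
  proof (rule transform_time[OF D t])
    fix s assume s: "\<bar>s\<bar> < \<epsilon>"
    interpret s: split_metric A "g s" Dt D n p by (rule split_s[OF s])
    have "mean_curvature A Dt D (g s) x \<in> D x"
      unfolding mean_curvature_def trace_on_def Let_def
      by (intro subspace_sum subspace_scale s.subspace_Q s.second_ff_in_Q)
    then show "(\<Sum>i\<in>?Q. f.\<sigma> i * (\<tau> i s * \<tau> i s)) = g s x (mean_curvature A Dt D (g s) x) (mean_curvature A Dt D (g s) x)"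
      unfolding \<tau>_def
      by (intro inner_D_expansion[where e = "\<lambda>l. e l x", OF t f.on[OF f.W(2)] _ _ s, symmetric]) (simp_all add: f.e_P f.e_Q f.W)
  qed
  moreover have "(\<Sum>i\<in>?Q. f.\<sigma> i * (\<tau> i t * (- (1/2) * \<beta> i) + - (1/2) * \<beta> i * \<tau> i t)) =
    - (\<Sum>i\<in>?Q. f.\<sigma> i * ((\<Sum>a<n. f.\<sigma> a * f.hh i a a) * \<beta> i))"
    unfolding sum_negf[symmetric] \<tau>t by (intro sum.cong refl) simp
  ultimately have "((\<lambda>s. g s x (mean_curvature A Dt D (g s) x) (mean_curvature A Dt D (g s) x)) has_real_derivative
      - (\<Sum>i\<in>?Q. f.\<sigma> i * ((\<Sum>a<n. f.\<sigma> a * f.hh i a a) * \<beta> i))) (at t)" by (simp only:)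
  then show ?thesis
  proof (rule DERIV_cong, goal_cases)
    case 1
    show ?case unfolding \<beta>_def
      by (rule f.fourth_identity_rhs[where S = "B t", symmetric])
        (rule B_bilinear[OF t] B_sym[OF t] | erule B_D[OF t] | erule (1) velocity_differentiable)+
  qed
qed

text \<open>The integrability tensor does not depend on the metric, and its components are taken
  along vectors of \<open>D\<close>, where \<open>constant_D\<close> holds. They are constant, so
  the derivative comes entirely from the motion of the frame of \<open>Dt\<close>.\<close>

lemma sixth_identity_adapted:
  "((\<lambda>s. norm2_on (g s) Dt (integrability A Dt D) x) has_real_derivative
        2 * pairing (g t) (flat (g t) (cal_T A Dt D (g t))) (B t) x) (at t)"
proof (rule DERIV_cong)
  show "((\<lambda>s. norm2_on (g s) Dt (integrability A Dt D) x) has_real_derivative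
    (\<Sum>i\<in>{n..<n+p}. f.\<sigma> i * ((\<Sum>a<n. \<Sum>b<n. f.\<sigma> a * f.\<sigma> b * (2 * (f.tt i a b * 0)))
      - (\<Sum>a<n. \<Sum>b<n. \<Sum>c<n. f.\<sigma> a * f.\<sigma> b * f.\<sigma> c * (B t x (e b x) (e c x) * f.tt i a b * f.tt i a c))
      - (\<Sum>a<n. \<Sum>b<n. \<Sum>c<n. f.\<sigma> a * f.\<sigma> b * f.\<sigma> c * (B t x (e a x) (e c x) * f.tt i a b * f.tt i c b))))) (at t)"
    unfolding f.tt_def
  proof (rule norm2_derivative[where K = "\<lambda>s. integrability A Dt D" and e = "\<lambda>l. e l x", OF t f.on[OF f.W(2)]])
    show "((\<lambda>s. g s x (integrability A Dt D x (e a x) (e b x)) (e i x)) has_real_derivative 0) (at t)"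
      if "i \<in> {n..<n+p}" for i a b
      by (rule transform_time[OF DERIV_const t]) (rule constant_D[OF t _ f.e_Q[OF f.W(2) that]])
  qed (simp_all add: f.e_P f.e_Q f.W f.bilinear_integrability f.integrability_in_Q)
  show "(\<Sum>i\<in>{n..<n+p}. f.\<sigma> i * ((\<Sum>a<n. \<Sum>b<n. f.\<sigma> a * f.\<sigma> b * (2 * (f.tt i a b * 0)))
      - (\<Sum>a<n. \<Sum>b<n. \<Sum>c<n. f.\<sigma> a * f.\<sigma> b * f.\<sigma> c * (B t x (e b x) (e c x) * f.tt i a b * f.tt i a c))
      - (\<Sum>a<n. \<Sum>b<n. \<Sum>c<n. f.\<sigma> a * f.\<sigma> b * f.\<sigma> c * (B t x (e a x) (e c x) * f.tt i a b * f.tt i c b)))) =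
    2 * pairing (g t) (flat (g t) (cal_T A Dt D (g t))) (B t) x"
  proof (rule trans[OF _ arg_cong[where f = "(*) 2", OF f.sixth_identity_rhs[where S = "B t", symmetric]]], goal_cases)
    case 1
    have "f.\<sigma> i * ((\<Sum>a<n. \<Sum>b<n. f.\<sigma> a * f.\<sigma> b * (2 * (f.tt i a b * 0)))
      - (\<Sum>a<n. \<Sum>b<n. \<Sum>c<n. f.\<sigma> a * f.\<sigma> b * f.\<sigma> c * (B t x (e b x) (e c x) * f.tt i a b * f.tt i a c))
      - (\<Sum>a<n. \<Sum>b<n. \<Sum>c<n. f.\<sigma> a * f.\<sigma> b * f.\<sigma> c * (B t x (e a x) (e c x) * f.tt i a b * f.tt i c b))) =
      2 * (f.\<sigma> i * (\<Sum>a<n. \<Sum>b<n. f.\<sigma> a * f.\<sigma> b * (B t x (e a x) (e b x) * (\<Sum>c<n. f.\<sigma> c * (f.tt i a c * f.tt i c b)))))" for i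
      using torsion_contraction[of "f.tt i" f.\<sigma> "\<lambda>a b. B t x (e a x) (e b x)" n, OF tt_antisym] by simp
    then show ?case unfolding sum_distrib_left[of 2] by (intro sum.cong refl)
  qed (rule B_bilinear[OF t] B_sym[OF t] | erule B_D[OF t] | erule (1) velocity_differentiable)+
qed

end

lemma adapted_frame_at:
  assumes t: "\<bar>t\<bar> < \<epsilon>"
  shows "\<exists>W e. adapted_frame A (g t) Dt D n p x W e"
proof -
  interpret t: split_metric A "g t" Dt D n p by (rule split_s[OF t])
  from t.adapted_frame_exists[of x] obtain W e where H: "open W \<and> x \<in> W \<and> (\<forall>l<n+p. smooth_vfield_on A W (e l) \<and> e l x = full_frame (g t) Dt D x l) \<and>
    (\<forall>y\<in>W. (\<forall>l<n. e l y \<in> Dt y) \<and> (\<forall>l\<in>{n..<n+p}. e l y \<in> D y) \<and>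
      orthonormal_family (g t y) {..<n+p} (\<lambda>l. e l y) (\<lambda>l. g t x (full_frame (g t) Dt D x l) (full_frame (g t) Dt D x l)))"
    by (elim exE)
  have "adapted_frame A (g t) Dt D n p x W e"
    by unfold_locales (use H in blast)+
  then show ?thesis by blast
qed

end

theorem proposition1p3:
  fixes A :: "('a::{t2_space, second_countable_topology}, 'e::euclidean_space) chart set"
    and Dt D :: "('a, 'e) distribution"
    and g0 :: "('a, 'e) tensor02"
    and g B :: "real \<Rightarrow> ('a, 'e) tensor02"
    and n p :: nat and \<epsilon> t :: real and x :: 'a
  assumes "smooth_atlas A" and "connected (UNIV :: 'a set)" and "DIM('e) = n + p"
    and "smooth_distribution A n Dt"
    and "pseudo_metric A g0" and "\<And>y. nondegenerate_on (g0 y) (Dt y)"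
    and "D = orth_complement g0 Dt"
    and "gtop_variation A Dt g0 \<epsilon> g"
    and "B = metric_velocity g"
    and "\<bar>t\<bar> < \<epsilon>"
  shows
    "((\<lambda>s. norm2_on (g s) D (second_ff A D Dt (g s)) x) has_real_derivative
        Phi_h A D Dt (g t) (B t) x
        - B t x (mean_curvature A D Dt (g t) x) (mean_curvature A D Dt (g t) x)) (at t) \<and>
     ((\<lambda>s. g s x (mean_curvature A D Dt (g s) x) (mean_curvature A D Dt (g s) x)) has_real_derivative
        - B t x (mean_curvature A D Dt (g t) x) (mean_curvature A D Dt (g t) x)) (at t) \<and>
     ((\<lambda>s. norm2_on (g s) Dt (second_ff A Dt D (g s)) x) has_real_derivative
        pairing (g t) (\<lambda>y u v. div_h A Dt D (g t) y u v + flat (g t) (cal_K A Dt D (g t)) y u v) (B t) x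
        - divergence A Dt D (g t) (h_contract A Dt D (g t) (B t)) x) (at t) \<and>
     ((\<lambda>s. g s x (mean_curvature A Dt D (g s) x) (mean_curvature A Dt D (g s) x)) has_real_derivative
        pairing (g t)
          (\<lambda>y u v. divergence A Dt D (g t) (mean_curvature A Dt D (g t)) y
             * g t y (component Dt D y u) (component Dt D y v)) (B t) x
        - divergence A Dt D (g t)
            (\<lambda>y. trace_on (g t) Dt (B t) y *\<^sub>R mean_curvature A Dt D (g t) y) x) (at t) \<and>
     ((\<lambda>s. norm2_on (g s) D (integrability A D Dt) x) has_real_derivative
        - Phi_T A D Dt (g t) (B t) x) (at t) \<and>
     ((\<lambda>s. norm2_on (g s) Dt (integrability A Dt D) x) has_real_derivative
        2 * pairing (g t) (flat (g t) (cal_T A Dt D (g t))) (B t) x) (at t)"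
proof -
  interpret metric_variation A Dt D g0 g n p \<epsilon>
    by unfold_locales (fact assms)+
  note t = \<open>\<bar>t\<bar> < \<epsilon>\<close>
  obtain W e where "adapted_frame A (g t) Dt D n p x W e" using adapted_frame_at[OF t] by blast
  note adapted = t this
  show ?thesis
    unfolding \<open>B = metric_velocity g\<close>
    by (intro conjI first_identity second_identity fifth_identity t third_identity_adapted[OF adapted]
      fourth_identity_adapted[OF adapted] sixth_identity_adapted[OF adapted])
qed

end
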